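(* Let $n$ be a positive integer, let $\underline{a},\underline{b}\in C_{\leq n}$, and let $T=T_n(\underline{a}\mid\underline{b})$ be the tail of the symplectic meander $M_n^{\mathrm C}(\underline{a}\mid\underline{b})$. Then: (i) The index of the seaweed $\mathfrak{p}_n^{\mathrm C}(\underline{a}\mid\underline{b})$ is equal to the number of cycles in the graph $M_n^{\mathrm C}(\underline{a}\mid\underline{b})$ plus the number of connected components of $M_n^{\mathrm C}(\underline{a}\mid\underline{b})$ containing either $0$ or $2$ vertices from $T$. (ii) The index of $\mathfrak{p}_n^{\mathrm C}(\underline{a}\mid\underline{b})$ is equal to the number of cycles containing either $0$ or $2$ integers from $T$ in the disjoint cycle decomposition of the permutation $\sigma_{n,\underline{a},\underline{b}}$ of $\{1,\dots,n\}$ (fixed points are counted as cycles of length one).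
   Context: The ground field is algebraically closed of characteristic zero. Index. For a Lie algebra $\mathfrak{g}$, $\operatorname{ind}\mathfrak{g}=\min_{f\in\mathfrak{g}^*}\dim\ker(B_f)$, where $B_f(x,y)=f([x,y])$ for $x,y\in\mathfrak{g}$. Symplectic Lie algebra. $\mathfrak{sp}(2n)$ is the Lie algebra of $2n\times 2n$ block matrices $\begin{bmatrix}A&B\\C&-\widehat{A}\end{bmatrix}$ with $A,B,C$ of size $n\times n$, $B=\widehat{B}$, $C=\widehat{C}$, where $\widehat{X}$ is the transpose of $X$ with respect to the antidiagonal. Use the triangular decomposition $\mathfrak{sp}(2n)=\mathfrak{u}_+\oplus\mathfrak{h}\oplus\mathfrak{u}_-$ into strictly upper triangular, diagonal, and strictly lower triangular matrices. Let $\Pi=\{\alpha_1,\dots,\alpha_n\}$ be the simple roots in the standard order with $\alpha_n$ the exceptional (long) root: writing $\epsilon_i$ for the $i$-th diagonal entry functional on $\mathfrak h$, $\alpha_i=\epsilon_i-\epsilon_{i+1}$ for $i<n$ and $\alpha_n=2\epsilon_n$. Let $\mathfrak{g}_\alpha$ denote the root space of $\alpha$. Seaweeds. For $\Psi,\Psi'\subseteq\Pi$, $\mathfrak{p}_n^{\mathrm C}(\Psi\mid\Psi')$ is the (standard) seaweed subalgebra $\mathfrak{p}\cap\mathfrak{p}'$ of $\mathfrak{sp}(2n)$, where $\mathfrak{p}\supseteq\mathfrak{h}\oplus\mathfrak{u}_+$ and $\mathfrak{p}'\supseteq\mathfrak{h}\oplus\mathfrak{u}_-$ are the parabolic subalgebras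 determined by $\Psi=\{\alpha\in\Pi:\mathfrak{g}_{-\alpha}\not\subseteq\mathfrak{p}\}$ and $\Psi'=\{\alpha\in\Pi:\mathfrak{g}_{\alpha}\not\subseteq\mathfrak{p}'\}$. Let $C_{\leq n}$ be the set of finite strings of positive integers (possibly the empty string $\emptyset$) with sum at most $n$. For $\underline{a}=(a_1,\dots,a_m)\in C_{\leq n}$ put $\varphi_{\mathrm C}(\underline{a})=\{\alpha_{a_1},\alpha_{a_1+a_2},\dots,\alpha_{a_1+\dots+a_m}\}$ (with $\varphi_{\mathrm C}(\emptyset)=\emptyset$), and define $\mathfrak{p}_n^{\mathrm C}(\underline{a}\mid\underline{b})=\mathfrak{p}_n^{\mathrm C}(\varphi_{\mathrm C}(\underline{a})\mid\varphi_{\mathrm C}(\underline{b}))$. Symplectic meander. $M_n^{\mathrm C}(\underline{a}\mid\underline{b})$ is the loopless, 2-edge-colored multigraph (edges colored "top" or "bottom") with vertices $1,\dots,n$ defined as follows. For $\underline{a}=(a_1,\dots,a_m)$, the $i$-th block $V_i$ is the set of vertices $v$ with $a_1+\dots+a_{i-1}<v\leq a_1+\dots+a_i$; distinct $j,k\in V_i$ are joined by a top edge if $j+k=2(a_1+\dots+a_{i-1})+a_i+1$. Bottom edges are placed in the same way according to $\underline{b}$. A top edge and a bottom edge joining the same two vertices form a cycle (of length two). Tail. For $\underline{a}\in C_{\leq n}$ with sum $r$, $T_n(\underline{a})=\{r+1,r+2,\dots,n\}$; the tail $T_n(\underline{a}\mid\underline{b})$ is the symmetric difference of $T_n(\underline{a})$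 and $T_n(\underline{b})$. Permutation. Define $t(j)=k$ if there is a top edge from $j$ to $k$, and $t(j)=j$ if $j$ is not incident with a top edge; define $b(j)$ likewise using bottom edges. Then $\sigma_{n,\underline{a},\underline{b}}(j)=t(b(j))$. *)

theory Defs
  imports
    "Jordan_Normal_Form.VS_Connect"
    "HOL-Combinatorics.Orbits"
begin

section \<open>Index of a Lie algebra\<close>

text \<open>A Lie algebra over the field \<open>'k\<close> is given by a vector space record (over
  \<^const>\<open>class_ring\<close>) and a bracket.\<close>

definition linear_functionals :: "('k::field, 'v) module \<Rightarrow> ('v \<Rightarrow> 'k) set" where
  "linear_functionals V = {f.
     (\<forall>x\<in>carrier V. \<forall>y\<in>carrier V. f (x \<oplus>\<^bsub>V\<^esub> y) = f x + f y) \<and>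
     (\<forall>c. \<forall>x\<in>carrier V. f (c \<odot>\<^bsub>V\<^esub> x) = c * f x)}"

definition form_kernel :: "('k::field, 'v) module \<Rightarrow> ('v \<Rightarrow> 'v \<Rightarrow> 'v) \<Rightarrow> ('v \<Rightarrow> 'k) \<Rightarrow> 'v set" where
  "form_kernel V br f = {x \<in> carrier V. \<forall>y\<in>carrier V. f (br x y) = 0}"

text \<open>The infimum of a nonempty set of naturals is its minimum; the set is nonempty because
  of \<open>f = 0\<close>.\<close>

definition lie_index :: "('k::field, 'v) module \<Rightarrow> ('v \<Rightarrow> 'v \<Rightarrow> 'v) \<Rightarrow> nat" where
  "lie_index V br =
     (INF f\<in>linear_functionals V.
        vectorspace.dim class_ring (V\<lparr>carrier := form_kernel V br f\<rparr>))"

definition commutator :: "'k::field mat \<Rightarrow> 'k mat \<Rightarrow> 'k mat" where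
  "commutator X Y = X * Y - Y * X"

section \<open>The symplectic Lie algebra and its seaweed subalgebras\<close>

text \<open>Matrix entries are indexed from 0, so the antidiagonal transpose of an \<open>n \<times> n\<close> matrix
  exchanges the entries \<open>(i, j)\<close> and \<open>(n - 1 - j, n - 1 - i)\<close>.\<close>

definition anti_transpose :: "'k mat \<Rightarrow> 'k mat" where
  "anti_transpose X =
     mat (dim_col X) (dim_row X) (\<lambda>(i, j). X $$ (dim_row X - 1 - j, dim_col X - 1 - i))"

definition sp :: "nat \<Rightarrow> 'k::field mat set" where
  "sp n = {four_block_mat A B C (- anti_transpose A) | A B C.
     A \<in> carrier_mat n n \<and> B \<in> carrier_mat n n \<and> C \<in> carrier_mat n n \<and>
     B = anti_transpose B \<and> C = anti_transpose C}"

definition cartan :: "nat \<Rightarrow> 'k::field mat set" where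
  "cartan n = {X \<in> sp n. diagonal_mat X}"

definition u_plus :: "nat \<Rightarrow> 'k::field mat set" where
  "u_plus n = {X \<in> sp n. \<forall>i<2*n. \<forall>j<2*n. j \<le> i \<longrightarrow> X $$ (i, j) = 0}"

definition u_minus :: "nat \<Rightarrow> 'k::field mat set" where
  "u_minus n = {X \<in> sp n. \<forall>i<2*n. \<forall>j<2*n. i \<le> j \<longrightarrow> X $$ (i, j) = 0}"

definition borel_plus :: "nat \<Rightarrow> 'k::field mat set" where
  "borel_plus n = {H + X | H X. H \<in> cartan n \<and> X \<in> u_plus n}"

definition borel_minus :: "nat \<Rightarrow> 'k::field mat set" where
  "borel_minus n = {H + X | H X. H \<in> cartan n \<and> X \<in> u_minus n}"

text \<open>Functionals on \<open>cartan n\<close> are represented by functions on all matrices, given by the same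
  formula; only their values on \<open>cartan n\<close> are used. The indices of \<open>\<epsilon>\<close> and of the simple
  roots run over \<open>1, \<dots>, n\<close>.\<close>

definition eps :: "nat \<Rightarrow> 'k::field mat \<Rightarrow> 'k" where
  "eps i H = H $$ (i - 1, i - 1)"

definition simple_root :: "nat \<Rightarrow> nat \<Rightarrow> 'k::field mat \<Rightarrow> 'k" where
  "simple_root n i = (if i < n then (\<lambda>H. eps i H - eps (i + 1) H) else (\<lambda>H. 2 * eps n H))"

definition simple_roots :: "nat \<Rightarrow> ('k::field mat \<Rightarrow> 'k) set" where
  "simple_roots n = simple_root n ` {1..n}"

definition root_space :: "nat \<Rightarrow> ('k::field mat \<Rightarrow> 'k) \<Rightarrow> 'k mat set" where
  "root_space n \<alpha> = {X \<in> sp n. \<forall>H\<in>cartan n. commutator H X = \<alpha> H \<cdot>\<^sub>m X}"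

definition sp_subalgebra :: "nat \<Rightarrow> 'k::field mat set \<Rightarrow> bool" where
  "sp_subalgebra n \<pp> \<longleftrightarrow>
     subspace class_ring \<pp> (module_mat TYPE('k) (2*n) (2*n)) \<and> \<pp> \<subseteq> sp n \<and>
     (\<forall>X\<in>\<pp>. \<forall>Y\<in>\<pp>. commutator X Y \<in> \<pp>)"

text \<open>The standard parabolic subalgebras (subalgebras containing a given Borel subalgebra)
  correspond bijectively to the subsets of \<^term>\<open>simple_roots n\<close>, so the descriptions
  below are unambiguous for \<open>\<Psi> \<subseteq> simple_roots n\<close>.\<close>

definition parabolic_plus :: "nat \<Rightarrow> ('k::field mat \<Rightarrow> 'k) set \<Rightarrow> 'k mat set" where
  "parabolic_plus n \<Psi> = (THE \<pp>. sp_subalgebra n \<pp> \<and> borel_plus n \<subseteq> \<pp> \<and>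
     \<Psi> = {\<alpha> \<in> simple_roots n. \<not> root_space n (- \<alpha>) \<subseteq> \<pp>})"

definition parabolic_minus :: "nat \<Rightarrow> ('k::field mat \<Rightarrow> 'k) set \<Rightarrow> 'k mat set" where
  "parabolic_minus n \<Psi> = (THE \<pp>. sp_subalgebra n \<pp> \<and> borel_minus n \<subseteq> \<pp> \<and>
     \<Psi> = {\<alpha> \<in> simple_roots n. \<not> root_space n \<alpha> \<subseteq> \<pp>})"

definition seaweed :: "nat \<Rightarrow> ('k::field mat \<Rightarrow> 'k) set \<Rightarrow> ('k mat \<Rightarrow> 'k) set \<Rightarrow> 'k mat set" where
  "seaweed n \<Psi> \<Psi>' = parabolic_plus n \<Psi> \<inter> parabolic_minus n \<Psi>'"

definition strings_le :: "nat \<Rightarrow> nat list set" where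
  "strings_le n = {a. (\<forall>x\<in>set a. 0 < x) \<and> sum_list a \<le> n}"

definition phi_C :: "nat \<Rightarrow> nat list \<Rightarrow> ('k::field mat \<Rightarrow> 'k) set" where
  "phi_C n a = {simple_root n (sum_list (take i a)) | i. 1 \<le> i \<and> i \<le> length a}"

definition seaweed_C :: "nat \<Rightarrow> nat list \<Rightarrow> nat list \<Rightarrow> 'k::field mat set" where
  "seaweed_C n a b = seaweed n (phi_C n a) (phi_C n b)"

definition index_in_sp :: "nat \<Rightarrow> 'k::field mat set \<Rightarrow> nat" where
  "index_in_sp n \<ss> =
     lie_index ((module_mat TYPE('k) (2*n) (2*n))\<lparr>carrier := \<ss>\<rparr>) commutator"

section \<open>Edge-colored multigraphs\<close>

text \<open>An edge is a color together with its set of two end vertices, so two vertices may be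
  joined by one edge of each color.\<close>

record ('v, 'c) colored_multigraph =
  cverts :: "'v set"
  cedges :: "('c \<times> 'v set) set"

definition components :: "('v, 'c) colored_multigraph \<Rightarrow> 'v set set" where
  "components G =
     cverts G // {(u, v) \<in> cverts G \<times> cverts G. (u, v) \<in> {(x, y). \<exists>c. (c, {x, y}) \<in> cedges G}\<^sup>*}"

text \<open>Cycles as subgraphs, each identified with its set of edges: a cyclic sequence of
  \<open>l \<ge> 2\<close> distinct vertices \<open>vs\<close>, consecutive ones being joined by the distinct edges \<open>es\<close>.\<close>

definition graph_cycles :: "('v, 'c) colored_multigraph \<Rightarrow> ('c \<times> 'v set) set set" where
  "graph_cycles G = {set es | es vs.
     2 \<le> length vs \<and> length es = length vs \<and> distinct vs \<and> distinct es \<and>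
     set vs \<subseteq> cverts G \<and> set es \<subseteq> cedges G \<and>
     (\<forall>i<length vs. snd (es ! i) = {vs ! i, vs ! ((i + 1) mod length vs)})}"

section \<open>Symplectic meanders\<close>

datatype edge_color = Top | Bottom

text \<open>Blocks are numbered from 0.\<close>

definition block :: "nat list \<Rightarrow> nat \<Rightarrow> nat set" where
  "block a i = {v. sum_list (take i a) < v \<and> v \<le> sum_list (take (i + 1) a)}"

definition block_edges :: "nat list \<Rightarrow> nat set set" where
  "block_edges a = {{j, k} | i j k. i < length a \<and> j \<in> block a i \<and> k \<in> block a i \<and> j \<noteq> k \<and>
     j + k = 2 * sum_list (take i a) + a ! i + 1}"

definition meander_C :: "nat \<Rightarrow> nat list \<Rightarrow> nat list \<Rightarrow> (nat, edge_color) colored_multigraph" where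
  "meander_C n a b =
     \<lparr>cverts = {1..n}, cedges = {Top} \<times> block_edges a \<union> {Bottom} \<times> block_edges b\<rparr>"

definition tail1 :: "nat \<Rightarrow> nat list \<Rightarrow> nat set" where
  "tail1 n a = {sum_list a + 1..n}"

definition tail :: "nat \<Rightarrow> nat list \<Rightarrow> nat list \<Rightarrow> nat set" where
  "tail n a b = sym_diff (tail1 n a) (tail1 n b)"

text \<open>Used for meanders, where a vertex has at most one incident edge of each color.\<close>

definition opposite :: "('v, 'c) colored_multigraph \<Rightarrow> 'c \<Rightarrow> 'v \<Rightarrow> 'v" where
  "opposite G c j =
     (if \<exists>k. (c, {j, k}) \<in> cedges G then (THE k. (c, {j, k}) \<in> cedges G) else j)"

definition sigma :: "nat \<Rightarrow> nat list \<Rightarrow> nat list \<Rightarrow> nat \<Rightarrow> nat" where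
  "sigma n a b j = opposite (meander_C n a b) Top (opposite (meander_C n a b) Bottom j)"

text \<open>The cycles in the disjoint cycle decomposition of a permutation \<open>\<pi>\<close> of a finite set
  \<open>S\<close>, fixed points included, each identified with the set of elements it moves through.\<close>

definition perm_cycles :: "('v \<Rightarrow> 'v) \<Rightarrow> 'v set \<Rightarrow> 'v set set" where
  "perm_cycles \<pi> S = orbit \<pi> ` S"

end

theory Submission
  imports "Jordan_Normal_Form.Char_Poly" Defs
begin

text \<open>
  The bracket pairing of a functional \<open>f\<close> on the seaweed \<open>S\<close> is the alternating form \<open>f [x, y]\<close>.
  Kostant's cascade attaches to the top and bottom blocks the antidiagonal matrix entries. Let \<open>V\<close> be
  the span of the remaining off-diagonal root vectors. At a generic functional \<open>\<phi>0\<close> supported on the cascade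
  the form is nondegenerate on \<open>V\<close>, and its kernel is read off the meander: each component without
  tail vertices contributes a torus element, and each cycle and each component with two tail ends
  contributes a further one. For the reverse inequality, by semicontinuity it suffices
  to bound the kernel from below for functionals that vanish on \<open>V\<close>, since those near \<open>\<phi>0\<close> can be moved
  there by inner automorphisms. For such functionals the form splits along the components of the
  meander, and a parity count of the roots in a component makes the restricted form a skew form in an
  odd number of variables, hence singular.
\<close>

section \<open>Linear algebra over finite index sets\<close>

text \<open>The passage from arbitrary functionals to the slice is purely algebraic and of first
  order: every direction is a bracket with some \<open>x0\<close> plus a functional vanishing on
  \<open>V\<close>, hence tangent at \<open>phi0\<close> to a curve of conjugates of slice
  functionals. An induction on the order of vanishing turns singularity along all these curves into
  singularity everywhere. Nondegeneracy on \<open>V\<close> is certified by degrees: the cascade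
  coefficients are powers of one parameter with exponents \<open>3 ^ gap\<close>, chosen so that a
  single matching of roots dominates the determinant. The numbers 0 and 2 come from folding 2n
  matrix indices to n vertices. A vertex without a top edge is the centre of an odd block, where the
  reflection fixes its index, or a tail vertex, where the reflection is the mirror; likewise at the
  bottom. A centre kills the cascade part of a kernel element on its component, a mirror kills the
  torus part, and a path has two such ends in all. Hence two centres leave a torus element, two tail
  ends a cascade element, a mixed pair nothing, and a cycle both.\<close>

definition trivial_kernel :: "'i set \<Rightarrow> ('i \<Rightarrow> 'i \<Rightarrow> 'k::field) \<Rightarrow> bool" where
  "trivial_kernel I A \<longleftrightarrow>
     (\<forall>x. (\<forall>i\<in>I. (\<Sum>j\<in>I. A i j * x j) = 0) \<longrightarrow> (\<forall>i\<in>I. x i = 0))"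

definition indexed_mat :: "(nat \<Rightarrow> 'i) \<Rightarrow> nat \<Rightarrow> ('i \<Rightarrow> 'i \<Rightarrow> 'k) \<Rightarrow> 'k mat" where
  "indexed_mat h N A = mat N N (\<lambda>(i, j). A (h i) (h j))"

lemma indexed_mat_carrier [simp]: "indexed_mat h N A \<in> carrier_mat N N"
  by (simp add: indexed_mat_def)

lemma bij_betw_nat_obtain:
  assumes "bij_betw h {0..<N} I" "i \<in> I"
  obtains k where "k < (N::nat)" "i = h k"
  using assms unfolding bij_betw_def by auto

lemma indexed_mat_mult_vec:
  fixes A :: "'i \<Rightarrow> 'i \<Rightarrow> 'k::field"
  assumes h: "bij_betw h {0..<N} I" and i: "i < N"
  shows "(indexed_mat h N A *\<^sub>v vec N (\<lambda>j. x (h j))) $ i = (\<Sum>j\<in>I. A (h i) j * x j)"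
proof -
  have "(indexed_mat h N A *\<^sub>v vec N (\<lambda>j. x (h j))) $ i = (\<Sum>j\<in>{0..<N}. A (h i) (h j) * x (h j))"
    using i by (simp add: indexed_mat_def scalar_prod_def)
  also have "\<dots> = (\<Sum>j\<in>I. A (h i) j * x j)"
    using sum.reindex_bij_betw[OF h, of "\<lambda>j. A (h i) j * x j"] by simp
  finally show ?thesis .
qed

lemma trivial_kernel_iff_det:
  fixes A :: "'i \<Rightarrow> 'i \<Rightarrow> 'k::field"
  assumes h: "bij_betw h {0..<N} I"
  shows "trivial_kernel I A \<longleftrightarrow> det (indexed_mat h N A) \<noteq> 0"
proof -
  let ?M = "indexed_mat h N A"
  have *: "det ?M = 0 \<longleftrightarrow> (\<exists>v. v \<in> carrier_vec N \<and> v \<noteq> 0\<^sub>v N \<and> ?M *\<^sub>v v = 0\<^sub>v N)"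
    by (rule det_0_iff_vec_prod_zero) simp
  show ?thesis
  proof
    assume tk: "trivial_kernel I A"
    show "det ?M \<noteq> 0"
    proof
      assume "det ?M = 0"
      then obtain v where v: "v \<in> carrier_vec N" "v \<noteq> 0\<^sub>v N" "?M *\<^sub>v v = 0\<^sub>v N"
        using * by blast
      define x where "x j = v $ (inv_into {0..<N} h j)" for j
      have xv: "vec N (\<lambda>j. x (h j)) = v"
        using v(1) h by (intro eq_vecI) (auto simp: x_def bij_betw_def)
      have "(\<Sum>j\<in>I. A i j * x j) = 0" if "i \<in> I" for i
      proof -
        obtain k where k: "k < N" "i = h k" by (rule bij_betw_nat_obtain[OF h \<open>i \<in> I\<close>])
        show ?thesis using indexed_mat_mult_vec[OF h k(1), of A x] xv v(3) k by simp
      qed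
      then have "\<forall>i\<in>I. x i = 0" using tk unfolding trivial_kernel_def by blast
      then have "v = 0\<^sub>v N" using xv h by (intro eq_vecI) (auto simp: bij_betw_def simp flip: xv)
      then show False using v(2) by simp
    qed
  next
    assume d: "det ?M \<noteq> 0"
    show "trivial_kernel I A" unfolding trivial_kernel_def
    proof (intro allI impI ballI)
      fix x i assume x: "\<forall>i\<in>I. (\<Sum>j\<in>I. A i j * x j) = 0" and i: "i \<in> I"
      have "?M *\<^sub>v vec N (\<lambda>j. x (h j)) = 0\<^sub>v N"
      proof (intro eq_vecI)
        fix k assume k: "k < dim_vec (0\<^sub>v N :: 'k vec)"
        then have "h k \<in> I" using h by (auto simp: bij_betw_def)
        then show "(?M *\<^sub>v vec N (\<lambda>j. x (h j))) $ k = 0\<^sub>v N $ k"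
          using indexed_mat_mult_vec[OF h, of k A x] x k by simp
      qed (simp add: indexed_mat_def)
      moreover have "vec N (\<lambda>j. x (h j)) \<in> carrier_vec N" by simp
      ultimately have z: "vec N (\<lambda>j. x (h j)) = 0\<^sub>v N" using * d by blast
      obtain k where k: "k < N" "i = h k" by (rule bij_betw_nat_obtain[OF h i])
      have "x (h k) = vec N (\<lambda>j. x (h j)) $ k" using k by simp
      also have "\<dots> = 0" using k by (simp add: z)
      finally show "x i = 0" using k by simp
    qed
  qed
qed

lemma trivial_kernel_solve:
  fixes A :: "'i \<Rightarrow> 'i \<Rightarrow> 'k::field"
  assumes "finite I" "trivial_kernel I A"
  shows "\<exists>x. \<forall>i\<in>I. (\<Sum>j\<in>I. A i j * x j) = y i"
proof -
  obtain h where h: "bij_betw h {0..<card I} I"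
    using assms(1) ex_bij_betw_nat_finite by blast
  let ?N = "card I" and ?M = "indexed_mat h (card I) A"
  have "det ?M \<noteq> 0" using trivial_kernel_iff_det[OF h] assms(2) by blast
  then obtain B where B: "B \<in> carrier_mat ?N ?N" "?M * B = 1\<^sub>m ?N"
    using det_non_zero_imp_unit[of ?M ?N "()"] by (auto simp: Units_def ring_mat_def)
  define w where "w = B *\<^sub>v vec ?N (\<lambda>j. y (h j))"
  have w: "w \<in> carrier_vec ?N" using B by (auto simp: w_def)
  have Mw: "?M *\<^sub>v w = vec ?N (\<lambda>j. y (h j))"
    unfolding w_def using B by (subst assoc_mult_mat_vec[symmetric, of _ ?N ?N _ ?N]) auto
  define x where "x j = w $ (inv_into {0..<?N} h j)" for j
  have xw: "vec ?N (\<lambda>j. x (h j)) = w"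
    using w h by (intro eq_vecI) (auto simp: x_def bij_betw_def)
  have "(\<Sum>j\<in>I. A i j * x j) = y i" if "i \<in> I" for i
  proof -
    obtain k where k: "k < ?N" "i = h k" by (rule bij_betw_nat_obtain[OF h \<open>i \<in> I\<close>])
    show ?thesis using indexed_mat_mult_vec[OF h k(1), of A x] xw Mw k by simp
  qed
  then show ?thesis by blast
qed

text \<open>Padding the equations with zero rows makes the system square over \<open>J\<close>. A
  zero row cannot produce the right-hand side 1, so by \<open>trivial_kernel_solve\<close> the
  square system has a nontrivial kernel.\<close>

lemma underdetermined_system:
  fixes A :: "'i \<Rightarrow> 'j \<Rightarrow> 'k::field"
  assumes "finite I" "finite J" "card I < card J"
  shows "\<exists>x. (\<exists>j\<in>J. x j \<noteq> 0) \<and> (\<forall>i\<in>I. (\<Sum>j\<in>J. A i j * x j) = 0)"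
proof -
  obtain g where g: "inj_on g I" "g ` I \<subseteq> J"
    using card_le_inj[OF assms(1,2)] assms(3) by auto
  have "g ` I \<noteq> J" using assms g card_image[of g I] by auto
  then obtain j0 where j0: "j0 \<in> J" "j0 \<notin> g ` I" using g by blast
  define B where "B k j = (if k \<in> g ` I then A (inv_into I g k) j else 0)" for k j
  have "\<not> trivial_kernel J B"
  proof
    assume "trivial_kernel J B"
    from trivial_kernel_solve[OF assms(2) this, of "\<lambda>j. if j = j0 then 1 else 0"]
    obtain x where "\<forall>k\<in>J. (\<Sum>j\<in>J. B k j * x j) = (if k = j0 then 1 else 0)" by blast
    then have "(\<Sum>j\<in>J. B j0 j * x j) = 1" using j0 by simp
    then show False using j0 by (simp add: B_def)
  qed
  then obtain x j where x: "\<forall>k\<in>J. (\<Sum>j\<in>J. B k j * x j) = 0" "j \<in> J" "x j \<noteq> 0"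
    unfolding trivial_kernel_def by blast
  have "(\<Sum>j\<in>J. A i j * x j) = 0" if "i \<in> I" for i
  proof -
    have "g i \<in> J" using that g by blast
    then have "(\<Sum>j\<in>J. B (g i) j * x j) = 0" using x by blast
    then show ?thesis using that g by (simp add: B_def)
  qed
  then show ?thesis using x by blast
qed

text \<open>Transposition multiplies the determinant of a skew matrix by -1 in odd size, and
  characteristic zero then makes it vanish.\<close>

lemma odd_skew_kernel:
  fixes A :: "'i \<Rightarrow> 'i \<Rightarrow> 'k::field_char_0"
  assumes "finite I" "odd (card I)" and skew: "\<And>i j. i \<in> I \<Longrightarrow> j \<in> I \<Longrightarrow> A i j = - A j i"
  shows "\<exists>x. (\<exists>i\<in>I. x i \<noteq> 0) \<and> (\<forall>i\<in>I. (\<Sum>j\<in>I. A i j * x j) = 0)"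
proof -
  obtain h where h: "bij_betw h {0..<card I} I"
    using assms(1) ex_bij_betw_nat_finite by blast
  let ?N = "card I" and ?M = "indexed_mat h (card I) A"
  have "transpose_mat ?M = (-1) \<cdot>\<^sub>m ?M"
    using h by (intro eq_matI) (auto simp: indexed_mat_def bij_betw_def intro!: skew)
  then have "det ?M = det ((-1) \<cdot>\<^sub>m ?M)"
    using det_transpose[of ?M ?N] by simp
  also have "\<dots> = (-1) ^ ?N * det ?M" by (simp add: indexed_mat_def)
  finally have "det ?M = - det ?M" using assms(2) by simp
  then have "det ?M = 0" by simp
  then show ?thesis using trivial_kernel_iff_det[OF h, of A] unfolding trivial_kernel_def by blast
qed

text \<open>The rank of a skew matrix is attained by a principal submatrix. An \<open>R\<close> of
  maximal cardinality works, and every index outside it contributes a kernel vector, normalised to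
  be a unit vector outside \<open>R\<close> so that independence can be read off.\<close>

lemma maximal_nonsingular_principal:
  fixes A :: "'i \<Rightarrow> 'i \<Rightarrow> 'k::field_char_0"
  assumes fin: "finite I" and skew: "\<And>i j. i \<in> I \<Longrightarrow> j \<in> I \<Longrightarrow> A i j = - A j i"
  shows "\<exists>R z. R \<subseteq> I \<and> trivial_kernel R A \<and>
           (\<forall>i\<in>I-R. \<forall>k\<in>I. (\<Sum>j\<in>I. A k j * z i j) = 0) \<and>
           (\<forall>i\<in>I-R. \<forall>k\<in>I-R. z i k = (if k = i then 1 else 0))"
proof -
  let ?P = "\<lambda>R. R \<subseteq> I \<and> trivial_kernel R A"
  have "?P {}" by (simp add: trivial_kernel_def)
  moreover have "\<forall>R. ?P R \<longrightarrow> card R \<le> card I" using fin card_mono by blast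
  ultimately obtain R where R: "?P R" and max: "\<And>R'. ?P R' \<Longrightarrow> card R' \<le> card R"
    using ex_has_greatest_nat[of ?P "{}" card] by (metis le_SucI less_Suc_eq_le)
  have finR: "finite R" using R fin finite_subset by blast
  have "\<exists>x. \<forall>k\<in>R. (\<Sum>j\<in>R. A k j * x j) = - A k i" for i
    using trivial_kernel_solve[OF finR, of A "\<lambda>k. - A k i"] R by blast
  then obtain x where x: "\<And>i k. k \<in> R \<Longrightarrow> (\<Sum>j\<in>R. A k j * x i j) = - A k i" by metis
  define z where "z i j = (if j \<in> R then x i j else if j = i then 1 else 0)" for i j
  have zsum: "(\<Sum>j\<in>I. A k j * z i j) = (\<Sum>j\<in>R. A k j * x i j) + A k i" if "i \<in> I - R" for i k
  proof -
    have "(\<Sum>j\<in>I. A k j * z i j) = (\<Sum>j\<in>R. A k j * z i j) + (\<Sum>j\<in>I-R. A k j * z i j)"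
      using R fin by (metis add.commute sum.subset_diff)
    also have "(\<Sum>j\<in>R. A k j * z i j) = (\<Sum>j\<in>R. A k j * x i j)"
      by (intro sum.cong) (auto simp: z_def)
    also have "(\<Sum>j\<in>I-R. A k j * z i j) = (\<Sum>j\<in>I-R. if j = i then A k i else 0)"
      by (intro sum.cong) (auto simp: z_def)
    also have "\<dots> = A k i" using that fin by simp
    finally show ?thesis .
  qed
  have zR: "(\<Sum>j\<in>I. A k j * z i j) = 0" if "i \<in> I - R" "k \<in> R" for i k
    using zsum[OF that(1)] x[OF that(2)] by simp
  \<comment> \<open>The numbers \<open>s i k\<close> are the entries of the Schur complement of
    \<open>R\<close>. It inherits skewness, so a nonzero entry gives an invertible 2 by 2 block, and
    \<open>insert i (insert k R)\<close> would be a larger nonsingular set.\<close>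
  have zz: "(\<Sum>j\<in>I. A k j * z i j) = 0" if i: "i \<in> I - R" and k: "k \<in> I - R" for i k
  proof (rule ccontr)
    define s where "s i k = (\<Sum>j\<in>I. A k j * z i j)" for i k
    assume "(\<Sum>j\<in>I. A k j * z i j) \<noteq> 0"
    then have nz: "s i k \<noteq> 0" by (simp add: s_def)
    have pair: "(\<Sum>l\<in>I. z k' l * s i' l) = s i' k'" if "i' \<in> I - R" "k' \<in> I - R" for i' k'
    proof -
      have "(\<Sum>l\<in>I. z k' l * s i' l) = (\<Sum>l\<in>I. if l = k' then s i' k' else 0)"
      proof (intro sum.cong refl)
        fix l assume l: "l \<in> I"
        show "z k' l * s i' l = (if l = k' then s i' k' else 0)"
        proof (cases "l \<in> R")
          case True
          then show ?thesis using zR[OF that(1), of l] that by (auto simp: s_def)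
        next
          case False
          then show ?thesis using that by (auto simp: z_def)
        qed
      qed
      also have "\<dots> = s i' k'" using that fin by simp
      finally show ?thesis .
    qed
    have "s i' k' = - s k' i'" if "i' \<in> I - R" "k' \<in> I - R" for i' k'
    proof -
      have "s i' k' = (\<Sum>l\<in>I. z k' l * (\<Sum>j\<in>I. A l j * z i' j))"
        using pair[OF that] by (simp add: s_def)
      also have "\<dots> = (\<Sum>l\<in>I. \<Sum>j\<in>I. - (z i' j * (A j l * z k' l)))"
        unfolding sum_distrib_left
      proof (intro sum.cong refl)
        fix l j assume "l \<in> I" "j \<in> I"
        then show "z k' l * (A l j * z i' j) = - (z i' j * (A j l * z k' l))"
          using skew[of l j] by simp
      qed
      also have "\<dots> = (\<Sum>j\<in>I. \<Sum>l\<in>I. - (z i' j * (A j l * z k' l)))" by (rule sum.swap)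
      also have "\<dots> = - (\<Sum>j\<in>I. z i' j * s k' j)"
        by (simp add: s_def sum_negf sum_distrib_left)
      also have "\<dots> = - s k' i'" using pair that by simp
      finally show ?thesis .
    qed
    note sskew = this
    have "s i i = 0" "s k k = 0" using sskew[OF i i] sskew[OF k k] by auto
    have ik: "i \<noteq> k" using nz \<open>s i i = 0\<close> by auto
    let ?R' = "insert i (insert k R)"
    have "trivial_kernel ?R' A" unfolding trivial_kernel_def
    proof (intro allI impI)
      fix y assume y: "\<forall>l\<in>?R'. (\<Sum>j\<in>?R'. A l j * y j) = 0"
      \<comment> \<open>Removing the multiples of \<open>x i\<close> and \<open>x k\<close>
        decouples the rows in \<open>R\<close> from the two new unknowns.\<close>
      define r where "r j = y j - y i * x i j - y k * x k j" for j
      have split: "(\<Sum>j\<in>?R'. A l j * y j) = y i * s i l + y k * s k l + (\<Sum>j\<in>R. A l j * r j)" for l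
      proof -
        have "(\<Sum>j\<in>?R'. A l j * y j) = A l i * y i + (A l k * y k + (\<Sum>j\<in>R. A l j * y j))"
          using i k ik finR by simp
        moreover have "(\<Sum>j\<in>R. A l j * r j) = (\<Sum>j\<in>R. A l j * y j)
            - y i * (\<Sum>j\<in>R. A l j * x i j) - y k * (\<Sum>j\<in>R. A l j * x k j)"
          unfolding r_def sum_distrib_left sum_subtractf[symmetric]
          by (intro sum.cong) (auto simp: algebra_simps)
        ultimately show ?thesis
          using zsum[OF i, of l] zsum[OF k, of l] by (simp add: s_def algebra_simps)
      qed
      have "(\<Sum>j\<in>R. A l j * r j) = 0" if "l \<in> R" for l
        using split[of l] y zR[OF i that] zR[OF k that] that by (simp add: s_def)
      then have r0: "\<forall>j\<in>R. r j = 0" using R unfolding trivial_kernel_def by blast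
      have "y i * s i k = 0"
        using split[of k] y r0 \<open>s k k = 0\<close> by simp
      moreover have "y k * s k i = 0"
        using split[of i] y r0 \<open>s i i = 0\<close> by simp
      ultimately have "y i = 0" "y k = 0" using nz sskew[OF i k] by auto
      then show "\<forall>j\<in>?R'. y j = 0" using r0 by (auto simp: r_def)
    qed
    then have "card ?R' \<le> card R" using R i k by (intro max) auto
    then show False using i k ik finR by simp
  qed
  have "\<forall>i\<in>I-R. \<forall>k\<in>I. (\<Sum>j\<in>I. A k j * z i j) = 0" using zR zz by blast
  moreover have "\<forall>i\<in>I-R. \<forall>k\<in>I-R. z i k = (if k = i then 1 else 0)" by (auto simp: z_def)
  ultimately show ?thesis using R by blast
qed

section \<open>Determinants of matrices depending polynomially on a parameter\<close>

lemma trivial_kernel_cong: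
  assumes "\<And>i j. i \<in> I \<Longrightarrow> j \<in> I \<Longrightarrow> A i j = B i j"
  shows "trivial_kernel I A \<longleftrightarrow> trivial_kernel I B"
  unfolding trivial_kernel_def using assms by (simp cong: sum.cong ball_cong)

lemma prod_monom: "(\<Prod>i\<in>I. monom (c i) (d i)) = monom (\<Prod>i\<in>I. c i) (\<Sum>i\<in>I. d i)"
  by (induction I rule: infinite_finite_induct) (auto simp: mult_monom)

lemma poly_det: "poly (det A) t = det (map_mat (\<lambda>p. poly p t) A)"
  for t :: "'k::comm_ring_1"
  by (rule comm_ring_hom.hom_det[OF poly_hom.comm_ring_hom_axioms, symmetric])

text \<open>A field of characteristic zero is infinite. Leaving out the point 0 allows the
  applications to divide by the parameter.\<close>

lemma poly_zero_on_nonzero: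
  fixes p :: "'k::field_char_0 poly"
  assumes "\<And>t. t \<noteq> 0 \<Longrightarrow> poly p t = 0"
  shows "p = 0"
proof (rule ccontr)
  assume "p \<noteq> 0"
  then have "finite {t. poly p t = 0}" by (rule poly_roots_finite)
  moreover have "UNIV - {0} \<subseteq> {t. poly p t = 0}" using assms by auto
  ultimately have "finite (UNIV - {0 :: 'k})" using finite_subset by blast
  then show False using infinite_UNIV_char_0 by (metis finite_Diff2 finite.emptyI finite_insert)
qed

text \<open>In the Leibniz expansion of the determinant the permutation \<open>m\<close> alone attains the top
  degree in \<open>t\<close>.\<close>

lemma trivial_kernel_leading_matching:
  fixes c :: "'i \<Rightarrow> 'i \<Rightarrow> 'k::field_char_0" and d :: "'i \<Rightarrow> 'i \<Rightarrow> nat" and y :: "'i \<Rightarrow> nat"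
  assumes fin: "finite I" and m: "bij_betw m I I"
    and lead: "\<And>i. i \<in> I \<Longrightarrow> c i (m i) \<noteq> 0 \<and> 2 * d i (m i) = y i + y (m i)"
    and below: "\<And>i j. i \<in> I \<Longrightarrow> j \<in> I \<Longrightarrow> j \<noteq> m i \<Longrightarrow> c i j \<noteq> 0 \<Longrightarrow> 2 * d i j < y i + y j"
  shows "\<exists>t. t \<noteq> 0 \<and> trivial_kernel I (\<lambda>i j. c i j * t ^ d i j)"
proof -
  obtain h where h: "bij_betw h {0..<card I} I"
    using fin ex_bij_betw_nat_finite by blast
  let ?N = "card I" and ?X = "{0..<card I}"
  define P where "P = indexed_mat h ?N (\<lambda>i j. monom (c i j) (d i j))"
  have hI: "h i \<in> I" if "i \<in> ?X" for i using h that by (auto simp: bij_betw_def)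
  define D where "D = (\<Sum>i\<in>I. y i)"
  define m' where "m' i = (if i \<in> ?X then inv_into ?X h (m (h i)) else i)" for i
  have "bij_betw (inv_into ?X h \<circ> (m \<circ> h)) ?X ?X"
    using h m bij_betw_inv_into by (blast intro: bij_betw_trans)
  then have "bij_betw m' ?X ?X"
    by (rule iffD1[OF bij_betw_cong, rotated]) (auto simp: m'_def)
  then have m': "m' permutes ?X" by (rule bij_imp_permutes) (auto simp: m'_def)
  have hm': "h (m' i) = m (h i)" if "i \<in> ?X" for i
    using that hI[OF that] m h unfolding m'_def
    by (auto simp: bij_betw_def intro!: f_inv_into_f)
  \<comment> \<open>\<open>y\<close> acts as a potential: its row and column contributions add up to
    \<open>2 * D\<close> for every permutation, so the hypotheses on single entries compare every
    Leibniz term with the one degree \<open>D\<close>.\<close>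
  have Dsum: "(\<Sum>i\<in>?X. y (h i) + y (h (p i))) = 2 * D" if p: "p permutes ?X" for p
  proof -
    have "(\<Sum>i\<in>?X. y (h (p i))) = (\<Sum>i\<in>?X. y (h i))"
      using sum.permute[OF p, of "\<lambda>i. y (h i)"] by (simp add: o_def)
    moreover have "(\<Sum>i\<in>?X. y (h i)) = D"
      unfolding D_def using sum.reindex_bij_betw[OF h, of y] by simp
    ultimately show ?thesis by (simp add: sum.distrib)
  qed
  have trm: "(\<Prod>i = 0..<?N. P $$ (i, p i))
      = monom (\<Prod>i\<in>?X. c (h i) (h (p i))) (\<Sum>i\<in>?X. d (h i) (h (p i)))" if p: "p permutes ?X" for p
  proof -
    have "(\<Prod>i = 0..<?N. P $$ (i, p i)) = (\<Prod>i\<in>?X. monom (c (h i) (h (p i))) (d (h i) (h (p i))))"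
      using permutes_in_image[OF p] by (intro prod.cong) (auto simp: P_def indexed_mat_def)
    then show ?thesis by (simp add: prod_monom)
  qed
  have other: "coeff (\<Prod>i = 0..<?N. P $$ (i, p i)) D = 0" if p: "p permutes ?X" and "p \<noteq> m'" for p
  proof (cases "\<forall>i\<in>?X. c (h i) (h (p i)) \<noteq> 0")
    case False
    then have "(\<Prod>i\<in>?X. c (h i) (h (p i))) = 0" by auto
    then show ?thesis by (simp add: trm[OF p])
  next
    case True
    have pX: "p i \<in> ?X" if "i \<in> ?X" for i using permutes_in_image[OF p] that by blast
    have le: "2 * d (h i) (h (p i)) \<le> y (h i) + y (h (p i))" if "i \<in> ?X" for i
      using below[OF hI[OF that] hI[OF pX[OF that]]] lead[OF hI[OF that]] True that
      by (metis less_imp_le order_refl)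
    obtain i where i: "i \<in> ?X" "p i \<noteq> m' i"
      using \<open>p \<noteq> m'\<close> permutes_not_in[OF p] permutes_not_in[OF m'] by (metis ext)
    have "h (p i) \<noteq> m (h i)"
      using i hm'[OF i(1)] pX[OF i(1)] permutes_in_image[OF m', of i] h
      by (metis bij_betw_imp_inj_on inj_onD)
    then have "2 * d (h i) (h (p i)) < y (h i) + y (h (p i))"
      using below[OF hI[OF i(1)] hI[OF pX[OF i(1)]]] True i(1) by blast
    then have "(\<Sum>i\<in>?X. 2 * d (h i) (h (p i))) < (\<Sum>i\<in>?X. y (h i) + y (h (p i)))"
      using le i(1) by (intro sum_strict_mono_ex1) auto
    then have "(\<Sum>i\<in>?X. d (h i) (h (p i))) < D"
      by (simp add: Dsum[OF p] flip: sum_distrib_left)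
    then show ?thesis by (simp add: trm[OF p])
  qed
  have "(\<Sum>i\<in>?X. 2 * d (h i) (h (m' i))) = (\<Sum>i\<in>?X. y (h i) + y (h (m' i)))"
    using lead hI hm' by (intro sum.cong) auto
  then have "(\<Sum>i\<in>?X. d (h i) (h (m' i))) = D"
    by (simp add: Dsum[OF m'] flip: sum_distrib_left)
  then have main: "coeff (\<Prod>i = 0..<?N. P $$ (i, m' i)) D \<noteq> 0"
    using lead hI hm' by (auto simp: trm[OF m'])
  have "coeff (det P) D = (\<Sum>p | p permutes ?X. coeff (signof p * (\<Prod>i = 0..<?N. P $$ (i, p i))) D)"
    unfolding det_def'[of P ?N, unfolded P_def, OF indexed_mat_carrier, folded P_def]
    by (simp add: coeff_sum)
  also have "\<dots> = (\<Sum>p | p permutes ?X. if p = m' then coeff (signof p * (\<Prod>i = 0..<?N. P $$ (i, p i))) D else 0)"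
    using other by (intro sum.cong) (auto simp: sign_def)
  also have "\<dots> = coeff (signof m' * (\<Prod>i = 0..<?N. P $$ (i, m' i))) D"
    using m' by (simp add: finite_permutations)
  also have "\<dots> \<noteq> 0" using main by (simp add: sign_def)
  finally have "det P \<noteq> 0" by auto
  then obtain t where t: "t \<noteq> 0" "poly (det P) t \<noteq> 0" using poly_zero_on_nonzero by blast
  have "poly (det P) t = det (map_mat (\<lambda>p. poly p t) P)" by (rule poly_det)
  also have "map_mat (\<lambda>p. poly p t) P = indexed_mat h ?N (\<lambda>i j. c i j * t ^ d i j)"
    by (intro eq_matI) (auto simp: P_def indexed_mat_def poly_monom)
  finally show ?thesis using t trivial_kernel_iff_det[OF h, of "\<lambda>i j. c i j * t ^ d i j"] by auto
qed

text \<open>If every direction \<open>X\<close> is tangent at \<open>A\<^sub>0\<close> to a polynomial curve of singular matrices, then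
  the lowest-order term of the determinant at \<open>A\<^sub>0\<close> vanishes in every direction.\<close>

lemma singular_of_tangent_curves:
  fixes A0 :: "'i \<Rightarrow> 'i \<Rightarrow> 'k::field_char_0" and G :: "('i \<Rightarrow> 'i \<Rightarrow> 'k) set"
  assumes fin: "finite I"
    and closed: "\<And>X Y a b. X \<in> G \<Longrightarrow> Y \<in> G \<Longrightarrow> (\<lambda>i j. a * X i j + b * Y i j) \<in> G"
    and A0: "A0 \<in> G"
    and curve: "\<And>X. X \<in> G \<Longrightarrow> \<exists>q. (\<forall>i\<in>I. \<forall>j\<in>I. coeff (q i j) 0 = A0 i j \<and> coeff (q i j) 1 = X i j) \<and>
      (\<forall>t. \<exists>Y\<in>G. (\<forall>i\<in>I. \<forall>j\<in>I. Y i j = poly (q i j) t) \<and> \<not> trivial_kernel I Y)"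
    and X: "X \<in> G"
  shows "\<not> trivial_kernel I X"
proof -
  obtain h where h: "bij_betw h {0..<card I} I"
    using fin ex_bij_betw_nat_finite by blast
  let ?N = "card I"
  have hI: "h i \<in> I" if "i < ?N" for i using h that by (auto simp: bij_betw_def)
  \<comment> \<open>\<open>P X\<close> is det (A0 + s X) as a polynomial in s. The aim is
    \<open>P X = 0\<close> for all \<open>X\<close> in \<open>G\<close>, by induction on the
    coefficient and for all directions simultaneously.\<close>
  define P where "P X = det (indexed_mat h ?N (\<lambda>i j. [:A0 i j, X i j:]))" for X
  have P0: "coeff (P X) e = 0" if "X \<in> G" for X e using that
  proof (induction e arbitrary: X rule: less_induct)
    case (less e)
    obtain q where q: "\<And>i j. i \<in> I \<Longrightarrow> j \<in> I \<Longrightarrow> coeff (q i j) 0 = A0 i j \<and> coeff (q i j) 1 = X i j"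
      and qY: "\<And>t. \<exists>Y\<in>G. (\<forall>i\<in>I. \<forall>j\<in>I. Y i j = poly (q i j) t) \<and> \<not> trivial_kernel I Y"
      using curve[OF less.prems] by blast
    \<comment> \<open>The curve has the form A0 + s u(s) with u(0) = X.\<close>
    define u where "u i j = poly_shift 1 (q i j)" for i j
    have qu: "q i j = pCons (A0 i j) (u i j)" if "i \<in> I" "j \<in> I" for i j
      using q[OF that] by (intro poly_eqI) (auto simp: u_def coeff_poly_shift coeff_pCons split: nat.split)
    have u0: "poly (u i j) 0 = X i j" if "i \<in> I" "j \<in> I" for i j
      using q[OF that] by (simp add: u_def coeff_poly_shift poly_0_coeff_0)
    \<comment> \<open>A polynomial in two variables, det (A0 + y u(s)): the outer variable y scales
      \<open>u\<close>, the inner one s is the curve parameter. Setting y = s gives back the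
      determinant along the curve.\<close>
    define Q where "Q = det (indexed_mat h ?N (\<lambda>i j. [:[:A0 i j:], u i j:]))"
    have evalQ: "poly (coeff Q e') t = coeff (P V) e'"
      if V: "\<And>i j. i \<in> I \<Longrightarrow> j \<in> I \<Longrightarrow> V i j = poly (u i j) t" for V t e'
    proof -
      interpret ev: map_poly_comm_ring_hom "\<lambda>p. poly p t" ..
      have "P V = det (map_mat (map_poly (\<lambda>p. poly p t)) (indexed_mat h ?N (\<lambda>i j. [:[:A0 i j:], u i j:])))"
        unfolding P_def
      proof (rule arg_cong[where f = det], rule eq_matI)
        fix i j assume ij: "i < dim_row (map_mat (map_poly (\<lambda>p. poly p t)) (indexed_mat h ?N (\<lambda>i j. [:[:A0 i j:], u i j:])))"
          "j < dim_col (map_mat (map_poly (\<lambda>p. poly p t)) (indexed_mat h ?N (\<lambda>i j. [:[:A0 i j:], u i j:])))"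
        then have "h i \<in> I" "h j \<in> I" using h by (auto simp: indexed_mat_def bij_betw_def)
        then show "indexed_mat h ?N (\<lambda>i j. [:A0 i j, V i j:]) $$ (i, j) =
           map_mat (map_poly (\<lambda>p. poly p t)) (indexed_mat h ?N (\<lambda>i j. [:[:A0 i j:], u i j:])) $$ (i, j)"
          using ij V
            by (intro poly_eqI) (auto simp: indexed_mat_def coeff_map_poly coeff_pCons split: nat.split)
      qed (auto simp: indexed_mat_def)
      also have "\<dots> = map_poly (\<lambda>p. poly p t) Q" by (simp add: Q_def)
      finally show ?thesis by (simp add: coeff_map_poly)
    qed
    \<comment> \<open>For nonzero t, u(t) is the difference quotient (Y - A0) / t, which lies in
      \<open>G\<close>; the induction hypothesis therefore kills all coefficients below
      \<open>e\<close>.\<close>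
    have Qlow: "coeff Q e' = 0" if "e' < e" for e'
    proof (rule poly_zero_on_nonzero)
      fix t :: 'k assume t: "t \<noteq> 0"
      obtain Y where Y: "Y \<in> G" "\<And>i j. i \<in> I \<Longrightarrow> j \<in> I \<Longrightarrow> Y i j = poly (q i j) t" using qY by blast
      let ?V = "\<lambda>i j. (1 / t) * Y i j + (- 1 / t) * A0 i j"
      have "?V \<in> G" by (rule closed[OF Y(1) A0])
      moreover have "?V i j = poly (u i j) t" if "i \<in> I" "j \<in> I" for i j
        using t that by (simp add: Y(2) qu field_simps)
      ultimately show "poly (coeff Q e') t = 0"
        using less.IH[OF that] by (subst evalQ[of ?V]) blast+
    qed
    have "poly Q [:0, 1:] = det (map_mat (\<lambda>p. poly p [:0, 1:]) (indexed_mat h ?N (\<lambda>i j. [:[:A0 i j:], u i j:])))"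
      unfolding Q_def by (rule poly_det)
    also have "map_mat (\<lambda>p. poly p [:0, 1:]) (indexed_mat h ?N (\<lambda>i j. [:[:A0 i j:], u i j:])) = indexed_mat h ?N q"
      using hI by (intro eq_matI) (auto simp: indexed_mat_def qu)
    finally have Qq: "poly Q [:0, 1:] = det (indexed_mat h ?N q)" .
    have "poly (det (indexed_mat h ?N q)) t = 0" for t
    proof -
      obtain Y where Y: "\<And>i j. i \<in> I \<Longrightarrow> j \<in> I \<Longrightarrow> Y i j = poly (q i j) t" "\<not> trivial_kernel I Y"
        using qY by blast
      have "poly (det (indexed_mat h ?N q)) t = det (map_mat (\<lambda>p. poly p t) (indexed_mat h ?N q))" by (rule poly_det)
      also have "map_mat (\<lambda>p. poly p t) (indexed_mat h ?N q) = indexed_mat h ?N Y"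
        using hI by (intro eq_matI) (auto simp: indexed_mat_def Y(1))
      finally show ?thesis using Y(2) trivial_kernel_iff_det[OF h, of Y] by simp
    qed
    then have Qz: "poly Q [:0, 1:] = 0" unfolding Qq by (intro poly_zero_on_nonzero) auto
    \<comment> \<open>Now Q is y^e times Q', and y = s leaves s^e Q'(s, s) = 0. Cancelling s^e and
      putting s = 0 isolates coefficient \<open>e\<close> of \<open>P X\<close>, because u(0) =
      X.\<close>
    define Q' where "Q' = poly_shift e Q"
    have "Q = monom 1 e * Q'"
      using Qlow by (intro poly_eqI) (auto simp: Q'_def coeff_monom_mult coeff_poly_shift)
    then have "[:0, 1:] ^ e * poly Q' [:0, 1:] = 0" using Qz by (simp add: poly_monom)
    then have "poly Q' [:0, 1:] = 0" by simp
    moreover have "poly (poly Q' [:0, 1:]) 0 = poly (coeff Q' 0) 0"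
      by (cases Q') (simp)
    ultimately have "poly (coeff Q e) 0 = 0" by (simp add: Q'_def coeff_poly_shift)
    then show ?case using evalQ[of X 0 e] u0 by simp
  qed
  show ?thesis
  proof
    assume tk: "trivial_kernel I X"
    \<comment> \<open>The line from \<open>A0\<close> in the direction X - A0 reaches
      \<open>X\<close> at parameter 1.\<close>
    let ?W = "\<lambda>i j. 1 * X i j + (- 1) * A0 i j"
    have "?W \<in> G" by (rule closed[OF X A0])
    then have "P ?W = 0" using P0 by (intro poly_eqI) simp
    then have "poly (P ?W) 1 = 0" by simp
    moreover have "poly (P ?W) 1 = det (indexed_mat h ?N X)"
    proof -
      have "poly (P ?W) 1 = det (map_mat (\<lambda>p. poly p 1) (indexed_mat h ?N (\<lambda>i j. [:A0 i j, ?W i j:])))"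
        unfolding P_def by (rule poly_det)
      also have "map_mat (\<lambda>p. poly p 1) (indexed_mat h ?N (\<lambda>i j. [:A0 i j, ?W i j:])) = indexed_mat h ?N X"
        by (intro eq_matI) (auto simp: indexed_mat_def)
      finally show ?thesis .
    qed
    ultimately show False using tk trivial_kernel_iff_det[OF h, of X] by simp
  qed
qed

section \<open>Dimension of spaces of matrices\<close>

lemma module_mat_carrier_update_simps:
  "carrier ((module_mat TYPE('k::field) M M)\<lparr>carrier := U\<rparr>) = U"
  "add ((module_mat TYPE('k) M M)\<lparr>carrier := U\<rparr>) = (+)"
  "zero ((module_mat TYPE('k) M M)\<lparr>carrier := U\<rparr>) = 0\<^sub>m M M"
  "smult ((module_mat TYPE('k) M M)\<lparr>carrier := U\<rparr>) = (\<cdot>\<^sub>m)"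
  by (auto simp: module_mat_def)

lemma subspace_matI:
  fixes U :: "'k::field mat set"
  assumes "U \<subseteq> carrier_mat M M" "0\<^sub>m M M \<in> U"
    and "\<And>x y. x \<in> U \<Longrightarrow> y \<in> U \<Longrightarrow> x + y \<in> U"
    and "\<And>c x. x \<in> U \<Longrightarrow> c \<cdot>\<^sub>m x \<in> U"
  shows "subspace class_ring U (module_mat TYPE('k) M M)"
proof -
  have v: "vectorspace class_ring (module_mat TYPE('k) M M)" by (rule matrix_vs)
  then have "module class_ring (module_mat TYPE('k) M M)" by (simp add: vectorspace_def)
  then have "submodule class_ring U (module_mat TYPE('k) M M)"
    unfolding submodule_def module_mat_simps class_ring_simps using assms by blast
  with v show ?thesis by (simp add: subspace_def)
qed

lemma subspace_matD:
  fixes U :: "'k::field mat set"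
  assumes "subspace class_ring U (module_mat TYPE('k) M M)"
  shows "U \<subseteq> carrier_mat M M" "0\<^sub>m M M \<in> U"
    "x \<in> U \<Longrightarrow> y \<in> U \<Longrightarrow> x + y \<in> U" "x \<in> U \<Longrightarrow> c \<cdot>\<^sub>m x \<in> U"
proof -
  interpret submodule class_ring U "module_mat TYPE('k) M M"
    using assms by (simp add: subspace_def)
  show "U \<subseteq> carrier_mat M M" using subset by (simp add: module_mat_simps)
  show "x \<in> U \<Longrightarrow> y \<in> U \<Longrightarrow> x + y \<in> U" using m_closed[of x y] by (simp add: module_mat_simps)
  show "x \<in> U \<Longrightarrow> c \<cdot>\<^sub>m x \<in> U" using smult_closed[of c x] by (simp add: module_mat_simps)
  show "0\<^sub>m M M \<in> U" using zero_closed by (simp add: module_mat_simps)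
qed

context
  fixes U :: "'k::field_char_0 mat set" and M :: nat
  assumes U: "subspace class_ring U (module_mat TYPE('k) M M)"
begin

interpretation W: vectorspace "class_ring :: 'k ring" "(module_mat TYPE('k) M M)\<lparr>carrier := U\<rparr>"
  by (rule vectorspace.subspace_is_vs[OF matrix_vs U])

lemma lincomb_closed_mat: "A \<subseteq> U \<Longrightarrow> W.lincomb c A \<in> U"
  using W.lincomb_closed[of A c] unfolding module_mat_carrier_update_simps class_ring_simps by blast

lemma lincomb_empty_mat: "W.lincomb c {} = 0\<^sub>m M M"
  unfolding W.lincomb_def by (simp add: module_mat_carrier_update_simps)

lemma lincomb_insert_mat:
  assumes "finite A" "x \<notin> A" "insert x A \<subseteq> U"
  shows "W.lincomb c (insert x A) = c x \<cdot>\<^sub>m x + W.lincomb c A"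
proof -
  have "(\<lambda>v. c v \<cdot>\<^sub>m v) \<in> A \<rightarrow> U" "c x \<cdot>\<^sub>m x \<in> U"
    using assms(3) subspace_matD(4)[OF U] by blast+
  then show ?thesis
    using W.finsum_insert[OF assms(1,2), of "\<lambda>v. c v \<cdot>\<^sub>m v"]
    unfolding W.lincomb_def module_mat_carrier_update_simps by blast
qed

lemma lincomb_entry:
  assumes "finite A" "A \<subseteq> U" "i < M" "j < M"
  shows "W.lincomb c A $$ (i, j) = (\<Sum>a\<in>A. c a * a $$ (i, j))"
  using assms(1,2)
proof (induction A)
  case empty
  then show ?case using assms unfolding lincomb_empty_mat by simp
next
  case (insert x A)
  have "W.lincomb c (insert x A) = c x \<cdot>\<^sub>m x + W.lincomb c A"
    by (rule lincomb_insert_mat) (use insert in auto)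
  moreover have "x \<in> carrier_mat M M" "W.lincomb c A \<in> carrier_mat M M"
    using insert.prems subspace_matD(1)[OF U] lincomb_closed_mat[of A c] by blast+
  ultimately show ?case using insert.IH insert.prems insert.hyps assms(3,4) by simp
qed

lemma lin_dep_by_functionals:
  assumes "finite A" "A \<subseteq> U" "finite J" "card J < card A"
    and add: "\<And>l x y. l \<in> J \<Longrightarrow> x \<in> U \<Longrightarrow> y \<in> U \<Longrightarrow> g l (x + y) = g l x + g l y"
    and sm: "\<And>l c x. l \<in> J \<Longrightarrow> x \<in> U \<Longrightarrow> g l (c \<cdot>\<^sub>m x) = c * g l x"
    and sep: "\<And>x. x \<in> U \<Longrightarrow> (\<And>l. l \<in> J \<Longrightarrow> g l x = 0) \<Longrightarrow> x = 0\<^sub>m M M"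
  shows "W.lin_dep A"
proof -
  obtain c where c: "\<exists>a\<in>A. c a \<noteq> 0" "\<forall>l\<in>J. (\<Sum>a\<in>A. g l a * c a) = 0"
    using underdetermined_system[OF assms(3,1,4), of g] by blast
  have "g l (W.lincomb c B) = (\<Sum>a\<in>B. g l a * c a)" if "finite B" "B \<subseteq> A" "l \<in> J" for B l
    using that(1,2)
  proof (induction B)
    case empty
    have "g l (0 \<cdot>\<^sub>m 0\<^sub>m M M) = 0 * g l (0\<^sub>m M M)" by (rule sm[OF that(3) subspace_matD(2)[OF U]])
    then show ?case unfolding lincomb_empty_mat by simp
  next
    case (insert x B)
    have xU: "x \<in> U" "insert x B \<subseteq> U" "B \<subseteq> U" using insert.prems assms(2) by blast+
    have "g l (W.lincomb c (insert x B)) = c x * g l x + g l (W.lincomb c B)"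
      unfolding lincomb_insert_mat[OF insert.hyps xU(2)]
        add[OF that(3) subspace_matD(4)[OF U xU(1)] lincomb_closed_mat[OF xU(3)]] sm[OF that(3) xU(1)] ..
    then show ?case using insert.IH insert.prems insert.hyps by (simp add: mult.commute)
  qed
  then have "g l (W.lincomb c A) = 0" if "l \<in> J" for l using c(2) assms(1) that by simp
  then have "W.lincomb c A = 0\<^sub>m M M" using lincomb_closed_mat[OF assms(2)] by (rule sep[rotated])
  moreover obtain a where "a \<in> A" "c a \<noteq> 0" using c(1) by blast
  ultimately show ?thesis using assms(1) unfolding W.lin_dep_def
    by (intro exI[of _ A] exI[of _ c] exI[of _ a])
       (simp add: module_mat_carrier_update_simps class_ring_simps)
qed

text \<open>More vectors than separating functionals are dependent, so the sizes of independent sets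
  are bounded and a largest one is a basis. Finite dimension is part of the conclusion because
  \<open>dim_ge_independent\<close> relies on it.\<close>

lemma dim_le_functionals:
  assumes "finite J"
    and "\<And>l x y. l \<in> J \<Longrightarrow> x \<in> U \<Longrightarrow> y \<in> U \<Longrightarrow> g l (x + y) = g l x + g l y"
    and "\<And>l c x. l \<in> J \<Longrightarrow> x \<in> U \<Longrightarrow> g l (c \<cdot>\<^sub>m x) = c * g l x"
    and "\<And>x. x \<in> U \<Longrightarrow> (\<And>l. l \<in> J \<Longrightarrow> g l x = 0) \<Longrightarrow> x = 0\<^sub>m M M"
  shows "W.fin_dim \<and> W.dim \<le> card J"
proof -
  have bound: "finite A \<and> card A \<le> card J" if A: "A \<subseteq> U" "\<not> W.lin_dep A" for A
  proof (rule ccontr)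
    assume "\<not> ?thesis"
    then have "infinite A \<or> card J < card A" by auto
    then obtain B where B: "B \<subseteq> A" "finite B" "card J < card B"
    proof
      assume "infinite A"
      then show ?thesis using that infinite_arbitrarily_large[of A "Suc (card J)"] by auto
    next
      assume *: "card J < card A"
      then have "finite A" using card.infinite by fastforce
      then show ?thesis using that[of A] * by auto
    qed
    have "W.lin_dep B"
      by (rule lin_dep_by_functionals[of B J g, OF B(2) _ assms(1) B(3) assms(2,3,4)]) (use A B in auto)
    then show False using W.subset_li_is_li[OF A(2) B(1)] by simp
  qed
  let ?P = "\<lambda>A. A \<subseteq> U \<and> \<not> W.lin_dep A"
  have "?P {}" unfolding W.lin_dep_def by simp
  moreover have "\<forall>A. ?P A \<longrightarrow> card A < Suc (card J)"
  proof (intro allI impI)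
    fix A assume "?P A"
    then show "card A < Suc (card J)" using bound[of A] by simp
  qed
  ultimately obtain A where A: "A \<subseteq> U" "\<not> W.lin_dep A" and max: "\<forall>B. ?P B \<longrightarrow> card B \<le> card A"
    using ex_has_greatest_nat[of ?P "{}" card "Suc (card J)"] by (elim exE conjE) metis
  have "B = A" if "A \<subseteq> B" "B \<subseteq> U" "\<not> W.lin_dep B" for B
    using card_seteq[of B A] bound[OF that(2,3)] max[rule_format, of B] that by simp
  then have "maximal A (\<lambda>S. S \<subseteq> carrier ((module_mat TYPE('k) M M)\<lparr>carrier := U\<rparr>) \<and> W.lin_indpt S)"
    unfolding maximal_def module_mat_carrier_update_simps using A by simp
  then have gen: "W.gen_set A" by (rule W.max_li_is_gen)
  then have "W.basis A" using A by (simp add: W.basis_def module_mat_carrier_update_simps)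
  then have "W.dim = card A" using bound[OF A] W.dim_basis by simp
  moreover have "W.fin_dim" using gen A bound[OF A] unfolding W.fin_dim_def
    by (intro exI[of _ A]) (simp add: module_mat_carrier_update_simps)
  ultimately show ?thesis using bound[OF A] by simp
qed

lemma dim_ge_independent:
  assumes "finite J" and e: "\<And>l. l \<in> J \<Longrightarrow> e l \<in> U"
    and ind: "\<And>c. (\<And>i j. i < M \<Longrightarrow> j < M \<Longrightarrow> (\<Sum>l\<in>J. c l * e l $$ (i, j)) = 0) \<Longrightarrow> \<forall>l\<in>J. c l = 0"
  shows "card J \<le> W.dim"
proof -
  have U': "U \<subseteq> carrier_mat M M" by (rule subspace_matD[OF U])
  have e0: "x = 0\<^sub>m M M" if "x \<in> U" "\<And>l. l \<in> {..<M} \<times> {..<M} \<Longrightarrow> x $$ l = 0" for x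
  proof (rule eq_matI)
    have x: "x \<in> carrier_mat M M" using that(1) U' by (rule subsetD[rotated])
    then show "dim_row x = dim_row (0\<^sub>m M M)" "dim_col x = dim_col (0\<^sub>m M M)" by simp_all
    show "x $$ (i, j) = 0\<^sub>m M M $$ (i, j)"
      if "i < dim_row (0\<^sub>m M M)" "j < dim_col (0\<^sub>m M M)" for i j
      using that \<open>\<And>l. l \<in> {..<M} \<times> {..<M} \<Longrightarrow> x $$ l = 0\<close>[of "(i, j)"] by simp
  qed
  have e1: "(x + y) $$ l = x $$ l + y $$ l"
    if "l \<in> {..<M} \<times> {..<M}" "x \<in> U" "y \<in> U" for l x y
    using that subsetD[OF U' that(2)] subsetD[OF U' that(3)] by (cases l) simp
  have e2: "(c \<cdot>\<^sub>m x) $$ l = c * x $$ l"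
    if "l \<in> {..<M} \<times> {..<M}" "x \<in> U" for l x c
    using that subsetD[OF U' that(2)] by (cases l) simp
  \<comment> \<open>The matrix entries separate points; this is only to secure finite dimension for
    the comparison of independent sets with \<open>W.dim\<close>.\<close>
  have "W.fin_dim \<and> W.dim \<le> card ({..<M} \<times> {..<M})"
  proof (rule dim_le_functionals)
    show "finite ({..<M} \<times> {..<M})" by simp
  qed (fact e1 e2 e0)+
  then have fd: "W.fin_dim" ..
  \<comment> \<open>A repeated vector would satisfy the relation with coefficients 1 and -1, so the
    family has as many members as its image.\<close>
  have inj: "inj_on e J"
  proof
    fix k l assume kl: "k \<in> J" "l \<in> J" "e k = e l"
    show "k = l"
    proof (rule ccontr)
      assume ne: "k \<noteq> l"
      let ?c = "\<lambda>x. if x = k then 1 else if x = l then - 1 else (0 :: 'k)"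
      have z: "(\<Sum>x\<in>J. ?c x * e x $$ (i, j)) = 0" for i j
      proof -
        have "(\<Sum>x\<in>J. ?c x * e x $$ (i, j)) = (\<Sum>x\<in>{k, l}. ?c x * e x $$ (i, j))"
          using kl(1,2) assms(1) by (intro sum.mono_neutral_right) simp_all
        also have "\<dots> = 0" using ne by (simp add: kl(3))
        finally show ?thesis .
      qed
      have "\<forall>x\<in>J. ?c x = 0" by (rule ind[of ?c], rule z)
      from bspec[OF this kl(1)] show False by simp
    qed
  qed
  have "W.lin_indpt (e ` J)"
  proof
    assume "W.lin_dep (e ` J)"
    then obtain A c where A: "finite A" "A \<subseteq> e ` J" "W.lincomb c A = 0\<^sub>m M M" "\<exists>v\<in>A. c v \<noteq> 0"
      unfolding W.lin_dep_def module_mat_carrier_update_simps class_ring_simps by blast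
    have AU: "A \<subseteq> U" using A e by auto
    define c' where "c' l = (if e l \<in> A then c (e l) else 0)" for l
    have z: "(\<Sum>l\<in>J. c' l * e l $$ (i, j)) = 0" if ij: "i < M" "j < M" for i j
    proof -
      have "(\<Sum>l\<in>J. c' l * e l $$ (i, j)) = (\<Sum>a\<in>e ` J. (if a \<in> A then c a else 0) * a $$ (i, j))"
        using inj by (subst sum.reindex) (auto simp: c'_def)
      also have "\<dots> = (\<Sum>a\<in>A. c a * a $$ (i, j))"
        using A assms(1) by (intro sum.mono_neutral_cong_right) auto
      also have "\<dots> = 0" using lincomb_entry[OF A(1) AU ij, of c] A(3) ij by simp
      finally show ?thesis .
    qed
    have "\<forall>l\<in>J. c' l = 0" by (rule ind[of c'], rule z)
    moreover obtain v where v: "v \<in> A" "c v \<noteq> 0" using A(4) by blast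
    moreover obtain l where "l \<in> J" "v = e l" using A(2) v(1) by blast
    ultimately show False by (auto simp: c'_def)
  qed
  moreover have "e ` J \<subseteq> U" using e by auto
  ultimately have "card (e ` J) \<le> W.dim"
    using W.li_le_dim(2)[OF fd] by (simp add: module_mat_carrier_update_simps)
  then show ?thesis by (simp add: card_image[OF inj])
qed

end

section \<open>Symplectic matrices\<close>

text \<open>The mirror of a 0-based index at the centre of the range; on the diagonal of a matrix in
  \<open>sp n\<close> it exchanges an entry with its negative.\<close>

definition bar :: "nat \<Rightarrow> nat \<Rightarrow> nat" where
  "bar n i = 2 * n - 1 - i"

definition sgn_idx :: "nat \<Rightarrow> nat \<Rightarrow> 'k::field" where
  "sgn_idx n i = (if i < n then 1 else - 1)"

lemma bar_less [simp]: "i < 2 * n \<Longrightarrow> bar n i < 2 * n"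
  by (simp add: bar_def)

lemma bar_bar [simp]: "i < 2 * n \<Longrightarrow> bar n (bar n i) = i"
  by (simp add: bar_def)

lemma bar_eq_iff [simp]: "i < 2 * n \<Longrightarrow> j < 2 * n \<Longrightarrow> bar n i = bar n j \<longleftrightarrow> i = j"
  by (auto simp: bar_def)

lemma bar_neq [simp]: "i < 2 * n \<Longrightarrow> bar n i \<noteq> i"
  unfolding bar_def by presburger

lemma bar_less_iff: "i < 2 * n \<Longrightarrow> j < 2 * n \<Longrightarrow> bar n i < bar n j \<longleftrightarrow> j < i"
  by (auto simp: bar_def)

lemma bij_betw_bar: "bij_betw (bar n) {..<2 * n} {..<2 * n}"
  by (rule bij_betwI[where g = "bar n"]) auto

lemma sgn_idx_bar [simp]: "i < 2 * n \<Longrightarrow> sgn_idx n (bar n i) = - sgn_idx n i"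
  by (auto simp: sgn_idx_def bar_def)

lemma sgn_idx_sq [simp]: "sgn_idx n i * sgn_idx n i = 1" "sgn_idx n i * (sgn_idx n i * x) = x"
  by (auto simp: sgn_idx_def)

lemma sgn_idx_nz [simp]: "sgn_idx n i \<noteq> 0"
  by (auto simp: sgn_idx_def)

text \<open>The adjoint for the symplectic form whose Gram matrix is antidiagonal with signs
  \<open>sgn_idx\<close>. It reverses products, and \<open>sp n\<close> consists of the matrices it
  sends to their negatives.\<close>

definition star :: "nat \<Rightarrow> 'k::field mat \<Rightarrow> 'k mat" where
  "star n X = mat (2 * n) (2 * n) (\<lambda>(i, j). sgn_idx n i * sgn_idx n j * X $$ (bar n j, bar n i))"

lemma star_carrier [simp]: "star n X \<in> carrier_mat (2 * n) (2 * n)"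
  by (simp add: star_def)

lemma star_index [simp]:
  "i < 2 * n \<Longrightarrow> j < 2 * n \<Longrightarrow> star n X $$ (i, j) = sgn_idx n i * sgn_idx n j * X $$ (bar n j, bar n i)"
  by (simp add: star_def)

lemma star_dim [simp]: "dim_row (star n X) = 2 * n" "dim_col (star n X) = 2 * n"
  by (simp_all add: star_def)

lemma star_star: "X \<in> carrier_mat (2 * n) (2 * n) \<Longrightarrow> star n (star n X) = X"
  by (intro eq_matI) (auto simp: mult.assoc mult.left_commute)

lemma star_minus:
  "A \<in> carrier_mat (2 * n) (2 * n) \<Longrightarrow> B \<in> carrier_mat (2 * n) (2 * n) \<Longrightarrow> star n (A - B) = star n A - star n B"
  by (intro eq_matI) (auto simp: right_diff_distrib)

lemma mult_index_sum:
  "A \<in> carrier_mat M M \<Longrightarrow> B \<in> carrier_mat M M \<Longrightarrow> i < M \<Longrightarrow> j < M \<Longrightarrow>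
    (A * B) $$ (i, j) = (\<Sum>k<M. A $$ (i, k) * B $$ (k, j))"
  by (simp add: scalar_prod_def atLeast0LessThan)

lemma star_mult:
  assumes "A \<in> carrier_mat (2 * n) (2 * n)" "B \<in> carrier_mat (2 * n) (2 * n)"
  shows "star n (A * B) = star n B * star n A"
proof (intro eq_matI)
  fix i j assume "i < dim_row (star n B * star n A)" "j < dim_col (star n B * star n A)"
  then have ij: "i < 2 * n" "j < 2 * n" by auto
  have "(star n B * star n A) $$ (i, j) = (\<Sum>k<2*n. star n B $$ (i, k) * star n A $$ (k, j))"
    using ij by (intro mult_index_sum) auto
  also have "\<dots> = (\<Sum>k<2*n. sgn_idx n i * sgn_idx n j * (A $$ (bar n j, bar n k) * B $$ (bar n k, bar n i)))"
    using ij by (intro sum.cong) (auto simp: mult_ac)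
  also have "\<dots> = sgn_idx n i * sgn_idx n j * (\<Sum>k<2*n. A $$ (bar n j, bar n k) * B $$ (bar n k, bar n i))"
    by (simp add: sum_distrib_left)
  also have "(\<Sum>k<2*n. A $$ (bar n j, bar n k) * B $$ (bar n k, bar n i)) = (\<Sum>k<2*n. A $$ (bar n j, k) * B $$ (k, bar n i))"
    by (rule sum.reindex_bij_betw[OF bij_betw_bar])
  also have "\<dots> = (A * B) $$ (bar n j, bar n i)"
    using ij assms by (subst mult_index_sum) auto
  finally show "star n (A * B) $$ (i, j) = (star n B * star n A) $$ (i, j)"
    using ij by simp
qed (use assms in auto)

text \<open>The product of the two signs is -1 on the off-diagonal blocks, where the condition
  becomes symmetry under the antidiagonal transpose, and 1 on the diagonal blocks, where it relates
  the fourth block to the first with a minus sign.\<close>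

lemma sp_iff_entries:
  "X \<in> sp n \<longleftrightarrow> X \<in> carrier_mat (2 * n) (2 * n) \<and>
    (\<forall>i<2*n. \<forall>j<2*n. X $$ (bar n j, bar n i) = - (sgn_idx n i * sgn_idx n j * X $$ (i, j)))"
proof
  assume "X \<in> sp n"
  then obtain A B C where ABC: "A \<in> carrier_mat n n" "B \<in> carrier_mat n n" "C \<in> carrier_mat n n"
    "B = anti_transpose B" "C = anti_transpose C" and X: "X = four_block_mat A B C (- anti_transpose A)"
    unfolding sp_def by blast
  have aA: "anti_transpose A \<in> carrier_mat n n" using ABC by (simp add: anti_transpose_def)
  have B: "B $$ (i, j) = B $$ (n - 1 - j, n - 1 - i)" if "i < n" "j < n" for i j
    using that arg_cong[OF ABC(4), of "\<lambda>Y. Y $$ (i, j)"] ABC by (simp add: anti_transpose_def)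
  have C: "C $$ (i, j) = C $$ (n - 1 - j, n - 1 - i)" if "i < n" "j < n" for i j
    using that arg_cong[OF ABC(5), of "\<lambda>Y. Y $$ (i, j)"] ABC by (simp add: anti_transpose_def)
  have "X $$ (bar n j, bar n i) = - (sgn_idx n i * sgn_idx n j * X $$ (i, j))" if ij: "i < 2*n" "j < 2*n" for i j
  proof -
    have e1: "X $$ (k, l) = A $$ (k, l)" if "k < n" "l < n" for k l using that ABC aA X by simp
    have e2: "X $$ (k, l) = B $$ (k, l - n)" if "k < n" "n \<le> l" "l < 2 * n" for k l using that ABC aA X by simp
    have e3: "X $$ (k, l) = C $$ (k - n, l)" if "n \<le> k" "k < 2 * n" "l < n" for k l using that ABC aA X by simp
    have e4: "X $$ (k, l) = - (A $$ (n - 1 - (l - n), n - 1 - (k - n)))" if "n \<le> k" "k < 2 * n" "n \<le> l" "l < 2 * n" for k l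
      using that ABC aA X by (simp add: anti_transpose_def)
    consider "i < n" "j < n" | "i < n" "n \<le> j" | "n \<le> i" "j < n" | "n \<le> i" "n \<le> j" by linarith
    then show ?thesis
    proof cases
      case 1
      have "n - 1 - (bar n i - n) = i" "n - 1 - (bar n j - n) = j" "n \<le> bar n i" "n \<le> bar n j"
        using 1 by (auto simp: bar_def)
      then show ?thesis using 1 ij e1[of i j] e4[of "bar n j" "bar n i"] by (simp add: sgn_idx_def)
    next
      case 2
      have "bar n j < n" "n \<le> bar n i" "bar n i - n = n - 1 - i" "bar n j = n - 1 - (j - n)"
        using 2 ij by (auto simp: bar_def)
      then show ?thesis using 2 ij e2[of i j] e2[of "bar n j" "bar n i"] B[of i "j - n"]
        by (simp add: sgn_idx_def)
    next
      case 3
      have "n \<le> bar n j" "bar n i < n" "bar n j - n = n - 1 - j" "bar n i = n - 1 - (i - n)"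
        using 3 ij by (auto simp: bar_def)
      then show ?thesis using 3 ij e3[of i j] e3[of "bar n j" "bar n i"] C[of "i - n" j]
        by (simp add: sgn_idx_def)
    next
      case 4
      have "bar n i < n" "bar n j < n" "n - 1 - (i - n) = bar n i" "n - 1 - (j - n) = bar n j"
        using 4 ij by (auto simp: bar_def)
      then show ?thesis using 4 ij e4[of i j] e1[of "bar n j" "bar n i"] by (simp add: sgn_idx_def)
    qed
  qed
  moreover have "X \<in> carrier_mat (2 * n) (2 * n)"
    using X ABC aA by (auto intro!: carrier_matI)
  ultimately show "X \<in> carrier_mat (2 * n) (2 * n) \<and>
    (\<forall>i<2*n. \<forall>j<2*n. X $$ (bar n j, bar n i) = - (sgn_idx n i * sgn_idx n j * X $$ (i, j)))" by blast
next
  assume X: "X \<in> carrier_mat (2 * n) (2 * n) \<and>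
    (\<forall>i<2*n. \<forall>j<2*n. X $$ (bar n j, bar n i) = - (sgn_idx n i * sgn_idx n j * X $$ (i, j)))"
  then have Xs: "X $$ (bar n j, bar n i) = - (sgn_idx n i * sgn_idx n j * X $$ (i, j))"
    if "i < 2*n" "j < 2*n" for i j using that by blast
  define A where "A = mat n n (\<lambda>(i, j). X $$ (i, j))"
  define B where "B = mat n n (\<lambda>(i, j). X $$ (i, j + n))"
  define C where "C = mat n n (\<lambda>(i, j). X $$ (i + n, j))"
  have "B = anti_transpose B"
  proof (intro eq_matI)
    fix i j assume "i < dim_row (anti_transpose B)" "j < dim_col (anti_transpose B)"
    then have ij: "i < n" "j < n" by (auto simp: B_def anti_transpose_def)
    have "bar n (j + n) = n - 1 - j" "bar n i = n - 1 - i + n" using ij by (auto simp: bar_def)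
    then show "B $$ (i, j) = anti_transpose B $$ (i, j)"
      using ij Xs[of i "j + n"] by (simp add: B_def anti_transpose_def sgn_idx_def)
  qed (auto simp: B_def anti_transpose_def)
  moreover have "C = anti_transpose C"
  proof (intro eq_matI)
    fix i j assume "i < dim_row (anti_transpose C)" "j < dim_col (anti_transpose C)"
    then have ij: "i < n" "j < n" by (auto simp: C_def anti_transpose_def)
    have "bar n j = n - 1 - j + n" "bar n (i + n) = n - 1 - i" using ij by (auto simp: bar_def)
    then show "C $$ (i, j) = anti_transpose C $$ (i, j)"
      using ij Xs[of "i + n" j] by (simp add: C_def anti_transpose_def sgn_idx_def)
  qed (auto simp: C_def anti_transpose_def)
  moreover have "X = four_block_mat A B C (- anti_transpose A)"
  proof (intro eq_matI)
    fix i j assume "i < dim_row (four_block_mat A B C (- anti_transpose A))"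
      "j < dim_col (four_block_mat A B C (- anti_transpose A))"
    then have ij: "i < 2 * n" "j < 2 * n" by (auto simp: A_def B_def C_def anti_transpose_def)
    show "X $$ (i, j) = four_block_mat A B C (- anti_transpose A) $$ (i, j)"
    proof (cases "n \<le> i \<and> n \<le> j")
      case True
      have "n - 1 - (j - n) = bar n j" "n - 1 - (i - n) = bar n i" "bar n i < n" "bar n j < n"
        using True ij by (auto simp: bar_def)
      then show ?thesis using True ij Xs[OF ij]
        by (simp add: A_def B_def C_def anti_transpose_def sgn_idx_def)
    next
      case False
      then show ?thesis using ij by (auto simp: A_def B_def C_def anti_transpose_def)
    qed
  qed (use X in \<open>auto simp: A_def B_def C_def anti_transpose_def\<close>)
  moreover have "A \<in> carrier_mat n n" "B \<in> carrier_mat n n" "C \<in> carrier_mat n n"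
    by (auto simp: A_def B_def C_def)
  ultimately show "X \<in> sp n" unfolding sp_def by blast
qed

lemma spI:
  assumes "X \<in> carrier_mat (2 * n) (2 * n)"
    and "\<And>i j. i < 2 * n \<Longrightarrow> j < 2 * n \<Longrightarrow> X $$ (bar n j, bar n i) = - (sgn_idx n i * sgn_idx n j * X $$ (i, j))"
  shows "X \<in> sp n"
  unfolding sp_iff_entries by (intro conjI allI impI assms)

lemma sp_iff_star: "X \<in> sp n \<longleftrightarrow> X \<in> carrier_mat (2 * n) (2 * n) \<and> star n X = - X"
proof (cases "X \<in> carrier_mat (2 * n) (2 * n)")
  case True
  have "star n X = - X \<longleftrightarrow> (\<forall>i<2*n. \<forall>j<2*n. star n X $$ (i, j) = (- X) $$ (i, j))"
  proof
    assume R: "\<forall>i<2*n. \<forall>j<2*n. star n X $$ (i, j) = (- X) $$ (i, j)"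
    show "star n X = - X"
    proof (rule eq_matI)
      fix i j assume "i < dim_row (- X)" "j < dim_col (- X)"
      then show "star n X $$ (i, j) = (- X) $$ (i, j)" using R True by simp
    qed (use True in simp_all)
  qed simp
  also have "\<dots> \<longleftrightarrow> (\<forall>i<2*n. \<forall>j<2*n. X $$ (bar n j, bar n i) = - (sgn_idx n i * sgn_idx n j * X $$ (i, j)))"
  proof -
    have "star n X $$ (i, j) = (- X) $$ (i, j) \<longleftrightarrow>
        X $$ (bar n j, bar n i) = - (sgn_idx n i * sgn_idx n j * X $$ (i, j))"
      if "i < 2 * n" "j < 2 * n" for i j
      using that True minus_equation_iff[of "X $$ (bar n j, bar n i)" "X $$ (i, j)"]
      by (auto simp: sgn_idx_def)
    then show ?thesis by blast
  qed
  finally show ?thesis using True by (simp add: sp_iff_entries)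
qed (simp add: sp_iff_entries)

lemma sp_carrier: "X \<in> sp n \<Longrightarrow> X \<in> carrier_mat (2 * n) (2 * n)"
  by (simp add: sp_iff_star)

lemma sp_entry:
  "X \<in> sp n \<Longrightarrow> i < 2 * n \<Longrightarrow> j < 2 * n \<Longrightarrow>
    X $$ (bar n j, bar n i) = - (sgn_idx n i * sgn_idx n j * X $$ (i, j))"
  using sp_iff_entries by blast

lemma commutator_carrier:
  "X \<in> carrier_mat M M \<Longrightarrow> Y \<in> carrier_mat M M \<Longrightarrow> commutator X Y \<in> carrier_mat M M"
  unfolding commutator_def by (intro minus_carrier_mat mult_carrier_mat)

lemma commutator_index:
  "X \<in> carrier_mat M M \<Longrightarrow> Y \<in> carrier_mat M M \<Longrightarrow> i < M \<Longrightarrow> j < M \<Longrightarrow>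
    commutator X Y $$ (i, j) = (\<Sum>k<M. X $$ (i, k) * Y $$ (k, j)) - (\<Sum>k<M. Y $$ (i, k) * X $$ (k, j))"
  using mult_index_sum[of X M Y i j] mult_index_sum[of Y M X i j] by (simp add: commutator_def)

lemma star_commutator:
  assumes "X \<in> carrier_mat (2 * n) (2 * n)" "Y \<in> carrier_mat (2 * n) (2 * n)"
  shows "star n (commutator X Y) = commutator (star n Y) (star n X)"
  using assms by (simp add: commutator_def star_minus[of _ n] star_mult[of _ n])

lemma commutator_sp: "X \<in> sp n \<Longrightarrow> Y \<in> sp n \<Longrightarrow> commutator X Y \<in> sp n"
proof -
  assume XY: "X \<in> sp n" "Y \<in> sp n"
  then have c: "X \<in> carrier_mat (2 * n) (2 * n)" "Y \<in> carrier_mat (2 * n) (2 * n)" by (auto simp: sp_carrier)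
  have "star n (commutator X Y) = commutator (- Y) (- X)"
    using XY by (simp add: star_commutator[OF c] sp_iff_star)
  also have "\<dots> = - commutator X Y"
    using c by (intro eq_matI) (auto simp: commutator_def)
  finally show ?thesis using c by (simp add: sp_iff_star commutator_carrier)
qed

lemma sp_zero: "0\<^sub>m (2 * n) (2 * n) \<in> sp n"
  by (auto simp: sp_iff_entries)

lemma sp_add:
  assumes "X \<in> sp n" "Y \<in> sp n"
  shows "X + Y \<in> sp n"
proof (rule spI)
  note c = assms[THEN sp_carrier]
  then show "X + Y \<in> carrier_mat (2 * n) (2 * n)" by simp
  fix i j assume ij: "i < 2 * n" "j < 2 * n"
  have "(X + Y) $$ (bar n j, bar n i) = X $$ (bar n j, bar n i) + Y $$ (bar n j, bar n i)"
    using c ij by simp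
  also have "\<dots> = - (sgn_idx n i * sgn_idx n j * (X $$ (i, j) + Y $$ (i, j)))"
    unfolding sp_entry[OF assms(1) ij] sp_entry[OF assms(2) ij] by (simp add: distrib_left)
  also have "X $$ (i, j) + Y $$ (i, j) = (X + Y) $$ (i, j)" using c ij by simp
  finally show "(X + Y) $$ (bar n j, bar n i) = - (sgn_idx n i * sgn_idx n j * (X + Y) $$ (i, j))" .
qed

lemma sp_smult:
  assumes "X \<in> sp n"
  shows "c \<cdot>\<^sub>m X \<in> sp n"
proof (rule spI)
  note X = assms[THEN sp_carrier]
  then show "c \<cdot>\<^sub>m X \<in> carrier_mat (2 * n) (2 * n)" by simp
  fix i j assume ij: "i < 2 * n" "j < 2 * n"
  have "(c \<cdot>\<^sub>m X) $$ (bar n j, bar n i) = c * X $$ (bar n j, bar n i)" using X ij by simp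
  also have "\<dots> = - (sgn_idx n i * sgn_idx n j * (c * X $$ (i, j)))"
    unfolding sp_entry[OF assms ij] by (simp add: mult_ac)
  also have "c * X $$ (i, j) = (c \<cdot>\<^sub>m X) $$ (i, j)" using X ij by simp
  finally show "(c \<cdot>\<^sub>m X) $$ (bar n j, bar n i) = - (sgn_idx n i * sgn_idx n j * (c \<cdot>\<^sub>m X) $$ (i, j))" .
qed

section \<open>Elementary matrices and root vectors\<close>

definition unit_mat :: "nat \<Rightarrow> nat \<Rightarrow> nat \<Rightarrow> 'k::field mat" where
  "unit_mat n i j = mat (2 * n) (2 * n) (\<lambda>(a, b). if a = i \<and> b = j then 1 else 0)"

text \<open>A root vector for i \<noteq> j and a torus element for i = j. On the antidiagonal, where
  j is the mirror of i, the two terms coincide up to sign and the entry is 2; this causes the case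
  distinctions with 2 below.\<close>

definition skew_unit :: "nat \<Rightarrow> nat \<Rightarrow> nat \<Rightarrow> 'k::field mat" where
  "skew_unit n i j = unit_mat n i j - star n (unit_mat n i j)"

lemma unit_mat_carrier [simp]: "unit_mat n i j \<in> carrier_mat (2 * n) (2 * n)"
  by (simp add: unit_mat_def)

lemma unit_mat_index [simp]:
  "a < 2 * n \<Longrightarrow> b < 2 * n \<Longrightarrow> unit_mat n i j $$ (a, b) = (if a = i \<and> b = j then 1 else 0)"
  by (simp add: unit_mat_def)

lemma skew_unit_dim [simp]: "dim_row (skew_unit n i j) = 2 * n" "dim_col (skew_unit n i j) = 2 * n"
  by (simp_all add: skew_unit_def unit_mat_def)

lemma skew_unit_carrier [simp]: "skew_unit n i j \<in> carrier_mat (2 * n) (2 * n)"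
  by (rule carrier_matI) simp_all

lemma skew_unit_index:
  assumes "a < 2 * n" "b < 2 * n" "i < 2 * n" "j < 2 * n"
  shows "skew_unit n i j $$ (a, b) = (if a = i \<and> b = j then 1 else 0)
    - (if a = bar n j \<and> b = bar n i then sgn_idx n i * sgn_idx n j else 0)"
proof -
  have "bar n b = i \<longleftrightarrow> b = bar n i" "bar n a = j \<longleftrightarrow> a = bar n j" using assms by auto
  then show ?thesis using assms
    by (auto simp: skew_unit_def mult.commute[of "sgn_idx n j"] simp del: bar_eq_iff)
qed

lemma skew_unit_sp: "skew_unit n i j \<in> sp n"
proof -
  have "star n (skew_unit n i j) = star n (unit_mat n i j) - unit_mat n i j"
    unfolding skew_unit_def by (simp add: star_minus star_star)
  also have "\<dots> = - skew_unit n i j" unfolding skew_unit_def by (intro eq_matI) (auto simp: unit_mat_def)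
  finally show ?thesis by (simp add: sp_iff_star)
qed


lemma skew_unit_bar_index:
  assumes ab: "a < 2 * n" "b < 2 * n" and ij: "i < 2 * n" "j < 2 * n"
  shows "(skew_unit n (bar n j) (bar n i) :: 'k::field mat) $$ (a, b)
    = - (sgn_idx n i * sgn_idx n j) * skew_unit n i j $$ (a, b)"
proof -
  have gen: "(if P then 1 else 0) - (if Q then c else 0) = - c * ((if Q then 1 else 0) - (if P then c else 0))"
    if "c * c = 1" for P Q and c :: 'k
    using that by (cases P; cases Q) (simp_all add: algebra_simps)
  have sq: "sgn_idx n i * sgn_idx n j * (sgn_idx n i * sgn_idx n j) = (1 :: 'k)"
    by (simp add: sgn_idx_def)
  show ?thesis
    unfolding skew_unit_index[OF assms] skew_unit_index[OF ab bar_less[OF ij(2)] bar_less[OF ij(1)]]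
      bar_bar[OF ij(1)] bar_bar[OF ij(2)] sgn_idx_bar[OF ij(1)] sgn_idx_bar[OF ij(2)] minus_mult_minus
      mult.commute[of "sgn_idx n j" "sgn_idx n i"]
    by (rule gen[OF sq])
qed

lemma skew_unit_bar:
  assumes "i < 2 * n" "j < 2 * n"
  shows "skew_unit n (bar n j) (bar n i) = (- (sgn_idx n i * sgn_idx n j)) \<cdot>\<^sub>m (skew_unit n i j :: 'k::field mat)"
proof (rule eq_matI)
  fix a b assume "a < dim_row ((- (sgn_idx n i * sgn_idx n j)) \<cdot>\<^sub>m (skew_unit n i j :: 'k mat))"
    "b < dim_col ((- (sgn_idx n i * sgn_idx n j)) \<cdot>\<^sub>m (skew_unit n i j :: 'k mat))"
  then have ab: "a < 2 * n" "b < 2 * n" by simp_all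
  show "(skew_unit n (bar n j) (bar n i) :: 'k mat) $$ (a, b) = (- (sgn_idx n i * sgn_idx n j) \<cdot>\<^sub>m skew_unit n i j) $$ (a, b)"
    unfolding skew_unit_bar_index[OF ab assms] using ab by (intro index_smult_mat(1)[symmetric]) simp_all
qed simp_all

section \<open>Functionals and their alternating forms\<close>

definition lf :: "nat \<Rightarrow> (nat \<Rightarrow> nat \<Rightarrow> 'k::field) \<Rightarrow> 'k mat \<Rightarrow> 'k" where
  "lf n \<phi> X = (\<Sum>i<2*n. \<Sum>j<2*n. \<phi> i j * X $$ (i, j))"

definition bf :: "nat \<Rightarrow> (nat \<Rightarrow> nat \<Rightarrow> 'k::field) \<Rightarrow> 'k mat \<Rightarrow> 'k mat \<Rightarrow> 'k" where
  "bf n \<phi> X Y = lf n \<phi> (commutator X Y)"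

text \<open>Coefficients on all 2n by 2n positions represent a functional on \<open>sp n\<close>
  ambiguously. The normalisation asks that the coefficient matrix be itself odd under the symplectic
  adjoint, so that the functional changes sign under \<open>star\<close>.\<close>

definition skew_coeffs :: "nat \<Rightarrow> (nat \<Rightarrow> nat \<Rightarrow> 'k::field) \<Rightarrow> bool" where
  "skew_coeffs n \<phi> \<longleftrightarrow>
     (\<forall>i<2*n. \<forall>j<2*n. \<phi> (bar n j) (bar n i) = - (sgn_idx n i * sgn_idx n j * \<phi> i j))"

lemma lf_add:
  "X \<in> carrier_mat (2*n) (2*n) \<Longrightarrow> Y \<in> carrier_mat (2*n) (2*n) \<Longrightarrow> lf n \<phi> (X + Y) = lf n \<phi> X + lf n \<phi> Y"
  by (simp add: lf_def distrib_left sum.distrib)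

lemma lf_smult: "X \<in> carrier_mat (2*n) (2*n) \<Longrightarrow> lf n \<phi> (c \<cdot>\<^sub>m X) = c * lf n \<phi> X"
  by (simp add: lf_def sum_distrib_left mult.left_commute)

lemma lf_zero: "lf n \<phi> (0\<^sub>m (2*n) (2*n)) = 0"
  by (simp add: lf_def)

lemma lf_linear_combination:
  "lf n (\<lambda>i j. a * \<phi> i j + b * \<psi> i j) X = a * lf n \<phi> X + b * lf n \<psi> X"
  by (simp add: lf_def sum_distrib_left sum.distrib distrib_right mult.assoc)

lemma skew_coeffs_linear_combination:
  assumes "skew_coeffs n \<phi>" "skew_coeffs n \<psi>"
  shows "skew_coeffs n (\<lambda>i j. a * \<phi> i j + b * \<psi> i j)"
  unfolding skew_coeffs_def
proof (intro allI impI)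
  fix i j assume ij: "i < 2*n" "j < 2*n"
  have e: "\<phi> (bar n j) (bar n i) = - (sgn_idx n i * sgn_idx n j * \<phi> i j)"
    "\<psi> (bar n j) (bar n i) = - (sgn_idx n i * sgn_idx n j * \<psi> i j)"
    using assms ij unfolding skew_coeffs_def by blast+
  show "a * \<phi> (bar n j) (bar n i) + b * \<psi> (bar n j) (bar n i) =
      - (sgn_idx n i * sgn_idx n j * (a * \<phi> i j + b * \<psi> i j))"
    unfolding e by (simp add: distrib_left mult.left_commute)
qed

lemma lf_star:
  assumes "skew_coeffs n \<phi>"
  shows "lf n \<phi> (star n X) = - lf n \<phi> X"
proof -
  have "lf n \<phi> (star n X) = (\<Sum>i<2*n. \<Sum>j<2*n. - (\<phi> (bar n j) (bar n i) * X $$ (bar n j, bar n i)))"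
    unfolding lf_def
  proof (intro sum.cong refl)
    fix i j assume "i \<in> {..<2*n}" "j \<in> {..<2*n}"
    then have ij: "i < 2*n" "j < 2*n" by auto
    have "\<phi> (bar n j) (bar n i) = - (sgn_idx n i * sgn_idx n j * \<phi> i j)"
      using assms ij unfolding skew_coeffs_def by blast
    then show "\<phi> i j * star n X $$ (i, j) = - (\<phi> (bar n j) (bar n i) * X $$ (bar n j, bar n i))"
      by (simp add: star_index[OF ij] mult_ac)
  qed
  also have "\<dots> = (\<Sum>i<2*n. \<Sum>j<2*n. - (\<phi> (bar n j) i * X $$ (bar n j, i)))"
    by (rule sum.reindex_bij_betw[OF bij_betw_bar, of "\<lambda>i. \<Sum>j<2*n. - (\<phi> (bar n j) i * X $$ (bar n j, i))"])
  also have "\<dots> = (\<Sum>i<2*n. \<Sum>j<2*n. - (\<phi> j i * X $$ (j, i)))"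
  proof (rule sum.cong[OF refl])
    fix i
    show "(\<Sum>j<2*n. - (\<phi> (bar n j) i * X $$ (bar n j, i))) = (\<Sum>j<2*n. - (\<phi> j i * X $$ (j, i)))"
      by (rule sum.reindex_bij_betw[OF bij_betw_bar, of "\<lambda>j. - (\<phi> j i * X $$ (j, i))"])
  qed
  also have "\<dots> = - lf n \<phi> X"
    unfolding lf_def sum_negf by (subst sum.swap) simp
  finally show ?thesis .
qed

lemma bf_sum:
  assumes "X \<in> carrier_mat (2*n) (2*n)" "Y \<in> carrier_mat (2*n) (2*n)"
  shows "bf n \<phi> X Y = (\<Sum>i<2*n. \<Sum>j<2*n. \<Sum>k<2*n.
    \<phi> i j * (X $$ (i, k) * Y $$ (k, j)) - \<phi> i j * (Y $$ (i, k) * X $$ (k, j)))"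
  unfolding bf_def lf_def
proof (intro sum.cong refl)
  fix i j assume ij: "i \<in> {..<2*n}" "j \<in> {..<2*n}"
  have c: "commutator X Y $$ (i, j) = (\<Sum>k<2*n. X $$ (i, k) * Y $$ (k, j)) - (\<Sum>k<2*n. Y $$ (i, k) * X $$ (k, j))"
    by (rule commutator_index[OF assms]) (use ij in auto)
  show "\<phi> i j * commutator X Y $$ (i, j) = (\<Sum>k<2*n.
    \<phi> i j * (X $$ (i, k) * Y $$ (k, j)) - \<phi> i j * (Y $$ (i, k) * X $$ (k, j)))"
    unfolding c right_diff_distrib sum_distrib_left sum_subtractf ..
qed

lemma bf_skew:
  assumes "X \<in> carrier_mat (2*n) (2*n)" "Y \<in> carrier_mat (2*n) (2*n)"
  shows "bf n \<phi> X Y = - bf n \<phi> Y X"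
  unfolding bf_sum[OF assms] bf_sum[OF assms(2,1)] sum_negf[symmetric] minus_diff_eq ..

lemma bf_linear_combination_left:
  assumes "X \<in> carrier_mat (2*n) (2*n)" "Y \<in> carrier_mat (2*n) (2*n)"
    and "\<And>l. l \<in> I \<Longrightarrow> E l \<in> carrier_mat (2*n) (2*n)"
    and X: "\<And>i j. i < 2*n \<Longrightarrow> j < 2*n \<Longrightarrow> X $$ (i, j) = (\<Sum>l\<in>I. c l * E l $$ (i, j))"
  shows "bf n \<phi> X Y = (\<Sum>l\<in>I. c l * bf n \<phi> (E l) Y)"
proof -
  have "bf n \<phi> X Y = (\<Sum>i<2*n. \<Sum>j<2*n. \<Sum>k<2*n. \<Sum>l\<in>I. c l *
     (\<phi> i j * (E l $$ (i, k) * Y $$ (k, j)) - \<phi> i j * (Y $$ (i, k) * E l $$ (k, j))))"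
    unfolding bf_sum[OF assms(1,2)]
  proof (intro sum.cong refl)
    fix i j k assume "i \<in> {..<2*n}" "j \<in> {..<2*n}" "k \<in> {..<2*n}"
    then have "i < 2*n" "j < 2*n" "k < 2*n" by auto
    note e = X[OF this(1,3)] X[OF this(3,2)]
    show "\<phi> i j * (X $$ (i, k) * Y $$ (k, j)) - \<phi> i j * (Y $$ (i, k) * X $$ (k, j)) =
      (\<Sum>l\<in>I. c l * (\<phi> i j * (E l $$ (i, k) * Y $$ (k, j)) - \<phi> i j * (Y $$ (i, k) * E l $$ (k, j))))"
      unfolding e sum_distrib_left sum_distrib_right right_diff_distrib sum_subtractf
      by (simp only: mult_ac)
  qed
  also have "\<dots> = (\<Sum>l\<in>I. c l * bf n \<phi> (E l) Y)"
  proof -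
    have "(\<Sum>l\<in>I. c l * bf n \<phi> (E l) Y) = (\<Sum>l\<in>I. \<Sum>i<2*n. \<Sum>j<2*n. \<Sum>k<2*n. c l *
     (\<phi> i j * (E l $$ (i, k) * Y $$ (k, j)) - \<phi> i j * (Y $$ (i, k) * E l $$ (k, j))))"
      by (intro sum.cong refl) (simp only: bf_sum[OF assms(3,2)] sum_distrib_left)
    also have "\<dots> = (\<Sum>i<2*n. \<Sum>l\<in>I. \<Sum>j<2*n. \<Sum>k<2*n. c l *
     (\<phi> i j * (E l $$ (i, k) * Y $$ (k, j)) - \<phi> i j * (Y $$ (i, k) * E l $$ (k, j))))"
      by (rule sum.swap)
    also have "\<dots> = (\<Sum>i<2*n. \<Sum>j<2*n. \<Sum>l\<in>I. \<Sum>k<2*n. c l *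
     (\<phi> i j * (E l $$ (i, k) * Y $$ (k, j)) - \<phi> i j * (Y $$ (i, k) * E l $$ (k, j))))"
      by (intro sum.cong refl) (rule sum.swap)
    also have "\<dots> = (\<Sum>i<2*n. \<Sum>j<2*n. \<Sum>k<2*n. \<Sum>l\<in>I. c l *
     (\<phi> i j * (E l $$ (i, k) * Y $$ (k, j)) - \<phi> i j * (Y $$ (i, k) * E l $$ (k, j))))"
      by (intro sum.cong refl) (rule sum.swap)
    finally show ?thesis by simp
  qed
  finally show ?thesis .
qed

lemma bf_add_right:
  assumes "X \<in> carrier_mat (2*n) (2*n)" "Y \<in> carrier_mat (2*n) (2*n)" "Z \<in> carrier_mat (2*n) (2*n)"
  shows "bf n \<phi> X (Y + c \<cdot>\<^sub>m Z) = bf n \<phi> X Y + c * bf n \<phi> X Z"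
proof -
  have "bf n \<phi> (Y + c \<cdot>\<^sub>m Z) X = (\<Sum>l\<in>{True, False}. (if l then 1 else c) * bf n \<phi> (if l then Y else Z) X)"
    by (rule bf_linear_combination_left) (use assms in auto)
  then have "bf n \<phi> (Y + c \<cdot>\<^sub>m Z) X = bf n \<phi> Y X + c * bf n \<phi> Z X" by simp
  then show ?thesis
    using bf_skew[of X n "Y + c \<cdot>\<^sub>m Z" \<phi>] bf_skew[of X n Y \<phi>] bf_skew[of X n Z \<phi>] assms by simp
qed

lemma bf_unit:
  assumes "X \<in> carrier_mat (2*n) (2*n)" "k < 2*n" "l < 2*n"
  shows "bf n \<phi> X (unit_mat n k l) = (\<Sum>i<2*n. \<phi> i l * X $$ (i, k)) - (\<Sum>j<2*n. \<phi> k j * X $$ (l, j))"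
proof -
  have e: "commutator X (unit_mat n k l) $$ (i, j) = (if j = l then X $$ (i, k) else 0) - (if i = k then X $$ (l, j) else 0)"
    if ij: "i < 2*n" "j < 2*n" for i j
  proof -
    have "(\<Sum>m<2*n. X $$ (i, m) * unit_mat n k l $$ (m, j)) = (\<Sum>m<2*n. if m = k then (if j = l then X $$ (i, k) else 0) else 0)"
      by (intro sum.cong) (use ij in auto)
    moreover have "(\<Sum>m<2*n. unit_mat n k l $$ (i, m) * X $$ (m, j)) = (\<Sum>m<2*n. if m = l then (if i = k then X $$ (l, j) else 0) else 0)"
      by (intro sum.cong) (use ij in auto)
    ultimately show ?thesis
      using assms(2,3) by (simp add: commutator_index[OF assms(1) unit_mat_carrier ij])
  qed
  have "bf n \<phi> X (unit_mat n k l) = (\<Sum>i<2*n. \<Sum>j<2*n. (if j = l then \<phi> i l * X $$ (i, k) else 0) - (if i = k then \<phi> k j * X $$ (l, j) else 0))"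
    unfolding bf_def lf_def by (intro sum.cong refl) (simp add: e right_diff_distrib)
  also have "\<dots> = (\<Sum>i<2*n. \<Sum>j<2*n. if j = l then \<phi> i l * X $$ (i, k) else 0) - (\<Sum>i<2*n. \<Sum>j<2*n. if i = k then \<phi> k j * X $$ (l, j) else 0)"
    by (simp only: sum_subtractf)
  also have "(\<Sum>i<2*n. \<Sum>j<2*n. if i = k then \<phi> k j * X $$ (l, j) else 0) = (\<Sum>j<2*n. \<Sum>i<2*n. if i = k then \<phi> k j * X $$ (l, j) else 0)"
    by (rule sum.swap)
  finally show ?thesis using assms(2,3) by simp
qed

text \<open>For odd coefficients the two halves of the root vector pair equally with
  \<open>X\<close>. Kernel conditions can therefore be tested on elementary matrices, where
  \<open>bf_unit\<close> leaves just one column sum and one row sum.\<close>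

lemma bf_skew_unit:
  fixes X :: "'k::field mat"
  assumes X: "X \<in> sp n" and \<phi>: "skew_coeffs n \<phi>"
  shows "bf n \<phi> X (skew_unit n k l) = 2 * bf n \<phi> X (unit_mat n k l)"
proof -
  let ?E = "unit_mat n k l"
  have Xc: "X \<in> carrier_mat (2*n) (2*n)" using X by (rule sp_carrier)
  have "bf n \<phi> X (star n ?E) = - lf n \<phi> (star n (commutator X (star n ?E)))"
    unfolding bf_def by (simp add: lf_star[OF \<phi>])
  also have "star n (commutator X (star n ?E)) = commutator ?E (star n X)"
    using Xc by (simp add: star_commutator star_star)
  also have "star n X = - X" using X by (simp add: sp_iff_star)
  also have "commutator ?E (- X) = commutator X ?E"
    using Xc by (intro eq_matI) (auto simp: commutator_def unit_mat_def)
  finally have s: "bf n \<phi> X (star n ?E) = - bf n \<phi> X ?E" by (simp add: bf_def)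
  have e: "(skew_unit n k l :: 'k mat) = ?E + (-1) \<cdot>\<^sub>m star n ?E"
    unfolding skew_unit_def by (intro eq_matI) (auto simp: unit_mat_def)
  have "bf n \<phi> X (skew_unit n k l) = bf n \<phi> X ?E + (-1) * bf n \<phi> X (star n ?E)"
    unfolding e by (rule bf_add_right[OF Xc unit_mat_carrier star_carrier])
  then show ?thesis by (simp add: s)
qed

lemma lf_skew_unit:
  fixes \<phi> :: "nat \<Rightarrow> nat \<Rightarrow> 'k::field"
  assumes "skew_coeffs n \<phi>" "i < 2*n" "j < 2*n"
  shows "lf n \<phi> (skew_unit n i j) = 2 * \<phi> i j"
proof -
  let ?E = "unit_mat n i j"
  have "lf n \<phi> ?E = (\<Sum>a<2*n. \<Sum>b<2*n. if b = j then (if a = i then \<phi> i j else 0) else 0)"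
    unfolding lf_def by (intro sum.cong refl) auto
  then have E: "lf n \<phi> ?E = \<phi> i j" using assms by simp
  have e: "(skew_unit n i j :: 'k mat) = ?E + (-1) \<cdot>\<^sub>m star n ?E"
    unfolding skew_unit_def by (intro eq_matI) (auto simp: unit_mat_def)
  have "lf n \<phi> (skew_unit n i j) = lf n \<phi> ?E + (-1) * lf n \<phi> (star n ?E)"
    unfolding e by (simp only: lf_add lf_smult unit_mat_carrier star_carrier smult_carrier_mat)
  then show ?thesis by (simp add: lf_star[OF assms(1)] E)
qed

section \<open>Subalgebras of symplectic matrices with prescribed support\<close>

locale sp_support =
  fixes n :: nat and D :: "(nat \<times> nat) set"
  assumes D_range: "(i, j) \<in> D \<Longrightarrow> i < 2*n \<and> j < 2*n"
    and D_bar: "(i, j) \<in> D \<Longrightarrow> (bar n j, bar n i) \<in> D"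
    and D_refl: "i < 2*n \<Longrightarrow> (i, i) \<in> D"
    and D_trans: "(i, j) \<in> D \<Longrightarrow> (j, k) \<in> D \<Longrightarrow> (i, k) \<in> D"
begin

definition S :: "'k::field_char_0 mat set" where
  "S = {X \<in> sp n. \<forall>i<2*n. \<forall>j<2*n. (i, j) \<notin> D \<longrightarrow> X $$ (i, j) = 0}"

lemma S_sp: "X \<in> S \<Longrightarrow> X \<in> sp n"
  by (simp add: S_def)

lemma S_carrier: "X \<in> S \<Longrightarrow> X \<in> carrier_mat (2*n) (2*n)"
  by (rule sp_carrier[OF S_sp])

lemma S_entry: "X \<in> S \<Longrightarrow> i < 2*n \<Longrightarrow> j < 2*n \<Longrightarrow> (i, j) \<notin> D \<Longrightarrow> X $$ (i, j) = 0"
  by (simp add: S_def)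

lemma SI: "X \<in> sp n \<Longrightarrow> (\<And>i j. i < 2*n \<Longrightarrow> j < 2*n \<Longrightarrow> (i, j) \<notin> D \<Longrightarrow> X $$ (i, j) = 0) \<Longrightarrow> X \<in> S"
  by (simp add: S_def)

lemma S_zero: "0\<^sub>m (2*n) (2*n) \<in> S"
  by (rule SI[OF sp_zero]) simp

lemma S_add: assumes "X \<in> S" "Y \<in> S" shows "X + Y \<in> S"
proof (rule SI[OF sp_add[OF assms[THEN S_sp]]])
  fix i j assume ij: "i < 2*n" "j < 2*n" "(i, j) \<notin> D"
  show "(X + Y) $$ (i, j) = 0"
    using S_entry[OF assms(1) ij] S_entry[OF assms(2) ij] assms[THEN S_carrier] ij by simp
qed

lemma S_smult: assumes "X \<in> S" shows "c \<cdot>\<^sub>m X \<in> S"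
proof (rule SI[OF sp_smult[OF assms[THEN S_sp]]])
  fix i j assume ij: "i < 2*n" "j < 2*n" "(i, j) \<notin> D"
  show "(c \<cdot>\<^sub>m X) $$ (i, j) = 0"
    using S_entry[OF assms(1) ij] assms[THEN S_carrier] ij by simp
qed

lemma S_subspace: "subspace class_ring S (module_mat TYPE('k::field_char_0) (2*n) (2*n))"
  by (rule subspace_matI) (auto intro: S_carrier S_zero S_add S_smult)

lemma S_commutator:
  fixes X Y :: "'k::field_char_0 mat"
  assumes "X \<in> S" "Y \<in> S" shows "commutator X Y \<in> S"
proof (rule SI[OF commutator_sp[OF assms[THEN S_sp]]])
  fix i j assume ij: "i < 2*n" "j < 2*n" "(i, j) \<notin> D"
  have z: "A $$ (i, k) * B $$ (k, j) = 0" if "A \<in> S" "B \<in> S" "k < 2*n" for A B :: "'k mat" and k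
  proof (cases "(i, k) \<in> D")
    case True
    then have "(k, j) \<notin> D" using D_trans[OF True] ij(3) by blast
    then show ?thesis using S_entry[OF that(2,3) ij(2)] by simp
  next
    case False
    then show ?thesis using S_entry[OF that(1) ij(1) that(3)] by simp
  qed
  have "(\<Sum>k<2*n. X $$ (i, k) * Y $$ (k, j)) = 0"
    by (rule sum.neutral, rule ballI, rule z[OF assms]) simp
  moreover have "(\<Sum>k<2*n. Y $$ (i, k) * X $$ (k, j)) = 0"
    by (rule sum.neutral, rule ballI, rule z[OF assms(2,1)]) simp
  ultimately show "commutator X Y $$ (i, j) = 0"
    by (simp only: commutator_index[OF assms[THEN S_carrier] ij(1,2)] diff_self)
qed

lemma skew_unit_S: assumes "(i, j) \<in> D" shows "skew_unit n i j \<in> S"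
proof (rule SI[OF skew_unit_sp])
  fix a b assume ab: "a < 2*n" "b < 2*n" "(a, b) \<notin> D"
  have ij: "i < 2*n" "j < 2*n" using D_range[OF assms] by auto
  have "\<not> (a = i \<and> b = j)" using ab(3) assms by blast
  moreover have "\<not> (a = bar n j \<and> b = bar n i)" using ab(3) D_bar[OF assms] by blast
  ultimately show "skew_unit n i j $$ (a, b) = 0"
    unfolding skew_unit_index[OF ab(1,2) ij] by (simp only: if_False diff_self)
qed

lemma finite_D: "finite D"
  by (rule finite_subset[of _ "{..<2*n} \<times> {..<2*n}"]) (use D_range in auto)

text \<open>Subtracting a multiple of one root vector clears an entry together with its mirror and
  creates no new nonzero entry, so the support shrinks. This is the statement that root vectors and
  torus elements span, in the form of an induction rule.\<close>

lemma S_induct [consumes 1, case_names zero add]: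
  fixes X :: "'k::field_char_0 mat"
  assumes "X \<in> S" and z: "P (0\<^sub>m (2*n) (2*n))"
    and a: "\<And>Y c i j. Y \<in> S \<Longrightarrow> P Y \<Longrightarrow> (i, j) \<in> D \<Longrightarrow> P (Y + c \<cdot>\<^sub>m skew_unit n i j)"
  shows "P X"
  using assms(1)
proof (induction "card {p \<in> D. X $$ p \<noteq> 0}" arbitrary: X rule: less_induct)
  case less
  have Xc: "X \<in> carrier_mat (2*n) (2*n)" using less.prems by (rule S_carrier)
  show ?case
  proof (cases "\<exists>i j. (i, j) \<in> D \<and> X $$ (i, j) \<noteq> 0")
    case False
    have "X = 0\<^sub>m (2*n) (2*n)"
    proof (rule eq_matI)
      fix i j assume "i < dim_row (0\<^sub>m (2*n) (2*n) :: 'k mat)" "j < dim_col (0\<^sub>m (2*n) (2*n) :: 'k mat)"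
      then have "i < 2*n" "j < 2*n" by auto
      then show "X $$ (i, j) = 0\<^sub>m (2*n) (2*n) $$ (i, j)"
        using S_entry[OF less.prems, of i j] False by auto
    qed (use Xc in auto)
    then show ?thesis using z by simp
  next
    case True
    then obtain i j where ij: "(i, j) \<in> D" "X $$ (i, j) \<noteq> 0" by blast
    have r: "i < 2*n" "j < 2*n" using D_range[OF ij(1)] by auto
    \<comment> \<open>The division compensates the entry 2 of an antidiagonal root vector.\<close>
    define c where "c = (if j = bar n i then X $$ (i, j) / 2 else X $$ (i, j))"
    define Y where "Y = X + (- c) \<cdot>\<^sub>m skew_unit n i j"
    have YS: "Y \<in> S" unfolding Y_def by (intro S_add S_smult less.prems skew_unit_S ij)
    have Yab: "Y $$ (a, b) = X $$ (a, b) - c * ((if a = i \<and> b = j then 1 else 0)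
        - (if a = bar n j \<and> b = bar n i then sgn_idx n i * sgn_idx n j else 0))"
      if ab: "a < 2*n" "b < 2*n" for a b
    proof -
      have "Y $$ (a, b) = X $$ (a, b) + (- c) * skew_unit n i j $$ (a, b)"
        unfolding Y_def using ab Xc by simp
      then show ?thesis unfolding skew_unit_index[OF ab r] by simp
    qed
    have Y0: "Y $$ (i, j) = 0"
    proof (cases "j = bar n i")
      case True
      then have "i = bar n j" "sgn_idx n j = (- sgn_idx n i :: 'k)" using r by simp_all
      then have "Y $$ (i, j) = X $$ (i, j) - c * 2" using Yab[OF r] True by simp
      then show ?thesis using True by (simp add: c_def)
    next
      case False
      then show ?thesis using Yab[OF r] by (simp add: c_def)
    qed
    have Ysub: "X $$ (a, b) \<noteq> 0" if "(a, b) \<in> D" "Y $$ (a, b) \<noteq> 0" for a b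
    proof
      assume X0: "X $$ (a, b) = 0"
      have ab: "a < 2*n" "b < 2*n" using D_range[OF that(1)] by auto
      have "a = bar n j \<and> b = bar n i"
        using Yab[OF ab] X0 that(2) ij(2) by (auto split: if_splits)
      moreover have "Y $$ (bar n j, bar n i) = - (sgn_idx n i * sgn_idx n j * Y $$ (i, j))"
        by (rule sp_entry[OF S_sp[OF YS] r])
      ultimately show False using that(2) Y0 by simp
    qed
    have sub: "{p \<in> D. Y $$ p \<noteq> 0} \<subset> {p \<in> D. X $$ p \<noteq> 0}"
    proof (rule psubsetI)
      show "{p \<in> D. Y $$ p \<noteq> 0} \<subseteq> {p \<in> D. X $$ p \<noteq> 0}" using Ysub by auto
      have "(i, j) \<in> {p \<in> D. X $$ p \<noteq> 0}" "(i, j) \<notin> {p \<in> D. Y $$ p \<noteq> 0}" using ij Y0 by auto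
      then show "{p \<in> D. Y $$ p \<noteq> 0} \<noteq> {p \<in> D. X $$ p \<noteq> 0}" by blast
    qed
    have "finite {p \<in> D. X $$ p \<noteq> 0}" using finite_D by simp
    then have "card {p \<in> D. Y $$ p \<noteq> 0} < card {p \<in> D. X $$ p \<noteq> 0}"
      using sub by (rule psubset_card_mono)
    then have "P Y" using YS by (rule less.hyps)
    then have "P (Y + c \<cdot>\<^sub>m skew_unit n i j)" by (rule a[OF YS _ ij(1)])
    moreover have "Y + c \<cdot>\<^sub>m skew_unit n i j = X"
      unfolding Y_def using Xc by (intro eq_matI) auto
    ultimately show ?thesis by simp
  qed
qed

definition ker_form :: "(nat \<Rightarrow> nat \<Rightarrow> 'k::field_char_0) \<Rightarrow> 'k mat set" where
  "ker_form \<phi> = {X \<in> S. \<forall>Y\<in>S. bf n \<phi> X Y = 0}"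

text \<open>One position from each mirror pair is enough, because the root vector at the mirrored
  position is a scalar multiple.\<close>

lemma ker_form_units:
  fixes X :: "'k::field_char_0 mat"
  assumes "X \<in> S" "skew_coeffs n \<phi>"
    and "\<And>k l. (k, l) \<in> D \<Longrightarrow> k + l < 2*n \<Longrightarrow> bf n \<phi> X (skew_unit n k l) = 0"
  shows "X \<in> ker_form \<phi>"
proof -
  have Xc: "X \<in> carrier_mat (2*n) (2*n)" using assms(1) by (rule S_carrier)
  have all: "bf n \<phi> X (skew_unit n k l) = 0" if "(k, l) \<in> D" for k l
  proof (cases "k + l < 2*n")
    case True
    then show ?thesis using assms(3) that by blast
  next
    case False
    have kl: "k < 2*n" "l < 2*n" using D_range[OF that] by auto
    have "bf n \<phi> X (skew_unit n (bar n l) (bar n k)) = 0"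
      using D_bar[OF that] False kl by (intro assms(3)) (auto simp: bar_def)
    moreover have "(skew_unit n k l :: 'k mat) = 0\<^sub>m (2*n) (2*n) + (- (sgn_idx n (bar n l) * sgn_idx n (bar n k))) \<cdot>\<^sub>m skew_unit n (bar n l) (bar n k)"
      using skew_unit_bar[of "bar n l" n "bar n k"] kl by simp
    moreover have "bf n \<phi> X (0\<^sub>m (2*n) (2*n)) = 0"
      by (simp add: bf_sum[OF Xc])
    ultimately show ?thesis
      by (simp only: bf_add_right[OF Xc zero_carrier_mat skew_unit_carrier] mult_zero_right add_0_right)
  qed
  have "bf n \<phi> X Y = 0" if "Y \<in> S" for Y
    using that
  proof (induction rule: S_induct)
    case zero
    show ?case by (simp add: bf_sum[OF Xc])
  next
    case (add Y c i j)
    then show ?case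
      by (simp add: bf_add_right[OF Xc S_carrier[OF add.hyps(1)] skew_unit_carrier] all)
  qed
  then show ?thesis using assms(1) by (simp add: ker_form_def)
qed

lemma functional_coeffs:
  fixes f :: "'k::field_char_0 mat \<Rightarrow> 'k"
  assumes f: "f \<in> linear_functionals ((module_mat TYPE('k) (2*n) (2*n))\<lparr>carrier := S\<rparr>)"
  shows "\<exists>\<phi>. skew_coeffs n \<phi> \<and> (\<forall>X\<in>S. f X = lf n \<phi> X)"
proof -
  have fa: "f (X + Y) = f X + f Y" if "X \<in> S" "Y \<in> S" for X Y
    using f that by (simp add: linear_functionals_def module_mat_carrier_update_simps)
  have fs: "f (c \<cdot>\<^sub>m X) = c * f X" if "X \<in> S" for X c
    using f that by (simp add: linear_functionals_def module_mat_carrier_update_simps)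
  \<comment> \<open>The half offsets the factor 2 of \<open>lf_skew_unit\<close>. The default 0
    outside \<open>D\<close> keeps the coefficients odd, since \<open>D\<close> is closed under the
    mirror.\<close>
  define \<phi> where "\<phi> i j = (if (i, j) \<in> D then f (skew_unit n i j) / 2 else 0)" for i j
  have \<phi>: "skew_coeffs n \<phi>" unfolding skew_coeffs_def
  proof (intro allI impI)
    fix i j assume ij: "i < 2*n" "j < 2*n"
    show "\<phi> (bar n j) (bar n i) = - (sgn_idx n i * sgn_idx n j * \<phi> i j)"
    proof (cases "(i, j) \<in> D")
      case True
      then show ?thesis using D_bar[OF True]
        by (simp add: \<phi>_def skew_unit_bar[OF ij] fs[OF skew_unit_S])
    next
      case False
      then have "(bar n j, bar n i) \<notin> D" using D_bar[of "bar n j" "bar n i"] ij by auto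
      then show ?thesis using False by (simp add: \<phi>_def)
    qed
  qed
  have "f X = lf n \<phi> X" if "X \<in> S" for X
    using that
  proof (induction rule: S_induct)
    case zero
    have "f (0 \<cdot>\<^sub>m 0\<^sub>m (2*n) (2*n)) = 0" using fs[OF S_zero, of 0] by simp
    then show ?case by (simp add: lf_zero)
  next
    case (add Y c i j)
    have r: "i < 2*n" "j < 2*n" using D_range[OF add.hyps(2)] by auto
    have "f (Y + c \<cdot>\<^sub>m skew_unit n i j) = f Y + c * f (skew_unit n i j)"
      by (simp add: fa[OF add.hyps(1) S_smult[OF skew_unit_S[OF add.hyps(2)]]] fs[OF skew_unit_S[OF add.hyps(2)]])
    moreover have "lf n \<phi> (Y + c \<cdot>\<^sub>m skew_unit n i j) = lf n \<phi> Y + c * lf n \<phi> (skew_unit n i j)"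
      using S_carrier[OF add.hyps(1)] by (simp add: lf_add lf_smult)
    moreover have "lf n \<phi> (skew_unit n i j) = f (skew_unit n i j)"
      unfolding lf_skew_unit[OF \<phi> r] using add.hyps(2) by (simp add: \<phi>_def)
    ultimately show ?case using add.IH by simp
  qed
  then show ?thesis using \<phi> by blast
qed

lemma lf_functional: "lf n \<phi> \<in> linear_functionals ((module_mat TYPE('k::field_char_0) (2*n) (2*n))\<lparr>carrier := S\<rparr>)"
  unfolding linear_functionals_def module_mat_carrier_update_simps mem_Collect_eq
  by (intro conjI ballI allI lf_add lf_smult S_carrier)

lemma index_in_sp_S:
  "index_in_sp n (S :: 'k::field_char_0 mat set) =
    (INF \<phi>\<in>{\<phi>. skew_coeffs n \<phi>}. vectorspace.dim class_ring ((module_mat TYPE('k) (2*n) (2*n))\<lparr>carrier := ker_form \<phi>\<rparr>))"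
proof -
  let ?V = "(module_mat TYPE('k) (2*n) (2*n))\<lparr>carrier := S\<rparr>"
  have ker: "form_kernel ?V commutator f = ker_form \<phi>"
    if f: "\<forall>X\<in>S. f X = lf n \<phi> X" for f and \<phi> :: "nat \<Rightarrow> nat \<Rightarrow> 'k"
  proof -
    have "f (commutator X Y) = bf n \<phi> X Y" if "X \<in> S" "Y \<in> S" for X Y
      using f S_commutator[OF that] by (simp add: bf_def)
    then show ?thesis
      unfolding form_kernel_def ker_form_def module_mat_carrier_update_simps
      by (intro Collect_cong conj_cong ball_cong refl) simp
  qed
  have "(\<lambda>f. vectorspace.dim class_ring (?V\<lparr>carrier := form_kernel ?V commutator f\<rparr>)) ` linear_functionals ?V
      = (\<lambda>\<phi>. vectorspace.dim class_ring (?V\<lparr>carrier := ker_form \<phi>\<rparr>)) ` {\<phi>. skew_coeffs n \<phi>}" (is "?L = ?R")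
  proof
    show "?L \<subseteq> ?R"
    proof (rule image_subsetI)
      fix f assume "f \<in> linear_functionals ?V"
      then obtain \<phi> where \<phi>: "skew_coeffs n \<phi>" "\<forall>X\<in>S. f X = lf n \<phi> X"
        by (elim functional_coeffs[THEN exE] conjE)
      show "vectorspace.dim class_ring (?V\<lparr>carrier := form_kernel ?V commutator f\<rparr>) \<in> ?R"
        unfolding ker[OF \<phi>(2)] by (rule imageI) (simp add: \<phi>(1))
    qed
    show "?R \<subseteq> ?L"
    proof (rule image_subsetI)
      fix \<phi> :: "nat \<Rightarrow> nat \<Rightarrow> 'k"
      show "vectorspace.dim class_ring (?V\<lparr>carrier := ker_form \<phi>\<rparr>) \<in> ?L"
        unfolding ker[of "lf n \<phi>" \<phi>, simplified, symmetric] by (rule imageI[OF lf_functional])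
    qed
  qed
  then show ?thesis by (simp add: index_in_sp_def lie_index_def)
qed

end

section \<open>Lower semicontinuity along a slice\<close>

text \<open>A root vector squares to zero, even for a long root, so its exponential is 1 + c e with
  inverse 1 - c e and the inner automorphisms used below are polynomial.\<close>

lemma skew_unit_square:
  assumes "i < 2*n" "j < 2*n" "i \<noteq> j"
  shows "skew_unit n i j * skew_unit n i j = (0\<^sub>m (2*n) (2*n) :: 'k::field mat)"
proof (rule eq_matI)
  let ?e = "skew_unit n i j :: 'k mat"
  fix a b assume "a < dim_row (0\<^sub>m (2*n) (2*n) :: 'k mat)" "b < dim_col (0\<^sub>m (2*n) (2*n) :: 'k mat)"
  then have ab: "a < 2*n" "b < 2*n" by simp_all
  have "?e $$ (a, k) * ?e $$ (k, b) = 0" if k: "k < 2*n" for k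
  proof (rule ccontr)
    assume "?e $$ (a, k) * ?e $$ (k, b) \<noteq> 0"
    then have nz: "?e $$ (a, k) \<noteq> 0" "?e $$ (k, b) \<noteq> 0" by auto
    have "k = j \<or> k = bar n i"
      using nz(1) unfolding skew_unit_index[OF ab(1) k assms(1,2)] by (auto split: if_splits)
    moreover have "k = i \<or> k = bar n j"
      using nz(2) unfolding skew_unit_index[OF k ab(2) assms(1,2)] by (auto split: if_splits)
    ultimately show False using assms bar_neq[of i n] bar_neq[of j n] bar_eq_iff[of i n j] by metis
  qed
  then have "(?e * ?e) $$ (a, b) = 0"
    unfolding mult_index_sum[OF skew_unit_carrier skew_unit_carrier ab] by (intro sum.neutral) simp
  then show "(?e * ?e) $$ (a, b) = 0\<^sub>m (2*n) (2*n) $$ (a, b)" using ab by simp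
qed simp_all

lemma mult_minus_one_smult_square:
  fixes e :: "'k::field mat"
  assumes e: "e \<in> carrier_mat m m" "e * e = 0\<^sub>m m m"
  shows "(1\<^sub>m m - c \<cdot>\<^sub>m e) * (1\<^sub>m m + c \<cdot>\<^sub>m e) = 1\<^sub>m m"
proof -
  have ce: "c \<cdot>\<^sub>m e \<in> carrier_mat m m" using e by simp
  have pe: "1\<^sub>m m + c \<cdot>\<^sub>m e \<in> carrier_mat m m" using ce by simp
  have "c \<cdot>\<^sub>m e * (c \<cdot>\<^sub>m e) = c \<cdot>\<^sub>m (c \<cdot>\<^sub>m (e * e))"
    unfolding mult_smult_assoc_mat[OF e(1) ce] mult_smult_distrib[OF e(1) e(1)] ..
  then have sq: "c \<cdot>\<^sub>m e * (c \<cdot>\<^sub>m e) = 0\<^sub>m m m" unfolding e(2) by (simp add: smult_zero_mat)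
  have "(1\<^sub>m m - c \<cdot>\<^sub>m e) * (1\<^sub>m m + c \<cdot>\<^sub>m e)
      = 1\<^sub>m m * (1\<^sub>m m + c \<cdot>\<^sub>m e) - c \<cdot>\<^sub>m e * (1\<^sub>m m + c \<cdot>\<^sub>m e)"
    by (rule minus_mult_distrib_mat[OF one_carrier_mat ce pe])
  also have "c \<cdot>\<^sub>m e * (1\<^sub>m m + c \<cdot>\<^sub>m e) = c \<cdot>\<^sub>m e * 1\<^sub>m m + c \<cdot>\<^sub>m e * (c \<cdot>\<^sub>m e)"
    by (rule mult_add_distrib_mat[OF ce one_carrier_mat ce])
  also have "\<dots> = c \<cdot>\<^sub>m e + 0\<^sub>m m m" unfolding sq right_mult_one_mat[OF ce] ..
  also have "1\<^sub>m m * (1\<^sub>m m + c \<cdot>\<^sub>m e) = 1\<^sub>m m + c \<cdot>\<^sub>m e" by (rule left_mult_one_mat[OF pe])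
  finally show ?thesis using e(1) by (intro eq_matI) auto
qed

lemma conj_commutator:
  assumes "g \<in> carrier_mat m m" "g' \<in> carrier_mat m m" "g' * g = 1\<^sub>m m"
    "X \<in> carrier_mat m m" "Y \<in> carrier_mat m m"
  shows "commutator (g * X * g') (g * Y * g') = g * commutator X Y * g'"
proof -
  have m: "(g * A * g') * (g * B * g') = g * (A * B) * g'" if "A \<in> carrier_mat m m" "B \<in> carrier_mat m m" for A B
  proof -
    have "g' * (g * Z) = Z" if "Z \<in> carrier_mat m m" for Z
      unfolding assoc_mult_mat[OF assms(2,1) that, symmetric] assms(3) by (rule left_mult_one_mat[OF that])
    then show ?thesis using assms(1,2) that by (simp add: assoc_mult_mat[of _ m m _ m _ m])
  qed
  have "g * commutator X Y * g' = (g * (X * Y) - g * (Y * X)) * g'"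
    unfolding commutator_def using assms by (subst mult_minus_distrib_mat[of _ m m]) auto
  also have "\<dots> = g * (X * Y) * g' - g * (Y * X) * g'"
    using assms by (subst minus_mult_distrib_mat[of _ m m]) auto
  finally show ?thesis unfolding commutator_def m[OF assms(4,5)] m[OF assms(5,4)] ..
qed

lemma conj_nilpotent_index:
  fixes Z e :: "'k::field mat"
  assumes "Z \<in> carrier_mat m m" "e \<in> carrier_mat m m" "i < m" "j < m"
  shows "((1\<^sub>m m + c \<cdot>\<^sub>m e) * Z * (1\<^sub>m m - c \<cdot>\<^sub>m e)) $$ (i, j)
    = Z $$ (i, j) + c * commutator e Z $$ (i, j) - c\<^sup>2 * (e * Z * e) $$ (i, j)"
proof -
  have ce: "c \<cdot>\<^sub>m e \<in> carrier_mat m m" using assms by simp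
  have "(1\<^sub>m m + c \<cdot>\<^sub>m e) * Z = Z + c \<cdot>\<^sub>m (e * Z)"
    using assms ce by (subst add_mult_distrib_mat[of _ m m]) (auto simp: mult_smult_assoc_mat[of _ m m _ m])
  then have "(1\<^sub>m m + c \<cdot>\<^sub>m e) * Z * (1\<^sub>m m - c \<cdot>\<^sub>m e)
      = (Z + c \<cdot>\<^sub>m (e * Z)) * 1\<^sub>m m - (Z + c \<cdot>\<^sub>m (e * Z)) * (c \<cdot>\<^sub>m e)"
    using assms ce by (simp add: mult_minus_distrib_mat[of _ m m _ m])
  also have "(Z + c \<cdot>\<^sub>m (e * Z)) * (c \<cdot>\<^sub>m e) = c \<cdot>\<^sub>m (Z * e) + c \<cdot>\<^sub>m (c \<cdot>\<^sub>m (e * Z * e))"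
    using assms ce
    by (subst add_mult_distrib_mat[of _ m m])
       (auto simp: mult_smult_assoc_mat[of _ m m _ m] mult_smult_distrib[of _ m m _ m])
  finally show ?thesis
    using assms by (simp add: commutator_def power2_eq_square algebra_simps)
qed

section \<open>Coordinates on \<open>S\<close> and subspaces of kernels\<close>

context sp_support
begin

text \<open>One position from each pair consisting of (i, j) and its mirror (\<open>bar n j\<close>,
  \<open>bar n i\<close>); antidiagonal positions are their own mirrors. These positions index a
  basis of \<open>S\<close>.\<close>

definition reps :: "(nat \<times> nat) set" where
  "reps = {(i, j) \<in> D. i + j < 2*n}"

abbreviation basis_elt :: "nat \<times> nat \<Rightarrow> 'k::field_char_0 mat" where
  "basis_elt \<alpha> \<equiv> skew_unit n (fst \<alpha>) (snd \<alpha>)"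

definition comb :: "(nat \<times> nat) set \<Rightarrow> (nat \<times> nat \<Rightarrow> 'k::field_char_0) \<Rightarrow> 'k mat" where
  "comb I z = mat (2*n) (2*n) (\<lambda>(a, b). \<Sum>\<alpha>\<in>I. z \<alpha> * basis_elt \<alpha> $$ (a, b))"

lemma comb_carrier [simp]: "comb I z \<in> carrier_mat (2*n) (2*n)"
  by (simp add: comb_def)

lemma comb_index: "a < 2*n \<Longrightarrow> b < 2*n \<Longrightarrow> comb I z $$ (a, b) = (\<Sum>\<alpha>\<in>I. z \<alpha> * basis_elt \<alpha> $$ (a, b))"
  by (simp add: comb_def)

lemma comb_S:
  assumes "I \<subseteq> D" shows "comb I z \<in> S"
proof -
  have "finite I" using assms finite_D by (rule finite_subset)
  then show ?thesis using assms
  proof (induction I)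
    case empty
    have "comb {} z = 0\<^sub>m (2*n) (2*n)" by (rule eq_matI) (simp_all add: comb_def)
    then show ?case by (simp add: S_zero)
  next
    case (insert \<alpha> I)
    have "comb (insert \<alpha> I) z = comb I z + z \<alpha> \<cdot>\<^sub>m basis_elt \<alpha>"
      using insert by (intro eq_matI) (simp_all add: comb_def)
    moreover have "(fst \<alpha>, snd \<alpha>) \<in> D" using insert.prems by simp
    ultimately show ?case using insert by (simp add: S_add S_smult skew_unit_S)
  qed
qed

lemma finite_reps: "finite reps"
  unfolding reps_def using finite_D by (rule finite_subset[rotated]) auto

lemma reps_D: "reps \<subseteq> D"
  by (auto simp: reps_def)

lemma basis_elt_at_reps:
  assumes "\<alpha> \<in> reps" "\<beta> \<in> reps"
  shows "(basis_elt \<beta> :: 'k::field_char_0 mat) $$ \<alpha> =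
    (if \<alpha> = \<beta> then (if snd \<alpha> = bar n (fst \<alpha>) then 2 else 1) else 0)"
proof -
  obtain i j k l where ab: "\<alpha> = (i, j)" "\<beta> = (k, l)" by (cases \<alpha>, cases \<beta>) 
  have r: "i < 2*n" "j < 2*n" "k < 2*n" "l < 2*n" and s: "i + j < 2*n" "k + l < 2*n"
    using assms D_range unfolding ab reps_def by auto
  have "i = bar n l \<and> j = bar n k \<longleftrightarrow> (i = k \<and> j = l) \<and> j = bar n i"
    using r s by (auto simp: bar_def)
  then show ?thesis
    using r(3) unfolding ab fst_conv snd_conv skew_unit_index[OF r] by auto
qed

lemma comb_at_reps:
  assumes "I \<subseteq> reps" "\<alpha> \<in> reps"
  shows "comb I z $$ \<alpha> = (if \<alpha> \<in> I then (if snd \<alpha> = bar n (fst \<alpha>) then 2 else 1) * z \<alpha> else 0)"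
proof -
  have fin: "finite I" using assms(1) finite_reps by (rule finite_subset)
  have r: "fst \<alpha> < 2*n" "snd \<alpha> < 2*n" using assms(2) D_range unfolding reps_def by auto
  have "comb I z $$ \<alpha> = (\<Sum>\<beta>\<in>I. z \<beta> * basis_elt \<beta> $$ \<alpha>)"
    using comb_index[OF r, of I z] by simp
  also have "\<dots> = (\<Sum>\<beta>\<in>I. if \<beta> = \<alpha> then (if snd \<alpha> = bar n (fst \<alpha>) then 2 else 1) * z \<alpha> else 0)"
  proof (rule sum.cong[OF refl])
    fix \<beta> assume "\<beta> \<in> I"
    then have "\<beta> \<in> reps" using assms(1) by blast
    then show "z \<beta> * basis_elt \<beta> $$ \<alpha> = (if \<beta> = \<alpha> then (if snd \<alpha> = bar n (fst \<alpha>) then 2 else 1) * z \<alpha> else 0)"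
      unfolding basis_elt_at_reps[OF assms(2) \<open>\<beta> \<in> reps\<close>] by simp
  qed
  finally show ?thesis using fin by simp
qed

lemma S_eq_zero:
  assumes "X \<in> S" "\<And>\<alpha>. \<alpha> \<in> reps \<Longrightarrow> X $$ \<alpha> = 0" "i < 2*n" "j < 2*n"
  shows "X $$ (i, j) = 0"
proof (cases "(i, j) \<in> D \<and> i + j \<ge> 2*n")
  case True
  then have "(bar n j, bar n i) \<in> D" using D_bar[of i j] by blast
  moreover have "bar n j + bar n i < 2*n" using True assms(3,4) by (auto simp: bar_def)
  ultimately have "(bar n j, bar n i) \<in> reps" by (simp add: reps_def)
  then have "X $$ (bar n j, bar n i) = 0" by (rule assms(2))
  then show ?thesis using sp_entry[OF S_sp[OF assms(1)] assms(3,4)] by simp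
next
  case False
  show ?thesis
  proof (cases "(i, j) \<in> D")
    case True
    then have "(i, j) \<in> reps" using False by (simp add: reps_def)
    then show ?thesis by (rule assms(2))
  qed (rule S_entry[OF assms(1,3,4)])
qed

lemma ker_form_subspace: "subspace class_ring (ker_form \<phi>) (module_mat TYPE('k::field_char_0) (2*n) (2*n))"
proof (rule subspace_matI)
  have c: "bf n \<phi> (X + c \<cdot>\<^sub>m Y) Z = bf n \<phi> X Z + c * bf n \<phi> Y Z" if "X \<in> S" "Y \<in> S" "Z \<in> S" for X Y Z c
    using bf_add_right[OF that(3,1,2)[THEN S_carrier], of \<phi> c]
      bf_skew[OF that(1,3)[THEN S_carrier], of \<phi>] bf_skew[OF that(2,3)[THEN S_carrier], of \<phi>]
      bf_skew[OF S_carrier[OF S_add[OF that(1) S_smult[OF that(2)]]] S_carrier[OF that(3)], of \<phi> c] by simp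
  show "ker_form \<phi> \<subseteq> carrier_mat (2*n) (2*n)" using S_carrier by (auto simp: ker_form_def)
  have z: "bf n \<phi> (0\<^sub>m (2*n) (2*n)) Z = 0" if "Z \<in> S" for Z
    by (simp add: bf_sum[OF zero_carrier_mat S_carrier[OF that]])
  then show "0\<^sub>m (2*n) (2*n) \<in> ker_form \<phi>" by (simp add: ker_form_def S_zero)
  fix X Y :: "'k mat" and a :: 'k
  assume X: "X \<in> ker_form \<phi>"
  then have "X \<in> carrier_mat (2*n) (2*n)" unfolding ker_form_def by (blast intro: S_carrier)
  then have s: "0\<^sub>m (2*n) (2*n) + a \<cdot>\<^sub>m X = a \<cdot>\<^sub>m X" by simp
  show "a \<cdot>\<^sub>m X \<in> ker_form \<phi>"
    using X c[OF S_zero, of X _ a] z by (simp add: ker_form_def S_smult s)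
  assume Y: "Y \<in> ker_form \<phi>"
  then have "Y \<in> carrier_mat (2*n) (2*n)" unfolding ker_form_def by (blast intro: S_carrier)
  then have "X + 1 \<cdot>\<^sub>m Y = X + Y" by (intro eq_matI) auto
  then show "X + Y \<in> ker_form \<phi>"
    using X Y c[of X Y _ 1] by (simp add: ker_form_def S_add)
qed

text \<open>A product of two elements of \<open>S\<close> may leave \<open>sp n\<close>, but three
  factors give the right sign: the adjoint of e Y e is (-e) (-Y) (-e). Such a product is the
  quadratic term in conjugation by the exponential of e.\<close>

lemma mult_S:
  assumes "X \<in> S" "Y \<in> S" "e \<in> S"
  shows "e * Y * e \<in> S"
proof (rule SI)
  note c = assms(2,3)[THEN S_carrier]
  have "star n (e * Y * e) = star n e * (star n Y * star n e)"
    using c by (simp add: star_mult[of _ n] del: assoc_mult_mat)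
  also have "\<dots> = (- e) * ((- Y) * (- e))"
    using S_sp[OF assms(2)] S_sp[OF assms(3)] by (simp add: sp_iff_star)
  also have "\<dots> = - (e * Y * e)" using c by (simp add: assoc_mult_mat[of _ "2*n" "2*n" _ "2*n" _ "2*n"])
  finally show "e * Y * e \<in> sp n" using c by (simp add: sp_iff_star)
  fix i j assume ij: "i < 2*n" "j < 2*n" "(i, j) \<notin> D"
  have p: "A $$ (i, k) * e $$ (k, j) = 0"
    if A: "\<And>i j. i < 2*n \<Longrightarrow> j < 2*n \<Longrightarrow> (i, j) \<notin> D \<Longrightarrow> A $$ (i, j) = 0" and k: "k < 2*n" for k A
  proof (cases "(i, k) \<in> D")
    case True
    then have "(k, j) \<notin> D" using D_trans[OF True] ij(3) by blast
    then show ?thesis using S_entry[OF assms(3) k ij(2)] by simp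
  qed (simp add: A[OF ij(1) k])
  have q: "(e * Y) $$ (a, b) = 0" if ab: "a < 2*n" "b < 2*n" "(a, b) \<notin> D" for a b
  proof -
    have "e $$ (a, k) * Y $$ (k, b) = 0" if k: "k < 2*n" for k
    proof (cases "(a, k) \<in> D")
      case True
      then have "(k, b) \<notin> D" using D_trans[OF True] ab(3) by blast
      then show ?thesis using S_entry[OF assms(2) k ab(2)] by simp
    qed (simp add: S_entry[OF assms(3) ab(1) k])
    then show ?thesis unfolding mult_index_sum[OF c(2,1) ab(1,2)] by (intro sum.neutral) simp
  qed
  have "e * Y \<in> carrier_mat (2*n) (2*n)" using c by simp
  then show "(e * Y * e) $$ (i, j) = 0"
    unfolding mult_index_sum[OF \<open>e * Y \<in> carrier_mat (2*n) (2*n)\<close> c(2) ij(1,2)]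
    by (intro sum.neutral) (use p[OF q] in simp)
qed

end

section \<open>Curves of inner automorphisms and the dimension bound from the slice\<close>

context sp_support
begin

text \<open>Conjugation by a product of exponentials 1 + c t e over the roots in \<open>F\<close>.
  It has polynomial entries and preserves \<open>S\<close>; to first order the factors commute, so
  the derivative at 0 is the bracket with the whole combination.\<close>

lemma conj_curve:
  fixes c :: "nat \<times> nat \<Rightarrow> 'k::field_char_0"
  assumes "finite F" "F \<subseteq> D" "F \<subseteq> {\<alpha>. fst \<alpha> \<noteq> snd \<alpha>}"
  shows "\<exists>g g' :: 'k \<Rightarrow> 'k mat.
    (\<forall>t. g t \<in> carrier_mat (2*n) (2*n) \<and> g' t \<in> carrier_mat (2*n) (2*n) \<and> g' t * g t = 1\<^sub>m (2*n)) \<and>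
    (\<forall>t. \<forall>Y\<in>S. g t * Y * g' t \<in> S) \<and>
    (\<forall>Y\<in>S. \<exists>q. \<forall>i<2*n. \<forall>j<2*n. (\<forall>t. (g t * Y * g' t) $$ (i, j) = poly (q i j) t) \<and>
       coeff (q i j) 0 = Y $$ (i, j) \<and>
       coeff (q i j) 1 = (\<Sum>\<alpha>\<in>F. c \<alpha> * commutator (basis_elt \<alpha>) Y $$ (i, j)))"
  using assms
proof (induction F)
  case empty
  let ?one = "\<lambda>t :: 'k. 1\<^sub>m (2*n) :: 'k mat"
  have id: "?one t * Y * ?one t = Y" if "Y \<in> S" for Y t
    using S_carrier[OF that] by simp
  show ?case
  proof (intro exI[of _ ?one] conjI allI ballI)
    fix Y :: "'k mat" assume Y: "Y \<in> S"
    show "?one t * Y * ?one t \<in> S" for t using Y id[OF Y] by simp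
    show "\<exists>q. \<forall>i<2*n. \<forall>j<2*n. (\<forall>t. (?one t * Y * ?one t) $$ (i, j) = poly (q i j) t) \<and>
       coeff (q i j) 0 = Y $$ (i, j) \<and>
       coeff (q i j) 1 = (\<Sum>\<alpha>\<in>{}. c \<alpha> * commutator (basis_elt \<alpha>) Y $$ (i, j))"
      unfolding id[OF Y] by (rule exI[of _ "\<lambda>i j. [:Y $$ (i, j):]"]) simp
  qed simp_all
next
  case (insert \<alpha> F)
  have F: "F \<subseteq> D" "F \<subseteq> {\<alpha>. fst \<alpha> \<noteq> snd \<alpha>}" using insert.prems by auto
  obtain g g' :: "'k \<Rightarrow> 'k mat" where
    g0: "\<forall>t. g t \<in> carrier_mat (2*n) (2*n) \<and> g' t \<in> carrier_mat (2*n) (2*n) \<and> g' t * g t = 1\<^sub>m (2*n)"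
    and gS0: "\<forall>t. \<forall>Y\<in>S. g t * Y * g' t \<in> S"
    and gq: "\<forall>Y\<in>S. \<exists>q. \<forall>i<2*n. \<forall>j<2*n. (\<forall>t. (g t * Y * g' t) $$ (i, j) = poly (q i j) t) \<and>
       coeff (q i j) 0 = Y $$ (i, j) \<and>
       coeff (q i j) 1 = (\<Sum>\<alpha>\<in>F. c \<alpha> * commutator (basis_elt \<alpha>) Y $$ (i, j))"
    using insert.IH[OF F] by (elim exE conjE) (rule that)
  have g: "g t \<in> carrier_mat (2*n) (2*n)" "g' t \<in> carrier_mat (2*n) (2*n)" "g' t * g t = 1\<^sub>m (2*n)" for t
    using g0 by blast+
  have gS: "g t * Y * g' t \<in> S" if "Y \<in> S" for t Y using gS0 that by blast
  define e where "e = (basis_elt \<alpha> :: 'k mat)"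
  have \<alpha>D: "(fst \<alpha>, snd \<alpha>) \<in> D" "fst \<alpha> \<noteq> snd \<alpha>" using insert.prems by auto
  have eS: "e \<in> S" unfolding e_def by (rule skew_unit_S[OF \<alpha>D(1)])
  have ec: "e \<in> carrier_mat (2*n) (2*n)" by (rule S_carrier[OF eS])
  have e2: "e * e = 0\<^sub>m (2*n) (2*n)"
    unfolding e_def using D_range[OF \<alpha>D(1)] \<alpha>D(2) by (intro skew_unit_square) auto
  let ?p = "\<lambda>t. 1\<^sub>m (2*n) + (c \<alpha> * t) \<cdot>\<^sub>m e" and ?m = "\<lambda>t. 1\<^sub>m (2*n) - (c \<alpha> * t) \<cdot>\<^sub>m e"
  have pc: "?p t \<in> carrier_mat (2*n) (2*n)" "?m t \<in> carrier_mat (2*n) (2*n)" for t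
    using ec by (auto intro!: add_carrier_mat minus_carrier_mat)
  have mp: "?m t * ?p t = 1\<^sub>m (2*n)" for t by (rule mult_minus_one_smult_square[OF ec e2])
  have assoc: "?p t * g t * Y * (g' t * ?m t) = ?p t * (g t * Y * g' t) * ?m t" if "Y \<in> S" for Y t
    using g[of t] pc[of t] S_carrier[OF that] by (simp add: assoc_mult_mat[of _ "2*n" "2*n" _ "2*n" _ "2*n"])
  have step: "(?p t * Z * ?m t) $$ (i, j) = Z $$ (i, j) + (c \<alpha> * t) * commutator e Z $$ (i, j)
      - (c \<alpha> * t)\<^sup>2 * (e * Z * e) $$ (i, j)" if "Z \<in> S" "i < 2*n" "j < 2*n" for Z t i j
    by (rule conj_nilpotent_index[OF S_carrier[OF that(1)] ec that(2,3)])
  have pS: "?p t * Z * ?m t \<in> S" if Z: "Z \<in> S" for Z t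
  proof -
    have "?p t * Z * ?m t = Z + (c \<alpha> * t) \<cdot>\<^sub>m commutator e Z + (- ((c \<alpha> * t)\<^sup>2)) \<cdot>\<^sub>m (e * Z * e)" (is "?l = ?r")
    proof (rule eq_matI)
      have cc: "commutator e Z \<in> carrier_mat (2*n) (2*n)" "e * Z * e \<in> carrier_mat (2*n) (2*n)"
        using ec S_carrier[OF Z] commutator_carrier by auto
      then show "dim_row ?l = dim_row ?r" "dim_col ?l = dim_col ?r" using pc[of t] ec by auto
      fix i j assume "i < dim_row ?r" "j < dim_col ?r"
      then have "i < 2*n" "j < 2*n" using ec by auto
      then show "?l $$ (i, j) = ?r $$ (i, j)" unfolding step[OF Z \<open>i < 2*n\<close> \<open>j < 2*n\<close>] using cc ec by simp
    qed
    then show ?thesis using Z eS by (simp add: S_add S_smult S_commutator mult_S)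
  qed
  show ?case
  proof (rule exI[of _ "\<lambda>t. ?p t * g t"], rule exI[of _ "\<lambda>t. g' t * ?m t"], intro conjI allI ballI)
    fix t
    show "?p t * g t \<in> carrier_mat (2*n) (2*n)" "g' t * ?m t \<in> carrier_mat (2*n) (2*n)"
      using g[of t] pc[of t] by auto
    have "g' t * ?m t * (?p t * g t) = g' t * (?m t * ?p t * g t)"
      using g[of t] pc[of t] by (simp add: assoc_mult_mat[of _ "2*n" "2*n" _ "2*n" _ "2*n"])
    then show "g' t * ?m t * (?p t * g t) = 1\<^sub>m (2*n)"
      unfolding mp using g[of t] by simp
    fix Y :: "'k mat" assume Y: "Y \<in> S"
    show "?p t * g t * Y * (g' t * ?m t) \<in> S" unfolding assoc[OF Y] by (intro pS gS Y)
  next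
    fix Y :: "'k mat" assume Y: "Y \<in> S"
    obtain q where q0: "\<forall>i<2*n. \<forall>j<2*n. (\<forall>t. (g t * Y * g' t) $$ (i, j) = poly (q i j) t) \<and>
       coeff (q i j) 0 = Y $$ (i, j) \<and>
       coeff (q i j) 1 = (\<Sum>\<alpha>\<in>F. c \<alpha> * commutator (basis_elt \<alpha>) Y $$ (i, j))"
      using bspec[OF gq Y] by (elim exE) (rule that)
    note q = q0[rule_format]
    \<comment> \<open>\<open>q1\<close> and \<open>q2\<close> are the polynomial forms of [e, Z] and
      e Z e, the linear and quadratic terms of one further conjugation.\<close>
    define q1 where "q1 i j = (\<Sum>k<2*n. [:e $$ (i, k):] * q k j) - (\<Sum>k<2*n. q i k * [:e $$ (k, j):])" for i j
    define q2 where "q2 i j = (\<Sum>k<2*n. (\<Sum>l<2*n. [:e $$ (i, l):] * q l k) * [:e $$ (k, j):])" for i j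
    define r where "r i j = q i j + [:0, c \<alpha>:] * q1 i j - [:0, 0, (c \<alpha>)\<^sup>2:] * q2 i j" for i j
    show "\<exists>q. \<forall>i<2*n. \<forall>j<2*n. (\<forall>t. (?p t * g t * Y * (g' t * ?m t)) $$ (i, j) = poly (q i j) t) \<and>
       coeff (q i j) 0 = Y $$ (i, j) \<and>
       coeff (q i j) 1 = (\<Sum>\<alpha>\<in>insert \<alpha> F. c \<alpha> * commutator (basis_elt \<alpha>) Y $$ (i, j))"
    proof (intro exI[of _ r] allI impI conjI)
      fix i j assume ij: "i < 2*n" "j < 2*n"
      show "coeff (r i j) 0 = Y $$ (i, j)" using q[OF ij] by (simp add: r_def coeff_mult)
      have "coeff (q1 i j) 0 = (\<Sum>k<2*n. e $$ (i, k) * Y $$ (k, j)) - (\<Sum>k<2*n. Y $$ (i, k) * e $$ (k, j))"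
        unfolding q1_def coeff_diff coeff_sum using q ij
        by (intro arg_cong2[where f = minus] sum.cong refl) (simp_all add: mult.commute)
      also have "\<dots> = commutator e Y $$ (i, j)"
        by (rule commutator_index[OF ec S_carrier[OF Y] ij, symmetric])
      finally have "coeff (r i j) 1 = coeff (q i j) 1 + c \<alpha> * commutator e Y $$ (i, j)"
        by (simp add: r_def)
      then show "coeff (r i j) 1 = (\<Sum>\<alpha>\<in>insert \<alpha> F. c \<alpha> * commutator (basis_elt \<alpha>) Y $$ (i, j))"
        using q[OF ij] insert.hyps by (simp add: e_def)
      fix t
      define Z where "Z = g t * Y * g' t"
      have Z: "Z \<in> S" unfolding Z_def by (rule gS[OF Y])
      have Zq: "Z $$ (a, b) = poly (q a b) t" if "a < 2*n" "b < 2*n" for a b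
        using q[OF that] unfolding Z_def by blast
      have "commutator e Z $$ (i, j) = (\<Sum>k<2*n. e $$ (i, k) * Z $$ (k, j)) - (\<Sum>k<2*n. Z $$ (i, k) * e $$ (k, j))"
        by (rule commutator_index[OF ec S_carrier[OF Z] ij])
      also have "\<dots> = poly (q1 i j) t"
        unfolding q1_def poly_diff poly_sum using Zq ij
        by (intro arg_cong2[where f = minus] sum.cong refl) (simp_all add: mult.commute)
      finally have c1: "commutator e Z $$ (i, j) = poly (q1 i j) t" .
      have "(e * Z * e) $$ (i, j) = (\<Sum>k<2*n. (e * Z) $$ (i, k) * e $$ (k, j))"
        by (rule mult_index_sum[OF mult_carrier_mat[OF ec S_carrier[OF Z]] ec ij])
      also have "\<dots> = (\<Sum>k<2*n. (\<Sum>l<2*n. e $$ (i, l) * Z $$ (l, k)) * e $$ (k, j))"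
        by (rule sum.cong[OF refl]) (simp only: mult_index_sum[OF ec S_carrier[OF Z] ij(1)] lessThan_iff)
      also have "\<dots> = poly (q2 i j) t"
        unfolding q2_def poly_sum poly_mult using Zq ij
        by (intro sum.cong arg_cong2[where f = times] refl) (simp_all add: mult.commute)
      finally have c2: "(e * Z * e) $$ (i, j) = poly (q2 i j) t" .
      show "(?p t * g t * Y * (g' t * ?m t)) $$ (i, j) = poly (r i j) t"
        unfolding assoc[OF Y] Z_def[symmetric] step[OF Z ij] c1 c2 Zq[OF ij]
        by (simp add: r_def power2_eq_square algebra_simps)
    qed
  qed
qed

text \<open>The semicontinuity step. If the kernel at \<open>\<phi>1\<close> had dimension below
  \<open>card J\<close>, a principal minor \<open>R\<close> with more than
  \<open>card reps - card J\<close> rows would be nonsingular there. That minor is singular at every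
  conjugate of a slice functional, and nondegeneracy on \<open>V\<close> makes each direction
  tangent at \<open>\<phi>0\<close> to a curve of such conjugates, so
  \<open>singular_of_tangent_curves\<close> gives a contradiction.\<close>

lemma slice_dim_bound:
  fixes \<phi>0 \<phi>1 :: "nat \<Rightarrow> nat \<Rightarrow> 'k::field_char_0"
  assumes V: "V \<subseteq> D" "\<And>i j. (i, j) \<in> V \<Longrightarrow> i \<noteq> j"
    and V_bar: "\<And>i j. (i, j) \<in> V \<Longrightarrow> (bar n j, bar n i) \<in> V"
    and \<phi>0: "skew_coeffs n \<phi>0" "\<And>i j. (i, j) \<in> V \<Longrightarrow> \<phi>0 i j = 0"
    and nondeg: "trivial_kernel (V \<inter> reps) (\<lambda>\<beta> \<alpha>. bf n \<phi>0 (basis_elt \<alpha>) (basis_elt \<beta>))"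
    and J: "finite J"
    and slice: "\<And>\<phi> :: nat \<Rightarrow> nat \<Rightarrow> 'k. skew_coeffs n \<phi> \<Longrightarrow> \<forall>p\<in>V. \<phi> (fst p) (snd p) = 0 \<Longrightarrow>
      \<exists>w. (\<forall>l\<in>J. w l \<in> ker_form \<phi>) \<and>
        (\<forall>c. (\<forall>i<2*n. \<forall>j<2*n. (\<Sum>l\<in>J. c l * w l $$ (i, j)) = 0) \<longrightarrow> (\<forall>l\<in>J. c l = 0))"
    and \<phi>1: "skew_coeffs n \<phi>1"
  shows "card J \<le> vectorspace.dim class_ring ((module_mat TYPE('k) (2*n) (2*n))\<lparr>carrier := ker_form \<phi>1\<rparr>)"
proof (rule ccontr)
  let ?dim = "vectorspace.dim class_ring ((module_mat TYPE('k) (2*n) (2*n))\<lparr>carrier := ker_form \<phi>1\<rparr>)"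
  assume "\<not> card J \<le> ?dim"
  define gram where "gram \<phi> \<alpha> \<beta> = bf n \<phi> (basis_elt \<alpha>) (basis_elt \<beta>)" for \<phi> :: "nat \<Rightarrow> nat \<Rightarrow> 'k" and \<alpha> \<beta> :: "nat \<times> nat"
  have gskew: "gram \<phi> \<alpha> \<beta> = - gram \<phi> \<beta> \<alpha>" for \<phi> \<alpha> \<beta>
    unfolding gram_def by (rule bf_skew[OF skew_unit_carrier skew_unit_carrier])
  obtain R z where R0: "R \<subseteq> reps \<and> trivial_kernel R (gram \<phi>1) \<and>
      (\<forall>i\<in>reps - R. \<forall>k\<in>reps. (\<Sum>j\<in>reps. gram \<phi>1 k j * z i j) = 0) \<and>
      (\<forall>i\<in>reps - R. \<forall>k\<in>reps - R. z i k = (if k = i then 1 else 0))"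
    using maximal_nonsingular_principal[OF finite_reps, of "gram \<phi>1", OF gskew] by (elim exE) (rule that)
  have R: "R \<subseteq> reps" "trivial_kernel R (gram \<phi>1)" using R0 by simp_all
  note z = R0[THEN conjunct2, THEN conjunct2, THEN conjunct1, rule_format]
  note z1 = R0[THEN conjunct2, THEN conjunct2, THEN conjunct2, rule_format]
  have zker: "comb reps (z i) \<in> ker_form \<phi>1" if i: "i \<in> reps - R" for i
  proof (rule ker_form_units[OF comb_S[OF reps_D] \<phi>1])
    fix k l assume kl: "(k, l) \<in> D" "k + l < 2*n"
    have "bf n \<phi>1 (comb reps (z i)) (skew_unit n k l) = (\<Sum>\<alpha>\<in>reps. z i \<alpha> * bf n \<phi>1 (basis_elt \<alpha>) (skew_unit n k l))"
      by (rule bf_linear_combination_left[OF comb_carrier skew_unit_carrier skew_unit_carrier comb_index])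
    also have "\<dots> = (\<Sum>\<alpha>\<in>reps. - (gram \<phi>1 (k, l) \<alpha> * z i \<alpha>))"
    proof (rule sum.cong[OF refl])
      fix \<alpha> :: "nat \<times> nat"
      show "z i \<alpha> * bf n \<phi>1 (basis_elt \<alpha>) (skew_unit n k l) = - (gram \<phi>1 (k, l) \<alpha> * z i \<alpha>)"
        unfolding gram_def fst_conv snd_conv bf_skew[OF skew_unit_carrier skew_unit_carrier, of n _ "fst \<alpha>" "snd \<alpha>" k l]
        by (simp add: mult.commute)
    qed
    also have "\<dots> = 0" using z[OF i, of "(k, l)"] kl by (simp add: sum_negf reps_def)
    finally show "bf n \<phi>1 (comb reps (z i)) (skew_unit n k l) = 0" .
  qed
  have "card (reps - R) \<le> ?dim"
  proof (rule dim_ge_independent[OF ker_form_subspace])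
    show "finite (reps - R)" using finite_reps by simp
    show "comb reps (z i) \<in> ker_form \<phi>1" if "i \<in> reps - R" for i by (rule zker[OF that])
    fix c :: "nat \<times> nat \<Rightarrow> 'k"
    assume c: "\<And>i j. i < 2*n \<Longrightarrow> j < 2*n \<Longrightarrow> (\<Sum>l\<in>reps - R. c l * comb reps (z l) $$ (i, j)) = 0"
    show "\<forall>l\<in>reps - R. c l = 0"
    proof
      fix k assume k: "k \<in> reps - R"
      have kr: "fst k < 2*n" "snd k < 2*n" using k D_range by (auto simp: reps_def)
      let ?d = "if snd k = bar n (fst k) then 2 else 1 :: 'k"
      have "0 = (\<Sum>l\<in>reps - R. c l * comb reps (z l) $$ k)" using c[OF kr] by simp
      also have "\<dots> = (\<Sum>l\<in>reps - R. if l = k then c k * ?d else 0)"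
      proof (rule sum.cong[OF refl])
        fix l assume l: "l \<in> reps - R"
        have "comb reps (z l) $$ k = ?d * z l k"
          using comb_at_reps[of reps k "z l"] k by simp
        then show "c l * comb reps (z l) $$ k = (if l = k then c k * ?d else 0)"
          using z1[OF l k] by simp
      qed
      also have "\<dots> = c k * ?d" using k finite_reps by simp
      finally show "c k = 0" by (simp split: if_splits)
    qed
  qed
  then have "card (reps - R) < card J" using \<open>\<not> card J \<le> ?dim\<close> by simp
  moreover have "card (reps - R) = card reps - card R" "card R \<le> card reps"
    using R(1) finite_reps by (auto intro: card_Diff_subset card_mono finite_subset)
  ultimately have big: "card reps < card R + card J" by linarith
  have finR: "finite R" using R(1) finite_reps by (rule finite_subset)
  define G where "G = {gram \<phi> |\<phi>. skew_coeffs n \<phi>}"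
  have "\<not> trivial_kernel R (gram \<phi>1)"
  proof (rule singular_of_tangent_curves[OF finR, of G "gram \<phi>0"])
    show "gram \<phi>0 \<in> G" "gram \<phi>1 \<in> G" using \<phi>0(1) \<phi>1 by (auto simp: G_def)
    fix X Y :: "nat \<times> nat \<Rightarrow> nat \<times> nat \<Rightarrow> 'k" and a b :: 'k
    assume X: "X \<in> G"
    then obtain \<phi> where \<phi>: "skew_coeffs n \<phi>" "X = gram \<phi>" unfolding G_def by (elim CollectE exE conjE)
    {
      assume "Y \<in> G"
      then obtain \<psi> where \<psi>: "skew_coeffs n \<psi>" "Y = gram \<psi>" unfolding G_def by (elim CollectE exE conjE)
      have "skew_coeffs n (\<lambda>i j. a * \<phi> i j + b * \<psi> i j)"
        by (rule skew_coeffs_linear_combination[OF \<phi>(1) \<psi>(1)])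
      moreover have "(\<lambda>i j. a * X i j + b * Y i j) = gram (\<lambda>i j. a * \<phi> i j + b * \<psi> i j)"
        unfolding \<phi>(2) \<psi>(2) gram_def bf_def lf_linear_combination ..
      ultimately show "(\<lambda>i j. a * X i j + b * Y i j) \<in> G" unfolding G_def by (intro CollectI exI conjI)
    }
    \<comment> \<open>\<open>x0\<close> is chosen in the span of the root vectors of
      \<open>V\<close> so that Y \<mapsto> \<open>bf n \<phi>0 x0 Y\<close> agrees with the given
      direction on \<open>V\<close>. The remainder \<open>\<mu>\<close> then vanishes on
      \<open>V\<close> and moves within the slice.\<close>
    obtain x where x: "\<forall>\<beta>\<in>V \<inter> reps. (\<Sum>\<alpha>\<in>V \<inter> reps. bf n \<phi>0 (basis_elt \<alpha>) (basis_elt \<beta>) * x \<alpha>) = lf n \<phi> (basis_elt \<beta>)"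
      using trivial_kernel_solve[OF _ nondeg, of "\<lambda>\<beta>. lf n \<phi> (basis_elt \<beta>)"] finite_reps by auto
    define x0 :: "'k mat" where "x0 = comb (V \<inter> reps) x"
    have x0S: "x0 \<in> S" unfolding x0_def by (rule comb_S) (use V in auto)
    have bx0: "bf n \<phi>0 x0 Y = (\<Sum>\<alpha>\<in>V \<inter> reps. x \<alpha> * bf n \<phi>0 (basis_elt \<alpha>) Y)" if "Y \<in> S" for Y
      unfolding x0_def
      by (rule bf_linear_combination_left[OF comb_carrier S_carrier[OF that] skew_unit_carrier comb_index])
    define f where "f Y = lf n \<phi> Y - bf n \<phi>0 x0 Y" for Y
    have "f \<in> linear_functionals ((module_mat TYPE('k) (2*n) (2*n))\<lparr>carrier := S\<rparr>)"
      unfolding linear_functionals_def module_mat_carrier_update_simps mem_Collect_eq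
    proof (intro conjI ballI allI)
      fix Y Z :: "'k mat" and d :: 'k assume Y: "Y \<in> S"
      have "bf n \<phi>0 x0 (0\<^sub>m (2*n) (2*n) + d \<cdot>\<^sub>m Y) = d * bf n \<phi>0 x0 Y"
        unfolding bf_add_right[OF S_carrier[OF x0S] zero_carrier_mat S_carrier[OF Y]]
        by (simp add: bf_sum[OF S_carrier[OF x0S] zero_carrier_mat])
      moreover have "0\<^sub>m (2*n) (2*n) + d \<cdot>\<^sub>m Y = d \<cdot>\<^sub>m Y" using S_carrier[OF Y] by simp
      ultimately show "f (d \<cdot>\<^sub>m Y) = d * f Y"
        by (simp add: f_def lf_smult[OF S_carrier[OF Y]] right_diff_distrib)
      assume Z: "Z \<in> S"
      have "Y + 1 \<cdot>\<^sub>m Z = Y + Z" using S_carrier[OF Z] by (intro eq_matI) auto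
      then show "f (Y + Z) = f Y + f Z"
        using bf_add_right[OF S_carrier[OF x0S] S_carrier[OF Y] S_carrier[OF Z], of \<phi>0 1]
        by (simp add: f_def lf_add[OF S_carrier[OF Y] S_carrier[OF Z]])
    qed
    then obtain \<mu> where \<mu>: "skew_coeffs n \<mu>" "\<forall>Y\<in>S. f Y = lf n \<mu> Y"
      by (elim functional_coeffs[THEN exE] conjE)
    have \<mu>reps: "\<mu> i j = 0" if "(i, j) \<in> V" "i + j < 2*n" for i j
    proof -
      have D: "(i, j) \<in> D" using that V by blast
      have \<beta>: "(i, j) \<in> V \<inter> reps" using that D by (simp add: reps_def)
      have "2 * \<mu> i j = lf n \<mu> (skew_unit n i j)"
        using lf_skew_unit[OF \<mu>(1)] D_range[OF D] by simp
      also have "\<dots> = f (skew_unit n i j)" by (rule bspec[OF \<mu>(2) skew_unit_S[OF D], symmetric])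
      also have "\<dots> = 0"
        using bspec[OF x \<beta>] by (simp add: f_def bx0[OF skew_unit_S[OF D]] mult.commute)
      finally show ?thesis by simp
    qed
    have \<mu>V: "\<mu> i j = 0" if "(i, j) \<in> V" for i j
    proof (cases "i + j < 2*n")
      case False
      have ij: "i < 2*n" "j < 2*n" using that V D_range by auto
      have "\<mu> (bar n j) (bar n i) = 0" by (rule \<mu>reps[OF V_bar[OF that]]) (use False ij in \<open>auto simp: bar_def\<close>)
      moreover have "\<mu> (bar n j) (bar n i) = - (sgn_idx n i * sgn_idx n j * \<mu> i j)"
        using \<mu>(1) ij unfolding skew_coeffs_def by blast
      ultimately show ?thesis by simp
    qed (rule \<mu>reps[OF that])
    have fV: "finite (V \<inter> reps)" "V \<inter> reps \<subseteq> D" "V \<inter> reps \<subseteq> {\<alpha>. fst \<alpha> \<noteq> snd \<alpha>}"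
      using finite_reps V by auto
    obtain g g' :: "'k \<Rightarrow> 'k mat" where
      g: "\<forall>t. g t \<in> carrier_mat (2*n) (2*n) \<and> g' t \<in> carrier_mat (2*n) (2*n) \<and> g' t * g t = 1\<^sub>m (2*n)"
      and gS: "\<forall>t. \<forall>Y\<in>S. g t * Y * g' t \<in> S"
      and gq: "\<forall>Y\<in>S. \<exists>q. \<forall>i<2*n. \<forall>j<2*n. (\<forall>t. (g t * Y * g' t) $$ (i, j) = poly (q i j) t) \<and>
         coeff (q i j) 0 = Y $$ (i, j) \<and>
         coeff (q i j) 1 = (\<Sum>\<alpha>\<in>V \<inter> reps. x \<alpha> * commutator (basis_elt \<alpha>) Y $$ (i, j))"
      using conj_curve[OF fV, of x] by (elim exE conjE) (rule that)
    obtain Q where Q: "\<forall>Y\<in>S. \<forall>i<2*n. \<forall>j<2*n. (\<forall>t. (g t * Y * g' t) $$ (i, j) = poly (Q Y i j) t) \<and>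
         coeff (Q Y i j) 0 = Y $$ (i, j) \<and>
         coeff (Q Y i j) 1 = (\<Sum>\<alpha>\<in>V \<inter> reps. x \<alpha> * commutator (basis_elt \<alpha>) Y $$ (i, j))"
      using bchoice[OF gq] by (elim exE)
    define com where "com \<alpha> \<beta> = commutator (basis_elt \<alpha>) (basis_elt \<beta> :: 'k mat)" for \<alpha> \<beta> :: "nat \<times> nat"
    have comS: "com \<alpha> \<beta> \<in> S" if "\<alpha> \<in> R" "\<beta> \<in> R" for \<alpha> \<beta>
    proof -
      have "(fst \<alpha>, snd \<alpha>) \<in> D" "(fst \<beta>, snd \<beta>) \<in> D" using that R(1) reps_D by auto
      then show ?thesis unfolding com_def by (intro S_commutator skew_unit_S)
    qed
    \<comment> \<open>The functional \<phi>0 + t \<mu>, evaluated on the conjugated bracket. Its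
      derivative at t = 0 is \<mu> plus the bracket functional of \<open>x0\<close>, that is, the
      prescribed direction \<phi>.\<close>
    define q where "q \<alpha> \<beta> = (\<Sum>i<2*n. \<Sum>j<2*n. [:\<phi>0 i j, \<mu> i j:] * Q (com \<alpha> \<beta>) i j)" for \<alpha> \<beta>
    show "\<exists>q. (\<forall>\<alpha>\<in>R. \<forall>\<beta>\<in>R. coeff (q \<alpha> \<beta>) 0 = gram \<phi>0 \<alpha> \<beta> \<and> coeff (q \<alpha> \<beta>) 1 = X \<alpha> \<beta>) \<and>
      (\<forall>t. \<exists>Y\<in>G. (\<forall>\<alpha>\<in>R. \<forall>\<beta>\<in>R. Y \<alpha> \<beta> = poly (q \<alpha> \<beta>) t) \<and> \<not> trivial_kernel R Y)"
    proof (intro exI[of _ q] conjI ballI allI)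
      fix \<alpha> \<beta> assume ab: "\<alpha> \<in> R" "\<beta> \<in> R"
      note QC = Q[rule_format, OF comS[OF ab]]
      have "coeff (q \<alpha> \<beta>) 0 = (\<Sum>i<2*n. \<Sum>j<2*n. \<phi>0 i j * com \<alpha> \<beta> $$ (i, j))"
        unfolding q_def coeff_sum
      proof (intro sum.cong refl)
        fix i j assume "i \<in> {..<2*n}" "j \<in> {..<2*n}"
        then have "coeff (Q (com \<alpha> \<beta>) i j) 0 = com \<alpha> \<beta> $$ (i, j)" using QC[of i j] by simp
        then show "coeff ([:\<phi>0 i j, \<mu> i j:] * Q (com \<alpha> \<beta>) i j) 0 = \<phi>0 i j * com \<alpha> \<beta> $$ (i, j)" by simp
      qed
      then show "coeff (q \<alpha> \<beta>) 0 = gram \<phi>0 \<alpha> \<beta>" by (simp add: gram_def bf_def lf_def com_def)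
      have "coeff (q \<alpha> \<beta>) 1 = (\<Sum>i<2*n. \<Sum>j<2*n. \<mu> i j * com \<alpha> \<beta> $$ (i, j)
          + (\<Sum>\<gamma>\<in>V \<inter> reps. x \<gamma> * (\<phi>0 i j * commutator (basis_elt \<gamma>) (com \<alpha> \<beta>) $$ (i, j))))"
        unfolding q_def coeff_sum
      proof (intro sum.cong refl)
        fix i j assume "i \<in> {..<2*n}" "j \<in> {..<2*n}"
        then have e: "coeff (Q (com \<alpha> \<beta>) i j) 0 = com \<alpha> \<beta> $$ (i, j)"
          "coeff (Q (com \<alpha> \<beta>) i j) 1 = (\<Sum>\<gamma>\<in>V \<inter> reps. x \<gamma> * commutator (basis_elt \<gamma>) (com \<alpha> \<beta>) $$ (i, j))"
          using QC[of i j] by simp_all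
        have "coeff ([:\<phi>0 i j, \<mu> i j:] * Q (com \<alpha> \<beta>) i j) 1
            = \<phi>0 i j * coeff (Q (com \<alpha> \<beta>) i j) 1 + \<mu> i j * coeff (Q (com \<alpha> \<beta>) i j) 0"
          by simp
        then show "coeff ([:\<phi>0 i j, \<mu> i j:] * Q (com \<alpha> \<beta>) i j) 1 = \<mu> i j * com \<alpha> \<beta> $$ (i, j)
          + (\<Sum>\<gamma>\<in>V \<inter> reps. x \<gamma> * (\<phi>0 i j * commutator (basis_elt \<gamma>) (com \<alpha> \<beta>) $$ (i, j)))"
          unfolding e sum_distrib_left by (simp add: mult.left_commute)
      qed
      also have "\<dots> = lf n \<mu> (com \<alpha> \<beta>) + (\<Sum>i<2*n. \<Sum>j<2*n. \<Sum>\<gamma>\<in>V \<inter> reps. x \<gamma> * (\<phi>0 i j * commutator (basis_elt \<gamma>) (com \<alpha> \<beta>) $$ (i, j)))"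
        unfolding lf_def sum.distrib ..
      also have "(\<Sum>i<2*n. \<Sum>j<2*n. \<Sum>\<gamma>\<in>V \<inter> reps. x \<gamma> * (\<phi>0 i j * commutator (basis_elt \<gamma>) (com \<alpha> \<beta>) $$ (i, j)))
          = (\<Sum>i<2*n. \<Sum>\<gamma>\<in>V \<inter> reps. \<Sum>j<2*n. x \<gamma> * (\<phi>0 i j * commutator (basis_elt \<gamma>) (com \<alpha> \<beta>) $$ (i, j)))"
        by (rule sum.cong[OF refl], rule sum.swap)
      also have "\<dots> = (\<Sum>\<gamma>\<in>V \<inter> reps. \<Sum>i<2*n. \<Sum>j<2*n. x \<gamma> * (\<phi>0 i j * commutator (basis_elt \<gamma>) (com \<alpha> \<beta>) $$ (i, j)))"
        by (rule sum.swap)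
      also have "\<dots> = bf n \<phi>0 x0 (com \<alpha> \<beta>)"
        unfolding bx0[OF comS[OF ab]] unfolding bf_def lf_def sum_distrib_left ..
      also have "lf n \<mu> (com \<alpha> \<beta>) + bf n \<phi>0 x0 (com \<alpha> \<beta>) = lf n \<phi> (com \<alpha> \<beta>)"
        using bspec[OF \<mu>(2) comS[OF ab]] by (simp add: f_def algebra_simps)
      finally show "coeff (q \<alpha> \<beta>) 1 = X \<alpha> \<beta>" unfolding \<phi>(2) gram_def bf_def com_def .
    next
      fix t :: 'k
      define \<psi> where "\<psi> = (\<lambda>i j. \<phi>0 i j + t * \<mu> i j)"
      have \<psi>: "skew_coeffs n \<psi>"
        using skew_coeffs_linear_combination[OF \<phi>0(1) \<mu>(1), of 1 t] by (simp add: \<psi>_def)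
      have \<psi>V: "\<forall>p\<in>V. \<psi> (fst p) (snd p) = 0"
      proof
        fix p assume "p \<in> V"
        then have "(fst p, snd p) \<in> V" by simp
        from \<phi>0(2)[OF this] \<mu>V[OF this] show "\<psi> (fst p) (snd p) = 0" by (simp add: \<psi>_def)
      qed
      define h where "h Y = g t * Y * g' t" for Y
      have gt: "g t \<in> carrier_mat (2*n) (2*n)" "g' t \<in> carrier_mat (2*n) (2*n)" "g' t * g t = 1\<^sub>m (2*n)"
        using g by blast+
      have hS: "h Y \<in> S" if "Y \<in> S" for Y using gS that unfolding h_def by blast
      have hcom: "h (commutator Y Z) = commutator (h Y) (h Z)" if "Y \<in> S" "Z \<in> S" for Y Z
        unfolding h_def by (rule conj_commutator[OF gt that[THEN S_carrier], symmetric])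
      have hadd: "h (Y + Z) = h Y + h Z" if "Y \<in> S" "Z \<in> S" for Y Z
      proof -
        note c = that[THEN S_carrier]
        have "g t * (Y + Z) = g t * Y + g t * Z" by (rule mult_add_distrib_mat[OF gt(1) c])
        then show ?thesis unfolding h_def
          using add_mult_distrib_mat[OF mult_carrier_mat[OF gt(1) c(1)] mult_carrier_mat[OF gt(1) c(2)] gt(2)] by simp
      qed
      have hsm: "h (d \<cdot>\<^sub>m Y) = d \<cdot>\<^sub>m h Y" if "Y \<in> S" for Y d
        unfolding h_def mult_smult_distrib[OF gt(1) S_carrier[OF that]]
        by (rule mult_smult_assoc_mat[OF mult_carrier_mat[OF gt(1) S_carrier[OF that]] gt(2)])
      define fh where "fh Y = lf n \<psi> (h Y)" for Y
      have "fh \<in> linear_functionals ((module_mat TYPE('k) (2*n) (2*n))\<lparr>carrier := S\<rparr>)"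
        unfolding linear_functionals_def module_mat_carrier_update_simps mem_Collect_eq fh_def
        by (intro conjI ballI allI) (simp_all only: hadd hsm lf_add lf_smult S_carrier hS)
      then obtain \<psi>' where \<psi>': "skew_coeffs n \<psi>'" "\<forall>Y\<in>S. fh Y = lf n \<psi>' Y"
        by (elim functional_coeffs[THEN exE] conjE)
      have bS: "basis_elt \<alpha> \<in> S" if "\<alpha> \<in> R" for \<alpha>
        by (rule skew_unit_S) (use that R(1) reps_D in auto)
      have gram': "gram \<psi>' \<alpha> \<beta> = bf n \<psi> (h (basis_elt \<alpha>)) (h (basis_elt \<beta>))" if "\<alpha> \<in> R" "\<beta> \<in> R" for \<alpha> \<beta>
        using bspec[OF \<psi>'(2) comS[OF that]] hcom[OF that[THEN bS]]
        by (simp add: gram_def bf_def fh_def com_def)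
      show "\<exists>Y\<in>G. (\<forall>\<alpha>\<in>R. \<forall>\<beta>\<in>R. Y \<alpha> \<beta> = poly (q \<alpha> \<beta>) t) \<and> \<not> trivial_kernel R Y"
      proof (rule bexI[of _ "gram \<psi>'"], intro conjI ballI)
        show "gram \<psi>' \<in> G" using \<psi>'(1) by (auto simp: G_def)
        fix \<alpha> \<beta> assume ab: "\<alpha> \<in> R" "\<beta> \<in> R"
        have "gram \<psi>' \<alpha> \<beta> = lf n \<psi> (h (com \<alpha> \<beta>))"
          using bspec[OF \<psi>'(2) comS[OF ab]] by (simp add: gram_def bf_def fh_def com_def)
        also have "\<dots> = poly (q \<alpha> \<beta>) t" unfolding lf_def q_def poly_sum
        proof (intro sum.cong refl)
          fix i j assume "i \<in> {..<2*n}" "j \<in> {..<2*n}"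
          then have "h (com \<alpha> \<beta>) $$ (i, j) = poly (Q (com \<alpha> \<beta>) i j) t"
            using Q[rule_format, OF comS[OF ab], of i j] by (simp add: h_def)
          then show "\<psi> i j * h (com \<alpha> \<beta>) $$ (i, j) = poly ([:\<phi>0 i j, \<mu> i j:] * Q (com \<alpha> \<beta>) i j) t"
            by (simp add: \<psi>_def distrib_right mult.assoc)
        qed
        finally show "gram \<psi>' \<alpha> \<beta> = poly (q \<alpha> \<beta>) t" .
      next
        obtain w where w: "\<forall>l\<in>J. w l \<in> ker_form \<psi>"
          and wind: "\<forall>c. (\<forall>i<2*n. \<forall>j<2*n. (\<Sum>l\<in>J. c l * w l $$ (i, j)) = 0) \<longrightarrow> (\<forall>l\<in>J. c l = 0)"
          using slice[OF \<psi> \<psi>V] by (elim exE conjE)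
        \<comment> \<open>The conjugated vectors of \<open>R\<close> and the kernel vectors
          outnumber the coordinates of \<open>S\<close>, so they satisfy a linear relation. It
          involves \<open>R\<close> nontrivially because the kernel vectors are independent, and its
          \<open>R\<close> part lies in the kernel, which yields a null vector of the minor.\<close>
        define u where "u p = (case p of Inl \<beta> \<Rightarrow> h (basis_elt \<beta>) | Inr l \<Rightarrow> (-1) \<cdot>\<^sub>m w l)" for p
        have wS: "w l \<in> S" if "l \<in> J" for l using w that by (auto simp: ker_form_def)
        have uS: "u p \<in> S" if "p \<in> R <+> J" for p
        proof (cases p)
          case (Inl \<beta>)
          then have "\<beta> \<in> R" using that by blast
          then show ?thesis unfolding u_def Inl by (simp only: sum.case hS bS)
        next
          case (Inr l)
          then have "l \<in> J" using that by blast
          then show ?thesis unfolding u_def Inr by (simp only: sum.case S_smult wS)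
        qed
        have "card reps < card (R <+> J)" using big finR J by (simp add: card_Plus)
        then obtain d where d: "\<exists>p\<in>R <+> J. d p \<noteq> 0" "\<forall>\<gamma>\<in>reps. (\<Sum>p\<in>R <+> J. u p $$ \<gamma> * d p) = 0"
          using underdetermined_system[OF finite_reps, of "R <+> J" "\<lambda>\<gamma> p. u p $$ \<gamma>"] finR J by auto
        define Z where "Z = mat (2*n) (2*n) (\<lambda>(a, b). \<Sum>p\<in>R <+> J. d p * u p $$ (a, b))"
        have Zi: "Z $$ (a, b) = (\<Sum>p\<in>R <+> J. d p * u p $$ (a, b))" if "a < 2*n" "b < 2*n" for a b
          using that by (simp add: Z_def)
        have ZS: "Z \<in> S"
        proof (rule SI, rule spI)
          show "Z \<in> carrier_mat (2*n) (2*n)" by (simp add: Z_def)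
          fix a b assume ab: "a < 2*n" "b < 2*n"
          show "Z $$ (bar n b, bar n a) = - (sgn_idx n a * sgn_idx n b * Z $$ (a, b))"
            unfolding Zi[OF ab] Zi[OF bar_less[OF ab(2)] bar_less[OF ab(1)]] sum_distrib_left sum_negf[symmetric]
          proof (rule sum.cong[OF refl])
            fix p assume "p \<in> R <+> J"
            from sp_entry[OF S_sp[OF uS[OF this]] ab]
            show "d p * u p $$ (bar n b, bar n a) = - (sgn_idx n a * sgn_idx n b * (d p * u p $$ (a, b)))"
              by (simp add: mult_ac)
          qed
        next
          fix a b assume ab: "a < 2*n" "b < 2*n" "(a, b) \<notin> D"
          show "Z $$ (a, b) = 0" unfolding Zi[OF ab(1,2)]
            by (rule sum.neutral) (simp add: S_entry[OF uS ab])
        qed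
        have Z0: "(\<Sum>p\<in>R <+> J. d p * u p $$ (a, b)) = 0" if ab: "a < 2*n" "b < 2*n" for a b
        proof -
          have "Z $$ \<gamma> = 0" if "\<gamma> \<in> reps" for \<gamma>
          proof -
            have "fst \<gamma> < 2*n" "snd \<gamma> < 2*n" using that D_range by (auto simp: reps_def)
            then show ?thesis using Zi[of "fst \<gamma>" "snd \<gamma>"] bspec[OF d(2) that] by (simp add: mult.commute)
          qed
          from S_eq_zero[OF ZS this ab] show ?thesis using Zi[OF ab] by simp
        qed
        have split: "(\<Sum>p\<in>R <+> J. F p) = (\<Sum>\<beta>\<in>R. F (Inl \<beta>)) + (\<Sum>l\<in>J. F (Inr l))" for F :: "_ \<Rightarrow> 'k"
          using finR J by (subst sum.Plus) auto
        have eqw: "(\<Sum>\<beta>\<in>R. d (Inl \<beta>) * h (basis_elt \<beta>) $$ (a, b)) = (\<Sum>l\<in>J. d (Inr l) * w l $$ (a, b))"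
          if ab: "a < 2*n" "b < 2*n" for a b
        proof -
          have "(\<Sum>l\<in>J. d (Inr l) * u (Inr l) $$ (a, b)) = (\<Sum>l\<in>J. - (d (Inr l) * w l $$ (a, b)))"
          proof (rule sum.cong[OF refl])
            fix l assume "l \<in> J"
            then have "w l \<in> carrier_mat (2*n) (2*n)" by (rule S_carrier[OF wS])
            then show "d (Inr l) * u (Inr l) $$ (a, b) = - (d (Inr l) * w l $$ (a, b))"
              using ab by (simp add: u_def)
          qed
          then show ?thesis using Z0[OF ab] by (simp add: split u_def sum_negf)
        qed
        have r0: "\<exists>\<beta>\<in>R. d (Inl \<beta>) \<noteq> 0"
        proof (rule ccontr)
          assume "\<not> ?thesis"
          then have r: "d (Inl \<beta>) = 0" if "\<beta> \<in> R" for \<beta> using that by blast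
          have "\<forall>i<2*n. \<forall>j<2*n. (\<Sum>l\<in>J. d (Inr l) * w l $$ (i, j)) = 0"
          proof (intro allI impI)
            fix i j assume "i < 2*n" "j < 2*n"
            from eqw[OF this] show "(\<Sum>l\<in>J. d (Inr l) * w l $$ (i, j)) = 0" using r by simp
          qed
          then have "\<forall>l\<in>J. d (Inr l) = 0" by (rule mp[OF spec[OF wind, of "\<lambda>l. d (Inr l)"]])
          then show False using d(1) r by (elim bexE PlusE) auto
        qed
        have "(\<Sum>\<beta>\<in>R. gram \<psi>' \<alpha> \<beta> * d (Inl \<beta>)) = 0" if \<alpha>: "\<alpha> \<in> R" for \<alpha>
        proof -
          define W where "W = mat (2*n) (2*n) (\<lambda>(a, b). \<Sum>l\<in>J. d (Inr l) * w l $$ (a, b))"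
          have Wc: "W \<in> carrier_mat (2*n) (2*n)" by (simp add: W_def)
          have Wi: "W $$ (a, b) = (\<Sum>l\<in>J. d (Inr l) * w l $$ (a, b))" if "a < 2*n" "b < 2*n" for a b
            using that by (simp add: W_def)
          have ha: "h (basis_elt \<alpha>) \<in> carrier_mat (2*n) (2*n)" by (rule S_carrier[OF hS[OF bS[OF \<alpha>]]])
          have "bf n \<psi> W (h (basis_elt \<alpha>)) = (\<Sum>l\<in>J. d (Inr l) * bf n \<psi> (w l) (h (basis_elt \<alpha>)))"
            by (rule bf_linear_combination_left[OF Wc ha S_carrier[OF wS] Wi])
          also have "\<dots> = 0"
            using w hS[OF bS[OF \<alpha>]] by (intro sum.neutral) (simp add: ker_form_def)
          also have "bf n \<psi> W (h (basis_elt \<alpha>)) = (\<Sum>\<beta>\<in>R. d (Inl \<beta>) * bf n \<psi> (h (basis_elt \<beta>)) (h (basis_elt \<alpha>)))"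
            by (rule bf_linear_combination_left[OF Wc ha S_carrier[OF hS[OF bS]]]) (simp_all add: Wi eqw)
          also have "\<dots> = (\<Sum>\<beta>\<in>R. - (gram \<psi>' \<alpha> \<beta> * d (Inl \<beta>)))"
          proof (rule sum.cong[OF refl])
            fix \<beta> assume \<beta>: "\<beta> \<in> R"
            show "d (Inl \<beta>) * bf n \<psi> (h (basis_elt \<beta>)) (h (basis_elt \<alpha>)) = - (gram \<psi>' \<alpha> \<beta> * d (Inl \<beta>))"
              unfolding gram'[OF \<alpha> \<beta>] bf_skew[OF S_carrier[OF hS[OF bS[OF \<beta>]]] ha] by simp
          qed
          finally show ?thesis by (simp add: sum_negf)
        qed
        then have sys: "\<forall>\<alpha>\<in>R. (\<Sum>\<beta>\<in>R. gram \<psi>' \<alpha> \<beta> * d (Inl \<beta>)) = 0" by (rule ballI)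
        show "\<not> trivial_kernel R (gram \<psi>')"
        proof
          assume "trivial_kernel R (gram \<psi>')"
          from mp[OF spec[OF this[unfolded trivial_kernel_def]] sys] have "\<forall>\<beta>\<in>R. d (Inl \<beta>) = 0" .
          then show False using r0 by blast
        qed
      qed
    qed
  qed
  then show False using R(2) by simp
qed

end

section \<open>Block reflections and the cascade functional\<close>

text \<open>The blocks are intervals that divide the 2n matrix indices symmetrically about the
  centre. They are encoded by an equivalence relation with convex classes, and \<open>r\<close>
  reverses each block.\<close>

locale block_reflection =
  fixes n :: nat and R :: "nat \<Rightarrow> nat \<Rightarrow> bool" and r :: "nat \<Rightarrow> nat"
  assumes R_refl: "R i i" and R_sym: "R i j \<Longrightarrow> R j i" and R_trans: "R i j \<Longrightarrow> R j k \<Longrightarrow> R i k"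
    and R_convex: "R i k \<Longrightarrow> i \<le> j \<Longrightarrow> j \<le> k \<Longrightarrow> R i j"
    and R_bar: "i < 2*n \<Longrightarrow> j < 2*n \<Longrightarrow> R i j \<Longrightarrow> R (bar n i) (bar n j)"
    and r_less: "i < 2*n \<Longrightarrow> r i < 2*n" and r_r: "i < 2*n \<Longrightarrow> r (r i) = i"
    and R_r: "i < 2*n \<Longrightarrow> R i (r i)"
    and r_sum: "i < 2*n \<Longrightarrow> j < 2*n \<Longrightarrow> R i j \<Longrightarrow> i + r i = j + r j"
    and r_bar: "i < 2*n \<Longrightarrow> r (bar n i) = bar n (r i)"
begin

text \<open>A block meeting both halves contains n - 1 and n, which are mirror images. It is
  therefore its own mirror, and its reversal is \<open>bar\<close>.\<close>

lemma r_cross: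
  assumes "i < n" "n \<le> r i"
  shows "r i = bar n i"
proof -
  have n: "i < 2*n" "n - 1 < 2*n" "n < 2*n" using assms by auto
  have ri: "R i (r i)" by (rule R_r[OF n(1)])
  have "R i (n - 1)" by (rule R_convex[OF ri]) (use assms in auto)
  moreover have "R i n" by (rule R_convex[OF ri]) (use assms in auto)
  ultimately have c: "i + r i = (n - 1) + r (n - 1)" "i + r i = n + r n"
    using r_sum n by blast+
  have "bar n (n - 1) = n" using assms by (auto simp: bar_def)
  then have "r n = bar n (r (n - 1))" using r_bar[OF n(2)] by simp
  then have "r n + r (n - 1) + 1 = 2*n" using r_less[OF n(2)] unfolding bar_def by linarith
  then have "i + r i + 1 = 2*n" using c assms by linarith
  then show ?thesis unfolding bar_def by linarith
qed

lemma r_between: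
  assumes "p < 2*n" "r p < s" "s < p"
  shows "R p s" "r s = p + r p - s" "r p < r s" "r s < p"
proof -
  have "R (r p) s" by (rule R_convex[OF R_sym[OF R_r]]) (use assms in auto)
  then show 1: "R p s" using R_trans[OF R_r[OF assms(1)]] by blast
  have "p + r p = s + r s" by (rule r_sum[OF assms(1) _ 1]) (use assms in auto)
  then show "r s = p + r p - s" "r p < r s" "r s < p" using assms by auto
qed

text \<open>Within one block the intervals between an index and its reflection all have the same
  centre, hence are nested: a point outside the interval of p spans a longer one.\<close>

lemma r_outside_above:
  assumes "p < 2*n" "r p < p" "p < s" "s < 2*n" "R s (r p)"
  shows "r s < s" "p - r p < s - r s"
proof -
  have "R s p" using R_trans[OF assms(5) R_sym[OF R_r[OF assms(1)]]] .
  then have "s + r s = p + r p" using r_sum assms by blast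
  then show "r s < s" "p - r p < s - r s" using assms by auto
qed

lemma r_outside_below:
  assumes "p < 2*n" "r p < p" "s < r p" "R p s"
  shows "s < r s" "p - r p < r s - s"
proof -
  have "p + r p = s + r s" by (rule r_sum[OF assms(1) _ assms(4)]) (use assms r_less[OF assms(1)] in auto)
  then show "s < r s" "p - r p < r s - s" using assms by auto
qed

end

section \<open>The cascade and the matching of the remaining roots\<close>

definition gap :: "nat \<Rightarrow> nat \<Rightarrow> nat" where
  "gap i j = (if i \<le> j then j - i else i - j)"

text \<open>\<open>RA\<close> bounds the entries below the diagonal and \<open>RB\<close> those
  above, corresponding to the parabolic subalgebras that contain the upper and the lower Borel
  subalgebra.\<close>

locale seaweed_blocks =
  A: block_reflection n RA ra + B: block_reflection n RB rb
  for n RA ra RB rb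
begin

definition D :: "(nat \<times> nat) set" where
  "D = {(i, j). i < 2*n \<and> j < 2*n \<and> (j < i \<longrightarrow> RA i j) \<and> (i < j \<longrightarrow> RB i j)}"

lemma D_trans': 
  assumes "(i, j) \<in> D" "(j, k) \<in> D"
  shows "(i, k) \<in> D"
proof -
  have ij: "i < 2*n" "j < 2*n" "j < i \<Longrightarrow> RA i j" "i < j \<Longrightarrow> RB i j"
    and jk: "k < 2*n" "k < j \<Longrightarrow> RA j k" "j < k \<Longrightarrow> RB j k" using assms by (auto simp: D_def)
  have "RA i k" if ki: "k < i"
  proof -
    consider "j < k" | "j = k" | "j = i" | "i < j" | "k < j" "j < i" by linarith
    then show ?thesis
    proof cases
      case 1
      have "RA j i" using ij(3) ki 1 A.R_sym by simp
      from A.R_convex[OF this, of k] have "RA j k" using 1 ki by simp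
      then show ?thesis using A.R_trans[OF A.R_sym[OF \<open>RA j i\<close>]] by blast
    next
      case 4
      have "RA k j" using jk(2) ki 4 A.R_sym by simp
      from A.R_convex[OF this, of i] show ?thesis using 4 ki A.R_sym by simp
    next
      case 5
      then show ?thesis using ij(3) jk(2) A.R_trans by blast
    qed (use ij jk ki in auto)
  qed
  moreover have "RB i k" if ki: "i < k"
  proof -
    consider "k < j" | "j = k" | "j = i" | "j < i" | "i < j" "j < k" by linarith
    then show ?thesis
    proof cases
      case 1
      have "RB i j" using ij(4) ki 1 by simp
      from B.R_convex[OF this, of k] show ?thesis using 1 ki by simp
    next
      case 4
      have *: "RB j k" using jk(3) ki 4 by simp
      from B.R_convex[OF this, of i] have "RB j i" using 4 ki by simp
      then show ?thesis using B.R_trans[OF B.R_sym *] by blast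
    next
      case 5
      then show ?thesis using ij(4) jk(3) B.R_trans by blast
    qed (use ij jk ki in auto)
  qed
  ultimately show ?thesis using ij(1) jk(1) by (simp add: D_def)
qed

sublocale sp_support n D
proof
  show "(i, j) \<in> D \<Longrightarrow> (j, k) \<in> D \<Longrightarrow> (i, k) \<in> D" for i j k by (rule D_trans')
  show "(i, j) \<in> D \<Longrightarrow> i < 2*n \<and> j < 2*n" for i j by (simp add: D_def)
  show "i < 2*n \<Longrightarrow> (i, i) \<in> D" for i by (simp add: D_def)
  show "(bar n j, bar n i) \<in> D" if "(i, j) \<in> D" for i j
  proof -
    have ij: "i < 2*n" "j < 2*n" "j < i \<Longrightarrow> RA i j" "i < j \<Longrightarrow> RB i j" using that by (auto simp: D_def)
    have "RA (bar n j) (bar n i)" if "j < i" using A.R_sym[OF A.R_bar[OF ij(1,2) ij(3)[OF that]]] .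
    moreover have "RB (bar n j) (bar n i)" if "i < j" using B.R_sym[OF B.R_bar[OF ij(1,2) ij(4)[OF that]]] .
    ultimately show ?thesis using ij(1,2) by (simp add: D_def bar_less_iff)
  qed
qed

definition cascade :: "nat \<Rightarrow> nat \<Rightarrow> bool" where
  "cascade i j \<longleftrightarrow> (j < i \<and> j = ra i) \<or> (i < j \<and> j = rb i)"

definition V :: "(nat \<times> nat) set" where
  "V = {(i, j) \<in> D. i \<noteq> j \<and> \<not> cascade i j}"

definition refl_of :: "nat \<times> nat \<Rightarrow> nat \<Rightarrow> nat" where
  "refl_of p = (if snd p < fst p then ra else rb)"

text \<open>The partner of a non-cascade root is its difference with the cascade root
  whose Heisenberg subalgebra contains it.\<close>

definition partner :: "nat \<times> nat \<Rightarrow> nat \<times> nat" where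
  "partner p = (case p of (i, j) \<Rightarrow>
     if j < i then (if j < ra i then (ra j, i) else (j, ra i))
     else (if rb i < j then (rb j, i) else (j, rb i)))"

text \<open>The potential \<open>y\<close> for \<open>trivial_kernel_leading_matching\<close>. Base
  3 is used because \<open>2 * 3 ^ a < 3 ^ b\<close> whenever a < b: one longer interval already
  outweighs two copies of a shorter one.\<close>

definition level :: "nat \<times> nat \<Rightarrow> nat" where
  "level p = 3 ^ max (gap (fst p) (refl_of p (fst p))) (gap (snd p) (refl_of p (snd p)))"

lemma cascade_D: "cascade i j \<Longrightarrow> i < 2*n \<Longrightarrow> j < 2*n \<Longrightarrow> (i, j) \<in> D"
  using A.R_r B.R_r by (auto simp: cascade_def D_def)

lemma cascade_bar:
  assumes "i < 2*n" "j < 2*n"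
  shows "cascade (bar n j) (bar n i) \<longleftrightarrow> cascade i j"
proof -
  have "bar n i = ra (bar n j) \<longleftrightarrow> i = ra j"
    using assms A.r_bar[OF assms(2)] A.r_less[OF assms(2)] by simp
  moreover have "bar n i = rb (bar n j) \<longleftrightarrow> i = rb j"
    using assms B.r_bar[OF assms(2)] B.r_less[OF assms(2)] by simp
  moreover have "i = ra j \<longleftrightarrow> j = ra i" "i = rb j \<longleftrightarrow> j = rb i"
    using A.r_r B.r_r assms by metis+
  ultimately show ?thesis using assms by (simp add: cascade_def bar_less_iff)
qed

lemma V_D: "V \<subseteq> D" by (auto simp: V_def)

lemma V_bar: "(i, j) \<in> V \<Longrightarrow> (bar n j, bar n i) \<in> V"
  using D_bar[of i j] D_range[of i j] cascade_bar[of i j] by (auto simp: V_def)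

lemma V_lower: "(i, j) \<in> V \<Longrightarrow> j < i \<Longrightarrow> i < 2*n \<and> j < 2*n \<and> RA i j \<and> j \<noteq> ra i"
  by (auto simp: V_def D_def cascade_def)

lemma V_upper: "(i, j) \<in> V \<Longrightarrow> i < j \<Longrightarrow> i < 2*n \<and> j < 2*n \<and> RB i j \<and> j \<noteq> rb i"
  by (auto simp: V_def D_def cascade_def)

lemma V_lowerI: "i < 2*n \<Longrightarrow> j < i \<Longrightarrow> RA i j \<Longrightarrow> j \<noteq> ra i \<Longrightarrow> (i, j) \<in> V"
  by (auto simp: V_def D_def cascade_def)

lemma V_upperI: "j < 2*n \<Longrightarrow> i < j \<Longrightarrow> RB i j \<Longrightarrow> j \<noteq> rb i \<Longrightarrow> (i, j) \<in> V"
  by (auto simp: V_def D_def cascade_def)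

text \<open>All cases rest on the equality of i + r i and j + r j inside a block. It decides which
  of the two nested intervals is the outer one, and that choice survives passing to the partner and
  to the mirror. The parity count over components later depends on the partner never being the
  mirror.\<close>

lemma partner_V:
  assumes "p \<in> V"
  shows "partner p \<in> V \<and> partner (partner p) = p \<and> partner p \<noteq> p \<and>
    partner p \<noteq> (bar n (snd p), bar n (fst p)) \<and>
    partner (bar n (snd p), bar n (fst p)) = (bar n (snd (partner p)), bar n (fst (partner p)))"
proof -
  obtain i j where p: "p = (i, j)" by (cases p)
  have ne: "i \<noteq> j" using assms p by (simp add: V_def)
  then consider "j < i" | "i < j" by linarith
  then show ?thesis
  proof cases
    case 1
    have v: "i < 2*n" "j < 2*n" "RA i j" "j \<noteq> ra i" using V_lower assms 1 p by auto
    note rl = A.r_less[OF v(1)] A.r_less[OF v(2)]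
    have s: "i + ra i = j + ra j" by (rule A.r_sum[OF v(1,2,3)])
    have rr: "ra (ra i) = i" "ra (ra j) = j" using A.r_r v by auto
    have b: "ra (bar n j) = bar n (ra j)" "ra (bar n i) = bar n (ra i)" using A.r_bar v by auto
    have bl: "bar n i < bar n j" "bar n i < bar n (ra j) \<longleftrightarrow> ra j < i"
      using bar_less_iff v rl 1 by auto
    show ?thesis
    proof (cases "j < ra i")
      case True
      then have l: "i < ra j" using s by linarith
      have "RA (ra j) i" using A.R_trans[OF A.R_sym[OF A.R_r[OF v(2)]] A.R_sym[OF v(3)]] .
      then have "(ra j, i) \<in> V" using l rl rr 1 by (intro V_lowerI) auto
      moreover have "partner (i, j) = (ra j, i)" using 1 True by (simp add: partner_def)
      moreover have "partner (ra j, i) = (i, j)" using l 1 rr by (simp add: partner_def)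
      moreover have "partner (bar n j, bar n i) = (bar n i, bar n (ra j))"
        using bl b l by (simp add: partner_def)
      ultimately show ?thesis using p v ne bar_neq[OF v(1)] bar_neq[OF v(1), THEN not_sym] by auto
    next
      case False
      then have l: "ra i < j" using v(4) by linarith
      have "ra j < i" using l s by linarith
      have "RA j (ra i)" using A.R_trans[OF A.R_sym[OF v(3)] A.R_r[OF v(1)]] .
      moreover have "ra i \<noteq> ra j" using rr ne by metis
      ultimately have "(j, ra i) \<in> V" using l rl v by (intro V_lowerI) auto
      moreover have "partner (i, j) = (j, ra i)" using 1 False by (simp add: partner_def)
      moreover have "partner (j, ra i) = (i, j)" using l \<open>ra j < i\<close> s 1 rr by (simp add: partner_def)
      moreover have "partner (bar n j, bar n i) = (bar n (ra i), bar n j)"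
        using bl b \<open>ra j < i\<close> A.r_bar[OF v(1)] by (simp add: partner_def)
      ultimately show ?thesis using p v ne bar_neq[OF v(2)] bar_neq[OF v(2), THEN not_sym] by auto
    qed
  next
    case 2
    have v: "i < 2*n" "j < 2*n" "RB i j" "j \<noteq> rb i" using V_upper assms 2 p by auto
    note rl = B.r_less[OF v(1)] B.r_less[OF v(2)]
    have s: "i + rb i = j + rb j" by (rule B.r_sum[OF v(1,2,3)])
    have rr: "rb (rb i) = i" "rb (rb j) = j" using B.r_r v by auto
    have b: "rb (bar n j) = bar n (rb j)" "rb (bar n i) = bar n (rb i)" using B.r_bar v by auto
    have bl: "bar n j < bar n i" "bar n (rb j) < bar n i \<longleftrightarrow> i < rb j"
      using bar_less_iff v rl 2 by auto
    show ?thesis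
    proof (cases "rb i < j")
      case True
      then have l: "rb j < i" using s by linarith
      have "RB (rb j) i" using B.R_trans[OF B.R_sym[OF B.R_r[OF v(2)]] B.R_sym[OF v(3)]] .
      then have "(rb j, i) \<in> V" using l rl rr v 2 by (intro V_upperI) auto
      moreover have "partner (i, j) = (rb j, i)" using 2 True by (simp add: partner_def)
      moreover have "partner (rb j, i) = (i, j)" using l 2 rr by (simp add: partner_def)
      moreover have "partner (bar n j, bar n i) = (bar n i, bar n (rb j))"
        using bl b l by (simp add: partner_def)
      ultimately show ?thesis using p v ne bar_neq[OF v(1)] bar_neq[OF v(1), THEN not_sym] by auto
    next
      case False
      then have l: "j < rb i" using v(4) by linarith
      have "i < rb j" using l s by linarith
      have "RB j (rb i)" using B.R_trans[OF B.R_sym[OF v(3)] B.R_r[OF v(1)]] .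
      moreover have "rb i \<noteq> rb j" using rr ne by metis
      ultimately have "(j, rb i) \<in> V" using l rl v by (intro V_upperI) auto
      moreover have "partner (i, j) = (j, rb i)" using 2 False by (simp add: partner_def)
      moreover have "partner (j, rb i) = (i, j)" using l \<open>i < rb j\<close> s 2 rr by (simp add: partner_def)
      moreover have "partner (bar n j, bar n i) = (bar n (rb i), bar n j)"
        using bl b \<open>i < rb j\<close> B.r_bar[OF v(1)] by (simp add: partner_def)
      ultimately show ?thesis using p v ne bar_neq[OF v(2)] bar_neq[OF v(2), THEN not_sym] by auto
    qed
  qed
qed

lemma pow3_less: "a < b \<Longrightarrow> 2 * 3 ^ a < (3::nat) ^ b"
proof -
  assume "a < b"
  then have "(3::nat) ^ Suc a \<le> 3 ^ b" by (intro power_increasing) auto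
  moreover have "(0::nat) < 3 ^ a" by simp
  ultimately show ?thesis unfolding power_Suc by linarith
qed

lemma level_ge:
  "3 ^ gap (fst p) (refl_of p (fst p)) \<le> level p" "3 ^ gap (snd p) (refl_of p (snd p)) \<le> level p" "0 < level p"
  unfolding level_def by (auto intro!: power_increasing)

text \<open>If the intermediate index s lies between p and q, the two halves of the cascade root are
  partners. If it lies outside, one half overshoots, and its level is at least the power of 3 for
  the longer interval of s.\<close>

lemma cascade_split:
  assumes c: "cascade p q" and V: "(p, s) \<in> V" "(s, q) \<in> V"
  shows "(partner (p, s) = (s, q) \<and> partner (s, q) = (p, s)) \<or> 2 * 3 ^ gap p q < level (p, s) + level (s, q)"
proof -
  have ne: "p \<noteq> s" "s \<noteq> q" using V by (auto simp: V_def)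
  have r: "p < 2*n" "s < 2*n" "q < 2*n" using V V_D D_range by blast+
  from c consider (lower) "q < p" "q = ra p" | (upper) "p < q" "q = rb p" unfolding cascade_def by blast
  then show ?thesis
  proof cases
    case lower
    have rq: "ra q = p" using lower A.r_r r by simp
    consider "s < q" | "q < s" "s < p" | "p < s" using ne by linarith
    then show ?thesis
    proof cases
      case 1
      have "RA p s" using V_lower[OF V(1)] 1 lower by simp
      from A.r_outside_below[OF r(1) _ _ this] 1 lower have "s < ra s" "p - q < ra s - s" by auto
      then have "gap p q < gap s (ra s)" using lower by (simp add: gap_def)
      moreover have "3 ^ gap s (ra s) \<le> level (p, s)" using level_ge(2)[of "(p, s)"] 1 lower by (simp add: refl_of_def)
      ultimately show ?thesis using pow3_less[of "gap p q" "gap s (ra s)"] by linarith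
    next
      case 2
      from A.r_between[OF r(1), of s] 2 lower have "ra s = p + q - s" "q < ra s" "ra s < p" by auto
      then have "partner (p, s) = (s, q)" "partner (s, q) = (p, s)" using 2 lower rq by (auto simp: partner_def)
      then show ?thesis by blast
    next
      case 3
      have "RA s q" using V_lower[OF V(2)] 3 lower by simp
      from A.r_outside_above[OF r(1) _ 3 r(2)] this lower have "ra s < s" "p - q < s - ra s" by auto
      then have "gap p q < gap s (ra s)" using lower by (simp add: gap_def)
      moreover have "3 ^ gap s (ra s) \<le> level (s, q)" using level_ge(1)[of "(s, q)"] 3 lower by (simp add: refl_of_def)
      ultimately show ?thesis using pow3_less[of "gap p q" "gap s (ra s)"] by linarith
    qed
  next
    case upper
    have rq: "rb q = p" using upper B.r_r r by simp
    consider "s < p" | "p < s" "s < q" | "q < s" using ne by linarith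
    then show ?thesis
    proof cases
      case 1
      have "RB q s" using V_upper[OF V(2)] 1 upper B.R_sym by simp
      from B.r_outside_below[OF r(3) _ _ this] 1 upper rq have "s < rb s" "q - p < rb s - s" by auto
      then have "gap p q < gap s (rb s)" using upper by (simp add: gap_def)
      moreover have "3 ^ gap s (rb s) \<le> level (s, q)" using level_ge(1)[of "(s, q)"] 1 upper by (simp add: refl_of_def)
      ultimately show ?thesis using pow3_less[of "gap p q" "gap s (rb s)"] by linarith
    next
      case 2
      from B.r_between[OF r(3), of s] 2 upper rq have "rb s = q + p - s" "p < rb s" "rb s < q" by auto
      then have "partner (p, s) = (s, q)" "partner (s, q) = (p, s)" using 2 upper rq by (auto simp: partner_def)
      then show ?thesis by blast
    next
      case 3
      have "RB s p" using V_upper[OF V(1)] 3 upper B.R_sym by simp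
      from B.r_outside_above[OF r(3) _ 3 r(2)] this upper rq have "rb s < s" "q - p < s - rb s" by auto
      then have "gap p q < gap s (rb s)" using upper by (simp add: gap_def)
      moreover have "3 ^ gap s (rb s) \<le> level (p, s)" using level_ge(2)[of "(p, s)"] 3 upper by (simp add: refl_of_def)
      ultimately show ?thesis using pow3_less[of "gap p q" "gap s (rb s)"] by linarith
    qed
  qed
qed

text \<open>A root and its partner share the outer interval, which is that of their common cascade
  root, so both have its power of 3 as level.\<close>

lemma partner_level:
  assumes "(i, j) \<in> V"
  shows "(\<exists>k. partner (i, j) = (k, i) \<and> cascade k j \<and> 2 * 3 ^ gap k j = level (i, j) + level (k, i)) \<or>
    (\<exists>k. partner (i, j) = (j, k) \<and> cascade i k \<and> 2 * 3 ^ gap i k = level (i, j) + level (j, k))"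
proof -
  have ne: "i \<noteq> j" using assms by (simp add: V_def)
  then consider "j < i" | "i < j" by linarith
  then show ?thesis
  proof cases
    case 1
    have v: "i < 2*n" "j < 2*n" "RA i j" "j \<noteq> ra i" using V_lower assms 1 by auto
    have s: "i + ra i = j + ra j" by (rule A.r_sum[OF v(1,2,3)])
    have rr: "ra (ra i) = i" "ra (ra j) = j" using A.r_r v by auto
    show ?thesis
    proof (cases "j < ra i")
      case True
      then have l: "i < ra j" using s by linarith
      have g: "gap i (ra i) \<le> gap j (ra j)" "gap (ra j) j = gap j (ra j)" using s 1 l True by (auto simp: gap_def)
      have "level (i, j) = 3 ^ gap j (ra j)" "level (ra j, i) = 3 ^ gap j (ra j)"
        using g 1 l rr by (simp_all add: level_def refl_of_def max_def)
      moreover have "partner (i, j) = (ra j, i)" using 1 True by (simp add: partner_def)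
      moreover have "cascade (ra j) j" using l 1 rr by (simp add: cascade_def)
      ultimately show ?thesis using g by auto
    next
      case False
      then have l: "ra i < j" using v(4) by linarith
      have g: "gap j (ra j) \<le> gap i (ra i)" "gap (ra i) i = gap i (ra i)" using s 1 l by (auto simp: gap_def)
      have "level (i, j) = 3 ^ gap i (ra i)" "level (j, ra i) = 3 ^ gap i (ra i)"
        using g 1 l rr by (simp_all add: level_def refl_of_def max_def)
      moreover have "partner (i, j) = (j, ra i)" using 1 False by (simp add: partner_def)
      moreover have "cascade i (ra i)" using l 1 by (simp add: cascade_def)
      ultimately show ?thesis by auto
    qed
  next
    case 2
    have v: "i < 2*n" "j < 2*n" "RB i j" "j \<noteq> rb i" using V_upper assms 2 by auto
    have s: "i + rb i = j + rb j" by (rule B.r_sum[OF v(1,2,3)])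
    have rr: "rb (rb i) = i" "rb (rb j) = j" using B.r_r v by auto
    show ?thesis
    proof (cases "rb i < j")
      case True
      then have l: "rb j < i" using s by linarith
      have g: "gap i (rb i) \<le> gap j (rb j)" "gap (rb j) j = gap j (rb j)" using s 2 l True by (auto simp: gap_def)
      have "level (i, j) = 3 ^ gap j (rb j)" "level (rb j, i) = 3 ^ gap j (rb j)"
        using g 2 l rr by (simp_all add: level_def refl_of_def max_def)
      moreover have "partner (i, j) = (rb j, i)" using 2 True by (simp add: partner_def)
      moreover have "cascade (rb j) j" using l 2 rr by (simp add: cascade_def)
      ultimately show ?thesis using g by auto
    next
      case False
      then have l: "j < rb i" using v(4) by linarith
      have g: "gap j (rb j) \<le> gap i (rb i)" "gap (rb i) i = gap i (rb i)" using s 2 l by (auto simp: gap_def)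
      have "level (i, j) = 3 ^ gap i (rb i)" "level (j, rb i) = 3 ^ gap i (rb i)"
        using g 2 l rr by (simp_all add: level_def refl_of_def max_def)
      moreover have "partner (i, j) = (j, rb i)" using 2 False by (simp add: partner_def)
      moreover have "cascade i (rb i)" using l 2 by (simp add: cascade_def)
      ultimately show ?thesis by auto
    qed
  qed
qed

text \<open>The sign -1 on the lower right block is what \<open>skew_coeffs\<close> demands when the
  other cascade coefficients are all 1.\<close>

definition cas_sgn :: "nat \<Rightarrow> nat \<Rightarrow> 'k::field_char_0" where
  "cas_sgn i j = (if cascade i j then if n \<le> i \<and> n \<le> j then - 1 else 1 else 0)"

text \<open>Powers of one parameter replace generic coefficients: longer cascade roots dominate, and
  the determinant on \<open>V\<close> gets a unique leading term.\<close>

definition phi0 :: "'k::field_char_0 \<Rightarrow> nat \<Rightarrow> nat \<Rightarrow> 'k" where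
  "phi0 t i j = cas_sgn i j * t ^ (3 ^ gap i j)"

lemma phi0_skew: "skew_coeffs n (phi0 t)"
  unfolding skew_coeffs_def
proof (intro allI impI)
  fix i j assume ij: "i < 2*n" "j < 2*n"
  have "gap (bar n j) (bar n i) = gap i j" using ij by (auto simp: gap_def bar_def)
  moreover have "n \<le> bar n i \<longleftrightarrow> i < n" "n \<le> bar n j \<longleftrightarrow> j < n" using ij by (auto simp: bar_def)
  ultimately show "phi0 t (bar n j) (bar n i) = - (sgn_idx n i * sgn_idx n j * phi0 t i j)"
    using cascade_bar[OF ij] by (simp add: phi0_def cas_sgn_def sgn_idx_def)
qed

lemma bf_unit_unit:
  assumes "i < 2*n" "j < 2*n" "k < 2*n" "l < 2*n"
  shows "bf n \<phi> (unit_mat n i j) (unit_mat n k l) = (if j = k then \<phi> i l else 0) - (if l = i then \<phi> k j else 0)"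
proof -
  have "(\<Sum>a<2*n. \<phi> a l * unit_mat n i j $$ (a, k)) = (\<Sum>a<2*n. if a = i then (if j = k then \<phi> i l else 0) else 0)"
    by (rule sum.cong[OF refl]) (use assms in auto)
  moreover have "(\<Sum>b<2*n. \<phi> k b * unit_mat n i j $$ (l, b)) = (\<Sum>b<2*n. if b = j then (if l = i then \<phi> k j else 0) else 0)"
    by (rule sum.cong[OF refl]) (use assms in auto)
  ultimately show ?thesis using assms by (simp add: bf_unit[OF unit_mat_carrier assms(3,4)])
qed

lemma finite_V: "finite V"
  using V_D finite_D by (rule finite_subset)

lemma phi0_nondegenerate_units:
  "\<exists>t::'k::field_char_0. t \<noteq> 0 \<and>
    trivial_kernel V (\<lambda>\<beta> \<alpha>. bf n (phi0 t) (unit_mat n (fst \<alpha>) (snd \<alpha>)) (unit_mat n (fst \<beta>) (snd \<beta>)))"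
proof -
  define c :: "nat \<times> nat \<Rightarrow> nat \<times> nat \<Rightarrow> 'k" where
    "c \<beta> \<alpha> = (if snd \<alpha> = fst \<beta> then cas_sgn (fst \<alpha>) (snd \<beta>) else 0)
      - (if snd \<beta> = fst \<alpha> then cas_sgn (fst \<beta>) (snd \<alpha>) else 0)" for \<beta> \<alpha>
  define d :: "nat \<times> nat \<Rightarrow> nat \<times> nat \<Rightarrow> nat" where
    "d \<beta> \<alpha> = (if snd \<alpha> = fst \<beta> then 3 ^ gap (fst \<alpha>) (snd \<beta>) else 3 ^ gap (fst \<beta>) (snd \<alpha>))" for \<beta> \<alpha>
  \<comment> \<open>If both index conditions in \<open>c\<close> hold, the two terms are diagonal
    coefficients, which vanish. Every Gram entry is thus a single monomial, as the degree argument
    requires.\<close>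
  have z: "cas_sgn i i = (0 :: 'k)" for i by (simp add: cas_sgn_def cascade_def)
  have casn: "cas_sgn i j \<noteq> (0 :: 'k) \<longleftrightarrow> cascade i j" for i j by (simp add: cas_sgn_def)
  have "\<exists>t. t \<noteq> 0 \<and> trivial_kernel V (\<lambda>i j. c i j * t ^ d i j)"
  proof (rule trivial_kernel_leading_matching[OF finite_V, where m = partner and y = level])
    show "bij_betw partner V V" by (rule bij_betwI[of _ _ _ partner]) (use partner_V in auto)
    fix \<beta> assume \<beta>: "\<beta> \<in> V"
    obtain i j where ij: "\<beta> = (i, j)" by (cases \<beta>)
    have ne: "i \<noteq> j" using \<beta> ij by (simp add: V_def)
    from partner_level[of i j] \<beta> ij
    consider k where "partner \<beta> = (k, i)" "cascade k j" "2 * 3 ^ gap k j = level (i, j) + level (k, i)"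
      | k where "partner \<beta> = (j, k)" "cascade i k" "2 * 3 ^ gap i k = level (i, j) + level (j, k)" by blast
    then show "c \<beta> (partner \<beta>) \<noteq> 0 \<and> 2 * d \<beta> (partner \<beta>) = level \<beta> + level (partner \<beta>)"
    proof cases
      case 1
      have "j \<noteq> k" using 1(2) by (auto simp: cascade_def)
      then show ?thesis using 1 ij casn[of k j] by (simp add: c_def d_def)
    next
      case 2
      have "k \<noteq> i" using 2(2) by (auto simp: cascade_def)
      then show ?thesis using 2 ij casn[of i k] by (simp add: c_def d_def)
    qed
    fix \<alpha> assume \<alpha>: "\<alpha> \<in> V" "\<alpha> \<noteq> partner \<beta>" "c \<beta> \<alpha> \<noteq> 0"
    obtain a b where ab: "\<alpha> = (a, b)" by (cases \<alpha>)
    show "2 * d \<beta> \<alpha> < level \<beta> + level \<alpha>"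
    proof (cases "b = i")
      case True
      have "cas_sgn a j \<noteq> (0 :: 'k)"
      proof
        assume *: "cas_sgn a j = (0 :: 'k)"
        then have "j = a" using \<alpha>(3) True by (auto simp: c_def ij ab split: if_splits)
        then show False using \<alpha>(3) True * z by (simp add: c_def ij ab)
      qed
      then have "cascade a j" using casn by blast
      then have "(partner (a, i) = (i, j) \<and> partner (i, j) = (a, i)) \<or> 2 * 3 ^ gap a j < level (a, i) + level (i, j)"
        by (rule cascade_split) (use \<alpha> \<beta> ij ab True in auto)
      then show ?thesis using \<alpha>(2) ij ab True by (simp add: d_def)
    next
      case False
      then have *: "j = a" "cas_sgn i b \<noteq> (0 :: 'k)" using \<alpha>(3) by (auto simp: c_def ij ab split: if_splits)
      then have "cascade i b" using casn by blast
      then have "(partner (i, j) = (j, b) \<and> partner (j, b) = (i, j)) \<or> 2 * 3 ^ gap i b < level (i, j) + level (j, b)"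
        by (rule cascade_split) (use \<alpha> \<beta> ij ab * in auto)
      then show ?thesis using \<alpha>(2) ij ab * False by (simp add: d_def)
    qed
  qed
  then obtain t :: 'k where t: "t \<noteq> 0" "trivial_kernel V (\<lambda>i j. c i j * t ^ d i j)" by (elim exE conjE)
  have "bf n (phi0 t) (unit_mat n (fst \<alpha>) (snd \<alpha>)) (unit_mat n (fst \<beta>) (snd \<beta>)) = c \<beta> \<alpha> * t ^ d \<beta> \<alpha>"
    if "\<alpha> \<in> V" "\<beta> \<in> V" for \<alpha> \<beta>
  proof -
    have r: "fst \<alpha> < 2*n" "snd \<alpha> < 2*n" "fst \<beta> < 2*n" "snd \<beta> < 2*n"
      using that V_D D_range by (metis prod.collapse subsetD)+
    show ?thesis unfolding bf_unit_unit[OF r] phi0_def c_def d_def using z by auto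
  qed
  then have "trivial_kernel V (\<lambda>\<beta> \<alpha>. bf n (phi0 t) (unit_mat n (fst \<alpha>) (snd \<alpha>)) (unit_mat n (fst \<beta>) (snd \<beta>)))"
    using t(2) trivial_kernel_cong[of V "\<lambda>\<beta> \<alpha>. bf n (phi0 t) (unit_mat n (fst \<alpha>) (snd \<alpha>)) (unit_mat n (fst \<beta>) (snd \<beta>))" "\<lambda>i j. c i j * t ^ d i j"]
    by simp
  then show ?thesis using t(1) by blast
qed

end

section \<open>Upper bound: the kernel at the cascade functional\<close>

context seaweed_blocks
begin

abbreviation units_nondegenerate :: "(nat \<Rightarrow> nat \<Rightarrow> 'k::field_char_0) \<Rightarrow> bool" where
  "units_nondegenerate \<phi> \<equiv>
    trivial_kernel V (\<lambda>\<beta> \<alpha>. bf n \<phi> (unit_mat n (fst \<alpha>) (snd \<alpha>)) (unit_mat n (fst \<beta>) (snd \<beta>)))"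

lemma V_supported_zero:
  fixes X :: "'k::field_char_0 mat"
  assumes tk: "units_nondegenerate \<phi>" and X: "X \<in> carrier_mat (2*n) (2*n)"
    and supp: "\<And>i j. i < 2*n \<Longrightarrow> j < 2*n \<Longrightarrow> (i, j) \<notin> V \<Longrightarrow> X $$ (i, j) = 0"
    and bf: "\<And>k l. (k, l) \<in> V \<Longrightarrow> bf n \<phi> X (unit_mat n k l) = 0"
  shows "\<forall>\<alpha>\<in>V. X $$ \<alpha> = 0"
proof -
  have e: "X $$ (i, j) = (\<Sum>\<alpha>\<in>V. X $$ \<alpha> * unit_mat n (fst \<alpha>) (snd \<alpha>) $$ (i, j))" if ij: "i < 2*n" "j < 2*n" for i j
  proof -
    have "(\<Sum>\<alpha>\<in>V. X $$ \<alpha> * unit_mat n (fst \<alpha>) (snd \<alpha>) $$ (i, j)) = (\<Sum>\<alpha>\<in>V. if \<alpha> = (i, j) then X $$ (i, j) else 0)"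
      by (rule sum.cong[OF refl]) (use ij in auto)
    also have "\<dots> = X $$ (i, j)" using supp[OF ij] finite_V by simp
    finally show ?thesis by simp
  qed
  have "\<forall>\<beta>\<in>V. (\<Sum>\<alpha>\<in>V. bf n \<phi> (unit_mat n (fst \<alpha>) (snd \<alpha>)) (unit_mat n (fst \<beta>) (snd \<beta>)) * X $$ \<alpha>) = 0"
  proof
    fix \<beta> assume "\<beta> \<in> V"
    then have "bf n \<phi> X (unit_mat n (fst \<beta>) (snd \<beta>)) = 0" by (intro bf) simp
    moreover have "bf n \<phi> X (unit_mat n (fst \<beta>) (snd \<beta>))
        = (\<Sum>\<alpha>\<in>V. X $$ \<alpha> * bf n \<phi> (unit_mat n (fst \<alpha>) (snd \<alpha>)) (unit_mat n (fst \<beta>) (snd \<beta>)))"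
      by (rule bf_linear_combination_left[OF X unit_mat_carrier unit_mat_carrier e])
    ultimately show "(\<Sum>\<alpha>\<in>V. bf n \<phi> (unit_mat n (fst \<alpha>) (snd \<alpha>)) (unit_mat n (fst \<beta>) (snd \<beta>)) * X $$ \<alpha>) = 0"
      by (simp add: mult.commute)
  qed
  then show ?thesis by (rule mp[OF spec[OF tk[unfolded trivial_kernel_def]]])
qed

text \<open>A null vector of this Gram matrix gives an element of \<open>S\<close> supported on
  \<open>V\<close>. By \<open>bf_skew_unit\<close> it is orthogonal to the elementary matrices of
  \<open>V\<close> too, where nondegeneracy is known.\<close>

lemma basis_nondegenerate:
  fixes \<phi> :: "nat \<Rightarrow> nat \<Rightarrow> 'k::field_char_0"
  assumes tk: "units_nondegenerate \<phi>" and \<phi>: "skew_coeffs n \<phi>"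
  shows "trivial_kernel (V \<inter> reps) (\<lambda>\<beta> \<alpha>. bf n \<phi> (basis_elt \<alpha>) (basis_elt \<beta>))"
  unfolding trivial_kernel_def
proof (intro allI impI)
  fix x assume x: "\<forall>\<beta>\<in>V \<inter> reps. (\<Sum>\<alpha>\<in>V \<inter> reps. bf n \<phi> (basis_elt \<alpha>) (basis_elt \<beta>) * x \<alpha>) = 0"
  define X where "X = comb (V \<inter> reps) x"
  have XS: "X \<in> S" unfolding X_def by (rule comb_S) (use V_D in auto)
  have b: "bf n \<phi> X (skew_unit n k l) = 0" if kl: "(k, l) \<in> V" "k + l < 2*n" for k l
  proof -
    have "(k, l) \<in> V \<inter> reps" using kl V_D by (auto simp: reps_def)
    from bspec[OF x this] have "(\<Sum>\<alpha>\<in>V \<inter> reps. x \<alpha> * bf n \<phi> (basis_elt \<alpha>) (skew_unit n k l)) = 0"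
      by (simp add: mult.commute)
    moreover have "bf n \<phi> X (skew_unit n k l) = (\<Sum>\<alpha>\<in>V \<inter> reps. x \<alpha> * bf n \<phi> (basis_elt \<alpha>) (skew_unit n k l))"
      unfolding X_def
      by (rule bf_linear_combination_left[OF comb_carrier skew_unit_carrier skew_unit_carrier comb_index])
    ultimately show ?thesis by simp
  qed
  have "bf n \<phi> X (unit_mat n k l) = 0" if kl: "(k, l) \<in> V" for k l
  proof -
    have r: "k < 2*n" "l < 2*n" using kl V_D D_range by auto
    have "bf n \<phi> X (skew_unit n k l) = 0"
    proof (cases "k + l < 2*n")
      case False
      have "bf n \<phi> X (skew_unit n (bar n l) (bar n k)) = 0"
        by (rule b[OF V_bar[OF kl]]) (use False r in \<open>auto simp: bar_def\<close>)
      moreover have "(skew_unit n k l :: 'k mat) = 0\<^sub>m (2*n) (2*n) + (- (sgn_idx n (bar n l) * sgn_idx n (bar n k))) \<cdot>\<^sub>m skew_unit n (bar n l) (bar n k)"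
        using skew_unit_bar[of "bar n l" n "bar n k"] r by simp
      moreover have "bf n \<phi> X (0\<^sub>m (2*n) (2*n)) = 0" by (simp add: bf_sum[OF S_carrier[OF XS]])
      ultimately show ?thesis
        by (simp only: bf_add_right[OF S_carrier[OF XS] zero_carrier_mat skew_unit_carrier] mult_zero_right add_0_right)
    qed (rule b[OF kl])
    then show ?thesis using bf_skew_unit[OF S_sp[OF XS] \<phi>, of k l] by simp
  qed
  moreover have "X $$ (i, j) = 0" if ij: "i < 2*n" "j < 2*n" "(i, j) \<notin> V" for i j
    unfolding X_def comb_index[OF ij(1,2)]
  proof (rule sum.neutral, rule ballI)
    fix \<alpha> assume "\<alpha> \<in> V \<inter> reps"
    then have \<alpha>: "(fst \<alpha>, snd \<alpha>) \<in> V" by simp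
    then have r: "fst \<alpha> < 2*n" "snd \<alpha> < 2*n" using V_D D_range by blast+
    have "\<not> (i = fst \<alpha> \<and> j = snd \<alpha>)" using \<alpha> ij(3) by auto
    moreover have "\<not> (i = bar n (snd \<alpha>) \<and> j = bar n (fst \<alpha>))" using V_bar[OF \<alpha>] ij(3) by auto
    ultimately have "basis_elt \<alpha> $$ (i, j) = (0 :: 'k)"
      unfolding skew_unit_index[OF ij(1,2) r] by (simp only: if_False diff_self)
    then show "x \<alpha> * basis_elt \<alpha> $$ (i, j) = 0" by (simp only: mult_zero_right)
  qed
  ultimately have X0: "\<forall>\<alpha>\<in>V. X $$ \<alpha> = 0" using V_supported_zero[OF tk S_carrier[OF XS]] by blast
  show "\<forall>\<alpha>\<in>V \<inter> reps. x \<alpha> = 0"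
  proof
    fix \<alpha> assume \<alpha>: "\<alpha> \<in> V \<inter> reps"
    then have "X $$ \<alpha> = 0" using X0 by blast
    moreover have "X $$ \<alpha> = (if snd \<alpha> = bar n (fst \<alpha>) then 2 else 1) * x \<alpha>"
      unfolding X_def using comb_at_reps[of "V \<inter> reps" \<alpha> x] \<alpha> by simp
    ultimately show "x \<alpha> = 0" by (simp split: if_splits)
  qed
qed

text \<open>A flow along the top cascade edge at index i: coefficient times matrix entry, taken with
  opposite signs at the two ends of the edge. \<open>pbot\<close> is its counterpart for bottom
  edges.\<close>

definition ptop :: "(nat \<Rightarrow> nat \<Rightarrow> 'k::field_char_0) \<Rightarrow> 'k mat \<Rightarrow> nat \<Rightarrow> 'k" where
  "ptop \<phi> X i = (if ra i < i then \<phi> i (ra i) * X $$ (i, ra i)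
     else if i < ra i then - (\<phi> (ra i) i * X $$ (ra i, i)) else 0)"

definition pbot :: "(nat \<Rightarrow> nat \<Rightarrow> 'k::field_char_0) \<Rightarrow> 'k mat \<Rightarrow> nat \<Rightarrow> 'k" where
  "pbot \<phi> X i = (if i < rb i then \<phi> i (rb i) * X $$ (i, rb i)
     else if rb i < i then - (\<phi> (rb i) i * X $$ (rb i, i)) else 0)"

lemma ptop_ra: "i < 2*n \<Longrightarrow> ptop \<phi> X (ra i) = - ptop \<phi> X i"
  by (simp add: ptop_def A.r_r)

lemma pbot_rb: "i < 2*n \<Longrightarrow> pbot \<phi> X (rb i) = - pbot \<phi> X i"
  by (simp add: pbot_def B.r_r)

lemma ptop_bar:
  assumes "X \<in> sp n" "skew_coeffs n \<phi>" "i < 2*n"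
  shows "ptop \<phi> X (bar n i) = - ptop \<phi> X i"
proof -
  have e: "\<phi> (bar n k) (bar n j) * X $$ (bar n k, bar n j) = \<phi> j k * X $$ (j, k)" if jk: "j < 2*n" "k < 2*n" for j k
  proof -
    have s: "sgn_idx n j * sgn_idx n k * (sgn_idx n j * sgn_idx n k) = (1 :: 'a)" by (simp add: sgn_idx_def)
    have "\<phi> (bar n k) (bar n j) = - (sgn_idx n j * sgn_idx n k * \<phi> j k)"
      using assms(2) jk unfolding skew_coeffs_def by blast
    then have "\<phi> (bar n k) (bar n j) * X $$ (bar n k, bar n j)
        = (sgn_idx n j * sgn_idx n k * (sgn_idx n j * sgn_idx n k)) * (\<phi> j k * X $$ (j, k))"
      unfolding sp_entry[OF assms(1) jk] by (simp only: minus_mult_minus mult_ac)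
    then show ?thesis unfolding s by simp
  qed
  show ?thesis
    using e[OF assms(3) A.r_less[OF assms(3)]] e[OF A.r_less[OF assms(3)] assms(3)]
      bar_less_iff[OF assms(3) A.r_less[OF assms(3)]] bar_less_iff[OF A.r_less[OF assms(3)] assms(3)]
    by (simp add: ptop_def A.r_bar[OF assms(3)])
qed

context
  fixes t :: "'k::field_char_0"
  assumes t: "t \<noteq> 0" and nd: "units_nondegenerate (phi0 t)"
begin

lemma phi0_nz: "phi0 t i j \<noteq> 0 \<longleftrightarrow> cascade i j"
  using t by (simp add: phi0_def cas_sgn_def)

lemma ker_units:
  assumes "X \<in> ker_form (phi0 t)" "(k, l) \<in> D"
  shows "bf n (phi0 t) X (unit_mat n k l) = 0"
proof -
  have X: "X \<in> S" and "bf n (phi0 t) X (skew_unit n k l) = 0"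
    using assms skew_unit_S[OF assms(2)] unfolding ker_form_def by blast+
  then show ?thesis using bf_skew_unit[OF S_sp[OF X] phi0_skew, of t k l] by simp
qed

lemma column_sum:
  fixes X :: "'k mat"
  assumes k: "k < 2*n"
  shows "(\<Sum>i<2*n. phi0 t i k * X $$ (i, k)) = (if k < ra k then phi0 t (ra k) k * X $$ (ra k, k) else 0)
    + (if rb k < k then phi0 t (rb k) k * X $$ (rb k, k) else 0)"
proof -
  have "(\<Sum>i<2*n. phi0 t i k * X $$ (i, k)) = (\<Sum>i<2*n.
      (if i = ra k then (if k < ra k then phi0 t (ra k) k * X $$ (ra k, k) else 0) else 0)
    + (if i = rb k then (if rb k < k then phi0 t (rb k) k * X $$ (rb k, k) else 0) else 0))"
  proof (rule sum.cong[OF refl])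
    fix i assume "i \<in> {..<2*n}"
    then have i: "i < 2*n" by simp
    have e: "k = ra i \<longleftrightarrow> i = ra k" "k = rb i \<longleftrightarrow> i = rb k" using A.r_r B.r_r i k by metis+
    show "phi0 t i k * X $$ (i, k) = (if i = ra k then (if k < ra k then phi0 t (ra k) k * X $$ (ra k, k) else 0) else 0)
      + (if i = rb k then (if rb k < k then phi0 t (rb k) k * X $$ (rb k, k) else 0) else 0)"
    proof (cases "cascade i k")
      case True
      then show ?thesis unfolding cascade_def e by auto
    next
      case False
      then have "phi0 t i k = 0" using phi0_nz by blast
      moreover have "\<not> (k < i \<and> i = ra k)" "\<not> (i < k \<and> i = rb k)" using False unfolding cascade_def e by blast+
      ultimately show ?thesis by auto
    qed
  qed
  then show ?thesis using A.r_less[OF k] B.r_less[OF k] by (simp add: sum.distrib)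
qed

lemma row_sum:
  fixes X :: "'k mat"
  assumes k: "k < 2*n"
  shows "(\<Sum>j<2*n. phi0 t k j * X $$ (k, j)) = (if ra k < k then phi0 t k (ra k) * X $$ (k, ra k) else 0)
    + (if k < rb k then phi0 t k (rb k) * X $$ (k, rb k) else 0)"
proof -
  have "(\<Sum>j<2*n. phi0 t k j * X $$ (k, j)) = (\<Sum>j<2*n.
      (if j = ra k then (if ra k < k then phi0 t k (ra k) * X $$ (k, ra k) else 0) else 0)
    + (if j = rb k then (if k < rb k then phi0 t k (rb k) * X $$ (k, rb k) else 0) else 0))"
  proof (rule sum.cong[OF refl])
    fix j assume "j \<in> {..<2*n}"
    show "phi0 t k j * X $$ (k, j) = (if j = ra k then (if ra k < k then phi0 t k (ra k) * X $$ (k, ra k) else 0) else 0)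
      + (if j = rb k then (if k < rb k then phi0 t k (rb k) * X $$ (k, rb k) else 0) else 0)"
    proof (cases "cascade k j")
      case True
      then show ?thesis unfolding cascade_def by auto
    next
      case False
      then have "phi0 t k j = 0" using phi0_nz by blast
      moreover have "\<not> (j < k \<and> j = ra k)" "\<not> (k < j \<and> j = rb k)" using False unfolding cascade_def by blast+
      ultimately show ?thesis by auto
    qed
  qed
  then show ?thesis using A.r_less[OF k] B.r_less[OF k] by (simp add: sum.distrib)
qed

text \<open>Orthogonality to the diagonal elementary matrix at k is a conservation law: only the
  cascade entries in row k and column k contribute, and the top and bottom flows at k
  cancel.\<close>

lemma balance:
  assumes X: "X \<in> ker_form (phi0 t)" and k: "k < 2*n"
  shows "pbot (phi0 t) X k = - ptop (phi0 t) X k"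
proof -
  have Xc: "X \<in> carrier_mat (2*n) (2*n)" using X S_carrier unfolding ker_form_def by blast
  have "bf n (phi0 t) X (unit_mat n k k) = 0" by (rule ker_units[OF X D_refl[OF k]])
  then have "(\<Sum>i<2*n. phi0 t i k * X $$ (i, k)) - (\<Sum>j<2*n. phi0 t k j * X $$ (k, j)) = 0"
    unfolding bf_unit[OF Xc k k] .
  then show ?thesis
    unfolding column_sum[OF k] row_sum[OF k] by (auto simp: ptop_def pbot_def eq_neg_iff_add_eq_0 neg_eq_iff_add_eq_0 add.commute split: if_splits)
qed

text \<open>Vanishing flows clear the cascade entries. The part of \<open>X\<close> on
  \<open>V\<close> then pairs with \<open>V\<close> exactly as \<open>X\<close> does, since diagonal
  entries of \<open>X\<close> meet only coefficients on \<open>V\<close>, which are zero.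
  Nondegeneracy leaves a diagonal matrix, and pairing that with a cascade position equates two
  diagonal entries.\<close>

lemma kernel_diagonal:
  assumes X: "X \<in> ker_form (phi0 t)" and p0': "\<forall>i<2*n. ptop (phi0 t) X i = 0"
  shows "i < 2*n \<Longrightarrow> j < 2*n \<Longrightarrow> i \<noteq> j \<Longrightarrow> X $$ (i, j) = 0"
    and "cascade k l \<Longrightarrow> k < 2*n \<Longrightarrow> l < 2*n \<Longrightarrow> X $$ (k, k) = X $$ (l, l)"
proof -
  note p0 = p0'[rule_format]
  have XS: "X \<in> S" using X unfolding ker_form_def by blast
  have Xc: "X \<in> carrier_mat (2*n) (2*n)" by (rule S_carrier[OF XS])
  have cas: "X $$ (i, j) = 0" if c: "cascade i j" and ij: "i < 2*n" "j < 2*n" for i j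
  proof -
    have "phi0 t i j * X $$ (i, j) = 0"
      using c p0[OF ij(1)] balance[OF X ij(1)] unfolding cascade_def ptop_def pbot_def by (auto split: if_splits)
    then show ?thesis using phi0_nz[of i j] c by simp
  qed
  define X' where "X' = mat (2*n) (2*n) (\<lambda>p. if p \<in> V then X $$ p else 0)"
  have X'c: "X' \<in> carrier_mat (2*n) (2*n)" by (simp add: X'_def)
  have X'i: "X' $$ (i, j) = (if (i, j) \<in> V then X $$ (i, j) else 0)" if "i < 2*n" "j < 2*n" for i j
    using that by (simp add: X'_def)
  have same: "X' $$ (i, j) = X $$ (i, j)" if ij: "i < 2*n" "j < 2*n" "i \<noteq> j" for i j
    using X'i[OF ij(1,2)] S_entry[OF XS ij(1,2)] cas[OF _ ij(1,2)] ij(3) unfolding V_def by auto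
  have "\<forall>\<alpha>\<in>V. X' $$ \<alpha> = 0"
  proof (rule V_supported_zero[OF nd X'c])
    show "X' $$ (i, j) = 0" if "i < 2*n" "j < 2*n" "(i, j) \<notin> V" for i j using X'i that by simp
    fix k l assume kl: "(k, l) \<in> V"
    have r: "k < 2*n" "l < 2*n" using kl V_D D_range by auto
    have z: "phi0 t k l = 0" using kl phi0_nz unfolding V_def by blast
    have "(\<Sum>i<2*n. phi0 t i l * X' $$ (i, k)) = (\<Sum>i<2*n. phi0 t i l * X $$ (i, k))"
    proof (rule sum.cong[OF refl])
      fix i assume "i \<in> {..<2*n}"
      then show "phi0 t i l * X' $$ (i, k) = phi0 t i l * X $$ (i, k)" using same[of i k] r z by (cases "i = k") auto
    qed
    moreover have "(\<Sum>j<2*n. phi0 t k j * X' $$ (l, j)) = (\<Sum>j<2*n. phi0 t k j * X $$ (l, j))"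
    proof (rule sum.cong[OF refl])
      fix j assume "j \<in> {..<2*n}"
      then show "phi0 t k j * X' $$ (l, j) = phi0 t k j * X $$ (l, j)" using same[of l j] r z by (cases "j = l") auto
    qed
    ultimately have "bf n (phi0 t) X' (unit_mat n k l) = bf n (phi0 t) X (unit_mat n k l)"
      unfolding bf_unit[OF X'c r] bf_unit[OF Xc r] by simp
    also have "\<dots> = 0" by (rule ker_units[OF X]) (use kl V_D in blast)
    finally show "bf n (phi0 t) X' (unit_mat n k l) = 0" .
  qed
  then have off: "X $$ (i, j) = 0" if "i < 2*n" "j < 2*n" "i \<noteq> j" for i j
    using same[OF that] X'i[OF that(1,2)] by (cases "(i, j) \<in> V") auto
  then show "i < 2*n \<Longrightarrow> j < 2*n \<Longrightarrow> i \<noteq> j \<Longrightarrow> X $$ (i, j) = 0" .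
  assume kl: "cascade k l" "k < 2*n" "l < 2*n"
  have "(\<Sum>i<2*n. phi0 t i l * X $$ (i, k)) = (\<Sum>i<2*n. if i = k then phi0 t k l * X $$ (k, k) else 0)"
    by (rule sum.cong[OF refl]) (use off kl in auto)
  moreover have "(\<Sum>j<2*n. phi0 t k j * X $$ (l, j)) = (\<Sum>j<2*n. if j = l then phi0 t k l * X $$ (l, l) else 0)"
    by (rule sum.cong[OF refl]) (use off kl in auto)
  ultimately have "phi0 t k l * X $$ (k, k) - phi0 t k l * X $$ (l, l) = 0"
    using ker_units[OF X cascade_D[OF kl]] kl unfolding bf_unit[OF Xc kl(2,3)] by simp
  then show "X $$ (k, k) = X $$ (l, l)" using phi0_nz[of k l] kl(1) by (simp flip: right_diff_distrib)
qed

end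

end

text \<open>A 0-based matrix index and its mirror lie over the same 1-based meander vertex v; v - 1
  is the preimage in the first half.\<close>

definition vtx :: "nat \<Rightarrow> nat \<Rightarrow> nat" where
  "vtx n i = (if i < n then Suc i else 2*n - i)"

lemma vtx_bar: "i < 2*n \<Longrightarrow> vtx n (bar n i) = vtx n i"
  by (auto simp: vtx_def bar_def)

lemma vtx_range: "i < 2*n \<Longrightarrow> vtx n i \<in> {1..n}"
  by (auto simp: vtx_def)

lemma vtx_minus_one: "i < 2*n \<Longrightarrow> vtx n i - 1 = i \<or> vtx n i - 1 = bar n i"
  by (auto simp: vtx_def bar_def)

text \<open>Only the two vertex involutions, the two tails and the partition into components enter
  the algebraic part. \<open>K_minimal\<close> expresses connectedness, and \<open>K_fixed\<close>
  says that a component is a cycle or a path whose ends, counted by colour, number two.\<close>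

locale meander_components = seaweed_blocks +
  fixes t b :: "nat \<Rightarrow> nat" and Ta Tb :: "nat set" and \<K> :: "nat set set"
  assumes t_vtx: "i < 2*n \<Longrightarrow> vtx n (ra i) = t (vtx n i)"
    and b_vtx: "i < 2*n \<Longrightarrow> vtx n (rb i) = b (vtx n i)"
    and Ta: "Ta = {v \<in> {1..n}. ra (v - 1) = bar n (v - 1)}"
    and Tb: "Tb = {v \<in> {1..n}. rb (v - 1) = bar n (v - 1)}"
    and K_union: "\<Union>\<K> = {1..n}"
    and K_disjoint: "K \<in> \<K> \<Longrightarrow> L \<in> \<K> \<Longrightarrow> K \<inter> L \<noteq> {} \<Longrightarrow> K = L"
    and K_nonempty: "K \<in> \<K> \<Longrightarrow> K \<noteq> {}"
    and K_t: "K \<in> \<K> \<Longrightarrow> v \<in> K \<Longrightarrow> t v \<in> K"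
    and K_b: "K \<in> \<K> \<Longrightarrow> v \<in> K \<Longrightarrow> b v \<in> K"
    and K_minimal: "K \<in> \<K> \<Longrightarrow> Z \<subseteq> K \<Longrightarrow> Z \<noteq> {} \<Longrightarrow>
      (\<And>v. v \<in> Z \<Longrightarrow> t v \<in> Z \<and> b v \<in> Z) \<Longrightarrow> Z = K"
    and K_fixed: "K \<in> \<K> \<Longrightarrow> card {v \<in> K. t v = v} + card {v \<in> K. b v = v} \<in> {0, 2}"
begin

text \<open>The components that carry a torus element of the kernel. At a tail vertex an index is
  reflected to its mirror, where the diagonal entry has the opposite sign, so the torus element
  would have to vanish.\<close>

definition loop_free :: "nat set set" where
  "loop_free = {K \<in> \<K>. K \<inter> (Ta \<union> Tb) = {}}"

definition cyclic :: "nat set \<Rightarrow> bool" where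
  "cyclic K \<longleftrightarrow> (\<forall>v\<in>K. t v \<noteq> v \<and> b v \<noteq> v)"

text \<open>The components that may carry a nonzero flow: cycles, and paths both of whose ends are
  tail ends. A vertex in both tails is an end twice, which is why two cardinalities are
  added.\<close>

definition closed_up :: "nat set set" where
  "closed_up = {K \<in> \<K>. cyclic K \<or> card (K \<inter> Ta) + card (K \<inter> Tb) = 2}"

lemma K_sub: "K \<in> \<K> \<Longrightarrow> K \<subseteq> {1..n}"
  using K_union by blast

lemma K_finite: "K \<in> \<K> \<Longrightarrow> finite K"
  using K_sub finite_subset by blast

lemma finite_\<K>: "finite \<K>"
proof -
  have "\<K> \<subseteq> Pow {1..n}" using K_sub by blast
  then show ?thesis by (rule finite_subset) simp
qed

lemma Ta_fixed: "v \<in> Ta \<Longrightarrow> t v = v"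
proof -
  assume v: "v \<in> Ta"
  then have vr: "v \<in> {1..n}" and e: "ra (v - 1) = bar n (v - 1)" unfolding Ta by blast+
  have r: "v - 1 < 2*n" "vtx n (v - 1) = v" using vr by (auto simp: vtx_def)
  have "t v = t (vtx n (v - 1))" unfolding r(2) ..
  also have "\<dots> = vtx n (ra (v - 1))" by (rule t_vtx[OF r(1), symmetric])
  also have "\<dots> = v" unfolding e vtx_bar[OF r(1)] by (rule r(2))
  finally show ?thesis .
qed

lemma Tb_fixed: "v \<in> Tb \<Longrightarrow> b v = v"
proof -
  assume v: "v \<in> Tb"
  then have vr: "v \<in> {1..n}" and e: "rb (v - 1) = bar n (v - 1)" unfolding Tb by blast+
  have r: "v - 1 < 2*n" "vtx n (v - 1) = v" using vr by (auto simp: vtx_def)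
  have "b v = b (vtx n (v - 1))" unfolding r(2) ..
  also have "\<dots> = vtx n (rb (v - 1))" by (rule b_vtx[OF r(1), symmetric])
  also have "\<dots> = v" unfolding e vtx_bar[OF r(1)] by (rule r(2))
  finally show ?thesis .
qed

lemma vtx_eq: "i < 2*n \<Longrightarrow> j < 2*n \<Longrightarrow> vtx n i = vtx n j \<Longrightarrow> i = j \<or> i = bar n j"
  by (auto simp: vtx_def bar_def split: if_splits)

text \<open>The reflection sends the index of a fixed vertex to itself or to its mirror. The second
  case is the tail, so the first one remains: the centre of an odd block.\<close>

lemma fixed_not_Ta: "v \<in> {1..n} \<Longrightarrow> t v = v \<Longrightarrow> v \<notin> Ta \<Longrightarrow> ra (v - 1) = v - 1"
proof -
  assume v: "v \<in> {1..n}" "t v = v" "v \<notin> Ta"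
  then have r: "v - 1 < 2*n" "vtx n (v - 1) = v" by (auto simp: vtx_def)
  have "vtx n (ra (v - 1)) = vtx n (v - 1)" using t_vtx[OF r(1)] r v by simp
  from vtx_eq[OF A.r_less[OF r(1)] r(1) this] show ?thesis using v by (auto simp: Ta)
qed

lemma fixed_not_Tb: "v \<in> {1..n} \<Longrightarrow> b v = v \<Longrightarrow> v \<notin> Tb \<Longrightarrow> rb (v - 1) = v - 1"
proof -
  assume v: "v \<in> {1..n}" "b v = v" "v \<notin> Tb"
  then have r: "v - 1 < 2*n" "vtx n (v - 1) = v" by (auto simp: vtx_def)
  have "vtx n (rb (v - 1)) = vtx n (v - 1)" using b_vtx[OF r(1)] r v by simp
  from vtx_eq[OF B.r_less[OF r(1)] r(1) this] show ?thesis using v by (auto simp: Tb)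
qed

text \<open>The set of vertices where \<open>f\<close> vanishes is stable under both involutions,
  hence is all of the component by connectedness. The factors are -1 for flows and 1 for diagonal
  entries.\<close>

lemma zero_on_component:
  fixes f :: "nat \<Rightarrow> 'k::field_char_0"
  assumes f: "\<And>i. i < 2*n \<Longrightarrow> f (bar n i) = - f i"
    "\<And>i. i < 2*n \<Longrightarrow> f (ra i) = c * f i" "\<And>i. i < 2*n \<Longrightarrow> f (rb i) = d * f i"
    and K: "K \<in> \<K>" and v: "v \<in> K" "f (v - 1) = 0" and i: "i < 2*n" "vtx n i \<in> K"
  shows "f i = 0"
proof -
  have z: "f (vtx n j - 1) = 0 \<longleftrightarrow> f j = 0" if "j < 2*n" for j
    using vtx_minus_one[OF that] f(1)[OF that] by auto
  have "{v \<in> K. f (v - 1) = 0} = K"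
  proof (rule K_minimal[OF K])
    fix w assume w: "w \<in> {v \<in> K. f (v - 1) = 0}"
    then have "w \<in> {1..n}" using K_sub[OF K] by blast
    then have r: "w - 1 < 2*n" "vtx n (w - 1) = w" by (auto simp: vtx_def)
    have "f (t w - 1) = 0" using z[OF A.r_less[OF r(1)]] t_vtx[OF r(1)] r f(2)[OF r(1)] w by simp
    moreover have "f (b w - 1) = 0" using z[OF B.r_less[OF r(1)]] b_vtx[OF r(1)] r f(3)[OF r(1)] w by simp
    ultimately show "t w \<in> {v \<in> K. f (v - 1) = 0} \<and> b w \<in> {v \<in> K. f (v - 1) = 0}"
      using w K_t[OF K] K_b[OF K] by simp
  qed (use v in auto)
  then have "f (vtx n i - 1) = 0" using i(2) by blast
  then show ?thesis using z[OF i(1)] by simp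
qed

text \<open>One diagonal entry for each component in \<open>loop_free\<close> and one flow value for
  each in \<open>closed_up\<close> separate the points of the kernel. On any other component the
  flow, respectively the diagonal entry, equals its own negative at some vertex and then vanishes
  throughout.\<close>

lemma dim_upper_bound:
  fixes s :: "'k::field_char_0"
  assumes s: "s \<noteq> 0" "units_nondegenerate (phi0 s)"
  shows "vectorspace.dim class_ring ((module_mat TYPE('k) (2*n) (2*n))\<lparr>carrier := ker_form (phi0 s)\<rparr>)
    \<le> card loop_free + card closed_up"
proof -
  define rep where "rep K = (SOME v. v \<in> K)" for K :: "nat set"
  have rep: "rep K \<in> K" if "K \<in> \<K>" for K unfolding rep_def using K_nonempty[OF that] by (simp add: some_in_eq)
  have repr: "rep K - 1 < 2*n" if "K \<in> \<K>" for K using rep[OF that] K_sub[OF that] by force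
  let ?\<phi> = "phi0 s :: nat \<Rightarrow> nat \<Rightarrow> 'k"
  define g where "g l X = (case l of Inl K \<Rightarrow> X $$ (rep K - 1, rep K - 1) | Inr K \<Rightarrow> ptop ?\<phi> X (rep K - 1))"
    for l and X :: "'k mat"
  have kS: "X \<in> S" if "X \<in> ker_form ?\<phi>" for X using that unfolding ker_form_def by blast
  have fin: "finite loop_free" "finite closed_up" using finite_\<K> by (auto simp: loop_free_def closed_up_def)
  have JK: "K \<in> \<K>" if "Inl K \<in> loop_free <+> closed_up \<or> Inr K \<in> loop_free <+> closed_up" for K
    using that by (auto simp: loop_free_def closed_up_def)
  let ?J = "loop_free <+> closed_up"
  have finJ: "finite ?J" using fin by simp
  have Xc: "X \<in> carrier_mat (2*n) (2*n)" if "X \<in> ker_form ?\<phi>" for X by (rule S_carrier[OF kS[OF that]])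
  have gadd: "g l (X + Y) = g l X + g l Y"
    if l: "l \<in> ?J" and X: "X \<in> ker_form ?\<phi>" and Y: "Y \<in> ker_form ?\<phi>" for l X Y
    using repr[OF JK] A.r_less[OF repr[OF JK]] l Xc[OF X] Xc[OF Y]
    by (cases l) (auto simp: g_def ptop_def distrib_left)
  have gsm: "g l (c \<cdot>\<^sub>m X) = c * g l X" if l: "l \<in> ?J" and X: "X \<in> ker_form ?\<phi>" for l c X
    using repr[OF JK] A.r_less[OF repr[OF JK]] l Xc[OF X]
    by (cases l) (auto simp: g_def ptop_def)
  have gz: "X = 0\<^sub>m (2*n) (2*n)" if X: "X \<in> ker_form ?\<phi>" and g0: "\<And>l. l \<in> ?J \<Longrightarrow> g l X = 0" for X
  proof -
    have XS: "X \<in> S" by (rule kS[OF X])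
    have Xsp: "X \<in> sp n" by (rule S_sp[OF XS])
    have comp: "\<exists>K\<in>\<K>. vtx n i \<in> K" if "i < 2*n" for i using vtx_range[OF that] K_union by blast
    \<comment> \<open>\<open>balance\<close> exchanges top and bottom flow at both ends of the
      bottom edge; the sign is that of \<open>pbot_rb\<close>.\<close>
    have pr: "ptop ?\<phi> X (rb i) = - 1 * ptop ?\<phi> X i" if i: "i < 2*n" for i
      using balance[OF s X i] balance[OF s X B.r_less[OF i]] pbot_rb[OF i, of ?\<phi> X] by simp
    have pa: "ptop ?\<phi> X (ra i) = - 1 * ptop ?\<phi> X i" if i: "i < 2*n" for i using ptop_ra[OF i, of ?\<phi> X] by simp
    have p0: "ptop ?\<phi> X i = 0" if i: "i < 2*n" for i
    proof -
      obtain K where K: "K \<in> \<K>" "vtx n i \<in> K" using comp[OF i] by blast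
      have "\<exists>v\<in>K. ptop ?\<phi> X (v - 1) = 0"
      proof (cases "K \<in> closed_up")
        case True
        then show ?thesis using g0[of "Inr K"] rep[OF K(1)] by (auto simp: g_def)
      next
        case False
        then have nc: "\<not> cyclic K" "card (K \<inter> Ta) + card (K \<inter> Tb) \<noteq> 2" using K(1) by (auto simp: closed_up_def)
        have fK: "finite K" by (rule K_finite[OF K(1)])
        have "card {v \<in> K. t v = v} + card {v \<in> K. b v = v} \<noteq> 0"
          using nc(1) fK by (auto simp: cyclic_def)
        note nz = this
        have c2: "c = 2" if "c \<noteq> 0" "c \<in> {0, 2}" for c :: nat using that by simp
        have two: "card {v \<in> K. t v = v} + card {v \<in> K. b v = v} = 2"
          by (rule c2[OF nz K_fixed[OF K(1)]])
        have "\<exists>v\<in>K. (t v = v \<and> v \<notin> Ta) \<or> (b v = v \<and> v \<notin> Tb)"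
        proof (rule ccontr)
          assume "\<not> ?thesis"
          then have "{v \<in> K. t v = v} = K \<inter> Ta" "{v \<in> K. b v = v} = K \<inter> Tb" using Ta_fixed Tb_fixed by blast+
          then show False using two nc(2) by simp
        qed
        then obtain v where v: "v \<in> K" "(t v = v \<and> v \<notin> Ta) \<or> (b v = v \<and> v \<notin> Tb)" by blast
        have vr: "v \<in> {1..n}" using K_sub[OF K(1)] v(1) by blast
        then have r: "v - 1 < 2*n" by auto
        from v(2) have "ptop ?\<phi> X (v - 1) = - 1 * ptop ?\<phi> X (v - 1)"
        proof
          assume "t v = v \<and> v \<notin> Ta"
          then have "ra (v - 1) = v - 1" using fixed_not_Ta[OF vr] by blast
          then show ?thesis using pa[OF r] by simp
        next
          assume "b v = v \<and> v \<notin> Tb"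
          then have "rb (v - 1) = v - 1" using fixed_not_Tb[OF vr] by blast
          then show ?thesis using pr[OF r] by simp
        qed
        then show ?thesis using v(1) by auto
      qed
      then obtain v where "v \<in> K" "ptop ?\<phi> X (v - 1) = 0" by blast
      from zero_on_component[of "ptop ?\<phi> X", OF ptop_bar[OF Xsp phi0_skew] pa pr K(1) this i K(2)]
      show ?thesis .
    qed
    have p0': "\<forall>i<2*n. ptop ?\<phi> X i = 0" by (intro allI impI p0)
    note off = kernel_diagonal(1)[OF s X p0'] and hc = kernel_diagonal(2)[OF s X p0']
    define h where "h i = X $$ (i, i)" for i
    have hb: "h (bar n i) = - h i" if "i < 2*n" for i
      unfolding h_def using sp_entry[OF Xsp that that] by simp
    have ha: "h (ra i) = 1 * h i" if i: "i < 2*n" for i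
    proof (cases "ra i = i")
      case False
      then have "cascade i (ra i) \<or> cascade (ra i) i" using A.r_r[OF i] by (auto simp: cascade_def)
      then show ?thesis using hc[OF _ i A.r_less[OF i]] hc[OF _ A.r_less[OF i] i] by (auto simp: h_def)
    qed simp
    have hbb: "h (rb i) = 1 * h i" if i: "i < 2*n" for i
    proof (cases "rb i = i")
      case False
      then have "cascade i (rb i) \<or> cascade (rb i) i" using B.r_r[OF i] by (auto simp: cascade_def)
      then show ?thesis using hc[OF _ i B.r_less[OF i]] hc[OF _ B.r_less[OF i] i] by (auto simp: h_def)
    qed simp
    have h0: "h i = 0" if i: "i < 2*n" for i
    proof -
      obtain K where K: "K \<in> \<K>" "vtx n i \<in> K" using comp[OF i] by blast
      have "\<exists>v\<in>K. h (v - 1) = 0"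
      proof (cases "K \<in> loop_free")
        case True
        then show ?thesis using g0[of "Inl K"] rep[OF K(1)] by (auto simp: g_def h_def)
      next
        case False
        then have "K \<inter> (Ta \<union> Tb) \<noteq> {}" using K(1) by (simp add: loop_free_def)
        then obtain v where v: "v \<in> K" "v \<in> Ta \<or> v \<in> Tb" by blast
        have r: "v - 1 < 2*n" using K_sub[OF K(1)] v(1) by force
        from v(2) have "h (v - 1) = - h (v - 1)"
        proof
          assume "v \<in> Ta"
          then show ?thesis using ha[OF r] hb[OF r] by (simp add: Ta)
        next
          assume "v \<in> Tb"
          then show ?thesis using hbb[OF r] hb[OF r] by (simp add: Tb)
        qed
        then show ?thesis using v(1) by auto
      qed
      then obtain v where "v \<in> K" "h (v - 1) = 0" by blast
      from zero_on_component[of h, OF hb ha hbb K(1) this i K(2)] show ?thesis .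
    qed
    show "X = 0\<^sub>m (2*n) (2*n)"
    proof (rule eq_matI)
      fix i j :: nat assume "i < dim_row (0\<^sub>m (2*n) (2*n) :: 'k mat)" "j < dim_col (0\<^sub>m (2*n) (2*n) :: 'k mat)"
      then have ij: "i < 2*n" "j < 2*n" by auto
      then show "X $$ (i, j) = 0\<^sub>m (2*n) (2*n) $$ (i, j)"
        using off[OF ij] h0[OF ij(1)] by (cases "i = j") (auto simp: h_def)
    next
      show "dim_row X = dim_row (0\<^sub>m (2*n) (2*n) :: 'k mat)" "dim_col X = dim_col (0\<^sub>m (2*n) (2*n) :: 'k mat)"
        using S_carrier[OF XS] by (simp_all only: carrier_matD index_zero_mat)
    qed
  qed
  have "vectorspace.dim class_ring ((module_mat TYPE('k) (2*n) (2*n))\<lparr>carrier := ker_form ?\<phi>\<rparr>) \<le> card ?J"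
    by (rule conjunct2, rule dim_le_functionals[OF ker_form_subspace, where g = g]) (fact finJ gadd gsm gz)+
  then show ?thesis unfolding card_Plus[OF fin] .
qed

end

section \<open>Lower bound on the slice of functionals vanishing off the cascade\<close>

lemma even_card_fixpoint_free_involution:
  assumes "finite A" "\<And>x. x \<in> A \<Longrightarrow> f x \<in> A \<and> f (f x) = x \<and> f x \<noteq> x"
  shows "even (card A)"
  using assms
proof (induction "card A" arbitrary: A rule: less_induct)
  case less
  show ?case
  proof (cases "A = {}")
    case False
    then obtain x where x: "x \<in> A" by blast
    note fx = less.prems(2)[OF x]
    have c: "card A = card (A - {x, f x}) + 2"
      using card_Diff_subset[of "{x, f x}" A] card_mono[OF less.prems(1), of "{x, f x}"] x fx by auto
    have "even (card (A - {x, f x}))"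
    proof (rule less.hyps)
      show "card (A - {x, f x}) < card A" using c by simp
      show "finite (A - {x, f x})" using less.prems(1) by simp
      fix y assume y: "y \<in> A - {x, f x}"
      then have yA: "y \<in> A" and n: "y \<noteq> x" "y \<noteq> f x" by auto
      note fy = less.prems(2)[OF yA]
      have "f y \<noteq> x" using fy n(2) by auto
      moreover have "f y \<noteq> f x" using fy fx n(1) by metis
      ultimately show "f y \<in> A - {x, f x} \<and> f (f y) = y \<and> f y \<noteq> y" using fy by simp
    qed
    then show ?thesis using c by simp
  qed simp
qed

lemma card_involution_moved:
  fixes K :: "nat set"
  assumes fin: "finite K" and f: "\<And>x. x \<in> K \<Longrightarrow> f x \<in> K \<and> f (f x) = x"
  shows "card K = 2 * card {x \<in> K. f x < x} + card {x \<in> K. f x = x}"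
proof -
  have "bij_betw f {x \<in> K. f x < x} {x \<in> K. x < f x}"
    by (rule bij_betwI[of _ _ _ f]) (use f in auto)
  then have e: "card {x \<in> K. f x < x} = card {x \<in> K. x < f x}" by (rule bij_betw_same_card)
  have "K = ({x \<in> K. f x < x} \<union> {x \<in> K. x < f x}) \<union> {x \<in> K. f x = x}" by auto
  then have "card K = card (({x \<in> K. f x < x} \<union> {x \<in> K. x < f x}) \<union> {x \<in> K. f x = x})" by simp
  also have "\<dots> = card ({x \<in> K. f x < x} \<union> {x \<in> K. x < f x}) + card {x \<in> K. f x = x}"
    by (rule card_Un_disjoint) (use fin in auto)
  also have "card ({x \<in> K. f x < x} \<union> {x \<in> K. x < f x}) = card {x \<in> K. f x < x} + card {x \<in> K. x < f x}"
    by (rule card_Un_disjoint) (use fin in auto)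
  finally show ?thesis using e by simp
qed

context meander_components
begin

text \<open>Positions with both indices over \<open>K\<close>. A matrix in \<open>S\<close>
  supported here is paired by slice functionals only with positions of the same set, which splits
  the form along components.\<close>

definition supp :: "nat set \<Rightarrow> (nat \<times> nat) set" where
  "supp K = {(i, j). vtx n i \<in> K \<and> vtx n j \<in> K}"

lemma t_t: "v \<in> {1..n} \<Longrightarrow> t (t v) = v"
proof -
  assume "v \<in> {1..n}"
  then have r: "v - 1 < 2*n" "vtx n (v - 1) = v" by (auto simp: vtx_def)
  show ?thesis using t_vtx[OF r(1)] t_vtx[OF A.r_less[OF r(1)]] A.r_r[OF r(1)] r by simp
qed

lemma b_b: "v \<in> {1..n} \<Longrightarrow> b (b v) = v"
proof -
  assume "v \<in> {1..n}"
  then have r: "v - 1 < 2*n" "vtx n (v - 1) = v" by (auto simp: vtx_def)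
  show ?thesis using b_vtx[OF r(1)] b_vtx[OF B.r_less[OF r(1)]] B.r_r[OF r(1)] r by simp
qed

text \<open>The partner, moved back to a representative by the mirror where necessary, is an
  involution. It has no fixed point because a partner is neither the root itself nor its
  mirror.\<close>

lemma even_noncascade:
  assumes K: "K \<in> \<K>"
  shows "even (card (reps \<inter> V \<inter> supp K))"
proof -
  define mir where "mir p = (bar n (snd p), bar n (fst p))" for p :: "nat \<times> nat"
  define f where "f p = (if fst (partner p) + snd (partner p) < 2*n then partner p else mir (partner p))" for p
  have rng: "fst p < 2*n" "snd p < 2*n" if "p \<in> V" for p
    using that V_D D_range[of "fst p" "snd p"] by auto
  have mir_mir: "mir (mir p) = p" if "p \<in> V" for p using rng[OF that] by (simp add: mir_def)
  have mirV: "mir p \<in> V" if "p \<in> V" for p using V_bar[of "fst p" "snd p"] that by (simp add: mir_def)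
  have part: "partner p \<in> V" "partner (partner p) = p" "partner p \<noteq> p" "partner p \<noteq> mir p" "partner (mir p) = mir (partner p)"
    if "p \<in> V" for p using partner_V[OF that] by (auto simp: mir_def)
  have ps: "partner p \<in> supp K" if "p \<in> V" "p \<in> supp K" for p
  proof -
    obtain i j where p: "p = (i, j)" by (cases p)
    have ij: "i < 2*n" "j < 2*n" "vtx n i \<in> K" "vtx n j \<in> K" using rng[OF that(1)] that(2) p by (auto simp: supp_def)
    have "vtx n (ra i) \<in> K" "vtx n (ra j) \<in> K" "vtx n (rb i) \<in> K" "vtx n (rb j) \<in> K"
      using K_t[OF K] K_b[OF K] ij by (simp_all add: t_vtx b_vtx)
    then show ?thesis using ij p by (simp add: partner_def supp_def)
  qed
  have ms: "mir p \<in> supp K" if "p \<in> V" "p \<in> supp K" for p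
    using rng[OF that(1)] that(2) by (auto simp: mir_def supp_def vtx_bar)
  show ?thesis
  proof (rule even_card_fixpoint_free_involution[where f = f])
    show "finite (reps \<inter> V \<inter> supp K)" using finite_V by simp
    fix p assume "p \<in> reps \<inter> V \<inter> supp K"
    then have p: "p \<in> V" "p \<in> supp K" "fst p + snd p < 2*n" by (auto simp: reps_def)
    note q = part(1)[OF p(1)] 
    note r = rng[OF q] and rp = rng[OF p(1)]
    show "f p \<in> reps \<inter> V \<inter> supp K \<and> f (f p) = p \<and> f p \<noteq> p"
    proof (cases "fst (partner p) + snd (partner p) < 2*n")
      case True
      then have "f p = partner p" by (simp add: f_def)
      moreover have "partner p \<in> reps" using True q V_D by (auto simp: reps_def)
      moreover have "f (partner p) = p" using p(3) by (simp add: f_def part(2)[OF p(1)])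
      ultimately show ?thesis using q ps[OF p(1,2)] part(3)[OF p(1)] by simp
    next
      case False
      then have fp: "f p = mir (partner p)" by (simp add: f_def)
      have s: "fst (mir (partner p)) + snd (mir (partner p)) < 2*n" using False r by (auto simp: mir_def bar_def)
      then have "mir (partner p) \<in> reps" using mirV[OF q] V_D by (auto simp: reps_def)
      moreover have "partner (mir (partner p)) = mir p" using part(5)[OF q] part(2)[OF p(1)] by simp
      then have "f (mir (partner p)) = p"
        using mir_mir[OF p(1)] rp p(3) by (cases p) (auto simp: f_def mir_def bar_def)
      moreover have "mir (partner p) \<noteq> p" using part(4)[OF p(1)] mir_mir[OF q] by metis
      ultimately show ?thesis using fp mirV[OF q] ms[OF q ps[OF p(1,2)]] by simp
    qed
  qed
qed

lemma card_diagonal: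
  assumes K: "K \<in> \<K>"
  shows "card {(i, j). i = j \<and> i < n \<and> vtx n i \<in> K} = card K"
proof -
  have "{(i, j). i = j \<and> i < n \<and> vtx n i \<in> K} = (\<lambda>v. (v - 1, v - 1)) ` K"
  proof (rule equalityI; rule subsetI)
    fix p assume "p \<in> {(i, j). i = j \<and> i < n \<and> vtx n i \<in> K}"
    then have "p = (Suc (fst p) - 1, Suc (fst p) - 1)" "Suc (fst p) \<in> K" by (auto simp: vtx_def)
    then show "p \<in> (\<lambda>v. (v - 1, v - 1)) ` K" by (rule image_eqI)
  next
    fix p assume "p \<in> (\<lambda>v. (v - 1, v - 1)) ` K"
    then obtain v where v: "p = (v - 1, v - 1)" "v \<in> K" by (rule imageE)
    then have "v - 1 < n" "vtx n (v - 1) = v" using K_sub[OF K] by (force simp: vtx_def)+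
    then show "p \<in> {(i, j). i = j \<and> i < n \<and> vtx n i \<in> K}" using v by simp
  qed
  moreover have "inj_on (\<lambda>v. (v - 1, v - 1)) K"
  proof (rule inj_onI)
    fix x y assume "x \<in> K" "y \<in> K" "(x - 1, x - 1) = (y - 1, y - 1)"
    moreover from this have "1 \<le> x" "1 \<le> y" using K_sub[OF K] by auto
    ultimately show "x = y" by auto
  qed
  ultimately show ?thesis by (simp add: card_image)
qed

text \<open>A representative cascade position below the diagonal comes either from an edge, counted
  at its larger vertex, or from a reflection across the centre, which is a long root attached to a
  tail vertex.\<close>

lemma card_cascade:
  assumes fin: "finite K" and KN: "K \<subseteq> {1..n}" and rr: "block_reflection n R r"
    and u: "\<And>i. i < 2*n \<Longrightarrow> vtx n (r i) = u (vtx n i)" and Ku: "\<And>v. v \<in> K \<Longrightarrow> u v \<in> K"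
    and T: "T = {v \<in> {1..n}. r (v - 1) = bar n (v - 1)}"
  shows "card {i. i < 2*n \<and> r i < i \<and> i + r i < 2*n \<and> vtx n i \<in> K} = card {v \<in> K. u v < v} + card (K \<inter> T)"
proof -
  interpret r: block_reflection n R r by (rule rr)
  have "{i. i < 2*n \<and> r i < i \<and> i + r i < 2*n \<and> vtx n i \<in> K} = (\<lambda>v. v - 1) ` {v \<in> K. u v < v} \<union> (\<lambda>v. bar n (v - 1)) ` (K \<inter> T)"
    (is "?L = ?R")
  proof (rule equalityI; rule subsetI)
    fix i assume "i \<in> ?L"
    then have i: "i < 2*n" "r i < i" "i + r i < 2*n" "vtx n i \<in> K" by auto
    show "i \<in> ?R"
    proof (cases "i < n")
      case True
      then have "vtx n i = Suc i" "vtx n (r i) = Suc (r i)" using i by (auto simp: vtx_def)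
      then have "Suc i \<in> {v \<in> K. u v < v}" using i u[OF i(1)] by simp
      then have "Suc i - 1 \<in> (\<lambda>v. v - 1) ` {v \<in> K. u v < v}" by (rule imageI)
      then show ?thesis by simp
    next
      case False
      then have c: "r i < n" using i by linarith
      have "r (r i) = bar n (r i)" by (rule r.r_cross[OF c]) (use False r.r_r[OF i(1)] in simp)
      then have e: "i = bar n (r i)" using r.r_r[OF i(1)] by simp
      have w: "Suc (r i) = vtx n i" using c e vtx_bar[of "r i" n] by (simp add: vtx_def)
      have "Suc (r i) \<in> T" using e c r.r_r[OF i(1)] by (simp add: T)
      then have "Suc (r i) \<in> K \<inter> T" using i(4) w by simp
      then have "bar n (Suc (r i) - 1) \<in> (\<lambda>v. bar n (v - 1)) ` (K \<inter> T)" by (rule imageI)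
      then show ?thesis using e by simp
    qed
  next
    fix i assume "i \<in> ?R"
    then show "i \<in> ?L"
    proof
      assume "i \<in> (\<lambda>v. v - 1) ` {v \<in> K. u v < v}"
      then obtain v where v: "v \<in> K" "u v < v" "i = v - 1" by blast
      then have vr: "1 \<le> v" "v \<le> n" using KN by auto
      then have iv: "i < n" "vtx n i = v" "i < 2*n" using v by (auto simp: vtx_def)
      have x: "vtx n (r i) < vtx n i" using u[OF iv(3)] iv v by simp
      have "r i < n"
      proof (rule ccontr)
        assume "\<not> r i < n"
        then have "r i = bar n i" using r.r_cross[OF iv(1)] by simp
        then show False using x vtx_bar[OF iv(3)] by simp
      qed
      then show ?thesis using x iv v by (auto simp: vtx_def)
    next
      assume "i \<in> (\<lambda>v. bar n (v - 1)) ` (K \<inter> T)"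
      then obtain v where v: "v \<in> K" "v \<in> T" "i = bar n (v - 1)" by blast
      then have vr: "1 \<le> v" "v \<le> n" using KN by auto
      then have w: "v - 1 < n" "v - 1 < 2*n" "vtx n (v - 1) = v" by (auto simp: vtx_def)
      have "r (v - 1) = i" using v(2,3) by (simp add: T)
      then have "r i = v - 1" using r.r_r[OF w(2)] by simp
      moreover have "bar n (v - 1) < 2*n" "v - 1 < bar n (v - 1)" "bar n (v - 1) + (v - 1) < 2*n"
        using w(1) by (auto simp: bar_def)
      moreover have "vtx n (bar n (v - 1)) \<in> K" using v(1) w vtx_bar[OF w(2)] by simp
      ultimately show ?thesis using v(3) by simp
    qed
  qed
  moreover have "card ?R = card ((\<lambda>v. v - 1) ` {v \<in> K. u v < v}) + card ((\<lambda>v. bar n (v - 1)) ` (K \<inter> T))"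
  proof (rule card_Un_disjoint)
    have "i < n" if "i \<in> (\<lambda>v. v - 1) ` {v \<in> K. u v < v}" for i using that KN by force
    moreover have "\<not> i < n" if "i \<in> (\<lambda>v. bar n (v - 1)) ` (K \<inter> T)" for i
      using that KN by (force simp: bar_def)
    ultimately show "(\<lambda>v. v - 1) ` {v \<in> K. u v < v} \<inter> (\<lambda>v. bar n (v - 1)) ` (K \<inter> T) = {}" by blast
  qed (use fin in auto)
  moreover have "card ((\<lambda>v. v - 1) ` {v \<in> K. u v < v}) = card {v \<in> K. u v < v}"
  proof (rule card_image, rule inj_onI)
    fix x y assume "x \<in> {v \<in> K. u v < v}" "y \<in> {v \<in> K. u v < v}" "x - 1 = y - 1"
    moreover from this have "1 \<le> x" "1 \<le> y" using KN by auto
    ultimately show "x = y" by auto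
  qed
  moreover have "card ((\<lambda>v. bar n (v - 1)) ` (K \<inter> T)) = card (K \<inter> T)"
  proof (rule card_image, rule inj_onI)
    fix x y assume "x \<in> K \<inter> T" "y \<in> K \<inter> T" "bar n (x - 1) = bar n (y - 1)"
    moreover from this have "1 \<le> x" "x \<le> n" "1 \<le> y" "y \<le> n" using KN by auto
    ultimately show "x = y" by (auto simp: bar_def)
  qed
  ultimately show ?thesis by simp
qed

lemma card_reps_supp:
  assumes K: "K \<in> \<K>"
  shows "card (reps \<inter> supp K) = card (reps \<inter> V \<inter> supp K) + card K
    + card {v \<in> K. t v < v} + card (K \<inter> Ta) + card {v \<in> K. b v < v} + card (K \<inter> Tb)"
proof -
  let ?D = "{(i, j). i = j \<and> i < n \<and> vtx n i \<in> K}"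
  let ?A = "{i. i < 2*n \<and> ra i < i \<and> i + ra i < 2*n \<and> vtx n i \<in> K}"
  let ?B = "{i. i < 2*n \<and> rb i < i \<and> i + rb i < 2*n \<and> vtx n i \<in> K}"
  let ?CA = "(\<lambda>i. (i, ra i)) ` ?A" and ?CB = "(\<lambda>i. (rb i, i)) ` ?B"
  have vt: "vtx n (ra i) \<in> K" "vtx n (rb i) \<in> K" if "i < 2*n" "vtx n i \<in> K" for i
    using that t_vtx b_vtx K_t[OF K] K_b[OF K] by auto
  have eq: "reps \<inter> supp K = (((reps \<inter> V \<inter> supp K) \<union> ?D) \<union> ?CA) \<union> ?CB" (is "?L = ?R")
  proof (rule equalityI; rule subsetI)
    fix p assume p: "p \<in> ?L"
    obtain i j where ij: "p = (i, j)" by (cases p)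
    have h: "(i, j) \<in> D" "i + j < 2*n" "vtx n i \<in> K" "vtx n j \<in> K" "i < 2*n" "j < 2*n"
      using p ij D_range[of i j] by (auto simp: reps_def supp_def)
    show "p \<in> ?R"
    proof (cases "(i, j) \<in> V")
      case True
      then show ?thesis using p ij by blast
    next
      case False
      then consider "i = j" | "j < i" "j = ra i" | "i < j" "j = rb i" using h by (auto simp: V_def cascade_def)
      then show ?thesis
      proof cases
        case 1
        then show ?thesis using h ij by auto
      next
        case 2
        then have "i \<in> ?A" using h by auto
        then show ?thesis using 2 ij by blast
      next
        case 3
        then have e: "rb j = i" using B.r_r[OF h(5)] by simp
        then have "j \<in> ?B" using h 3 by auto
        then have "(rb j, j) \<in> ?CB" by (rule imageI)
        then show ?thesis using e ij by blast
      qed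
    qed
  next
    fix p assume "p \<in> ?R"
    then consider "p \<in> reps \<inter> V \<inter> supp K" | "p \<in> ?D" | "p \<in> ?CA" | "p \<in> ?CB" by blast
    then show "p \<in> ?L"
    proof cases
      case 2
      then show ?thesis using D_refl by (auto simp: reps_def supp_def)
    next
      case 3
      then show ?thesis using vt cascade_D A.r_less by (auto simp: reps_def supp_def cascade_def)
    next
      case 4
      then obtain i where i: "p = (rb i, i)" "i < 2*n" "rb i < i" "i + rb i < 2*n" "vtx n i \<in> K" by blast
      have "cascade (rb i) i" using i B.r_r[OF i(2)] by (simp add: cascade_def)
      then show ?thesis using i vt[of i] cascade_D[of "rb i" i] B.r_less[of i] by (auto simp: reps_def supp_def)
    qed auto
  qed
  have fin: "finite (reps \<inter> V \<inter> supp K)" "finite ?D" "finite ?CA" "finite ?CB"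
  proof -
    have "?D \<subseteq> (\<lambda>i. (i, i)) ` {..<n}" by auto
    then show "finite ?D" by (rule finite_subset) simp
  qed (use finite_V in auto)
  have "card ?R = card (((reps \<inter> V \<inter> supp K) \<union> ?D) \<union> ?CA) + card ?CB"
    by (rule card_Un_disjoint) (use fin in \<open>auto simp: V_def cascade_def B.r_r\<close>)
  also have "card (((reps \<inter> V \<inter> supp K) \<union> ?D) \<union> ?CA) = card ((reps \<inter> V \<inter> supp K) \<union> ?D) + card ?CA"
    by (rule card_Un_disjoint) (use fin in \<open>auto simp: V_def cascade_def\<close>)
  also have "card ((reps \<inter> V \<inter> supp K) \<union> ?D) = card (reps \<inter> V \<inter> supp K) + card ?D"
    by (rule card_Un_disjoint) (use fin in \<open>auto simp: V_def\<close>)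
  finally have *: "card (reps \<inter> supp K) = card (reps \<inter> V \<inter> supp K) + card ?D + card ?CA + card ?CB"
    unfolding eq .
  have "card ?CA = card ?A" by (rule card_image) (auto simp: inj_on_def)
  moreover have "card ?CB = card ?B" by (rule card_image) (auto simp: inj_on_def)
  moreover have "card ?A = card {v \<in> K. t v < v} + card (K \<inter> Ta)"
    by (rule card_cascade[OF K_finite[OF K] K_sub[OF K] A.block_reflection_axioms t_vtx K_t[OF K] Ta])
  moreover have "card ?B = card {v \<in> K. b v < v} + card (K \<inter> Tb)"
    by (rule card_cascade[OF K_finite[OF K] K_sub[OF K] B.block_reflection_axioms b_vtx K_b[OF K] Tb])
  ultimately show ?thesis using * card_diagonal[OF K] by simp
qed

lemma cyclic_loop_free: "K \<in> \<K> \<Longrightarrow> cyclic K \<Longrightarrow> K \<in> loop_free"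
  using Ta_fixed Tb_fixed by (auto simp: loop_free_def cyclic_def)

lemma loop_free_closed_up: "K \<in> loop_free \<Longrightarrow> K \<in> closed_up \<Longrightarrow> cyclic K"
proof -
  assume "K \<in> loop_free" "K \<in> closed_up"
  then have "K \<inter> Ta = {}" "K \<inter> Tb = {}" "cyclic K \<or> card (K \<inter> Ta) + card (K \<inter> Tb) = 2"
    by (auto simp: loop_free_def closed_up_def)
  then show ?thesis by simp
qed

definition base :: "nat set \<Rightarrow> nat" where
  "base K = (SOME v. v \<in> K) - 1"

lemma base: assumes "K \<in> \<K>" shows "vtx n (base K) \<in> K" "base K < n" 
proof -
  have "(SOME v. v \<in> K) \<in> K" using K_nonempty[OF assms] by (simp add: some_in_eq)
  moreover from this have "1 \<le> (SOME v. v \<in> K)" "(SOME v. v \<in> K) \<le> n" using K_sub[OF assms] by auto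
  ultimately show "vtx n (base K) \<in> K" "base K < n" by (auto simp: base_def vtx_def)
qed

text \<open>On a cycle the number of positions is even and \<open>component_one K\<close> is already
  a null vector. Dropping one diagonal position makes the number odd and keeps the second null
  vector independent of the first.\<close>

definition odd_part :: "nat set \<Rightarrow> (nat \<times> nat) set" where
  "odd_part K = reps \<inter> supp K - (if cyclic K then {(base K, base K)} else {})"

lemma base_reps: "K \<in> \<K> \<Longrightarrow> (base K, base K) \<in> reps \<inter> supp K"
  using base[of K] D_refl[of "base K"] by (auto simp: reps_def supp_def)

text \<open>The non-cascade roots are even in number. A cycle has half as many edges of each colour
  as vertices, so torus and cascade positions amount to twice \<open>card K\<close>, from which one
  is removed. A path has \<open>card K - 1\<close> edges and two tail ends, which gives twice
  \<open>card K\<close> plus 1.\<close>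

lemma odd_odd_part:
  assumes "K \<in> closed_up"
  shows "odd (card (odd_part K))"
proof -
  have K: "K \<in> \<K>" using assms by (simp add: closed_up_def)
  have fK: "finite K" by (rule K_finite[OF K])
  have a: "card K = 2 * card {v \<in> K. t v < v} + card {v \<in> K. t v = v}"
    by (rule card_involution_moved[OF fK]) (use K_t[OF K] t_t K_sub[OF K] in blast)
  have b: "card K = 2 * card {v \<in> K. b v < v} + card {v \<in> K. b v = v}"
    by (rule card_involution_moved[OF fK]) (use K_b[OF K] b_b K_sub[OF K] in blast)
  obtain m where m: "card (reps \<inter> V \<inter> supp K) = 2 * m" using even_noncascade[OF K] by (rule evenE)
  note c = card_reps_supp[OF K]
  show ?thesis
  proof (cases "cyclic K")
    case True
    then have z: "{v \<in> K. t v = v} = {}" "{v \<in> K. b v = v} = {}" by (auto simp: cyclic_def)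
    have T: "K \<inter> Ta = {}" "K \<inter> Tb = {}" using cyclic_loop_free[OF K True] by (auto simp: loop_free_def)
    have "card (reps \<inter> supp K) = 2 * (m + card K)" using c a b m unfolding z T by simp
    moreover have "card (reps \<inter> supp K) \<noteq> 0" using base_reps[OF K] finite_reps by auto
    moreover have "card (odd_part K) = card (reps \<inter> supp K) - 1"
      using base_reps[OF K] True by (simp add: odd_part_def)
    ultimately show ?thesis by simp
  next
    case False
    then have s: "card (K \<inter> Ta) + card (K \<inter> Tb) = 2" using assms by (simp add: closed_up_def)
    have "{v \<in> K. t v = v} \<noteq> {} \<or> {v \<in> K. b v = v} \<noteq> {}" using False by (auto simp: cyclic_def)
    then have nz: "card {v \<in> K. t v = v} + card {v \<in> K. b v = v} \<noteq> 0" using fK by auto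
    have c2: "x = 2" if "x \<noteq> 0" "x \<in> {0, 2}" for x :: nat using that by simp
    have F: "card {v \<in> K. t v = v} + card {v \<in> K. b v = v} = 2" by (rule c2[OF nz K_fixed[OF K]])
    have "card (odd_part K) = card (reps \<inter> supp K)" using False by (simp add: odd_part_def)
    also have "\<dots> = 2 * m + card K + card {v \<in> K. t v < v} + card {v \<in> K. b v < v} + 2" using c m s by simp
    finally have e: "card (odd_part K) = 2 * m + card K + card {v \<in> K. t v < v} + card {v \<in> K. b v < v} + 2" .
    have "card K = card {v \<in> K. t v < v} + card {v \<in> K. b v < v} + 1" using a b F by linarith
    then have "card (odd_part K) = 2 * (m + card {v \<in> K. t v < v} + card {v \<in> K. b v < v} + 1) + 1" unfolding e by simp
    then show ?thesis by simp
  qed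
qed

lemma supp_closed:
  assumes K: "K \<in> \<K>" and ij: "i < 2*n" "j < 2*n" "cascade i j \<or> cascade j i \<or> i = j"
  shows "vtx n i \<in> K \<longleftrightarrow> vtx n j \<in> K"
proof -
  have c: "vtx n p \<in> K \<longleftrightarrow> vtx n q \<in> K" if pq: "p < 2*n" "q < 2*n" "cascade p q" for p q
  proof -
    have "q = ra p \<and> p = ra q \<or> q = rb p \<and> p = rb q" using pq(3) A.r_r[OF pq(1)] B.r_r[OF pq(1)] by (auto simp: cascade_def)
    then have "vtx n q = t (vtx n p) \<and> vtx n p = t (vtx n q) \<or> vtx n q = b (vtx n p) \<and> vtx n p = b (vtx n q)"
      using t_vtx[OF pq(1)] t_vtx[OF pq(2)] b_vtx[OF pq(1)] b_vtx[OF pq(2)] by auto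
    then show ?thesis using K_t[OF K] K_b[OF K] by metis
  qed
  show ?thesis using ij(3) c[OF ij(1,2)] c[OF ij(2,1)] by blast
qed

section \<open>Kernel elements of an arbitrary functional in the slice\<close>

context
  fixes \<phi> :: "nat \<Rightarrow> nat \<Rightarrow> 'k::field_char_0"
  assumes \<phi>: "skew_coeffs n \<phi>" and \<phi>V: "\<forall>p\<in>V. \<phi> (fst p) (snd p) = 0"
begin

lemma slice_cascade: "(i, j) \<in> D \<Longrightarrow> \<phi> i j \<noteq> 0 \<Longrightarrow> cascade i j \<or> i = j"
proof (rule ccontr)
  assume "(i, j) \<in> D" "\<phi> i j \<noteq> 0" "\<not> (cascade i j \<or> i = j)"
  moreover from this have "(i, j) \<in> V" by (simp add: V_def)
  from bspec[OF \<phi>V this] have "\<phi> i j = 0" by simp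
  ultimately show False by simp
qed

definition component_one :: "nat set \<Rightarrow> 'k mat" where
  "component_one K = comb {(i, j). i = j \<and> i < n \<and> vtx n i \<in> K} (\<lambda>_. 1)"

lemma diag_reps: "{(i, j). i = j \<and> i < n \<and> vtx n i \<in> K} \<subseteq> reps"
  using D_refl by (auto simp: reps_def)

lemma component_one_S: "component_one K \<in> S"
  unfolding component_one_def by (rule comb_S[OF subset_trans[OF diag_reps reps_D]])

lemma component_one_at_reps: "(i, j) \<in> reps \<Longrightarrow> component_one K $$ (i, j) = (if i = j \<and> vtx n i \<in> K then 1 else 0)"
  using comb_at_reps[OF diag_reps, of "(i, j)" K "\<lambda>_. 1 :: 'k"]
  by (auto simp: component_one_def reps_def bar_def split: if_splits)

lemma component_one_diag: "i < 2*n \<Longrightarrow> component_one K $$ (i, i) = (if vtx n i \<in> K then (if i < n then 1 else - 1) else 0)"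
proof (cases "i < n")
  case True
  then have "(i, i) \<in> reps" using D_refl[of i] by (simp add: reps_def)
  then show ?thesis using component_one_at_reps[of i i K] True by simp
next
  case False
  assume i: "i < 2*n"
  then have bi: "bar n i < n" "bar n i < 2*n" using False by (auto simp: bar_def)
  then have "(bar n i, bar n i) \<in> reps" using D_refl[of "bar n i"] by (simp add: reps_def)
  then show ?thesis using component_one_at_reps[of "bar n i" "bar n i" K] False vtx_bar[OF i]
      sp_entry[OF S_sp[OF component_one_S[of K]] bi(2) bi(2)] i by simp
qed

lemma component_one_off: "i < 2*n \<Longrightarrow> j < 2*n \<Longrightarrow> i \<noteq> j \<Longrightarrow> component_one K $$ (i, j) = 0"
proof -
  assume ij: "i < 2*n" "j < 2*n" "i \<noteq> j"
  have "bar n j + bar n i < 2*n" if "\<not> i + j < 2*n" using that ij unfolding bar_def by linarith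
  then consider "(i, j) \<notin> D" | "(i, j) \<in> reps" | "(bar n j, bar n i) \<in> reps"
    using D_bar[of i j] unfolding reps_def by blast
  then show ?thesis
  proof cases
    case 1
    then show ?thesis using S_entry[OF component_one_S ij(1,2)] by simp
  next
    case 2
    then show ?thesis using component_one_at_reps[OF 2] ij by simp
  next
    case 3
    have "component_one K $$ (bar n j, bar n i) = 0" using component_one_at_reps[OF 3, of K] ij by simp
    then show ?thesis using sp_entry[OF S_sp[OF component_one_S[of K]] ij(1,2)] by simp
  qed
qed

lemma component_one_bf:
  assumes kl: "k < 2*n" "l < 2*n"
  shows "bf n \<phi> (component_one K) (unit_mat n k l) = \<phi> k l * (component_one K $$ (k, k) - component_one K $$ (l, l))"
proof -
  have "(\<Sum>i<2*n. \<phi> i l * component_one K $$ (i, k)) = (\<Sum>i<2*n. if i = k then \<phi> k l * component_one K $$ (k, k) else 0)"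
    by (rule sum.cong[OF refl]) (use component_one_off kl in auto)
  moreover have "(\<Sum>j<2*n. \<phi> k j * component_one K $$ (l, j)) = (\<Sum>j<2*n. if j = l then \<phi> k l * component_one K $$ (l, l) else 0)"
    by (rule sum.cong[OF refl]) (use component_one_off kl in auto)
  ultimately show ?thesis using kl
    by (simp add: bf_unit[OF S_carrier[OF component_one_S] kl] right_diff_distrib)
qed

text \<open>A cascade position joins two indices over the same component. In the absence of tail
  vertices it does not cross the centre, by \<open>r_cross\<close>, and within one half the diagonal
  entries over \<open>K\<close> are constant.\<close>

lemma component_one_ker:
  assumes "K \<in> loop_free"
  shows "component_one K \<in> ker_form \<phi>"
proof (rule ker_form_units[OF component_one_S \<phi>])
  have K: "K \<in> \<K>" using assms by (simp add: loop_free_def)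
  fix k l assume kl: "(k, l) \<in> D" "k + l < 2*n"
  have r: "k < 2*n" "l < 2*n" using D_range[OF kl(1)] by auto
  have half: "q < n" if pq: "p < n" "vtx n p \<in> K" "q = ra p \<or> q = rb p" for p q
  proof (rule ccontr)
    assume "\<not> q < n"
    then have "q = bar n p \<and> (ra p = bar n p \<or> rb p = bar n p)"
      using pq A.r_cross[OF pq(1)] B.r_cross[OF pq(1)] by auto
    then have "vtx n p \<in> Ta \<union> Tb" using pq(1) by (auto simp: Ta Tb vtx_def)
    then show False using assms pq(2) by (auto simp: loop_free_def)
  qed
  have "component_one K $$ (k, k) = component_one K $$ (l, l)" if nz: "\<phi> k l \<noteq> 0"
  proof -
    have "cascade k l \<or> k = l" using slice_cascade[OF kl(1) nz] .
    then show ?thesis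
    proof
      assume c: "cascade k l"
      have m: "vtx n k \<in> K \<longleftrightarrow> vtx n l \<in> K" using supp_closed[OF K r] c by blast
      have rel: "l = ra k \<or> l = rb k" "k = ra l \<or> k = rb l" using c A.r_r[OF r(1)] B.r_r[OF r(1)] by (auto simp: cascade_def)
      have "k < n \<longleftrightarrow> l < n" if "vtx n k \<in> K" using half[of k l] half[of l k] rel m that by blast
      then show ?thesis unfolding component_one_diag[OF r(1)] component_one_diag[OF r(2)] using m by simp
    qed simp
  qed
  then have "bf n \<phi> (component_one K) (unit_mat n k l) = 0" unfolding component_one_bf[OF r] by auto
  then show "bf n \<phi> (component_one K) (skew_unit n k l) = 0" unfolding bf_skew_unit[OF S_sp[OF component_one_S] \<phi>] by simp
qed

text \<open>The Gram matrix on \<open>odd_part K\<close> is skew of odd size, so it has a null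
  vector. The equations outside the component hold because slice functionals do not leave it, and on
  a cycle the equation at the dropped diagonal position follows from \<open>component_one K\<close>
  lying in the kernel.\<close>

lemma odd_part_kernel:
  assumes "K \<in> closed_up"
  shows "\<exists>x. (\<exists>p\<in>odd_part K. x p \<noteq> 0) \<and> comb (odd_part K) x \<in> ker_form \<phi>"
proof -
  have K: "K \<in> \<K>" using assms by (simp add: closed_up_def)
  let ?I = "odd_part K"
  have IR: "?I \<subseteq> reps" and IS: "?I \<subseteq> supp K" by (auto simp: odd_part_def)
  have fI: "finite ?I" using IR finite_reps by (rule finite_subset)
  have "\<exists>x. (\<exists>i\<in>?I. x i \<noteq> 0) \<and> (\<forall>i\<in>?I. (\<Sum>j\<in>?I. - bf n \<phi> (basis_elt i) (basis_elt j) * x j) = 0)"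
    by (rule odd_skew_kernel[OF fI odd_odd_part[OF assms]], rule arg_cong[where f = uminus],
        rule bf_skew[OF skew_unit_carrier skew_unit_carrier])
  then obtain x where x: "\<exists>i\<in>?I. x i \<noteq> 0" and s: "\<forall>i\<in>?I. (\<Sum>j\<in>?I. - bf n \<phi> (basis_elt i) (basis_elt j) * x j) = 0" by blast
  define X where "X = comb ?I x"
  have XS: "X \<in> S" unfolding X_def by (rule comb_S[OF subset_trans[OF IR reps_D]])
  have Xc: "X \<in> carrier_mat (2*n) (2*n)" by (rule S_carrier[OF XS])
  have lin: "bf n \<phi> X Y = (\<Sum>\<alpha>\<in>?I. x \<alpha> * bf n \<phi> (basis_elt \<alpha>) Y)" if "Y \<in> carrier_mat (2*n) (2*n)" for Y
    unfolding X_def by (rule bf_linear_combination_left[OF comb_carrier that skew_unit_carrier comb_index])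
  have in_I: "bf n \<phi> X (skew_unit n k l) = 0" if kl: "(k, l) \<in> ?I" for k l
  proof -
    have "bf n \<phi> X (skew_unit n k l) = (\<Sum>\<alpha>\<in>?I. x \<alpha> * bf n \<phi> (basis_elt \<alpha>) (skew_unit n k l))"
      by (rule lin[OF skew_unit_carrier])
    also have "\<dots> = (\<Sum>j\<in>?I. - bf n \<phi> (basis_elt (k, l)) (basis_elt j) * x j)"
    proof (rule sum.cong[OF refl])
      fix j assume "j \<in> ?I"
      have "bf n \<phi> (basis_elt j) (skew_unit n k l) = - bf n \<phi> (basis_elt (k, l)) (basis_elt j)"
        unfolding fst_conv snd_conv by (rule bf_skew[OF skew_unit_carrier skew_unit_carrier])
      then show "x j * bf n \<phi> (basis_elt j) (skew_unit n k l) = - bf n \<phi> (basis_elt (k, l)) (basis_elt j) * x j"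
        by (simp only: mult.commute)
    qed
    also have "\<dots> = 0" using bspec[OF s kl] .
    finally show ?thesis .
  qed
  have Xsupp: "vtx n i \<in> K \<and> vtx n j \<in> K" if ij: "i < 2*n" "j < 2*n" "X $$ (i, j) \<noteq> 0" for i j
  proof -
    have D: "(i, j) \<in> D" using S_entry[OF XS ij(1,2)] ij(3) by blast
    show ?thesis
    proof (cases "i + j < 2*n")
      case True
      then have r: "(i, j) \<in> reps" using D by (simp add: reps_def)
      have "(i, j) \<in> ?I" using comb_at_reps[OF IR r, of x] ij(3) by (auto simp: X_def split: if_splits)
      then show ?thesis using IS by (auto simp: supp_def)
    next
      case False
      then have r: "(bar n j, bar n i) \<in> reps" using D_bar[OF D] ij(1,2) by (auto simp: reps_def bar_def)
      have "X $$ (bar n j, bar n i) \<noteq> 0" using sp_entry[OF S_sp[OF XS] ij(1,2)] ij(3) by simp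
      then have "(bar n j, bar n i) \<in> ?I" using comb_at_reps[OF IR r, of x] by (auto simp: X_def split: if_splits)
      then show ?thesis using IS ij(1,2) by (auto simp: supp_def vtx_bar)
    qed
  qed
  have out: "bf n \<phi> X (unit_mat n k l) = 0" if kl: "(k, l) \<in> D" "(k, l) \<notin> supp K" for k l
  proof -
    have r: "k < 2*n" "l < 2*n" using D_range[OF kl(1)] by auto
    have "(\<Sum>i<2*n. \<phi> i l * X $$ (i, k)) = 0"
    proof (rule sum.neutral, rule ballI, rule ccontr)
      fix i assume "i \<in> {..<2*n}" and nz: "\<phi> i l * X $$ (i, k) \<noteq> 0"
      then have i: "i < 2*n" and nz': "\<phi> i l \<noteq> 0" "X $$ (i, k) \<noteq> 0" by auto
      have "(i, k) \<in> D" using S_entry[OF XS i r(1)] nz'(2) by blast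
      \<comment> \<open>The slice condition says nothing about coefficients outside
        \<open>D\<close>, so transitivity has to place (i, l) in \<open>D\<close> first.\<close>
      then have "(i, l) \<in> D" using kl(1) by (rule D_trans)
      then have "cascade i l \<or> i = l" using nz'(1) by (rule slice_cascade)
      then have "vtx n l \<in> K" using supp_closed[OF K i r(2)] Xsupp[OF i r(1) nz'(2)] by blast
      then show False using kl(2) Xsupp[OF i r(1) nz'(2)] by (simp add: supp_def)
    qed
    moreover have "(\<Sum>j<2*n. \<phi> k j * X $$ (l, j)) = 0"
    proof (rule sum.neutral, rule ballI, rule ccontr)
      fix j assume "j \<in> {..<2*n}" and nz: "\<phi> k j * X $$ (l, j) \<noteq> 0"
      then have j: "j < 2*n" and nz': "\<phi> k j \<noteq> 0" "X $$ (l, j) \<noteq> 0" by auto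
      have "(l, j) \<in> D" using S_entry[OF XS r(2) j] nz'(2) by blast
      then have "(k, j) \<in> D" using kl(1) D_trans by blast
      then have "cascade k j \<or> k = j" using nz'(1) by (rule slice_cascade)
      then have "vtx n k \<in> K" using supp_closed[OF K r(1) j] Xsupp[OF r(2) j nz'(2)] by blast
      then show False using kl(2) Xsupp[OF r(2) j nz'(2)] by (simp add: supp_def)
    qed
    ultimately show ?thesis unfolding bf_unit[OF Xc r] by simp
  qed
  have "X \<in> ker_form \<phi>"
  proof (rule ker_form_units[OF XS \<phi>])
    fix k l assume kl: "(k, l) \<in> D" "k + l < 2*n"
    have "(k, l) \<in> reps" using kl by (simp add: reps_def)
    then consider "(k, l) \<notin> supp K" | "(k, l) \<in> ?I" | "cyclic K" "k = base K" "l = base K"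
      unfolding odd_part_def by (cases "cyclic K") auto
    then show "bf n \<phi> X (skew_unit n k l) = 0"
    proof cases
      case 1
      then show ?thesis unfolding bf_skew_unit[OF S_sp[OF XS] \<phi>] using out[OF kl(1)] by simp
    next
      case 2
      then show ?thesis by (rule in_I)
    next
      case 3
      let ?Dg = "{(i, j). i = j \<and> i < n \<and> vtx n i \<in> K}"
      have fD: "finite ?Dg" using diag_reps finite_reps by (rule finite_subset)
      have bD: "(base K, base K) \<in> ?Dg" using base[OF K] by simp
      have "component_one K \<in> ker_form \<phi>" by (rule component_one_ker[OF cyclic_loop_free[OF K 3(1)]])
      then have "bf n \<phi> (component_one K) X = 0" using XS by (simp add: ker_form_def)
      moreover have "bf n \<phi> (component_one K) X = (\<Sum>\<alpha>\<in>?Dg. 1 * bf n \<phi> (basis_elt \<alpha>) X)"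
        unfolding component_one_def by (rule bf_linear_combination_left[OF comb_carrier Xc skew_unit_carrier comb_index])
      moreover have "(\<Sum>\<alpha>\<in>?Dg. 1 * bf n \<phi> (basis_elt \<alpha>) X) = (\<Sum>\<alpha>\<in>?Dg. if \<alpha> = (base K, base K) then bf n \<phi> (basis_elt (base K, base K)) X else 0)"
      proof (rule sum.cong[OF refl])
        fix \<alpha> assume a: "\<alpha> \<in> ?Dg"
        show "1 * bf n \<phi> (basis_elt \<alpha>) X = (if \<alpha> = (base K, base K) then bf n \<phi> (basis_elt (base K, base K)) X else 0)"
        proof (cases "\<alpha> = (base K, base K)")
          case False
          have "\<alpha> \<in> reps" using a diag_reps[of K] by (rule set_mp[rotated])
          then have "(fst \<alpha>, snd \<alpha>) \<in> ?I" using False a by (auto simp: odd_part_def supp_def)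
          from in_I[OF this] show ?thesis using False bf_skew[OF Xc skew_unit_carrier, of \<phi> "fst \<alpha>" "snd \<alpha>"] by simp
        qed simp
      qed
      ultimately have "bf n \<phi> (basis_elt (base K, base K)) X = 0" using fD bD by simp
      then show ?thesis using bf_skew[OF Xc skew_unit_carrier, of \<phi> k l] 3 by simp
    qed
  qed
  then show ?thesis using x unfolding X_def by blast
qed

text \<open>Vectors from different components have disjoint supports. Only a cycle contributes two
  vectors, and there the position (\<open>base K\<close>, \<open>base K\<close>) detects
  \<open>component_one K\<close> but not the vector from \<open>odd_part K\<close>.\<close>

lemma slice_independent:
  "\<exists>w. (\<forall>l\<in>loop_free <+> closed_up. w l \<in> ker_form \<phi>) \<and>
    (\<forall>c. (\<forall>i<2*n. \<forall>j<2*n. (\<Sum>l\<in>loop_free <+> closed_up. c l * w l $$ (i, j)) = 0) \<longrightarrow> (\<forall>l\<in>loop_free <+> closed_up. c l = 0))"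
proof -
  let ?J = "loop_free <+> closed_up"
  have "\<forall>K\<in>closed_up. \<exists>x. (\<exists>p\<in>odd_part K. x p \<noteq> 0) \<and> comb (odd_part K) x \<in> ker_form \<phi>"
    by (intro ballI odd_part_kernel)
  from bchoice[OF this] obtain x where x: "\<forall>K\<in>closed_up. (\<exists>p\<in>odd_part K. x K p \<noteq> 0) \<and> comb (odd_part K) (x K) \<in> ker_form \<phi>"
    by (rule exE)
  define w where "w l = (case l of Inl K \<Rightarrow> component_one K | Inr K \<Rightarrow> comb (odd_part K) (x K))" for l
  have fin: "finite ?J" using finite_\<K> by (simp add: loop_free_def closed_up_def)
  have LK: "K \<in> \<K>" if "K \<in> loop_free" for K using that by (simp add: loop_free_def)
  have CK: "K \<in> \<K>" if "K \<in> closed_up" for K using that by (simp add: closed_up_def)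
  have IR: "odd_part K \<subseteq> reps" for K by (auto simp: odd_part_def)
  have other: "w l $$ (i, j) = 0" if l: "l \<in> ?J" "l \<noteq> Inl K" "l \<noteq> Inr K" and K: "K \<in> \<K>" and ij: "(i, j) \<in> reps \<inter> supp K" for l i j K
  proof -
    have v: "vtx n i \<in> K" using ij by (simp add: supp_def)
    show ?thesis
    proof (cases l)
      case (Inl L)
      then have "vtx n i \<notin> L" using K_disjoint[OF K LK[of L]] v l by auto
      then show ?thesis using component_one_at_reps[of i j L] ij Inl by (simp add: w_def)
    next
      case (Inr L)
      then have "vtx n i \<notin> L" using K_disjoint[OF K CK[of L]] v l by auto
      then have "(i, j) \<notin> odd_part L" by (simp add: odd_part_def supp_def)
      then show ?thesis using comb_at_reps[OF IR, of "(i, j)" L "x L"] ij Inr by (simp add: w_def)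
    qed
  qed
  have "\<forall>l\<in>?J. w l \<in> ker_form \<phi>" using x component_one_ker by (auto simp: w_def)
  moreover have "\<forall>l\<in>?J. c l = 0" if c: "\<forall>i<2*n. \<forall>j<2*n. (\<Sum>l\<in>?J. c l * w l $$ (i, j)) = 0" for c
  proof -
    have at: "(\<Sum>l\<in>?J. c l * w l $$ (i, j)) = (\<Sum>l\<in>?J \<inter> {Inl K, Inr K}. c l * w l $$ (i, j))"
      if K: "K \<in> \<K>" and ij: "(i, j) \<in> reps \<inter> supp K" for i j K
      by (rule sum.mono_neutral_right[OF fin]) (use other[OF _ _ _ K ij] in auto)
    have z: "(\<Sum>l\<in>?J \<inter> {Inl K, Inr K}. c l * w l $$ (i, j)) = 0" if K: "K \<in> \<K>" and ij: "(i, j) \<in> reps \<inter> supp K" for i j K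
    proof -
      have "i < 2*n" "j < 2*n" using ij D_range[of i j] by (auto simp: reps_def)
      then show ?thesis using c at[OF K ij] by simp
    qed
    have inl: "c (Inl K) = 0" if KL: "K \<in> loop_free" for K
    proof -
      have K: "K \<in> \<K>" by (rule LK[OF KL])
      note ij = base_reps[OF K]
      have 1: "w (Inl K) $$ (base K, base K) = 1" using component_one_at_reps[of "base K" "base K" K] ij base(1)[OF K] by (simp add: w_def)
      have 2: "w (Inr K) $$ (base K, base K) = 0" if "K \<in> closed_up"
      proof -
        have "cyclic K" by (rule loop_free_closed_up[OF KL that])
        then have "(base K, base K) \<notin> odd_part K" by (simp add: odd_part_def)
        then show ?thesis using comb_at_reps[OF IR, of "(base K, base K)" K "x K"] ij by (simp add: w_def)
      qed
      show ?thesis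
      proof (cases "K \<in> closed_up")
        case True
        have "?J \<inter> {Inl K, Inr K} = {Inl K, Inr K}" using True KL by auto
        then show ?thesis using z[OF K ij] 1 2[OF True] by simp
      next
        case False
        have "?J \<inter> {Inl K, Inr K} = {Inl K}" using False KL by auto
        then show ?thesis using z[OF K ij] 1 by simp
      qed
    qed
    have inr: "c (Inr K) = 0" if KC: "K \<in> closed_up" for K
    proof -
      have K: "K \<in> \<K>" by (rule CK[OF KC])
      obtain i j where p: "(i, j) \<in> odd_part K" "x K (i, j) \<noteq> 0" using bspec[OF x KC] by (metis surj_pair)
      then have ij: "(i, j) \<in> reps \<inter> supp K" by (simp add: odd_part_def)
      have nz: "w (Inr K) $$ (i, j) \<noteq> 0" using comb_at_reps[OF IR, of "(i, j)" K "x K"] ij p by (simp add: w_def)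
      show ?thesis
      proof (cases "K \<in> loop_free")
        case True
        have "?J \<inter> {Inl K, Inr K} = {Inl K, Inr K}" using True KC by auto
        then show ?thesis using z[OF K ij] nz inl[OF True] by simp
      next
        case False
        have "?J \<inter> {Inl K, Inr K} = {Inr K}" using False KC by auto
        then show ?thesis using z[OF K ij] nz by simp
      qed
    qed
    show ?thesis using inl inr by auto
  qed
  ultimately have "(\<forall>l\<in>?J. w l \<in> ker_form \<phi>) \<and>
    (\<forall>c. (\<forall>i<2*n. \<forall>j<2*n. (\<Sum>l\<in>?J. c l * w l $$ (i, j)) = 0) \<longrightarrow> (\<forall>l\<in>?J. c l = 0))" by blast
  then show ?thesis by (rule exI[where x = w])
qed

end

lemma index_S: "index_in_sp n (S :: 'k::field_char_0 mat set) = card loop_free + card closed_up"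
proof -
  have fin: "finite loop_free" "finite closed_up" using finite_\<K> by (auto simp: loop_free_def closed_up_def)
  obtain s :: 'k where s: "s \<noteq> 0" "units_nondegenerate (phi0 s)" using phi0_nondegenerate_units by blast
  let ?dim = "\<lambda>\<phi>. vectorspace.dim class_ring ((module_mat TYPE('k) (2*n) (2*n))\<lparr>carrier := ker_form \<phi>\<rparr>)"
  have lower: "card loop_free + card closed_up \<le> ?dim \<phi>1" if "skew_coeffs n \<phi>1" for \<phi>1 :: "nat \<Rightarrow> nat \<Rightarrow> 'k"
    unfolding card_Plus[OF fin, symmetric]
  proof (rule slice_dim_bound[where V = V and ?\<phi>0.0 = "phi0 s"])
    show "V \<subseteq> D" by (rule V_D)
    show "i \<noteq> j" if "(i, j) \<in> V" for i j using that by (simp add: V_def)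
    show "(bar n j, bar n i) \<in> V" if "(i, j) \<in> V" for i j using that by (rule V_bar)
    show "skew_coeffs n (phi0 s)" by (rule phi0_skew)
    show "phi0 s i j = 0" if "(i, j) \<in> V" for i j using that by (simp add: V_def phi0_def cas_sgn_def)
    show "trivial_kernel (V \<inter> reps) (\<lambda>\<beta> \<alpha>. bf n (phi0 s) (basis_elt \<alpha>) (basis_elt \<beta>))"
      by (rule basis_nondegenerate[OF s(2) phi0_skew])
    show "finite (loop_free <+> closed_up)" using fin by simp
    show "skew_coeffs n \<phi>1" by fact
  qed (rule slice_independent)
  have upper: "?dim (phi0 s) \<le> card loop_free + card closed_up" by (rule dim_upper_bound[OF s])
  show ?thesis unfolding index_in_sp_S
  proof (rule antisym)
    show "(INF \<phi>\<in>{\<phi> :: nat \<Rightarrow> nat \<Rightarrow> 'k. skew_coeffs n \<phi>}. ?dim \<phi>) \<le> card loop_free + card closed_up"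
      by (rule order_trans[OF _ upper], rule cINF_lower) (use phi0_skew in auto)
    show "card loop_free + card closed_up \<le> (INF \<phi>\<in>{\<phi> :: nat \<Rightarrow> nat \<Rightarrow> 'k. skew_coeffs n \<phi>}. ?dim \<phi>)"
      by (rule cINF_greatest) (use phi0_skew lower in auto)
  qed
qed

end

section \<open>Orbits of a product of two involutions\<close>

locale involution_pair =
  fixes V :: "nat set" and t b :: "nat \<Rightarrow> nat"
  assumes finite_verts: "finite V" and t_inv: "t (t v) = v" and b_inv: "b (b v) = v"
    and t_out: "v \<notin> V \<Longrightarrow> t v = v" and b_out: "v \<notin> V \<Longrightarrow> b v = v"
begin

definition \<sigma> :: "nat \<Rightarrow> nat" where
  "\<sigma> v = t (b v)"

definition component :: "nat set \<Rightarrow> bool" where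
  "component K \<longleftrightarrow> K \<subseteq> V \<and> K \<noteq> {} \<and> (\<forall>v\<in>K. t v \<in> K \<and> b v \<in> K) \<and>
    (\<forall>Z. Z \<subseteq> K \<longrightarrow> Z \<noteq> {} \<longrightarrow> (\<forall>v\<in>Z. t v \<in> Z \<and> b v \<in> Z) \<longrightarrow> Z = K)"

definition fixpoint_free :: "nat set \<Rightarrow> bool" where
  "fixpoint_free K \<longleftrightarrow> (\<forall>v\<in>K. t v \<noteq> v \<and> b v \<noteq> v)"

lemma componentD:
  assumes "component K"
  shows "K \<subseteq> V" "K \<noteq> {}" "v \<in> K \<Longrightarrow> t v \<in> K" "v \<in> K \<Longrightarrow> b v \<in> K" "finite K"
    "Z \<subseteq> K \<Longrightarrow> Z \<noteq> {} \<Longrightarrow> (\<And>v. v \<in> Z \<Longrightarrow> t v \<in> Z \<and> b v \<in> Z) \<Longrightarrow> Z = K"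
proof -
  show "K \<subseteq> V" "K \<noteq> {}" "v \<in> K \<Longrightarrow> t v \<in> K" "v \<in> K \<Longrightarrow> b v \<in> K" using assms by (auto simp: component_def)
  then show "finite K" using finite_verts finite_subset by blast
  show "Z \<subseteq> K \<Longrightarrow> Z \<noteq> {} \<Longrightarrow> (\<And>v. v \<in> Z \<Longrightarrow> t v \<in> Z \<and> b v \<in> Z) \<Longrightarrow> Z = K"
    using assms unfolding component_def by blast
qed

lemma t_inj: "t x = t y \<Longrightarrow> x = y"
  by (metis t_inv)

lemma b_inj: "b x = b y \<Longrightarrow> x = y"
  by (metis b_inv)

lemma inj_\<sigma>: "inj \<sigma>"
  by (rule injI) (auto simp: \<sigma>_def dest: t_inj b_inj)

lemma permutation_\<sigma>: "permutation \<sigma>"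
proof -
  have "surj \<sigma>" by (rule surjI[where f = "\<lambda>x. b (t x)"]) (simp add: \<sigma>_def t_inv b_inv)
  moreover have "{x. \<sigma> x \<noteq> x} \<subseteq> V" using t_out b_out by (force simp: \<sigma>_def)
  then have "finite {x. \<sigma> x \<noteq> x}" using finite_verts by (rule finite_subset)
  ultimately show ?thesis using inj_\<sigma> by (simp add: permutation bij_def)
qed

lemmas self_orbit = permutation_self_in_orbit[OF permutation_\<sigma>]

lemma orbit_eq: "y \<in> orbit \<sigma> x \<Longrightarrow> orbit \<sigma> y = orbit \<sigma> x"
  using cyclic_on_singleI[OF self_orbit refl, of x] unfolding cyclic_on_alldef by blast

lemma orbit_powers: "orbit \<sigma> x = {(\<sigma> ^^ m) x | m. True}"
  by (rule orbit_altdef_permutation[OF permutation_\<sigma>])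

lemma pow_orbit: "(\<sigma> ^^ m) x \<in> orbit \<sigma> x"
  unfolding orbit_powers by blast

lemma \<sigma>_pow_inj: "(\<sigma> ^^ m) x = (\<sigma> ^^ m) y \<Longrightarrow> x = y"
  using inj_fn[OF inj_\<sigma>, of m] by (auto dest: injD)

text \<open>Conjugation by \<open>t\<close> inverts \<sigma>; this form expresses it without inverse
  powers.\<close>

lemma conj_pow: "(\<sigma> ^^ m) (t ((\<sigma> ^^ m) x)) = t x"
proof (induction m)
  case (Suc m)
  have "\<sigma> (t (\<sigma> y)) = t y" for y by (simp add: \<sigma>_def t_inv b_inv)
  then have "(\<sigma> ^^ m) (\<sigma> (t (\<sigma> ((\<sigma> ^^ m) x)))) = t x" using Suc by simp
  then show ?case by (simp add: funpow_swap1)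
qed simp

lemma t_orbit: "y \<in> orbit \<sigma> x \<Longrightarrow> t y \<in> orbit \<sigma> (t x)"
proof -
  assume "y \<in> orbit \<sigma> x"
  then obtain m where "y = (\<sigma> ^^ m) x" unfolding orbit_powers by blast
  then have "(\<sigma> ^^ m) (t y) = t x" using conj_pow by simp
  then have "t x \<in> orbit \<sigma> (t y)" using pow_orbit[of m "t y"] by simp
  then show ?thesis using orbit_eq self_orbit by blast
qed

text \<open>\<open>b y\<close> is \<open>t\<close> applied to \<sigma> y, which lies in the orbit of
  y.\<close>

lemma b_orbit: "y \<in> orbit \<sigma> x \<Longrightarrow> b y \<in> orbit \<sigma> (t x)"
proof -
  assume "y \<in> orbit \<sigma> x"
  then have "\<sigma> y \<in> orbit \<sigma> x" by (rule orbit.step)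
  from t_orbit[OF this] show ?thesis by (simp add: \<sigma>_def t_inv)
qed

text \<open>Both involutions exchange the orbits of x and \<open>t x\<close>, so the union is closed
  and minimality of the component applies.\<close>

lemma component_orbits:
  assumes K: "component K" "x \<in> K"
  shows "K = orbit \<sigma> x \<union> orbit \<sigma> (t x)"
proof -
  have sub: "orbit \<sigma> y \<subseteq> K" if "y \<in> K" for y
  proof
    fix z assume "z \<in> orbit \<sigma> y"
    then show "z \<in> K" using componentD(3,4)[OF K(1)] that by induction (auto simp: \<sigma>_def)
  qed
  have "orbit \<sigma> x \<union> orbit \<sigma> (t x) = K"
  proof (rule componentD(6)[OF K(1)])
    show "orbit \<sigma> x \<union> orbit \<sigma> (t x) \<subseteq> K" using sub K componentD(3)[OF K] by simp
    show "orbit \<sigma> x \<union> orbit \<sigma> (t x) \<noteq> {}" using self_orbit by blast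
    show "t v \<in> orbit \<sigma> x \<union> orbit \<sigma> (t x) \<and> b v \<in> orbit \<sigma> x \<union> orbit \<sigma> (t x)"
      if "v \<in> orbit \<sigma> x \<union> orbit \<sigma> (t x)" for v
      using that t_orbit[of v x] t_orbit[of v "t x"] b_orbit[of v x] b_orbit[of v "t x"] by (auto simp: t_inv)
  qed
  then show ?thesis by simp
qed

text \<open>At a vertex z fixed by one of the involutions, \<open>t z\<close> is z or \<sigma> z, so
  the two orbits making up the component coincide.\<close>

lemma component_one_orbit:
  assumes K: "component K" "\<not> fixpoint_free K" "x \<in> K"
  shows "orbit \<sigma> x = K"
proof -
  obtain z where z: "z \<in> K" "t z = z \<or> b z = z" using K(2) by (auto simp: fixpoint_free_def)
  have "t z \<in> orbit \<sigma> z"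
    using z(2)
  proof
    assume "b z = z"
    then have "t z = \<sigma> z" by (simp add: \<sigma>_def)
    then show ?thesis using orbit.step[OF self_orbit] by simp
  qed (simp add: self_orbit)
  then have "K = orbit \<sigma> z" using component_orbits[OF K(1) z(1)] orbit_eq by blast
  then show ?thesis using orbit_eq K(3) by blast
qed

text \<open>If \<sigma> led from x to \<open>t x\<close> in m steps, the midpoint of that walk would
  be a fixed vertex: fixed by \<open>t\<close> for even m, by \<open>b\<close> for odd m.\<close>

lemma component_two_orbits:
  assumes K: "component K" "fixpoint_free K" "x \<in> K"
  shows "t x \<notin> orbit \<sigma> x"
proof
  assume "t x \<in> orbit \<sigma> x"
  then obtain m where m: "t x = (\<sigma> ^^ m) x" unfolding orbit_powers by blast
  have yK: "(\<sigma> ^^ k) x \<in> K" for k using component_orbits[OF K(1,3)] pow_orbit by blast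
  obtain k where "m = k + k \<or> m = k + Suc k" by (metis add_Suc_right evenE mult_2 oddE Suc_eq_plus1)
  then show False
  proof
    assume e: "m = k + k"
    have "(\<sigma> ^^ k) (t ((\<sigma> ^^ k) x)) = (\<sigma> ^^ k) ((\<sigma> ^^ k) x)"
      unfolding conj_pow m e by (simp add: funpow_add)
    then have "t ((\<sigma> ^^ k) x) = (\<sigma> ^^ k) x" by (rule \<sigma>_pow_inj)
    then show False using K(2) yK by (auto simp: fixpoint_free_def)
  next
    assume e: "m = k + Suc k"
    have "(\<sigma> ^^ k) (t ((\<sigma> ^^ k) x)) = (\<sigma> ^^ k) (\<sigma> ((\<sigma> ^^ k) x))"
      unfolding conj_pow m e funpow_add by simp
    then have "t ((\<sigma> ^^ k) x) = \<sigma> ((\<sigma> ^^ k) x)" by (rule \<sigma>_pow_inj)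
    then have "t ((\<sigma> ^^ k) x) = t (b ((\<sigma> ^^ k) x))" by (simp only: \<sigma>_def)
    then have "(\<sigma> ^^ k) x = b ((\<sigma> ^^ k) x)" by (rule t_inj)
    then show False using K(2) yK unfolding fixpoint_free_def by metis
  qed
qed

text \<open>The range up to twice the period is chosen to cover the exponents j + j and j +
  \<open>Suc j\<close> with j < N that arise when fixed vertices are located.\<close>

lemma period:
  obtains N where "0 < N" "(\<sigma> ^^ N) x = x" "orbit \<sigma> x = {(\<sigma> ^^ m) x | m. m < N}"
    "\<And>k. k < 2 * N \<Longrightarrow> (\<sigma> ^^ k) x = x \<Longrightarrow> k = 0 \<or> k = N"
proof -
  have "\<exists>k>0. (\<sigma> ^^ k) x = x" using self_orbit[of x] unfolding orbit_altdef by fastforce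
  then obtain N where N: "0 < N" "(\<sigma> ^^ N) x = x" and least: "\<And>k. k < N \<Longrightarrow> \<not> (0 < k \<and> (\<sigma> ^^ k) x = x)"
    using exists_least_iff[of "\<lambda>k. 0 < k \<and> (\<sigma> ^^ k) x = x"] by blast
  have "k = 0 \<or> k = N" if k: "k < 2 * N" "(\<sigma> ^^ k) x = x" for k
  proof (cases "k < N")
    case False
    have "(\<sigma> ^^ (k - N + N)) x = x" using False k by simp
    then have "(\<sigma> ^^ (k - N)) x = x" unfolding funpow_add by (simp add: N)
    moreover have "k - N < N" using k(1) False by linarith
    ultimately have "k - N = 0" using least[of "k - N"] by auto
    then show ?thesis using False by simp
  next
    case True
    have "\<not> (0 < k \<and> (\<sigma> ^^ k) x = x)" by (rule least[OF True])
    then show ?thesis using k(2) by simp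
  qed
  then show thesis using that[OF N orbit_altdef_bounded[OF N(2,1)]] by blast
qed

text \<open>Number the orbit from the fixed vertex x. Then \<open>t\<close> acts as j \<mapsto> -j
  and \<open>b\<close> as j \<mapsto> -j - 1 modulo N, so fixed vertices solve 2j = 0 or 2j + 1 = 0.
  Besides j = 0 there is at most one solution, and the parity of N decides its colour.\<close>

lemma card_fixed_le:
  assumes K: "component K" "x \<in> K" "t x = x"
  shows "card {v \<in> K. t v = v} + card {v \<in> K. b v = v} \<le> 2"
proof -
  obtain N where N: "0 < N" "(\<sigma> ^^ N) x = x" "orbit \<sigma> x = {(\<sigma> ^^ m) x | m. m < N}"
    "\<And>k. k < 2 * N \<Longrightarrow> (\<sigma> ^^ k) x = x \<Longrightarrow> k = 0 \<or> k = N" using period[of x] by blast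
  have "\<not> fixpoint_free K" using K by (auto simp: fixpoint_free_def)
  then have KO: "K = {(\<sigma> ^^ m) x | m. m < N}" using component_one_orbit[OF K(1) _ K(2)] N(3) by simp
  have T: "\<exists>j. y = (\<sigma> ^^ j) x \<and> (j = 0 \<or> j + j = N)" if y: "y \<in> K" "t y = y" for y
  proof -
    obtain j where j: "y = (\<sigma> ^^ j) x" "j < N" using y(1) KO by blast
    have "(\<sigma> ^^ j) (t y) = x" unfolding j(1) conj_pow by (rule K(3))
    then have "(\<sigma> ^^ (j + j)) x = x" unfolding funpow_add using y(2) j(1) by simp
    then have "j + j = 0 \<or> j + j = N" using N(4)[of "j + j"] j(2) by simp
    then show ?thesis using j(1) by auto
  qed
  have B: "\<exists>j. y = (\<sigma> ^^ j) x \<and> j + Suc j = N" if y: "y \<in> K" "b y = y" for y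
  proof -
    obtain j where j: "y = (\<sigma> ^^ j) x" "j < N" using y(1) KO by blast
    have "t y = \<sigma> y" by (simp add: \<sigma>_def y(2))
    moreover have "(\<sigma> ^^ j) (t y) = x" unfolding j(1) conj_pow by (rule K(3))
    ultimately have "(\<sigma> ^^ (j + Suc j)) x = x" unfolding funpow_add using j(1) by simp
    then have "j + Suc j = 0 \<or> j + Suc j = N" using N(4)[of "j + Suc j"] j(2) by simp
    then show ?thesis using j(1) by auto
  qed
  let ?y = "(\<sigma> ^^ (N div 2)) x"
  show ?thesis
  proof (cases "even N")
    case True
    have "{v \<in> K. b v = v} = {}"
    proof (rule equals0I)
      fix y assume "y \<in> {v \<in> K. b v = v}"
      then obtain j where "j + Suc j = N" using B by blast
      then show False using True by presburger
    qed
    then have "card {v \<in> K. b v = v} = 0" by (simp only: card.empty)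
    moreover have "{v \<in> K. t v = v} \<subseteq> {x, ?y}"
    proof
      fix y assume "y \<in> {v \<in> K. t v = v}"
      then obtain j where "y = (\<sigma> ^^ j) x" "j = 0 \<or> j + j = N" using T by blast
      then show "y \<in> {x, ?y}" by auto
    qed
    then have "card {v \<in> K. t v = v} \<le> card {x, ?y}" by (rule card_mono[rotated]) simp
    moreover have "card {x, ?y} \<le> 2" by (simp add: card_insert_if)
    ultimately show ?thesis by simp
  next
    case False
    have "{v \<in> K. t v = v} \<subseteq> {x}"
    proof
      fix y assume "y \<in> {v \<in> K. t v = v}"
      then obtain j where "y = (\<sigma> ^^ j) x" "j = 0 \<or> j + j = N" using T by blast
      moreover have "j + j \<noteq> N" using False by presburger
      ultimately show "y \<in> {x}" by auto
    qed
    then have "card {v \<in> K. t v = v} \<le> card {x}" by (rule card_mono[rotated]) simp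
    moreover have "{v \<in> K. b v = v} \<subseteq> {?y}"
    proof
      fix y assume "y \<in> {v \<in> K. b v = v}"
      then obtain j where j: "y = (\<sigma> ^^ j) x" "j + Suc j = N" using B by blast
      then have "N div 2 = j" by presburger
      then show "y \<in> {?y}" using j by simp
    qed
    then have "card {v \<in> K. b v = v} \<le> card {?y}" by (rule card_mono[rotated]) simp
    ultimately show ?thesis by simp
  qed
qed

text \<open>Each of the two counts has the parity of \<open>card K\<close>, so the sum is even. The
  bound 2 comes from \<open>card_fixed_le\<close>, applied with the involutions exchanged if the
  known fixed vertex belongs to \<open>b\<close>.\<close>

lemma card_fixed:
  assumes K: "component K"
  shows "card {v \<in> K. t v = v} + card {v \<in> K. b v = v} \<in> {0, 2}"
proof -
  interpret sw: involution_pair V b t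
  proof unfold_locales
    show "finite V" by (rule finite_verts)
    show "b (b v) = v" for v by (rule b_inv)
    show "t (t v) = v" for v by (rule t_inv)
    show "b v = v" if "v \<notin> V" for v by (rule b_out[OF that])
    show "t v = v" if "v \<notin> V" for v by (rule t_out[OF that])
  qed
  have swK: "sw.component K" using K unfolding component_def sw.component_def by blast
  note fin = componentD(5)[OF K]
  have "card K = 2 * card {v \<in> K. t v < v} + card {v \<in> K. t v = v}"
    by (rule card_involution_moved[OF fin]) (use componentD(3)[OF K] t_inv in blast)
  moreover have "card K = 2 * card {v \<in> K. b v < v} + card {v \<in> K. b v = v}"
    by (rule card_involution_moved[OF fin]) (use componentD(4)[OF K] b_inv in blast)
  ultimately have ev: "even (card {v \<in> K. t v = v} + card {v \<in> K. b v = v})" by presburger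
  have le: "card {v \<in> K. t v = v} + card {v \<in> K. b v = v} \<le> 2"
  proof (cases "fixpoint_free K")
    case True
    then have "{v \<in> K. t v = v} = {}" "{v \<in> K. b v = v} = {}" by (auto simp: fixpoint_free_def)
    then have "card {v \<in> K. t v = v} = 0" "card {v \<in> K. b v = v} = 0" by (simp_all only: card.empty)
    then show ?thesis by simp
  next
    case False
    then obtain x where "x \<in> K" "t x = x \<or> b x = x" by (auto simp: fixpoint_free_def)
    then show ?thesis using card_fixed_le[OF K, of x] sw.card_fixed_le[OF swK, of x] by (auto simp: add.commute)
  qed
  have "x \<in> {0, 2}" if "even x" "x \<le> 2" for x :: nat
  proof -
    have "x = 0 \<or> x = 2" using that by presburger
    then show ?thesis by simp
  qed
  from this[OF ev le] show ?thesis .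
qed

text \<open>A component with a fixed vertex is a single orbit. A fixpoint-free component splits into
  two orbits and contains no vertex of \<open>T\<close>, so both orbits are counted; one matches the
  component in the second summand, the other supplies the first summand.\<close>

lemma card_orbits:
  assumes KV: "\<Union>\<K> = V" and disj: "\<And>K L. K \<in> \<K> \<Longrightarrow> L \<in> \<K> \<Longrightarrow> K \<inter> L \<noteq> {} \<Longrightarrow> K = L"
    and comp: "\<And>K. K \<in> \<K> \<Longrightarrow> component K" and T: "\<And>v. v \<in> T \<Longrightarrow> t v = v \<or> b v = v"
  shows "card {Z \<in> orbit \<sigma> ` V. card (Z \<inter> T) \<in> {0, 2}} =
    card {K \<in> \<K>. fixpoint_free K} + card {K \<in> \<K>. card (K \<inter> T) \<in> {0, 2}}"
proof -
  define rep where "rep K = (SOME v. v \<in> K)" for K :: "nat set"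
  have rep: "rep K \<in> K" if "K \<in> \<K>" for K
    unfolding rep_def using componentD(2)[OF comp[OF that]] by (simp add: some_in_eq)
  have "\<K> \<subseteq> Pow V" using KV by blast
  then have fin: "finite \<K>" by (rule finite_subset) (simp add: finite_verts)
  define C where "C = {K \<in> \<K>. fixpoint_free K}"
  define P where "P = {K \<in> \<K>. \<not> fixpoint_free K \<and> card (K \<inter> T) \<in> {0, 2}}"
  have CK: "K \<in> \<K>" "fixpoint_free K" if "K \<in> C" for K using that by (auto simp: C_def)
  have CT: "K \<inter> T = {}" if "K \<in> C" for K using CK(2)[OF that] T by (auto simp: fixpoint_free_def)
  let ?A = "(\<lambda>K. orbit \<sigma> (rep K)) ` C" and ?B = "(\<lambda>K. orbit \<sigma> (t (rep K))) ` C"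
  have Csub: "orbit \<sigma> (rep K) \<subseteq> K" "orbit \<sigma> (t (rep K)) \<subseteq> K" "K = orbit \<sigma> (rep K) \<union> orbit \<sigma> (t (rep K))"
    if "K \<in> \<K>" for K using component_orbits[OF comp[OF that] rep[OF that]] by auto
  have tw: "K = L" if "K \<in> \<K>" "L \<in> \<K>" "z \<in> K" "z \<in> L" for K L z using disj[OF that(1,2)] that by blast
  have eq: "{Z \<in> orbit \<sigma> ` V. card (Z \<inter> T) \<in> {0, 2}} = P \<union> (?A \<union> ?B)"
  proof (rule equalityI; rule subsetI)
    fix Z assume "Z \<in> {Z \<in> orbit \<sigma> ` V. card (Z \<inter> T) \<in> {0, 2}}"
    then obtain x where x: "x \<in> V" "Z = orbit \<sigma> x" and c: "card (Z \<inter> T) \<in> {0, 2}" by blast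
    obtain K where K: "K \<in> \<K>" "x \<in> K" using x(1) KV by blast
    show "Z \<in> P \<union> (?A \<union> ?B)"
    proof (cases "fixpoint_free K")
      case True
      then have KC: "K \<in> C" using K by (simp add: C_def)
      have "x \<in> orbit \<sigma> (rep K) \<or> x \<in> orbit \<sigma> (t (rep K))" using Csub(3)[OF K(1)] K(2) by blast
      then have "Z = orbit \<sigma> (rep K) \<or> Z = orbit \<sigma> (t (rep K))" using orbit_eq x(2) by blast
      then show ?thesis using KC by blast
    next
      case False
      then have "Z = K" using component_one_orbit[OF comp[OF K(1)] _ K(2)] x(2) by simp
      then show ?thesis using False c K(1) by (simp add: P_def)
    qed
  next
    fix Z assume "Z \<in> P \<union> (?A \<union> ?B)"
    then consider "Z \<in> P" | K where "K \<in> C" "Z = orbit \<sigma> (rep K)" | K where "K \<in> C" "Z = orbit \<sigma> (t (rep K))" by blast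
    then show "Z \<in> {Z \<in> orbit \<sigma> ` V. card (Z \<inter> T) \<in> {0, 2}}"
    proof cases
      case 1
      then have Z: "Z \<in> \<K>" "\<not> fixpoint_free Z" "card (Z \<inter> T) \<in> {0, 2}" by (auto simp: P_def)
      have "Z = orbit \<sigma> (rep Z)" using component_one_orbit[OF comp[OF Z(1)] Z(2) rep[OF Z(1)]] by simp
      moreover have "rep Z \<in> V" using rep[OF Z(1)] Z(1) KV by blast
      ultimately show ?thesis using Z(3) by blast
    next
      case (2 K)
      have "Z \<inter> T = {}" using CT[OF 2(1)] Csub(1)[OF CK(1)[OF 2(1)]] 2(2) by blast
      moreover have "rep K \<in> V" using rep[OF CK(1)[OF 2(1)]] CK(1)[OF 2(1)] KV by blast
      ultimately show ?thesis using 2(2) by simp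
    next
      case (3 K)
      have "Z \<inter> T = {}" using CT[OF 3(1)] Csub(2)[OF CK(1)[OF 3(1)]] 3(2) by blast
      moreover have "t (rep K) \<in> V"
        using componentD(1)[OF comp[OF CK(1)[OF 3(1)]]] componentD(3)[OF comp[OF CK(1)[OF 3(1)]] rep[OF CK(1)[OF 3(1)]]] by blast
      ultimately show ?thesis using 3(2) by simp
    qed
  qed
  have fC: "finite C" "finite P" using fin by (auto simp: C_def P_def)
  have iA: "inj_on (\<lambda>K. orbit \<sigma> (rep K)) C"
  proof (rule inj_onI)
    fix K L assume KL: "K \<in> C" "L \<in> C" "orbit \<sigma> (rep K) = orbit \<sigma> (rep L)"
    show "K = L" by (rule tw[OF CK(1)[OF KL(1)] CK(1)[OF KL(2)] rep[OF CK(1)[OF KL(1)]]])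
      (use KL(3) self_orbit[of "rep K"] Csub(1)[OF CK(1)[OF KL(2)]] in blast)
  qed
  have iB: "inj_on (\<lambda>K. orbit \<sigma> (t (rep K))) C"
  proof (rule inj_onI)
    fix K L assume KL: "K \<in> C" "L \<in> C" "orbit \<sigma> (t (rep K)) = orbit \<sigma> (t (rep L))"
    have "t (rep K) \<in> K" "t (rep K) \<in> L"
      using KL(3) self_orbit[of "t (rep K)"] Csub(2)[OF CK(1)[OF KL(2)]] Csub(2)[OF CK(1)[OF KL(1)]] by blast+
    then show "K = L" by (rule tw[OF CK(1)[OF KL(1)] CK(1)[OF KL(2)]])
  qed
  have AB: "?A \<inter> ?B = {}"
  proof (rule equals0I)
    fix Z assume "Z \<in> ?A \<inter> ?B"
    then obtain K L where KL: "K \<in> C" "L \<in> C" "Z = orbit \<sigma> (rep K)" "Z = orbit \<sigma> (t (rep L))" by blast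
    have "rep K \<in> L" using KL(3,4) self_orbit[of "rep K"] Csub(2)[OF CK(1)[OF KL(2)]] by blast
    then have "K = L" by (rule tw[OF CK(1)[OF KL(1)] CK(1)[OF KL(2)] rep[OF CK(1)[OF KL(1)]]])
    then have "t (rep K) \<in> orbit \<sigma> (rep K)" using KL(3,4) self_orbit[of "t (rep K)"] by simp
    then show False using component_two_orbits[OF comp[OF CK(1)[OF KL(1)]] CK(2)[OF KL(1)] rep[OF CK(1)[OF KL(1)]]] by blast
  qed
  have PAB: "P \<inter> (?A \<union> ?B) = {}"
  proof (rule equals0I)
    fix Z assume z: "Z \<in> P \<inter> (?A \<union> ?B)"
    have ZK: "Z \<in> \<K>" "\<not> fixpoint_free Z" using IntD1[OF z] by (simp_all add: P_def)
    have "\<exists>K\<in>C. Z = orbit \<sigma> (rep K) \<or> Z = orbit \<sigma> (t (rep K))"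
      using IntD2[OF z]
    proof
      assume "Z \<in> ?A"
      then obtain K where "Z = orbit \<sigma> (rep K)" "K \<in> C" by (rule imageE)
      then show ?thesis by (intro bexI[where x = K] disjI1)
    next
      assume "Z \<in> ?B"
      then obtain K where "Z = orbit \<sigma> (t (rep K))" "K \<in> C" by (rule imageE)
      then show ?thesis by (intro bexI[where x = K] disjI2)
    qed
    then obtain K where K: "K \<in> C" "Z = orbit \<sigma> (rep K) \<or> Z = orbit \<sigma> (t (rep K))" by (rule bexE)
    have "Z \<subseteq> K" using K(2)
    proof
      assume "Z = orbit \<sigma> (rep K)"
      then show ?thesis using Csub(1)[OF CK(1)[OF K(1)]] by simp
    next
      assume "Z = orbit \<sigma> (t (rep K))"
      then show ?thesis using Csub(2)[OF CK(1)[OF K(1)]] by simp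
    qed
    then have "rep Z \<in> K" using rep[OF ZK(1)] by (rule subsetD)
    then have "Z = K" by (rule tw[OF ZK(1) CK(1)[OF K(1)] rep[OF ZK(1)]])
    then show False using ZK(2) CK(2)[OF K(1)] by blast
  qed
  have "card (P \<union> (?A \<union> ?B)) = card P + (card ?A + card ?B)"
    using card_Un_disjoint[OF _ _ PAB] card_Un_disjoint[OF _ _ AB] fC by simp
  also have "\<dots> = card P + (card C + card C)" by (simp add: card_image[OF iA] card_image[OF iB])
  also have "\<dots> = card C + card (P \<union> C)"
  proof -
    have "P \<inter> C = {}" by (auto simp: P_def C_def)
    from card_Un_disjoint[OF fC(2,1) this] show ?thesis by simp
  qed
  also have "P \<union> C = {K \<in> \<K>. card (K \<inter> T) \<in> {0, 2}}"
    using CT by (auto simp: P_def C_def)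
  finally show ?thesis unfolding eq C_def .
qed

section \<open>The graph of the two involutions, its components and its cycles\<close>

definition pair_graph :: "(nat, edge_color) colored_multigraph" where
  "pair_graph = \<lparr>cverts = V, cedges = {(Top, {v, t v}) | v. t v \<noteq> v} \<union> {(Bottom, {v, b v}) | v. b v \<noteq> v}\<rparr>"

lemma adjacent_iff: "(\<exists>c. (c, {x, y}) \<in> cedges pair_graph) \<longleftrightarrow> x \<noteq> y \<and> (y = t x \<or> y = b x)"
proof
  assume "\<exists>c. (c, {x, y}) \<in> cedges pair_graph"
  then obtain v where v: "({x, y} = {v, t v} \<and> t v \<noteq> v) \<or> ({x, y} = {v, b v} \<and> b v \<noteq> v)"
    by (auto simp: pair_graph_def)
  then show "x \<noteq> y \<and> (y = t x \<or> y = b x)" using t_inv b_inv by (auto simp: doubleton_eq_iff)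
next
  assume "x \<noteq> y \<and> (y = t x \<or> y = b x)"
  then have "(Top, {x, y}) \<in> cedges pair_graph \<or> (Bottom, {x, y}) \<in> cedges pair_graph"
    unfolding pair_graph_def by auto
  then show "\<exists>c. (c, {x, y}) \<in> cedges pair_graph" by blast
qed

lemma components_pair_graph:
  shows "\<Union>(components pair_graph) = V"
    and "K \<in> components pair_graph \<Longrightarrow> L \<in> components pair_graph \<Longrightarrow> K \<inter> L \<noteq> {} \<Longrightarrow> K = L"
    and "K \<in> components pair_graph \<Longrightarrow> component K"
proof -
  define E where "E = {(x, y). \<exists>c. (c, {x, y}) \<in> cedges pair_graph}"
  define r where "r = {(u, v) \<in> V \<times> V. (u, v) \<in> E\<^sup>*}"
  have comps: "components pair_graph = V // r"
    by (simp add: components_def r_def E_def) (simp add: pair_graph_def)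
  have E: "(x, y) \<in> E \<longleftrightarrow> x \<noteq> y \<and> (y = t x \<or> y = b x)" for x y unfolding E_def using adjacent_iff by simp
  have "sym E" by (rule symI) (use E t_inv b_inv in auto)
  then have sE: "sym (E\<^sup>*)" by (rule sym_rtrancl)
  have eq: "equiv V r"
  proof (rule equivI)
    show "refl_on V r" by (auto simp: refl_on_def r_def)
    show "sym r" using sE by (auto simp: sym_def r_def)
    show "trans r" by (auto simp: trans_def r_def)
    show "r \<subseteq> V \<times> V" by (auto simp: r_def)
  qed
  show "\<Union>(components pair_graph) = V" unfolding comps by (rule Union_quotient[OF eq])
  show "K = L" if KL: "K \<in> components pair_graph" "L \<in> components pair_graph" "K \<inter> L \<noteq> {}"
  proof -
    have "K = L \<or> K \<inter> L = {}" by (rule quotient_disj[OF eq]) (use KL(1,2) comps in simp_all)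
    then show ?thesis using KL(3) by simp
  qed
  have cl: "(v, t v) \<in> E\<^sup>*" "(v, b v) \<in> E\<^sup>*" for v
    using E[of v "t v"] E[of v "b v"] by (metis r_into_rtrancl rtrancl.rtrancl_refl)+
  have tbV: "t v \<in> V" "b v \<in> V" if "v \<in> V" for v using that t_out[of "t v"] b_out[of "b v"] t_inv b_inv by metis+
  assume "K \<in> components pair_graph"
  then obtain x where x: "x \<in> V" "K = r `` {x}" unfolding comps by (rule quotientE)
  have K: "y \<in> K \<longleftrightarrow> y \<in> V \<and> (x, y) \<in> E\<^sup>*" for y using x by (auto simp: r_def)
  show "component K" unfolding component_def
  proof (intro conjI ballI allI impI)
    show "K \<subseteq> V" using K by blast
    show "K \<noteq> {}" using K[of x] x(1) by auto
    show "t v \<in> K" "b v \<in> K" if "v \<in> K" for v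
      using that K tbV cl[of v] rtrancl_trans[of x v E] by blast+
    fix Z assume Z: "Z \<subseteq> K" "Z \<noteq> {}" "\<forall>v\<in>Z. t v \<in> Z \<and> b v \<in> Z"
    then obtain z where z: "z \<in> Z" by blast
    have "y \<in> Z" if "(z, y) \<in> E\<^sup>*" for y
      using that by induction (use z Z(3) E in auto)
    moreover have "(z, y) \<in> E\<^sup>*" if "y \<in> K" for y
    proof -
      have "(z, x) \<in> E\<^sup>*" using K[of z] z Z(1) symD[OF sE] by blast
      then show ?thesis using K[of y] that by (blast intro: rtrancl_trans)
    qed
    ultimately show "Z = K" using Z(1) by blast
  qed
qed

definition inner_edges :: "nat set \<Rightarrow> (edge_color \<times> nat set) set" where
  "inner_edges K = {e \<in> cedges pair_graph. snd e \<subseteq> K}"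

text \<open>The walk x, b x, t (b x) = \<sigma> x and so on, along bottom and top edges in
  turn.\<close>

definition alternating :: "nat \<Rightarrow> nat \<Rightarrow> nat" where
  "alternating x i = (if even i then (\<sigma> ^^ (i div 2)) x else b ((\<sigma> ^^ (i div 2)) x))"

lemma alternating_Suc: "alternating x (Suc i) = (if even i then b (alternating x i) else t (alternating x i))"
  by (auto simp: alternating_def \<sigma>_def elim!: oddE)

text \<open>The alternating walk closes after twice the \<sigma>-period of x. Its even positions run
  through the orbit of x and its odd ones through the disjoint orbit of \<open>t x\<close>, so no
  vertex repeats. Period 1 gives the cycle of two parallel edges.\<close>

lemma inner_edges_cycle:
  assumes K: "component K" "fixpoint_free K"
  shows "inner_edges K \<in> graph_cycles pair_graph"
proof -
  obtain x where x: "x \<in> K" using componentD(2)[OF K(1)] by blast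
  obtain N where N: "0 < N" "(\<sigma> ^^ N) x = x" "orbit \<sigma> x = {(\<sigma> ^^ m) x | m. m < N}"
    "\<And>k. k < 2 * N \<Longrightarrow> (\<sigma> ^^ k) x = x \<Longrightarrow> k = 0 \<or> k = N" using period[of x] by blast
  let ?f = "alternating x" and ?M = "2 * N"
  define g where "g i = (if even i then Bottom else Top, {?f i, ?f (Suc i)})" for i
  have disj: "orbit \<sigma> x \<inter> orbit \<sigma> (t x) = {}"
    using component_two_orbits[OF K x] orbit_eq self_orbit by blast
  have inj_even: "i = j" if "i < N" "j < N" "(\<sigma> ^^ i) x = (\<sigma> ^^ j) x" for i j
  proof -
    have le: "i = j" if "i \<le> j" "j < N" "(\<sigma> ^^ i) x = (\<sigma> ^^ j) x" for i j
    proof -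
      have "(\<sigma> ^^ i) x = (\<sigma> ^^ (i + (j - i))) x" using that by simp
      then have "(\<sigma> ^^ i) x = (\<sigma> ^^ i) ((\<sigma> ^^ (j - i)) x)" by (simp only: funpow_add comp_apply)
      then have "x = (\<sigma> ^^ (j - i)) x" by (rule \<sigma>_pow_inj)
      then have "j - i = 0 \<or> j - i = N" by (intro N(4)) (use that in auto)
      then show ?thesis using that by auto
    qed
    show ?thesis using le[of i j] le[of j i] that by (cases "i \<le> j") auto
  qed
  have mix: "?f i \<noteq> ?f j" if "even i" "odd j" for i j
  proof -
    have "?f i \<in> orbit \<sigma> x" using that pow_orbit by (simp add: alternating_def)
    moreover have "?f j \<in> orbit \<sigma> (t x)" using that b_orbit[OF pow_orbit] by (simp add: alternating_def)
    ultimately show ?thesis using disj by auto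
  qed
  have inj: "i = j" if ij: "i < ?M" "j < ?M" "?f i = ?f j" for i j
  proof -
    have p: "even i \<longleftrightarrow> even j" using mix[of i j] mix[of j i] ij(3) by metis
    then have "(\<sigma> ^^ (i div 2)) x = (\<sigma> ^^ (j div 2)) x" using ij(3) by (auto simp: alternating_def dest: b_inj split: if_splits)
    then have "i div 2 = j div 2" by (rule inj_even[rotated 2]) (use ij in auto)
    then show ?thesis using p by presburger
  qed
  have wrap: "?f ((i + 1) mod ?M) = ?f (Suc i)" if "i < ?M" for i
  proof (cases "Suc i = ?M")
    case True
    then have "?f (Suc i) = x" by (simp add: alternating_def N(2))
    then show ?thesis using True by (simp add: alternating_def)
  next
    case False
    then show ?thesis using that by simp
  qed
  have KO: "K = orbit \<sigma> x \<union> orbit \<sigma> (t x)" by (rule component_orbits[OF K(1) x])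
  have fK: "?f i \<in> K" for i
    using pow_orbit[of "i div 2" x] b_orbit[OF pow_orbit[of "i div 2" x]] KO by (auto simp: alternating_def)
  have Kf: "\<exists>i<?M. y = ?f i" if "y \<in> K" for y
  proof -
    have "y \<in> orbit \<sigma> x \<or> y \<in> orbit \<sigma> (t x)" using that KO by blast
    then show ?thesis
    proof
      assume "y \<in> orbit \<sigma> x"
      then obtain m where "y = (\<sigma> ^^ m) x" "m < N" using N(3) by blast
      then have "2 * m < ?M" "y = ?f (2 * m)" by (simp_all add: alternating_def)
      then show ?thesis by blast
    next
      assume "y \<in> orbit \<sigma> (t x)"
      then have "b y \<in> orbit \<sigma> x" using b_orbit[of y "t x"] by (simp add: t_inv)
      then obtain m where m: "b y = (\<sigma> ^^ m) x" "m < N" using N(3) by blast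
      then have "y = b ((\<sigma> ^^ m) x)" using b_inv[of y] by simp
      then have "2 * m + 1 < ?M" "y = ?f (2 * m + 1)" using m(2) by (simp_all add: alternating_def)
      then show ?thesis by blast
    qed
  qed
  have nf: "t (?f i) \<noteq> ?f i" "b (?f i) \<noteq> ?f i" for i using K(2) fK[of i] by (auto simp: fixpoint_free_def)
  have gE: "g i \<in> inner_edges K" for i
  proof -
    have "g i \<in> cedges pair_graph" using nf[of i] by (auto simp: g_def alternating_Suc pair_graph_def)
    then show ?thesis using fK by (simp add: inner_edges_def g_def)
  qed
  let ?vs = "map ?f [0..<?M]" and ?es = "map g [0..<?M]"
  have surj: "e \<in> g ` {0..<?M}" if e: "e \<in> inner_edges K" for e
  proof -
    from e obtain v where v: "e = (Top, {v, t v}) \<or> e = (Bottom, {v, b v})" "v \<in> K"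
      by (auto simp: inner_edges_def pair_graph_def)
    obtain i where i: "i < ?M" "v = ?f i" using Kf[OF v(2)] by blast
    from v(1) show ?thesis
    proof
      assume e: "e = (Bottom, {v, b v})"
      show ?thesis
      proof (cases "even i")
        case True
        then have "e = g i" using e i by (simp add: g_def alternating_Suc)
        then show ?thesis using i by simp
      next
        case False
        then obtain k where k: "i = Suc k" "even k" by (metis even_Suc odd_Suc_minus_one)
        then have "v = b (?f k)" using i by (simp add: alternating_Suc)
        then have "e = g k" using e k b_inv by (simp add: g_def alternating_Suc insert_commute)
        then show ?thesis using i k by simp
      qed
    next
      assume e: "e = (Top, {v, t v})"
      show ?thesis
      proof (cases "odd i")
        case True
        then have "e = g i" using e i by (simp add: g_def alternating_Suc)
        then show ?thesis using i by simp
      next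
        case False
        \<comment> \<open>Top edges leave from odd positions, so the top edge at an even position
          starts one step earlier, cyclically at the last position if i = 0.\<close>
        define k where "k = (if i = 0 then ?M - 1 else i - 1)"
        have k: "k < ?M" "odd k" using i N(1) False by (auto simp: k_def)
        have "?f (Suc k) = v"
        proof (cases "i = 0")
          case True
          then have "Suc k = ?M" using N(1) by (simp add: k_def)
          then show ?thesis using i True N(2) by (simp add: alternating_def)
        next
          case False
          then show ?thesis using i by (simp add: k_def)
        qed
        then have "v = t (?f k)" using k(2) by (simp add: alternating_Suc)
        then have "e = g k" using e k t_inv by (simp add: g_def alternating_Suc insert_commute)
        then show ?thesis using k by simp
      qed
    qed
  qed
  have set_es: "set ?es = inner_edges K" using gE surj by auto
  have inj_g: "i = j" if ij: "i < ?M" "j < ?M" "g i = g j" for i j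
  proof -
    have p: "even i \<longleftrightarrow> even j" using ij(3) by (auto simp: g_def split: if_splits)
    have "?f i \<in> {?f j, ?f (Suc j)}" using ij(3) by (auto simp: g_def)
    moreover have "?f i \<noteq> ?f (Suc j)" using mix[of i "Suc j"] mix[of "Suc j" i] p by (cases "even i") auto
    ultimately show ?thesis using inj[OF ij(1,2)] by simp
  qed
  have "\<exists>es vs. inner_edges K = set es \<and> 2 \<le> length vs \<and> length es = length vs \<and> distinct vs \<and> distinct es \<and>
     set vs \<subseteq> cverts pair_graph \<and> set es \<subseteq> cedges pair_graph \<and>
     (\<forall>i<length vs. snd (es ! i) = {vs ! i, vs ! ((i + 1) mod length vs)})"
  proof (rule exI[where x = ?es], rule exI[where x = ?vs], intro conjI)
    show "distinct ?vs" using inj by (auto simp: distinct_map inj_on_def)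
    show "distinct ?es" using inj_g by (auto simp: distinct_map inj_on_def)
    show "set ?vs \<subseteq> cverts pair_graph" using fK componentD(1)[OF K(1)] by (auto simp: pair_graph_def)
    show "set ?es \<subseteq> cedges pair_graph" unfolding set_es by (auto simp: inner_edges_def)
    show "\<forall>i<length ?vs. snd (?es ! i) = {?vs ! i, ?vs ! ((i + 1) mod length ?vs)}"
    proof (intro allI impI)
      fix i assume "i < length ?vs"
      then have i: "i < ?M" "(i + 1) mod ?M < ?M" by auto
      have "?vs ! ((i + 1) mod length ?vs) = ?f ((i + 1) mod ?M)" using i(2) by simp
      also have "\<dots> = ?f (Suc i)" by (rule wrap[OF i(1)])
      finally have "?vs ! ((i + 1) mod length ?vs) = ?f (Suc i)" .
      then show "snd (?es ! i) = {?vs ! i, ?vs ! ((i + 1) mod length ?vs)}" using i(1) by (simp add: g_def)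
    qed
    show "inner_edges K = set ?es" by (rule set_es[symmetric])
    show "2 \<le> length ?vs" using N(1) by simp
    show "length ?es = length ?vs" by simp
  qed
  then show ?thesis unfolding graph_cycles_def by blast
qed

text \<open>At each vertex of a cycle the two incident edges are distinct and therefore of different
  colours. The vertices of the cycle are then closed under both involutions and fill a
  component.\<close>

lemma graph_cycles_pair_graph:
  "graph_cycles pair_graph = inner_edges ` {K \<in> components pair_graph. fixpoint_free K}"
proof (rule equalityI; rule subsetI)
  fix c assume "c \<in> inner_edges ` {K \<in> components pair_graph. fixpoint_free K}"
  then show "c \<in> graph_cycles pair_graph" using inner_edges_cycle components_pair_graph(3) by blast
next
  fix c assume "c \<in> graph_cycles pair_graph"
  then obtain es vs where c: "c = set es" and len: "2 \<le> length vs" "length es = length vs"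
    and dis: "distinct vs" "distinct es" and sub: "set vs \<subseteq> V" "set es \<subseteq> cedges pair_graph"
    and inc: "\<And>i. i < length vs \<Longrightarrow> snd (es ! i) = {vs ! i, vs ! ((i + 1) mod length vs)}"
    unfolding graph_cycles_def pair_graph_def by auto
  let ?l = "length vs"
  have edge: "e = (Top, {v, t v}) \<and> t v \<noteq> v \<or> e = (Bottom, {v, b v}) \<and> b v \<noteq> v"
    if "e \<in> cedges pair_graph" "v \<in> snd e" for e v
    using that t_inv b_inv by (auto simp: pair_graph_def insert_commute)
  have both: "(Top, {v, t v}) \<in> set es \<and> (Bottom, {v, b v}) \<in> set es \<and> t v \<noteq> v \<and> b v \<noteq> v" if v: "v \<in> set vs" for v
  proof -
    obtain i where i: "i < ?l" "v = vs ! i" using v by (auto simp: in_set_conv_nth)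
    define k where "k = (if i = 0 then ?l - 1 else i - 1)"
    have k: "k < ?l" "(k + 1) mod ?l = i" "k \<noteq> i" using i len(1) by (auto simp: k_def)
    have v1: "v \<in> snd (es ! i)" using inc[OF i(1)] i(2) by simp
    have v2: "v \<in> snd (es ! k)" using inc[OF k(1)] k(2) i(2) by simp
    have e: "es ! i \<in> set es" "es ! k \<in> set es" using i(1) k(1) len(2) by auto
    have ne: "es ! i \<noteq> es ! k" using dis(2) i(1) k len(2) by (simp add: nth_eq_iff_index_eq)
    show ?thesis using edge[OF subsetD[OF sub(2) e(1)] v1] edge[OF subsetD[OF sub(2) e(2)] v2] ne e by auto
  qed
  have es_sub: "snd e \<subseteq> set vs" if "e \<in> set es" for e
  proof -
    obtain i where i: "i < ?l" "e = es ! i" using \<open>e \<in> set es\<close> len(2) by (auto simp: in_set_conv_nth)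
    have m: "(i + 1) mod ?l < ?l" by (rule mod_less_divisor) (use i(1) in linarith)
    show ?thesis unfolding i(2) inc[OF i(1)] using i(1) m nth_mem by auto
  qed
  have closed: "t v \<in> set vs \<and> b v \<in> set vs" if "v \<in> set vs" for v using both[OF that] es_sub by fastforce
  have v0: "vs ! 0 \<in> set vs" by (rule nth_mem) (use len(1) in linarith)
  then obtain K where K: "K \<in> components pair_graph" "vs ! 0 \<in> K" using components_pair_graph(1) sub(1) by blast
  note KC = components_pair_graph(3)[OF K(1)]
  have "vs ! i \<in> K" if "i < ?l" for i
    using that
  proof (induction i)
    case (Suc i)
    then have i: "i < ?l" "vs ! i \<in> K" by auto
    have "snd (es ! i) = {vs ! i, vs ! Suc i}" using inc[OF i(1)] Suc.prems by simp
    moreover have "es ! i \<in> cedges pair_graph" using sub(2) i(1) len(2) by auto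
    ultimately have "vs ! Suc i = t (vs ! i) \<or> vs ! Suc i = b (vs ! i)"
      using edge[of "es ! i" "vs ! i"] by (auto simp: doubleton_eq_iff)
    then show ?case using componentD(3,4)[OF KC i(2)] by auto
  qed (use K in simp)
  then have "set vs \<subseteq> K" by (auto simp: in_set_conv_nth)
  then have vK: "set vs = K" using closed v0 by (intro componentD(6)[OF KC]) auto
  have "fixpoint_free K" using both unfolding vK fixpoint_free_def by blast
  moreover have "set es = inner_edges K"
  proof (rule equalityI; rule subsetI)
    fix e assume "e \<in> set es"
    then show "e \<in> inner_edges K" using es_sub sub(2) vK by (auto simp: inner_edges_def)
  next
    fix e assume "e \<in> inner_edges K"
    then obtain v where "e = (Top, {v, t v}) \<or> e = (Bottom, {v, b v})" "v \<in> K"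
      by (auto simp: inner_edges_def pair_graph_def)
    then show "e \<in> set es" using both[of v] vK by blast
  qed
  ultimately show "c \<in> inner_edges ` {K \<in> components pair_graph. fixpoint_free K}" using K(1) c by blast
qed

lemma card_graph_cycles:
  "card (graph_cycles pair_graph) = card {K \<in> components pair_graph. fixpoint_free K}"
  unfolding graph_cycles_pair_graph
proof (rule card_image, rule inj_onI)
  have u: "\<Union>(snd ` inner_edges K) = K" if K: "K \<in> {K \<in> components pair_graph. fixpoint_free K}" for K
  proof (rule equalityI; rule subsetI)
    fix v assume v: "v \<in> K"
    have "component K" using K components_pair_graph(3) by blast
    then have "t v \<in> K" using v by (rule componentD(3))
    moreover have "t v \<noteq> v" using K v by (auto simp: fixpoint_free_def)
    ultimately have "(Top, {v, t v}) \<in> inner_edges K" using v by (auto simp: inner_edges_def pair_graph_def)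
    then show "v \<in> \<Union>(snd ` inner_edges K)" by force
  qed (auto simp: inner_edges_def)
  fix K L assume KL: "K \<in> {K \<in> components pair_graph. fixpoint_free K}" "L \<in> {K \<in> components pair_graph. fixpoint_free K}"
    "inner_edges K = inner_edges L"
  have "\<Union>(snd ` inner_edges K) = \<Union>(snd ` inner_edges L)" by (rule arg_cong[where f = "\<lambda>E. \<Union>(snd ` E)", OF KL(3)])
  then show "K = L" unfolding u[OF KL(1)] u[OF KL(2)] .
qed

end

section \<open>Standard parabolic subalgebras\<close>

lemma skew_unit_mult_sum:
  fixes X :: "'k::field mat"
  assumes "i < 2*n" "k < 2*n" "a < 2*n" "b < 2*n"
  shows "(\<Sum>c<2*n. skew_unit n i k $$ (a, c) * X $$ (c, b))
    = (if a = i then X $$ (k, b) else 0) - (if a = bar n k then sgn_idx n i * sgn_idx n k * X $$ (bar n i, b) else 0)"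
    (is ?left)
    and "(\<Sum>c<2*n. X $$ (a, c) * skew_unit n i k $$ (c, b))
    = (if b = k then X $$ (a, i) else 0) - (if b = bar n i then sgn_idx n i * sgn_idx n k * X $$ (a, bar n k) else 0)"
    (is ?right)
proof -
  have bi: "bar n i < 2*n" "bar n k < 2*n" using assms by auto
  have "(\<Sum>c<2*n. skew_unit n i k $$ (a, c) * X $$ (c, b)) =
    (\<Sum>c<2*n. (if c = k then (if a = i then X $$ (k, b) else 0) else 0)
      - (if c = bar n i then (if a = bar n k then sgn_idx n i * sgn_idx n k * X $$ (bar n i, b) else 0) else 0))"
    by (rule sum.cong[OF refl]) (use assms in \<open>simp add: skew_unit_index\<close>)
  then show ?left using assms bi by (simp add: sum_subtractf)
  have "(\<Sum>c<2*n. X $$ (a, c) * skew_unit n i k $$ (c, b)) =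
    (\<Sum>c<2*n. (if c = i then (if b = k then X $$ (a, i) else 0) else 0)
      - (if c = bar n k then (if b = bar n i then sgn_idx n i * sgn_idx n k * X $$ (a, bar n k) else 0) else 0))"
    by (rule sum.cong[OF refl]) (use assms in \<open>simp add: skew_unit_index mult.commute\<close>)
  then show ?right using assms bi by (simp add: sum_subtractf)
qed

text \<open>Since j \<noteq> k, at most one of the two extra terms is present, so the factor is 1 or
  2 and does not vanish in characteristic zero. This is the structure constant that makes root
  relations compose.\<close>

lemma commutator_skew_unit_entry:
  fixes X :: "'k::field mat"
  assumes X: "X \<in> sp n" and ij: "i < 2*n" "j < 2*n" "k < 2*n" "j \<noteq> k"
  shows "commutator (skew_unit n i k) X $$ (i, j)
    = (1 + (if i = bar n k then 1 else 0) + (if j = bar n i then 1 else 0)) * X $$ (k, j)"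
proof -
  have e: "commutator (skew_unit n i k) X $$ (i, j)
    = (X $$ (k, j) - (if i = bar n k then sgn_idx n i * sgn_idx n k * X $$ (bar n i, j) else 0))
      + (if j = bar n i then sgn_idx n i * sgn_idx n k * X $$ (i, bar n k) else 0)"
    unfolding commutator_index[OF skew_unit_carrier sp_carrier[OF X] ij(1,2)]
      skew_unit_mult_sum(1)[OF ij(1,3,1,2)] skew_unit_mult_sum(2)[OF ij(1,3,1,2)] using ij(4) by simp
  have 1: "sgn_idx n i * sgn_idx n k * X $$ (bar n i, j) = - X $$ (k, j)" if "i = bar n k"
    unfolding that using ij by simp
  have 2: "sgn_idx n i * sgn_idx n k * X $$ (i, bar n k) = X $$ (k, j)" if j: "j = bar n i"
  proof -
    have "X $$ (bar n j, bar n k) = - (sgn_idx n k * sgn_idx n j * X $$ (k, j))" by (rule sp_entry[OF X ij(3,2)])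
    then have "X $$ (i, bar n k) = sgn_idx n i * (sgn_idx n k * X $$ (k, j))" using j ij by simp
    then have "sgn_idx n i * sgn_idx n k * X $$ (i, bar n k)
        = (sgn_idx n i * sgn_idx n i) * ((sgn_idx n k * sgn_idx n k) * X $$ (k, j))" by (simp only: ac_simps)
    then show ?thesis unfolding sgn_idx_sq(1) by simp
  qed
  have 1: "(if i = bar n k then sgn_idx n i * sgn_idx n k * X $$ (bar n i, j) else 0) = (if i = bar n k then - X $$ (k, j) else 0)"
    by (rule if_cong[OF refl _ refl], rule 1)
  have 2: "(if j = bar n i then sgn_idx n i * sgn_idx n k * X $$ (i, bar n k) else 0) = (if j = bar n i then X $$ (k, j) else 0)"
    by (rule if_cong[OF refl _ refl], rule 2)
  have "x - (if P then - x else 0) + (if Q then x else 0) = (1 + (if P then 1 else 0) + (if Q then 1 else 0)) * x"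
    for x :: 'k and P Q by (simp add: distrib_right)
  then show ?thesis unfolding e 1 2 .
qed

lemma commutator_diagonal:
  fixes H :: "'k::field mat"
  assumes "H \<in> carrier_mat M M" "X \<in> carrier_mat M M" "\<And>a b. a < M \<Longrightarrow> b < M \<Longrightarrow> a \<noteq> b \<Longrightarrow> H $$ (a, b) = 0"
    and ab: "a < M" "b < M"
  shows "commutator H X $$ (a, b) = (H $$ (a, a) - H $$ (b, b)) * X $$ (a, b)"
proof -
  have "(\<Sum>c<M. H $$ (a, c) * X $$ (c, b)) = (\<Sum>c<M. if c = a then H $$ (a, a) * X $$ (a, b) else 0)"
    by (rule sum.cong[OF refl]) (use assms in auto)
  moreover have "(\<Sum>c<M. X $$ (a, c) * H $$ (c, b)) = (\<Sum>c<M. if c = b then X $$ (a, b) * H $$ (b, b) else 0)"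
    by (rule sum.cong[OF refl]) (use assms in auto)
  ultimately show ?thesis unfolding commutator_index[OF assms(1,2) ab] using ab by (simp add: algebra_simps)
qed

text \<open>The eigenvalue of the torus element \<open>skew_unit n x x\<close> on the a-th basis
  vector, as an integer so that the possible values can be enumerated.\<close>

definition weight :: "nat \<Rightarrow> nat \<Rightarrow> nat \<Rightarrow> int" where
  "weight n x a = (if a = x then 1 else if a = bar n x then -1 else 0)"

lemma torus_entry:
  assumes "x < 2*n" "a < 2*n" "b < 2*n"
  shows "(skew_unit n x x :: 'k::field mat) $$ (a, b) = (if a = b then of_int (weight n x a) else 0)"
  using assms bar_neq[OF assms(1)] by (auto simp: skew_unit_index weight_def)

lemma commutator_torus:
  fixes X :: "'k::field mat"
  assumes "X \<in> carrier_mat (2*n) (2*n)" "x < 2*n" "a < 2*n" "b < 2*n"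
  shows "commutator (skew_unit n x x) X $$ (a, b) = of_int (weight n x a - weight n x b) * X $$ (a, b)"
  by (subst commutator_diagonal[OF skew_unit_carrier assms(1) _ assms(3,4)]) (simp_all add: torus_entry assms)

text \<open>Testing with x = i and x = j alone already pins down the position up to its
  mirror.\<close>

lemma same_weights:
  assumes "i \<noteq> j" "i < 2*n" "j < 2*n" "a < 2*n" "b < 2*n"
    and w: "\<And>x. x < 2*n \<Longrightarrow> weight n x a - weight n x b = weight n x i - weight n x j"
  shows "a = i \<and> b = j \<or> a = bar n j \<and> b = bar n i"
proof -
  have v: "weight n x y = 1 \<Longrightarrow> y = x" "weight n x y = -1 \<Longrightarrow> y = bar n x" "weight n x y \<in> {-1, 0, 1}" for x y
    by (auto simp: weight_def split: if_splits)
  have vI: "weight n x x = 1" for x by (simp add: weight_def)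
  have v0: "y \<noteq> x \<Longrightarrow> y \<noteq> bar n x \<Longrightarrow> weight n x y = 0" for x y by (simp add: weight_def)
  have wi: "weight n i a - weight n i b = 1 - weight n i j" using w[OF assms(2)] vI by simp
  have wj: "weight n j a - weight n j b = weight n j i - 1" using w[OF assms(3)] vI by simp
  show ?thesis
  proof (cases "j = bar n i")
    case True
    then have "weight n i j = -1" using bar_neq[OF assms(2)] by (simp add: weight_def)
    then have "weight n i a = 1" "weight n i b = -1" using wi v(3)[of i a] v(3)[of i b] by auto
    then show ?thesis using v(1,2) True by blast
  next
    case False
    have ne: "i \<noteq> bar n j" "bar n i \<noteq> j" "bar n i \<noteq> bar n j" using False assms(1) bar_bar[OF assms(3)] bar_eq_iff[OF assms(2,3)] by auto
    have wi': "weight n i a - weight n i b = 1" unfolding wi using v0[OF assms(1)[symmetric] False] by simp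
    have wj': "weight n j a - weight n j b = -1" unfolding wj using v0[OF assms(1) ne(1)] by simp
    show ?thesis
    proof (cases "a = i")
      case True
      then have "weight n j b = 1" using wj' v0[OF assms(1) ne(1)] by simp
      then show ?thesis using v(1) True by blast
    next
      case a: False
      then have "weight n i a \<noteq> 1" using v(1) by blast
      then have "weight n i b = -1" using wi' v(3)[of i a] v(3)[of i b] by auto
      then have b: "b = bar n i" by (rule v(2))
      then have "weight n j a = -1" using wj' v0[OF ne(2,3)] by simp
      then show ?thesis using v(2) b by blast
    qed
  qed
qed

lemma skew_unit_self:
  assumes "i < 2*n" "j < 2*n"
  shows "(skew_unit n i j :: 'k::field_char_0 mat) $$ (i, j) \<noteq> 0"
proof -
  have e: "(skew_unit n i j :: 'k mat) $$ (i, j) = 1 - (if i = bar n j \<and> j = bar n i then sgn_idx n i * sgn_idx n j else 0)"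
    unfolding skew_unit_index[OF assms assms] by (simp only: refl simp_thms if_True)
  show ?thesis
  proof (cases "i = bar n j \<and> j = bar n i")
    case True
    have "sgn_idx n j = - (sgn_idx n i :: 'k)" using sgn_idx_bar[OF assms(1), where ?'a = 'k] conjunct2[OF True] by metis
    then have "sgn_idx n i * sgn_idx n j = (- 1 :: 'k)" by simp
    then show ?thesis unfolding e if_P[OF True] by simp
  next
    case False
    show ?thesis unfolding e if_not_P[OF False] by simp
  qed
qed

lemma skew_unit_other:
  assumes "i < 2*n" "j < 2*n" "a < 2*n" "b < 2*n" "\<not> (a = i \<and> b = j \<or> a = bar n j \<and> b = bar n i)"
  shows "(skew_unit n i j :: 'k::field mat) $$ (a, b) = 0"
proof -
  have n: "\<not> (a = i \<and> b = j)" "\<not> (a = bar n j \<and> b = bar n i)" using assms(5) by blast+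
  show ?thesis unfolding skew_unit_index[OF assms(3,4,1,2)] if_not_P[OF n(1)] if_not_P[OF n(2)] by simp
qed

lemma multiple_of_skew_unit:
  fixes Z :: "'k::field_char_0 mat"
  assumes Z: "Z \<in> sp n" and ij: "i \<noteq> j" "i < 2*n" "j < 2*n"
    and z: "\<And>a b. a < 2*n \<Longrightarrow> b < 2*n \<Longrightarrow> Z $$ (a, b) \<noteq> 0 \<Longrightarrow> a = i \<and> b = j \<or> a = bar n j \<and> b = bar n i"
  shows "Z = (Z $$ (i, j) / skew_unit n i j $$ (i, j)) \<cdot>\<^sub>m skew_unit n i j"
proof (rule eq_matI)
  let ?u = "skew_unit n i j :: 'k mat"
  let ?c = "Z $$ (i, j) / ?u $$ (i, j)"
  fix a b assume "a < dim_row (?c \<cdot>\<^sub>m ?u)" "b < dim_col (?c \<cdot>\<^sub>m ?u)"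
  then have ab: "a < 2*n" "b < 2*n" by auto
  have r: "(?c \<cdot>\<^sub>m ?u) $$ (a, b) = ?c * ?u $$ (a, b)" using ab by simp
  have nz: "?u $$ (i, j) \<noteq> 0" by (rule skew_unit_self[OF ij(2,3)])
  have d: "Z $$ (i, j) = ?c * ?u $$ (i, j)" using nz by simp
  consider "a = i \<and> b = j" | "a = bar n j \<and> b = bar n i" | "\<not> (a = i \<and> b = j \<or> a = bar n j \<and> b = bar n i)" by blast
  then show "Z $$ (a, b) = (?c \<cdot>\<^sub>m ?u) $$ (a, b)"
  proof cases
    case 1
    then show ?thesis using r d by simp
  next
    case 2
    have "Z $$ (bar n j, bar n i) = - (sgn_idx n i * sgn_idx n j * (?c * ?u $$ (i, j)))"
      unfolding d[symmetric] by (rule sp_entry[OF Z ij(2,3)])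
    also have "\<dots> = ?c * (- (sgn_idx n i * sgn_idx n j * ?u $$ (i, j)))" by (simp only: ac_simps mult_minus_right)
    also have "\<dots> = ?c * ?u $$ (bar n j, bar n i)" unfolding sp_entry[OF skew_unit_sp ij(2,3)] ..
    finally show ?thesis using 2 r by simp
  next
    case 3
    have "Z $$ (a, b) = 0" using z[OF ab] 3 by blast
    moreover have "?u $$ (a, b) = 0" by (rule skew_unit_other[OF ij(2,3) ab 3])
    ultimately show ?thesis using r by simp
  qed
qed (use sp_carrier[OF Z] in auto)

lemma cartanD:
  assumes "H \<in> cartan n"
  shows "H \<in> sp n" "\<And>a b. a < 2*n \<Longrightarrow> b < 2*n \<Longrightarrow> a \<noteq> b \<Longrightarrow> H $$ (a, b) = 0"
    "a < 2*n \<Longrightarrow> H $$ (bar n a, bar n a) = - H $$ (a, a)"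
proof -
  show sp: "H \<in> sp n" using assms by (simp add: cartan_def)
  show "H $$ (a, b) = 0" if "a < 2*n" "b < 2*n" "a \<noteq> b" for a b
    using assms that sp_carrier[OF sp] by (simp add: cartan_def diagonal_mat_def)
  show "a < 2*n \<Longrightarrow> H $$ (bar n a, bar n a) = - H $$ (a, a)" using sp_entry[OF sp, of a a] by simp
qed

lemma torus_cartan: "x < 2*n \<Longrightarrow> (skew_unit n x x :: 'k::field mat) \<in> cartan n"
proof -
  assume "x < 2*n"
  then have "(skew_unit n x x :: 'k mat) $$ (a, b) = 0" if "a < 2*n" "b < 2*n" "a \<noteq> b" for a b
    using torus_entry[of x n a b, where ?'k = 'k] that by simp
  then show ?thesis by (simp add: cartan_def diagonal_mat_def skew_unit_sp)
qed

text \<open>The torus weights determine a position up to its mirror, so the root space is the line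
  spanned by the root vector.\<close>

lemma root_space_le_iff:
  fixes \<beta> :: "'k::field_char_0 mat \<Rightarrow> 'k"
  assumes \<beta>: "\<And>H. H \<in> cartan n \<Longrightarrow> \<beta> H = H $$ (i, i) - H $$ (j, j)"
    and ij: "i \<noteq> j" "i < 2*n" "j < 2*n" and p: "\<And>c X. X \<in> p \<Longrightarrow> c \<cdot>\<^sub>m X \<in> p"
  shows "root_space n \<beta> \<subseteq> p \<longleftrightarrow> skew_unit n i j \<in> p"
proof
  have "commutator H (skew_unit n i j) = \<beta> H \<cdot>\<^sub>m skew_unit n i j" if H: "H \<in> cartan n" for H
  proof (rule eq_matI)
    note Hc = sp_carrier[OF cartanD(1)[OF H]]
    fix a b assume "a < dim_row (\<beta> H \<cdot>\<^sub>m (skew_unit n i j :: 'k mat))" "b < dim_col (\<beta> H \<cdot>\<^sub>m (skew_unit n i j :: 'k mat))"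
    then have ab: "a < 2*n" "b < 2*n" by auto
    have c: "commutator H (skew_unit n i j) $$ (a, b) = (H $$ (a, a) - H $$ (b, b)) * skew_unit n i j $$ (a, b)"
      by (rule commutator_diagonal[OF Hc skew_unit_carrier cartanD(2)[OF H] ab])
    have "H $$ (a, a) - H $$ (b, b) = \<beta> H" if "a = i \<and> b = j \<or> a = bar n j \<and> b = bar n i"
      using that cartanD(3)[OF H ij(2)] cartanD(3)[OF H ij(3)] \<beta>[OF H] by auto
    moreover have "(skew_unit n i j :: 'k mat) $$ (a, b) = 0" if "\<not> (a = i \<and> b = j \<or> a = bar n j \<and> b = bar n i)"
      by (rule skew_unit_other[OF ij(2,3) ab that])
    ultimately show "commutator H (skew_unit n i j) $$ (a, b) = (\<beta> H \<cdot>\<^sub>m skew_unit n i j) $$ (a, b)"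
      unfolding c using ab by (cases "a = i \<and> b = j \<or> a = bar n j \<and> b = bar n i") auto
  next
    have "commutator H (skew_unit n i j) \<in> carrier_mat (2*n) (2*n)"
      by (rule commutator_carrier[OF sp_carrier[OF cartanD(1)[OF H]] skew_unit_carrier])
    then show "dim_row (commutator H (skew_unit n i j)) = dim_row (\<beta> H \<cdot>\<^sub>m (skew_unit n i j :: 'k mat))"
      "dim_col (commutator H (skew_unit n i j)) = dim_col (\<beta> H \<cdot>\<^sub>m (skew_unit n i j :: 'k mat))" by auto
  qed
  then have "skew_unit n i j \<in> root_space n \<beta>" by (simp add: root_space_def skew_unit_sp)
  then show "root_space n \<beta> \<subseteq> p \<Longrightarrow> skew_unit n i j \<in> p" by blast
  assume u: "skew_unit n i j \<in> p"
  show "root_space n \<beta> \<subseteq> p"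
  proof
    fix X assume X: "X \<in> root_space n \<beta>"
    then have Xs: "X \<in> sp n" by (simp add: root_space_def)
    have "X = (X $$ (i, j) / skew_unit n i j $$ (i, j)) \<cdot>\<^sub>m skew_unit n i j"
    proof (rule multiple_of_skew_unit[OF Xs ij])
      fix a b assume ab: "a < 2*n" "b < 2*n" and nz: "X $$ (a, b) \<noteq> 0"
      show "a = i \<and> b = j \<or> a = bar n j \<and> b = bar n i"
      proof (rule same_weights[OF ij ab])
        fix x assume x: "x < 2*n"
        have "\<forall>H\<in>cartan n. commutator H X = \<beta> H \<cdot>\<^sub>m X" using X by (simp add: root_space_def)
        then have "commutator (skew_unit n x x) X = \<beta> (skew_unit n x x) \<cdot>\<^sub>m X"
          by (rule bspec[OF _ torus_cartan[OF x]])
        then have "commutator (skew_unit n x x) X $$ (a, b) = \<beta> (skew_unit n x x) * X $$ (a, b)"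
          using ab sp_carrier[OF Xs] by simp
        then have "of_int (weight n x a - weight n x b) = \<beta> (skew_unit n x x)"
          using nz unfolding commutator_torus[OF sp_carrier[OF Xs] x ab] by simp
        also have "\<dots> = of_int (weight n x i - weight n x j)"
          unfolding \<beta>[OF torus_cartan[OF x]] torus_entry[OF x ij(2,2)] torus_entry[OF x ij(3,3)] by simp
        finally show "weight n x a - weight n x b = weight n x i - weight n x j" by (simp only: of_int_eq_iff)
      qed
    qed
    then show "X \<in> p" using p[OF u] by metis
  qed
qed

section \<open>Subalgebras containing the torus\<close>

locale torus_subalgebra =
  fixes n :: nat and p :: "'k::field_char_0 mat set"
  assumes subalgebra: "sp_subalgebra n p" and torus: "x < 2*n \<Longrightarrow> skew_unit n x x \<in> p"
begin

lemma p_sp: "X \<in> p \<Longrightarrow> X \<in> sp n"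
  using subalgebra by (auto simp: sp_subalgebra_def)

lemma p_commutator: "X \<in> p \<Longrightarrow> Y \<in> p \<Longrightarrow> commutator X Y \<in> p"
  using subalgebra unfolding sp_subalgebra_def by blast

lemma p_subspace: "subspace class_ring p (module_mat TYPE('k) (2*n) (2*n))"
  using subalgebra unfolding sp_subalgebra_def by blast

lemmas p_zero = subspace_matD(2)[OF p_subspace]
lemmas p_add = subspace_matD(3)[OF p_subspace]
lemmas p_smult = subspace_matD(4)[OF p_subspace]

text \<open>The adjoint action of \<open>skew_unit n x x\<close> minus the scalar v clears precisely
  the entries of weight v and multiplies the others by nonzero numbers.\<close>

lemma eliminate_weights:
  fixes F :: "(nat \<times> int) set"
  assumes "finite F" "Y \<in> p" "\<forall>(x, v)\<in>F. x < 2*n"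
  shows "\<exists>Z\<in>p. \<forall>a<2*n. \<forall>b<2*n. Z $$ (a, b) = 0 \<longleftrightarrow> Y $$ (a, b) = 0 \<or> (\<exists>(x, v)\<in>F. weight n x a - weight n x b = v)"
  using assms(1,3)
proof (induction F)
  case empty
  then show ?case using assms(2) by auto
next
  case (insert f F)
  obtain x v where f: "f = (x, v)" by (cases f)
  have x: "x < 2*n" using insert.prems f by simp
  have "\<forall>(x, v)\<in>F. x < 2*n" using insert.prems by simp
  from insert.IH[OF this]
  obtain Z where Z: "Z \<in> p" "\<forall>a<2*n. \<forall>b<2*n. Z $$ (a, b) = 0 \<longleftrightarrow> Y $$ (a, b) = 0 \<or> (\<exists>(x, v)\<in>F. weight n x a - weight n x b = v)"
    by (rule bexE)
  let ?Z = "commutator (skew_unit n x x) Z + (- of_int v) \<cdot>\<^sub>m Z"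
  have Zc: "Z \<in> carrier_mat (2*n) (2*n)" by (rule sp_carrier[OF p_sp[OF Z(1)]])
  have Zp: "?Z \<in> p" by (rule p_add[OF p_commutator[OF torus[OF x] Z(1)] p_smult[OF Z(1)]])
  have "?Z $$ (a, b) = 0 \<longleftrightarrow> Y $$ (a, b) = 0 \<or> (\<exists>(x, v)\<in>insert f F. weight n x a - weight n x b = v)"
    if ab: "a < 2*n" "b < 2*n" for a b
  proof -
    have "?Z $$ (a, b) = of_int (weight n x a - weight n x b - v) * Z $$ (a, b)"
      using ab Zc commutator_torus[OF Zc x ab] commutator_carrier[OF skew_unit_carrier Zc]
      by (simp add: left_diff_distrib)
    then have "?Z $$ (a, b) = 0 \<longleftrightarrow> weight n x a - weight n x b = v \<or> Z $$ (a, b) = 0"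
      by (simp only: mult_eq_0_iff of_int_eq_0_iff right_minus_eq)
    moreover have "Z $$ (a, b) = 0 \<longleftrightarrow> Y $$ (a, b) = 0 \<or> (\<exists>(x, v)\<in>F. weight n x a - weight n x b = v)"
      using Z(2) ab by (elim allE impE)
    ultimately show ?thesis unfolding f by simp blast
  qed
  then have *: "\<forall>a<2*n. \<forall>b<2*n. ?Z $$ (a, b) = 0 \<longleftrightarrow> Y $$ (a, b) = 0 \<or> (\<exists>(x, v)\<in>insert f F. weight n x a - weight n x b = v)"
    by (intro allI impI)
  show ?case by (rule bexI[where x = ?Z], rule *, rule Zp)
qed

text \<open>Projection to a root space by a polynomial in the adjoint action of the torus: all
  weights except that of (i, j) are eliminated, and what survives is a nonzero multiple of one root
  vector.\<close>

lemma unit_mem: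
  assumes Y: "Y \<in> p" and ij: "i \<noteq> j" "i < 2*n" "j < 2*n" and nz: "Y $$ (i, j) \<noteq> 0"
  shows "skew_unit n i j \<in> p"
proof -
  let ?w = "\<lambda>x a b. weight n x a - weight n x b"
  \<comment> \<open>All weight values different from those of (i, j); differences of two weights lie
    between -2 and 2, so the set is finite.\<close>
  let ?F = "{(x, v). x \<in> {..<2*n} \<and> v \<in> {-2..2} \<and> v \<noteq> ?w x i j}"
  have "finite ?F" by (rule finite_subset[of _ "{..<2*n} \<times> {-2..2}"]) auto
  moreover have "\<forall>(x, v)\<in>?F. x < 2*n" by auto
  ultimately have "\<exists>Z\<in>p. \<forall>a<2*n. \<forall>b<2*n. Z $$ (a, b) = 0 \<longleftrightarrow> Y $$ (a, b) = 0 \<or> (\<exists>(x, v)\<in>?F. ?w x a b = v)"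
    by (rule eliminate_weights[OF _ Y])
  then
  obtain Z where Z: "Z \<in> p" "\<forall>a<2*n. \<forall>b<2*n. Z $$ (a, b) = 0 \<longleftrightarrow> Y $$ (a, b) = 0 \<or> (\<exists>(x, v)\<in>?F. ?w x a b = v)" by (rule bexE)
  have Z2: "Z $$ (a, b) = 0 \<longleftrightarrow> Y $$ (a, b) = 0 \<or> (\<exists>(x, v)\<in>?F. ?w x a b = v)" if "a < 2*n" "b < 2*n" for a b
    using Z(2) that by (elim allE impE)
  have Zij: "Z $$ (i, j) \<noteq> 0" unfolding Z2[OF ij(2,3)] using nz by auto
  have r: "?w x a b \<in> {-2..2}" for x a b by (auto simp: weight_def)
  have "Z = (Z $$ (i, j) / skew_unit n i j $$ (i, j)) \<cdot>\<^sub>m skew_unit n i j"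
  proof (rule multiple_of_skew_unit[OF p_sp[OF Z(1)] ij])
    fix a b assume ab: "a < 2*n" "b < 2*n" and nz: "Z $$ (a, b) \<noteq> 0"
    have "?w x a b = ?w x i j" if "x < 2*n" for x
    proof (rule ccontr)
      assume "?w x a b \<noteq> ?w x i j"
      then have "(x, ?w x a b) \<in> ?F" using that r[of x a b] by simp
      then have "\<exists>(x, v)\<in>?F. ?w x a b = v" by (rule bexI[rotated]) simp
      then have "Z $$ (a, b) = 0" unfolding Z2[OF ab] by (rule disjI2)
      then show False using nz by contradiction
    qed
    then show "a = i \<and> b = j \<or> a = bar n j \<and> b = bar n i" by (intro same_weights[OF ij ab])
  qed
  then have e: "Z = (Z $$ (i, j) / skew_unit n i j $$ (i, j)) \<cdot>\<^sub>m skew_unit n i j" (is "_ = ?c \<cdot>\<^sub>m _") .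
  have c: "?c \<noteq> 0" using Zij skew_unit_self[OF ij(2,3)] by simp
  have "(1 / ?c) \<cdot>\<^sub>m (?c \<cdot>\<^sub>m skew_unit n i j) \<in> p" using p_smult[OF Z(1), of "1 / ?c"] e by simp
  moreover have "(1 / ?c) \<cdot>\<^sub>m (?c \<cdot>\<^sub>m skew_unit n i j) = skew_unit n i j" by (rule eq_matI) (use c in auto)
  ultimately show ?thesis by simp
qed

definition root_rel :: "nat \<Rightarrow> nat \<Rightarrow> bool" where
  "root_rel i j \<longleftrightarrow> skew_unit n i j \<in> p"

lemma root_rel_trans:
  assumes r: "i < 2*n" "j < 2*n" "k < 2*n" and ik: "root_rel i k" "root_rel k j"
  shows "root_rel i j"
proof (cases "i = j \<or> j = k")
  case True
  then show ?thesis using ik torus[OF r(1)] by (auto simp: root_rel_def)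
next
  case False
  let ?Y = "commutator (skew_unit n i k) (skew_unit n k j) :: 'k mat"
  have "?Y \<in> p" using ik by (auto simp: root_rel_def intro: p_commutator)
  moreover have "?Y $$ (i, j) \<noteq> 0"
  proof -
    have "(skew_unit n k j :: 'k mat) $$ (k, j) \<noteq> 0" by (rule skew_unit_self) (use r False in auto)
    moreover have "?Y $$ (i, j) = (1 + (if i = bar n k then 1 else 0) + (if j = bar n i then 1 else 0)) * skew_unit n k j $$ (k, j)"
      by (rule commutator_skew_unit_entry[OF skew_unit_sp r]) (use False in auto)
    moreover have "(1 + (if i = bar n k then 1 else 0) + (if j = bar n i then 1 else 0) :: 'k) \<noteq> 0" by auto
    ultimately show ?thesis by simp
  qed
  ultimately show ?thesis unfolding root_rel_def using False r by (intro unit_mem) auto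
qed

lemma root_rel_bar: "i < 2*n \<Longrightarrow> j < 2*n \<Longrightarrow> root_rel i j \<Longrightarrow> root_rel (bar n j) (bar n i)"
  unfolding root_rel_def by (simp add: skew_unit_bar p_smult)

lemma eq_S:
  assumes "sp_support n D" and D: "\<And>i j. i < 2*n \<Longrightarrow> j < 2*n \<Longrightarrow> (i, j) \<in> D \<longleftrightarrow> root_rel i j"
  shows "p = sp_support.S n D"
proof -
  interpret sp_support n D by (rule assms(1))
  have "X \<in> S" if X: "X \<in> p" for X
  proof (rule SI[OF p_sp[OF X]])
    fix i j assume ij: "i < 2*n" "j < 2*n" "(i, j) \<notin> D"
    then have "i \<noteq> j" using D_refl by auto
    then show "X $$ (i, j) = 0" using unit_mem[OF X _ ij(1,2)] D[OF ij(1,2)] ij(3) by (auto simp: root_rel_def)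
  qed
  moreover have "X \<in> p" if "X \<in> S" for X
    using that
  proof (induction X rule: S_induct)
    case (add Y c i j)
    then have "skew_unit n i j \<in> p" using D[of i j] D_range[of i j] by (simp add: root_rel_def)
    then show ?case by (rule p_add[OF add.IH p_smult])
  qed (rule p_zero)
  ultimately show ?thesis by blast
qed

end

text \<open>A single block of all indices imposes no restriction. Paired with another relation it
  presents a parabolic subalgebra as a special seaweed, so the support lemmas carry over.\<close>

lemma total_reflection: "block_reflection n (\<lambda>_ _. True) (bar n)"
  by unfold_locales (auto simp: bar_def)

text \<open>In 0-based indices the negative of the m-th simple root sits at position (m, m - 1).
  This includes the long root, because the indices n - 1 and n are mirror images.\<close>

lemma simple_root_negative:
  fixes H :: "'k::field mat"
  assumes "m \<in> {1..n}" "H \<in> cartan n"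
  shows "(- simple_root n m) H = H $$ (m, m) - H $$ (m - 1, m - 1)"
proof (cases "m < n")
  case False
  then have m: "m = n" using assms by simp
  have "bar n (n - 1) = n" using assms by (auto simp: bar_def)
  then show ?thesis using cartanD(3)[OF assms(2), of "n - 1"] assms(1) m by (simp add: simple_root_def eps_def)
qed (simp add: simple_root_def eps_def)

text \<open>The simple roots are functions on all matrices here, so an elementary matrix outside
  \<open>cartan n\<close> may be used to separate them.\<close>

lemma simple_root_inj: "inj_on (simple_root n :: nat \<Rightarrow> 'k::field_char_0 mat \<Rightarrow> 'k) {1..n}"
proof (rule linorder_inj_onI)
  fix i j assume ij: "i < j" "i \<in> {1..n}" "j \<in> {1..n}"
  let ?E = "unit_mat n (i - 1) (i - 1) :: 'k mat"
  have "simple_root n i ?E = 1" using ij by (auto simp: simple_root_def eps_def)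
  moreover have "simple_root n j ?E = 0" using ij by (auto simp: simple_root_def eps_def)
  ultimately show "(simple_root n i :: 'k mat \<Rightarrow> 'k) \<noteq> simple_root n j" by auto
qed auto

lemma torus_subalgebra_of_borel:
  fixes p :: "'k::field_char_0 mat set"
  assumes "sp_subalgebra n p" "cartan n \<subseteq> p"
  shows "torus_subalgebra n p"
  by unfold_locales (use assms torus_cartan in blast)+

lemma cartan_zero: "0\<^sub>m (2*n) (2*n) \<in> cartan n"
  by (simp add: cartan_def sp_zero diagonal_mat_def)

section \<open>Parabolic subalgebras determined by block relations\<close>

context block_reflection
begin

text \<open>A transitive relation containing the upper triangle is determined by its subdiagonal
  steps: P i j forces every step between j and i, and conversely steps compose. Steps beyond n are
  mirror images of steps up to n, where \<open>cut\<close> applies.\<close>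

lemma chain_eq:
  assumes tr: "\<And>i j k. i < 2*n \<Longrightarrow> j < 2*n \<Longrightarrow> k < 2*n \<Longrightarrow> P i k \<Longrightarrow> P k j \<Longrightarrow> P i j"
    and br: "\<And>i j. i < 2*n \<Longrightarrow> j < 2*n \<Longrightarrow> P i j \<Longrightarrow> P (bar n j) (bar n i)"
    and up: "\<And>i j. i \<le> j \<Longrightarrow> j < 2*n \<Longrightarrow> P i j"
    and cut: "\<And>m. m \<in> {1..n} \<Longrightarrow> P m (m - 1) \<longleftrightarrow> R m (m - 1)"
    and ij: "j < i" "i < 2*n"
  shows "P i j \<longleftrightarrow> R i j"
proof -
  have cut': "P q (q - 1) \<longleftrightarrow> R q (q - 1)" if q: "1 \<le> q" "q < 2*n" for q
  proof (cases "q \<le> n")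
    case False
    let ?m = "2*n - q"
    have m: "?m \<in> {1..n}" "bar n q = ?m - 1" "bar n (q - 1) = ?m" "q - 1 < 2*n" using q False by (auto simp: bar_def)
    have m': "?m < 2*n" "?m - 1 < 2*n" "bar n (?m - 1) = q" "bar n ?m = q - 1" using q False by (auto simp: bar_def)
    have "P q (q - 1) \<longleftrightarrow> P ?m (?m - 1)"
      using br[OF q(2) m(4)] br[OF m'(1,2)] unfolding m(2,3) m'(3,4) by (rule iffI)
    moreover have "R q (q - 1) \<longleftrightarrow> R (?m - 1) ?m"
      using R_bar[OF q(2) m(4)] R_bar[OF m'(2,1)] unfolding m(2,3) m'(3,4) by (rule iffI)
    moreover have "R (?m - 1) ?m \<longleftrightarrow> R ?m (?m - 1)" by (rule iffI; rule R_sym)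
    ultimately show ?thesis using cut[OF m(1)] by simp
  qed (use cut q in simp)
  have RI: "R i j" if "\<forall>q. j < q \<and> q \<le> i \<longrightarrow> R q (q - 1)" "j < i" for i
    using that
  proof (induction i)
    case (Suc i)
    have s: "R (Suc i) i" using spec[OF Suc.prems(1), of "Suc i"] Suc.prems(2) by simp
    show ?case
    proof (cases "j = i")
      case False
      then have "R i j" using Suc by simp
      with s show ?thesis by (rule R_trans)
    qed (use s in simp)
  qed simp
  have PI: "P i j" if "R i j" "j < i" "i < 2*n" for i
    using that
  proof (induction i)
    case (Suc i)
    have ji: "R j i" by (rule R_convex[OF R_sym[OF Suc.prems(1)]]) (use Suc.prems in auto)
    have s: "R (Suc i) i" by (rule R_trans[OF Suc.prems(1) ji])
    then have Ps: "P (Suc i) i" using cut'[of "Suc i"] Suc.prems(3) by simp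
    show ?case
    proof (cases "j = i")
      case False
      then have "P i j" using Suc R_sym[OF ji] by simp
      with Ps show ?thesis by (rule tr[rotated 3]) (use Suc.prems in auto)
    qed (use Ps in simp)
  qed simp
  have "R q (q - 1)" if P: "P i j" and q: "j < q" "q \<le> i" for q
  proof -
    have "P q i" by (rule up) (use q ij in auto)
    then have "P q j" using P by (rule tr[rotated 3]) (use q ij in auto)
    moreover have "P j (q - 1)" by (rule up) (use q ij in auto)
    ultimately have "P q (q - 1)" by (rule tr[rotated 3]) (use q ij in auto)
    then show ?thesis using cut'[of q] q ij by simp
  qed
  then show ?thesis using RI[of i] PI[of i] ij by blast
qed

abbreviation cuts :: "nat set" where
  "cuts \<equiv> {m \<in> {1..n}. \<not> R m (m - 1)}"

definition plus_supp :: "(nat \<times> nat) set" where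
  "plus_supp = {(i, j). i < 2*n \<and> j < 2*n \<and> (j < i \<longrightarrow> R i j)}"

definition minus_supp :: "(nat \<times> nat) set" where
  "minus_supp = {(i, j). i < 2*n \<and> j < 2*n \<and> (i < j \<longrightarrow> R i j)}"

lemma plus_supp: "sp_support n plus_supp"
proof -
  interpret bl: seaweed_blocks n R r "\<lambda>_ _. True" "bar n"
    by (rule seaweed_blocks.intro[OF block_reflection_axioms total_reflection])
  have "bl.D = plus_supp" by (auto simp: bl.D_def plus_supp_def)
  then show ?thesis using bl.sp_support_axioms by simp
qed

lemma minus_supp: "sp_support n minus_supp"
proof -
  interpret bl: seaweed_blocks n "\<lambda>_ _. True" "bar n" R r
    by (rule seaweed_blocks.intro[OF total_reflection block_reflection_axioms])
  have "bl.D = minus_supp" by (auto simp: bl.D_def minus_supp_def)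
  then show ?thesis using bl.sp_support_axioms by simp
qed

text \<open>This resolves the definite description. A subalgebra containing the Borel subalgebra is
  spanned by the torus and its root vectors, and \<open>chain_eq\<close> recovers all of its roots
  from the simple ones, which gives uniqueness.\<close>

lemma parabolic_plus_cuts:
  "parabolic_plus n (simple_root n ` cuts) = (sp_support.S n plus_supp :: 'k::field_char_0 mat set)"
proof -
  interpret sp_support n plus_supp by (rule plus_supp)
  let ?S = "S :: 'k mat set"
  have Ssub: "sp_subalgebra n ?S"
    unfolding sp_subalgebra_def by (intro conjI ballI subsetI S_subspace S_commutator) (rule S_sp)
  \<comment> \<open>Injectivity of the simple roots turns the equality of sets of functionals into a
    condition on single indices m.\<close>
  have cond: "simple_root n ` cuts = {\<alpha> \<in> simple_roots n. \<not> root_space n (- \<alpha>) \<subseteq> p}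
      \<longleftrightarrow> (\<forall>m\<in>{1..n}. skew_unit n m (m - 1) \<in> p \<longleftrightarrow> R m (m - 1))"
    if p: "sp_subalgebra n p" for p :: "'k mat set"
  proof -
    have sub: "subspace class_ring p (module_mat TYPE('k) (2*n) (2*n))" using p unfolding sp_subalgebra_def by blast
    have "root_space n (- simple_root n m) \<subseteq> p \<longleftrightarrow> skew_unit n m (m - 1) \<in> p" if m: "m \<in> {1..n}" for m
    proof -
      have r: "m \<noteq> m - 1" "m < 2*n" "m - 1 < 2*n" using m by auto
      show ?thesis by (rule root_space_le_iff[OF simple_root_negative[OF m] r subspace_matD(4)[OF sub]])
    qed
    then have "{\<alpha> \<in> simple_roots n. \<not> root_space n (- \<alpha>) \<subseteq> p} = simple_root n ` {m \<in> {1..n}. skew_unit n m (m - 1) \<notin> p}"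
      unfolding simple_roots_def by blast
    moreover have "(simple_root n ` cuts :: ('k mat \<Rightarrow> 'k) set) = simple_root n ` {m \<in> {1..n}. skew_unit n m (m - 1) \<notin> p}
        \<longleftrightarrow> cuts = {m \<in> {1..n}. skew_unit n m (m - 1) \<notin> p}"
      by (rule inj_on_image_eq_iff[OF simple_root_inj]) auto
    moreover have "cuts = {m \<in> {1..n}. skew_unit n m (m - 1) \<notin> p} \<longleftrightarrow> (\<forall>m\<in>{1..n}. skew_unit n m (m - 1) \<in> p \<longleftrightarrow> R m (m - 1))"
      by blast
    ultimately show ?thesis by (simp only:)
  qed
  have units: "skew_unit n i j \<in> ?S \<longleftrightarrow> (i, j) \<in> plus_supp" if "i < 2*n" "j < 2*n" for i j
  proof (rule iffI, rule ccontr)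
    assume "skew_unit n i j \<in> ?S" "(i, j) \<notin> plus_supp"
    from S_entry[OF this(1) that this(2)] show False using skew_unit_self[OF that] by contradiction
  qed (rule skew_unit_S)
  have borel: "borel_plus n \<subseteq> ?S"
  proof
    fix X :: "'k mat" assume "X \<in> borel_plus n"
    then obtain H Y where X: "X = H + Y" and H: "H \<in> cartan n" and Y: "Y \<in> u_plus n" unfolding borel_plus_def by blast
    have Ysp: "Y \<in> sp n" using Y by (simp add: u_plus_def)
    show "X \<in> ?S"
    proof (rule SI)
      show "X \<in> sp n" unfolding X by (rule sp_add[OF cartanD(1)[OF H] Ysp])
      fix i j assume ij: "i < 2*n" "j < 2*n" "(i, j) \<notin> plus_supp"
      then have ji: "j < i" by (auto simp: plus_supp_def)
      have "H $$ (i, j) = 0" by (rule cartanD(2)[OF H ij(1,2)]) (use ji in simp)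
      moreover have "Y $$ (i, j) = 0" using Y ij ji by (simp add: u_plus_def)
      ultimately show "X $$ (i, j) = 0" unfolding X using ij sp_carrier[OF Ysp] by simp
    qed
  qed
  show ?thesis unfolding parabolic_plus_def
  proof (rule the_equality)
    have "\<forall>m\<in>{1..n}. skew_unit n m (m - 1) \<in> ?S \<longleftrightarrow> R m (m - 1)"
    proof
      fix m assume m: "m \<in> {1..n}"
      then have "m < 2*n" "m - 1 < 2*n" "m \<noteq> m - 1" "m - 1 < m" by auto
      then show "skew_unit n m (m - 1) \<in> ?S \<longleftrightarrow> R m (m - 1)" using units[of m "m - 1"] by (simp add: plus_supp_def)
    qed
    then show "sp_subalgebra n ?S \<and> borel_plus n \<subseteq> ?S \<and>
      simple_root n ` cuts = {\<alpha> \<in> simple_roots n. \<not> root_space n (- \<alpha>) \<subseteq> ?S}"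
      by (intro conjI Ssub borel) (simp only: cond[OF Ssub])
  next
    fix p :: "'k mat set"
    assume p: "sp_subalgebra n p \<and> borel_plus n \<subseteq> p \<and>
      simple_root n ` cuts = {\<alpha> \<in> simple_roots n. \<not> root_space n (- \<alpha>) \<subseteq> p}"
    note p1 = conjunct1[OF p] and p2 = conjunct1[OF conjunct2[OF p]] and p3 = conjunct2[OF conjunct2[OF p]]
    have upm: "X \<in> p" if "X \<in> u_plus n" for X
    proof -
      have "0\<^sub>m (2*n) (2*n) + X \<in> borel_plus n" unfolding borel_plus_def using cartan_zero that by blast
      moreover have "X \<in> carrier_mat (2*n) (2*n)" using that sp_carrier by (auto simp: u_plus_def)
      ultimately show ?thesis using subsetD[OF p2, of "0\<^sub>m (2*n) (2*n) + X"] by simp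
    qed
    have cm: "cartan n \<subseteq> p"
    proof
      fix H :: "'k mat" assume H: "H \<in> cartan n"
      have "0\<^sub>m (2*n) (2*n) \<in> u_plus n" by (simp add: u_plus_def sp_zero)
      then have "H + 0\<^sub>m (2*n) (2*n) \<in> borel_plus n" unfolding borel_plus_def using H by blast
      then show "H \<in> p" using subsetD[OF p2, of "H + 0\<^sub>m (2*n) (2*n)"] sp_carrier[OF cartanD(1)[OF H]] by simp
    qed
    interpret torus_subalgebra n p by (rule torus_subalgebra_of_borel[OF p1 cm])
    have up: "root_rel i j" if "i \<le> j" "j < 2*n" for i j
    proof (cases "i = j")
      case False
      have "(skew_unit n i j :: 'k mat) $$ (a, b) = 0" if ab: "a < 2*n" "b < 2*n" "b \<le> a" for a b
        by (rule skew_unit_other) (use that \<open>i \<le> j\<close> \<open>j < 2*n\<close> False ab in \<open>auto simp: bar_def\<close>)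
      then have "(skew_unit n i j :: 'k mat) \<in> u_plus n" by (simp add: u_plus_def skew_unit_sp)
      then show ?thesis using upm by (simp add: root_rel_def)
    qed (use torus that in \<open>simp add: root_rel_def\<close>)
    have "\<forall>m\<in>{1..n}. skew_unit n m (m - 1) \<in> p \<longleftrightarrow> R m (m - 1)" using p3 unfolding cond[OF p1] .
    then have cut: "root_rel m (m - 1) \<longleftrightarrow> R m (m - 1)" if "m \<in> {1..n}" for m using that by (simp add: root_rel_def)
    show "p = ?S"
    proof (rule eq_S[OF plus_supp])
      fix i j assume ij: "i < 2*n" "j < 2*n"
      show "(i, j) \<in> plus_supp \<longleftrightarrow> root_rel i j"
      proof (cases "j < i")
        case True
        have "root_rel i j \<longleftrightarrow> R i j"
          by (rule chain_eq[where P = root_rel, OF root_rel_trans root_rel_bar up cut True ij(1)])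
        then show ?thesis using True ij by (simp add: plus_supp_def)
      next
        case False
        then show ?thesis using up[of i j] ij by (simp add: plus_supp_def)
      qed
    qed
  qed
qed

text \<open>The argument for the opposite Borel subalgebra, with the root relation transposed before
  \<open>chain_eq\<close> is applied.\<close>

lemma parabolic_minus_cuts:
  "parabolic_minus n (simple_root n ` cuts) = (sp_support.S n minus_supp :: 'k::field_char_0 mat set)"
proof -
  interpret sp_support n minus_supp by (rule minus_supp)
  let ?S = "S :: 'k mat set"
  have Ssub: "sp_subalgebra n ?S"
    unfolding sp_subalgebra_def by (intro conjI ballI subsetI S_subspace S_commutator) (rule S_sp)
  have cond: "simple_root n ` cuts = {\<alpha> \<in> simple_roots n. \<not> root_space n \<alpha> \<subseteq> p}
      \<longleftrightarrow> (\<forall>m\<in>{1..n}. skew_unit n (m - 1) m \<in> p \<longleftrightarrow> R m (m - 1))"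
    if p: "sp_subalgebra n p" for p :: "'k mat set"
  proof -
    have sub: "subspace class_ring p (module_mat TYPE('k) (2*n) (2*n))" using p unfolding sp_subalgebra_def by blast
    have "root_space n (simple_root n m) \<subseteq> p \<longleftrightarrow> skew_unit n (m - 1) m \<in> p" if m: "m \<in> {1..n}" for m
    proof -
      have r: "m - 1 \<noteq> m" "m - 1 < 2*n" "m < 2*n" using m by auto
      have e: "simple_root n m H = H $$ (m - 1, m - 1) - H $$ (m, m)" if "H \<in> cartan n" for H :: "'k mat"
      proof -
        have "- (simple_root n m H) = H $$ (m, m) - H $$ (m - 1, m - 1)"
          using simple_root_negative[OF m that] by (simp only: uminus_apply)
        then have "- (- simple_root n m H) = - (H $$ (m, m) - H $$ (m - 1, m - 1))" by (rule arg_cong)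
        then show ?thesis by (simp only: minus_minus minus_diff_eq)
      qed
      show ?thesis by (rule root_space_le_iff[OF e r subspace_matD(4)[OF sub]])
    qed
    then have "{\<alpha> \<in> simple_roots n. \<not> root_space n \<alpha> \<subseteq> p} = simple_root n ` {m \<in> {1..n}. skew_unit n (m - 1) m \<notin> p}"
      unfolding simple_roots_def by blast
    moreover have "(simple_root n ` cuts :: ('k mat \<Rightarrow> 'k) set) = simple_root n ` {m \<in> {1..n}. skew_unit n (m - 1) m \<notin> p}
        \<longleftrightarrow> cuts = {m \<in> {1..n}. skew_unit n (m - 1) m \<notin> p}"
      by (rule inj_on_image_eq_iff[OF simple_root_inj]) auto
    moreover have "cuts = {m \<in> {1..n}. skew_unit n (m - 1) m \<notin> p} \<longleftrightarrow> (\<forall>m\<in>{1..n}. skew_unit n (m - 1) m \<in> p \<longleftrightarrow> R m (m - 1))"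
      by blast
    ultimately show ?thesis by (simp only:)
  qed
  have units: "skew_unit n i j \<in> ?S \<longleftrightarrow> (i, j) \<in> minus_supp" if "i < 2*n" "j < 2*n" for i j
  proof (rule iffI, rule ccontr)
    assume "skew_unit n i j \<in> ?S" "(i, j) \<notin> minus_supp"
    from S_entry[OF this(1) that this(2)] show False using skew_unit_self[OF that] by contradiction
  qed (rule skew_unit_S)
  have borel: "borel_minus n \<subseteq> ?S"
  proof
    fix X :: "'k mat" assume "X \<in> borel_minus n"
    then obtain H Y where X: "X = H + Y" and H: "H \<in> cartan n" and Y: "Y \<in> u_minus n" unfolding borel_minus_def by blast
    have Ysp: "Y \<in> sp n" using Y by (simp add: u_minus_def)
    show "X \<in> ?S"
    proof (rule SI)
      show "X \<in> sp n" unfolding X by (rule sp_add[OF cartanD(1)[OF H] Ysp])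
      fix i j assume ij: "i < 2*n" "j < 2*n" "(i, j) \<notin> minus_supp"
      then have ji: "i < j" by (auto simp: minus_supp_def)
      have "H $$ (i, j) = 0" by (rule cartanD(2)[OF H ij(1,2)]) (use ji in simp)
      moreover have "Y $$ (i, j) = 0" using Y ij ji by (simp add: u_minus_def)
      ultimately show "X $$ (i, j) = 0" unfolding X using ij sp_carrier[OF Ysp] by simp
    qed
  qed
  show ?thesis unfolding parabolic_minus_def
  proof (rule the_equality)
    have "\<forall>m\<in>{1..n}. skew_unit n (m - 1) m \<in> ?S \<longleftrightarrow> R m (m - 1)"
    proof
      fix m assume m: "m \<in> {1..n}"
      then have "m < 2*n" "m - 1 < 2*n" "m - 1 \<noteq> m" "m - 1 < m" by auto
      moreover have "R (m - 1) m \<longleftrightarrow> R m (m - 1)" using R_sym by blast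
      ultimately show "skew_unit n (m - 1) m \<in> ?S \<longleftrightarrow> R m (m - 1)" using units[of "m - 1" m] by (simp add: minus_supp_def)
    qed
    then show "sp_subalgebra n ?S \<and> borel_minus n \<subseteq> ?S \<and>
      simple_root n ` cuts = {\<alpha> \<in> simple_roots n. \<not> root_space n \<alpha> \<subseteq> ?S}"
      by (intro conjI Ssub borel) (simp only: cond[OF Ssub])
  next
    fix p :: "'k mat set"
    assume p: "sp_subalgebra n p \<and> borel_minus n \<subseteq> p \<and>
      simple_root n ` cuts = {\<alpha> \<in> simple_roots n. \<not> root_space n \<alpha> \<subseteq> p}"
    note p1 = conjunct1[OF p] and p2 = conjunct1[OF conjunct2[OF p]] and p3 = conjunct2[OF conjunct2[OF p]]
    have upm: "X \<in> p" if "X \<in> u_minus n" for X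
    proof -
      have "0\<^sub>m (2*n) (2*n) + X \<in> borel_minus n" unfolding borel_minus_def using cartan_zero that by blast
      moreover have "X \<in> carrier_mat (2*n) (2*n)" using that sp_carrier by (auto simp: u_minus_def)
      ultimately show ?thesis using subsetD[OF p2, of "0\<^sub>m (2*n) (2*n) + X"] by simp
    qed
    have cm: "cartan n \<subseteq> p"
    proof
      fix H :: "'k mat" assume H: "H \<in> cartan n"
      have "0\<^sub>m (2*n) (2*n) \<in> u_minus n" by (simp add: u_minus_def sp_zero)
      then have "H + 0\<^sub>m (2*n) (2*n) \<in> borel_minus n" unfolding borel_minus_def using H by blast
      then show "H \<in> p" using subsetD[OF p2, of "H + 0\<^sub>m (2*n) (2*n)"] sp_carrier[OF cartanD(1)[OF H]] by simp
    qed
    interpret torus_subalgebra n p by (rule torus_subalgebra_of_borel[OF p1 cm])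
    have up: "root_rel j i" if "i \<le> j" "j < 2*n" for i j
    proof (cases "i = j")
      case False
      have "(skew_unit n j i :: 'k mat) $$ (a, b) = 0" if ab: "a < 2*n" "b < 2*n" "a \<le> b" for a b
        by (rule skew_unit_other) (use that \<open>i \<le> j\<close> \<open>j < 2*n\<close> False ab in \<open>auto simp: bar_def\<close>)
      then have "(skew_unit n j i :: 'k mat) \<in> u_minus n" by (simp add: u_minus_def skew_unit_sp)
      then show ?thesis using upm by (simp add: root_rel_def)
    qed (use torus that in \<open>simp add: root_rel_def\<close>)
    have "\<forall>m\<in>{1..n}. skew_unit n (m - 1) m \<in> p \<longleftrightarrow> R m (m - 1)" using p3 unfolding cond[OF p1] .
    then have cut: "root_rel (m - 1) m \<longleftrightarrow> R m (m - 1)" if "m \<in> {1..n}" for m using that by (simp add: root_rel_def)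
    show "p = ?S"
    proof (rule eq_S[OF minus_supp])
      fix i j assume ij: "i < 2*n" "j < 2*n"
      show "(i, j) \<in> minus_supp \<longleftrightarrow> root_rel i j"
      proof (cases "i < j")
        case True
        have "root_rel i j \<longleftrightarrow> R j i"
          by (rule chain_eq[where P = "\<lambda>x y. root_rel y x", OF root_rel_trans root_rel_bar up cut True ij(2)])
        moreover have "R i j \<longleftrightarrow> R j i" using R_sym by blast
        ultimately show ?thesis using True ij by (simp add: minus_supp_def)
      next
        case False
        then show ?thesis using up[of j i] ij by (simp add: minus_supp_def)
      qed
    qed
  qed
qed

end

lemma (in seaweed_blocks) seaweed_cuts:
  "seaweed n (simple_root n ` A.cuts) (simple_root n ` B.cuts) = (S :: 'k::field_char_0 mat set)"
proof -
  interpret P: sp_support n A.plus_supp by (rule A.plus_supp)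
  interpret M: sp_support n B.minus_supp by (rule B.minus_supp)
  have "D = A.plus_supp \<inter> B.minus_supp" by (auto simp: D_def A.plus_supp_def B.minus_supp_def)
  then show ?thesis
    unfolding seaweed_def A.parabolic_plus_cuts B.parabolic_minus_cuts P.S_def M.S_def S_def by blast
qed

section \<open>Blocks of a composition\<close>

definition psum :: "nat list \<Rightarrow> nat \<Rightarrow> nat" where
  "psum a k = sum_list (take k a)"

lemma psum_Suc: "k < length a \<Longrightarrow> psum a (Suc k) = psum a k + a ! k"
  by (simp add: psum_def take_Suc_conv_app_nth)

lemma psum_0 [simp]: "psum a 0 = 0"
  by (simp add: psum_def)

lemma psum_length: "psum a (length a) = sum_list a"
  by (simp add: psum_def)

lemma psum_mono: "i \<le> j \<Longrightarrow> psum a i \<le> psum a j"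
proof -
  have s: "psum a k \<le> psum a (Suc k)" for k
  proof (cases "k < length a")
    case False
    then show ?thesis by (simp add: psum_def)
  qed (simp add: psum_Suc)
  assume "i \<le> j"
  with s show ?thesis by (rule lift_Suc_mono_le)
qed

lemma psum_le: "psum a k \<le> sum_list a"
proof (cases "k \<le> length a")
  case True
  then show ?thesis using psum_mono[of k "length a" a] psum_length[of a] by simp
qed (simp add: psum_def)

lemma block_exists:
  assumes "0 < v" "v \<le> sum_list a"
  obtains k where "k < length a" "psum a k < v" "v \<le> psum a (Suc k)"
proof -
  have l: "v \<le> psum a (length a)" using assms by (simp add: psum_length)
  define m where "m = (LEAST k. v \<le> psum a k)"
  have m: "v \<le> psum a m" "m \<le> length a"
    unfolding m_def by (rule LeastI[where P = "\<lambda>k. v \<le> psum a k", OF l], rule Least_le[where P = "\<lambda>k. v \<le> psum a k", OF l])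
  have "m \<noteq> 0" using m(1) assms(1) by (cases m) auto
  then obtain k where k: "m = Suc k" by (cases m) auto
  have "\<not> v \<le> psum a k" by (rule not_less_Least) (use k in \<open>simp add: m_def\<close>)
  then show thesis using that[of k] m k by simp
qed

lemma block_unique:
  assumes "psum a i < v" "v \<le> psum a (Suc i)" "psum a k < v" "v \<le> psum a (Suc k)"
  shows "i = k"
proof (rule ccontr)
  assume "i \<noteq> k"
  then consider "Suc i \<le> k" | "Suc k \<le> i" by linarith
  then show False using psum_mono[of "Suc i" k a] psum_mono[of "Suc k" i a] assms by cases linarith+
qed

definition mate :: "nat list \<Rightarrow> nat \<Rightarrow> nat" where
  "mate a v = (if \<exists>k. {v, k} \<in> block_edges a then (THE k. {v, k} \<in> block_edges a) else v)"

lemma block_edge_iff: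
  "{j, k} \<in> block_edges a \<longleftrightarrow> j \<noteq> k \<and> (\<exists>i<length a. psum a i < j \<and> j \<le> psum a (Suc i) \<and>
    psum a i < k \<and> k \<le> psum a (Suc i) \<and> j + k = psum a i + psum a (Suc i) + 1)"
proof -
  have e: "2 * sum_list (take i a) + a ! i + 1 = psum a i + psum a (Suc i) + 1" if "i < length a" for i
    using psum_Suc[OF that] by (simp add: psum_def)
  have bl: "v \<in> block a i \<longleftrightarrow> psum a i < v \<and> v \<le> psum a (Suc i)" for v i by (simp add: block_def psum_def)
  show ?thesis
  proof
    assume "{j, k} \<in> block_edges a"
    then obtain i j' k' where d: "{j, k} = {j', k'}" and h: "i < length a" "j' \<in> block a i" "k' \<in> block a i" "j' \<noteq> k'"
      "j' + k' = 2 * sum_list (take i a) + a ! i + 1" unfolding block_edges_def by blast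
    from d have "j = j' \<and> k = k' \<or> j = k' \<and> k = j'" by (simp add: doubleton_eq_iff)
    then show "j \<noteq> k \<and> (\<exists>i<length a. psum a i < j \<and> j \<le> psum a (Suc i) \<and>
      psum a i < k \<and> k \<le> psum a (Suc i) \<and> j + k = psum a i + psum a (Suc i) + 1)"
      using h(1) h(2-5)[unfolded bl e[OF h(1)]] by (intro conjI exI[where x = i]) auto
  next
    assume "j \<noteq> k \<and> (\<exists>i<length a. psum a i < j \<and> j \<le> psum a (Suc i) \<and>
      psum a i < k \<and> k \<le> psum a (Suc i) \<and> j + k = psum a i + psum a (Suc i) + 1)"
    then obtain i where i: "i < length a" and h: "j \<in> block a i" "k \<in> block a i" "j \<noteq> k" "j + k = 2 * sum_list (take i a) + a ! i + 1"
      unfolding bl using e by metis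
    then show "{j, k} \<in> block_edges a" unfolding block_edges_def by blast
  qed
qed

lemma block_edge_mate: "{v, k} \<in> block_edges a \<longleftrightarrow> k = mate a v \<and> k \<noteq> v"
proof -
  have uniq: "x = y" if x: "{v, x} \<in> block_edges a" and y: "{v, y} \<in> block_edges a" for x y
  proof -
    obtain i where i: "psum a i < v" "v \<le> psum a (Suc i)" "v + x = psum a i + psum a (Suc i) + 1"
      using x unfolding block_edge_iff by blast
    obtain i' where i': "psum a i' < v" "v \<le> psum a (Suc i')" "v + y = psum a i' + psum a (Suc i') + 1"
      using y unfolding block_edge_iff by blast
    have "i = i'" by (rule block_unique[OF i(1,2) i'(1,2)])
    then show ?thesis using i(3) i'(3) by simp
  qed
  show ?thesis
  proof (cases "\<exists>x. {v, x} \<in> block_edges a")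
    case True
    then obtain x where x: "{v, x} \<in> block_edges a" by blast
    have "(THE k. {v, k} \<in> block_edges a) = x" by (rule the_equality, rule x, rule uniq[OF _ x])
    then have m: "mate a v = x" using True by (simp add: mate_def)
    have "x \<noteq> v" using x unfolding block_edge_iff by blast
    then show ?thesis using x uniq[OF _ x, of k] unfolding m by blast
  next
    case False
    then have "mate a v = v" by (simp add: mate_def)
    then show ?thesis using False by auto
  qed
qed

text \<open>The equation also holds at the centre of an odd block: there it makes v its own mate, in
  agreement with the default value in \<open>mate\<close>.\<close>

lemma mate_block:
  assumes "k < length a" "psum a k < v" "v \<le> psum a (Suc k)"
  shows "mate a v + v = psum a k + psum a (Suc k) + 1"
proof -
  define w where "w = psum a k + psum a (Suc k) + 1 - v"
  have w: "psum a k < w" "w \<le> psum a (Suc k)" "v + w = psum a k + psum a (Suc k) + 1"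
    using assms by (auto simp: w_def)
  show ?thesis
  proof (cases "w = v")
    case True
    have "mate a v = v"
    proof (rule ccontr)
      assume "mate a v \<noteq> v"
      then have "{v, mate a v} \<in> block_edges a" unfolding block_edge_mate by blast
      then obtain i where i: "psum a i < v" "v \<le> psum a (Suc i)" "v + mate a v = psum a i + psum a (Suc i) + 1"
        unfolding block_edge_iff by blast
      have "i = k" by (rule block_unique[OF i(1,2) assms(2,3)])
      then show False using i(3) w(3) True \<open>mate a v \<noteq> v\<close> by simp
    qed
    then show ?thesis using True w(3) by simp
  next
    case False
    then have "{v, w} \<in> block_edges a" unfolding block_edge_iff using assms w by (intro conjI exI[where x = k]) auto
    then have "w = mate a v" unfolding block_edge_mate by blast
    then show ?thesis using w(3) by simp
  qed
qed

lemma mate_outside: "v = 0 \<or> sum_list a < v \<Longrightarrow> mate a v = v"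
proof (rule ccontr)
  assume v: "v = 0 \<or> sum_list a < v" and "mate a v \<noteq> v"
  then have "{v, mate a v} \<in> block_edges a" unfolding block_edge_mate by blast
  then obtain i where "psum a i < v" "v \<le> psum a (Suc i)" unfolding block_edge_iff by blast
  then show False using v psum_le[of a "Suc i"] by linarith
qed

lemma mate_mate: "mate a (mate a v) = v"
proof (cases "v = 0 \<or> sum_list a < v")
  case True
  then show ?thesis using mate_outside by simp
next
  case False
  then obtain k where k: "k < length a" "psum a k < v" "v \<le> psum a (Suc k)" by (auto intro: block_exists[of v a])
  have e: "mate a v + v = psum a k + psum a (Suc k) + 1" by (rule mate_block[OF k])
  have "mate a (mate a v) + mate a v = psum a k + psum a (Suc k) + 1" by (rule mate_block[OF k(1)]) (use e k in linarith)+
  then show ?thesis using e by linarith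
qed

text \<open>The boundaries of a symmetric composition of 2n: the parts of \<open>a\<close>, a middle
  part of size 2 (n - sum of a), and the parts of \<open>a\<close> reversed. If the sum is n, the
  two middle boundaries coincide and the middle block is empty.\<close>

definition cutset :: "nat \<Rightarrow> nat list \<Rightarrow> nat set" where
  "cutset n a = psum a ` {..length a} \<union> (\<lambda>k. 2*n - psum a k) ` {..length a}"

definition same_block :: "nat \<Rightarrow> nat list \<Rightarrow> nat \<Rightarrow> nat \<Rightarrow> bool" where
  "same_block n a i j \<longleftrightarrow> (\<forall>q\<in>cutset n a. q \<le> i \<longleftrightarrow> q \<le> j)"

definition lower_cut :: "nat \<Rightarrow> nat list \<Rightarrow> nat \<Rightarrow> nat" where
  "lower_cut n a i = Max {q \<in> cutset n a. q \<le> i}"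

definition upper_cut :: "nat \<Rightarrow> nat list \<Rightarrow> nat \<Rightarrow> nat" where
  "upper_cut n a i = Min {q \<in> cutset n a. i < q}"

text \<open>Reversal of the half-open interval from \<open>lower_cut\<close> to
  \<open>upper_cut\<close>; the upper end does not belong to the block, hence the
  \<open>Suc\<close>.\<close>

definition reflect :: "nat \<Rightarrow> nat list \<Rightarrow> nat \<Rightarrow> nat" where
  "reflect n a i = lower_cut n a i + upper_cut n a i - Suc i"

lemma finite_cutset: "finite (cutset n a)"
  by (simp add: cutset_def)

context
  fixes n :: nat and a :: "nat list"
  assumes a: "a \<in> strings_le n"
begin

lemma psum_le_n: "psum a k \<le> n"
  using psum_le[of a k] a by (simp add: strings_le_def)

lemma cutset_le: "q \<in> cutset n a \<Longrightarrow> q \<le> 2*n"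
  using psum_le_n by (auto simp: cutset_def intro: order_trans[of _ n])

lemma cutset_mirror: "q \<in> cutset n a \<Longrightarrow> 2*n - q \<in> cutset n a"
proof -
  have "2*n - (2*n - psum a k) = psum a k" for k using psum_le_n[of k] by simp
  then show "q \<in> cutset n a \<Longrightarrow> 2*n - q \<in> cutset n a" unfolding cutset_def by auto
qed

lemma cutset_0: "0 \<in> cutset n a" and cutset_2n: "2*n \<in> cutset n a"
proof -
  have "psum a 0 \<in> cutset n a" unfolding cutset_def by blast
  then show z: "0 \<in> cutset n a" by simp
  show "2*n \<in> cutset n a" using cutset_mirror[OF z] by simp
qed

lemma cuts_around:
  assumes "i < 2*n"
  shows "lower_cut n a i \<in> cutset n a" "upper_cut n a i \<in> cutset n a" "lower_cut n a i \<le> i" "i < upper_cut n a i"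
    "q \<in> cutset n a \<Longrightarrow> q \<le> lower_cut n a i \<or> upper_cut n a i \<le> q"
proof -
  let ?L = "{q \<in> cutset n a. q \<le> i}" and ?U = "{q \<in> cutset n a. i < q}"
  have fin: "finite ?L" "finite ?U" using finite_cutset by auto
  have ne: "?L \<noteq> {}" "?U \<noteq> {}" using cutset_0 cutset_2n assms by auto
  have "lower_cut n a i \<in> ?L" "upper_cut n a i \<in> ?U"
    unfolding lower_cut_def upper_cut_def by (rule Max_in[OF fin(1) ne(1)], rule Min_in[OF fin(2) ne(2)])
  then show "lower_cut n a i \<in> cutset n a" "upper_cut n a i \<in> cutset n a" "lower_cut n a i \<le> i" "i < upper_cut n a i" by auto
  assume q: "q \<in> cutset n a"
  show "q \<le> lower_cut n a i \<or> upper_cut n a i \<le> q"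
  proof (cases "q \<le> i")
    case True
    then show ?thesis unfolding lower_cut_def using q fin(1) by (intro disjI1 Max_ge) auto
  next
    case False
    then show ?thesis unfolding upper_cut_def using q fin(2) by (intro disjI2 Min_le) auto
  qed
qed

lemma cuts_unique:
  assumes "i < 2*n" "l \<in> cutset n a" "h \<in> cutset n a" "l \<le> i" "i < h" "\<And>q. q \<in> cutset n a \<Longrightarrow> q \<le> l \<or> h \<le> q"
  shows "lower_cut n a i = l" "upper_cut n a i = h"
  using cuts_around(5)[OF assms(1,2)] cuts_around(5)[OF assms(1,3)] cuts_around(3,4)[OF assms(1)]
    assms(6)[OF cuts_around(1)[OF assms(1)]] assms(6)[OF cuts_around(2)[OF assms(1)]] assms(4,5) by linarith+

lemma reflect_between:
  assumes "i < 2*n"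
  shows "lower_cut n a i \<le> reflect n a i" "reflect n a i < upper_cut n a i" "reflect n a i < 2*n"
    "i + reflect n a i + 1 = lower_cut n a i + upper_cut n a i"
proof -
  note c = cuts_around(3,4)[OF assms] cutset_le[OF cuts_around(2)[OF assms]]
  show "lower_cut n a i \<le> reflect n a i" "reflect n a i < upper_cut n a i" "reflect n a i < 2*n"
    "i + reflect n a i + 1 = lower_cut n a i + upper_cut n a i"
    using c unfolding reflect_def by linarith+
qed

lemma cuts_between:
  assumes "i < 2*n" "lower_cut n a i \<le> j" "j < upper_cut n a i"
  shows "lower_cut n a j = lower_cut n a i" "upper_cut n a j = upper_cut n a i" "same_block n a i j"
proof -
  have j: "j < 2*n" using assms(3) cutset_le[OF cuts_around(2)[OF assms(1)]] by linarith
  show "lower_cut n a j = lower_cut n a i" "upper_cut n a j = upper_cut n a i"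
    by (rule cuts_unique[OF j cuts_around(1,2)[OF assms(1)] assms(2,3) cuts_around(5)[OF assms(1)]], assumption)+
  show "same_block n a i j" unfolding same_block_def
  proof
    fix q assume q: "q \<in> cutset n a"
    show "q \<le> i \<longleftrightarrow> q \<le> j" using cuts_around(5)[OF assms(1) q] cuts_around(3,4)[OF assms(1)] assms(2,3) by linarith
  qed
qed

lemma block_reflection_reflect: "block_reflection n (same_block n a) (reflect n a)"
proof
  fix i j k
  show "same_block n a i i" by (simp add: same_block_def)
  show "same_block n a j i" if "same_block n a i j" using that unfolding same_block_def by blast
  show "same_block n a i k" if "same_block n a i j" "same_block n a j k" using that unfolding same_block_def by blast
  show "same_block n a i j" if "same_block n a i k" "i \<le> j" "j \<le> k"
    unfolding same_block_def
  proof
    fix q assume "q \<in> cutset n a"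
    then have "q \<le> i \<longleftrightarrow> q \<le> k" using that(1) unfolding same_block_def by blast
    then show "q \<le> i \<longleftrightarrow> q \<le> j" using that(2,3) by linarith
  qed
  show "same_block n a (bar n i) (bar n j)" if "i < 2*n" "j < 2*n" "same_block n a i j"
    unfolding same_block_def
  proof
    fix q assume q: "q \<in> cutset n a"
    have "2*n - q \<le> i \<longleftrightarrow> 2*n - q \<le> j" using that(3) cutset_mirror[OF q] unfolding same_block_def by blast
    then show "q \<le> bar n i \<longleftrightarrow> q \<le> bar n j" using that(1,2) cutset_le[OF q] unfolding bar_def by linarith
  qed
  show "reflect n a i < 2*n" if "i < 2*n" by (rule reflect_between(3)[OF that])
  show "same_block n a i (reflect n a i)" if "i < 2*n"
    by (rule cuts_between(3)[OF that reflect_between(1,2)[OF that]])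
  show "reflect n a (reflect n a i) = i" if i: "i < 2*n"
  proof -
    note c = cuts_between[OF i reflect_between(1,2)[OF i]]
    show ?thesis using reflect_between(4)[OF i] reflect_between(4)[OF reflect_between(3)[OF i]] unfolding c(1,2) by linarith
  qed
  show "i + reflect n a i = j + reflect n a j" if i: "i < 2*n" and j: "j < 2*n" and R: "same_block n a i j"
  proof -
    have "lower_cut n a i \<le> j" using R cuts_around(1,3)[OF i] unfolding same_block_def by blast
    moreover have "\<not> upper_cut n a i \<le> j" using R cuts_around(2,4)[OF i] unfolding same_block_def by (meson not_le)
    ultimately have c: "lower_cut n a j = lower_cut n a i" "upper_cut n a j = upper_cut n a i"
      using cuts_between(1,2)[OF i, of j] by auto
    show ?thesis using reflect_between(4)[OF i] reflect_between(4)[OF j] unfolding c by linarith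
  qed
  show "reflect n a (bar n i) = bar n (reflect n a i)" if i: "i < 2*n"
  proof -
    have bi: "bar n i < 2*n" using i by simp
    note h = cutset_le[OF cuts_around(2)[OF i]] and lh = cuts_around(3,4)[OF i]
    have 1: "2*n - upper_cut n a i \<le> bar n i" "bar n i < 2*n - lower_cut n a i"
      using h lh i unfolding bar_def by linarith+
    have 2: "q \<le> 2*n - upper_cut n a i \<or> 2*n - lower_cut n a i \<le> q" if q: "q \<in> cutset n a" for q
      using cuts_around(5)[OF i cutset_mirror[OF q]] cutset_le[OF q] by linarith
    note c = cuts_unique[OF bi cutset_mirror[OF cuts_around(2)[OF i]] cutset_mirror[OF cuts_around(1)[OF i]] 1 2]
    have "bar n i + reflect n a (bar n i) + 1 = (2*n - upper_cut n a i) + (2*n - lower_cut n a i)"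
      using reflect_between(4)[OF bi] c by simp
    then show ?thesis using reflect_between(4)[OF i] reflect_between(3)[OF i] h lh i unfolding bar_def by linarith
  qed
qed

text \<open>A vertex within the sum of \<open>a\<close> has its whole block in the first half, where
  the reflection is the mate shifted by one. A vertex beyond the sum lies in the middle block, whose
  reversal is the mirror; this is how the tail is recognised on matrix indices.\<close>

lemma reflect_mate:
  assumes v: "v \<in> {1..n}"
  shows "vtx n (reflect n a (v - 1)) = mate a v" "reflect n a (v - 1) = bar n (v - 1) \<longleftrightarrow> sum_list a < v"
proof -
  have i: "v - 1 < 2*n" and v': "1 \<le> v" "v \<le> n" using v by auto
  have mem: "psum a k \<in> cutset n a" if "k \<le> length a" for k using that unfolding cutset_def by blast
  have cut: "\<exists>m\<le>length a. q = psum a m \<or> q = 2*n - psum a m" if "q \<in> cutset n a" for q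
    using that unfolding cutset_def by blast
  have "vtx n (reflect n a (v - 1)) = mate a v \<and> (reflect n a (v - 1) = bar n (v - 1) \<longleftrightarrow> sum_list a < v)"
  proof (cases "sum_list a < v")
    case True
    have s: "sum_list a \<in> cutset n a" using mem[of "length a"] by (simp add: psum_length)
    have "lower_cut n a (v - 1) = sum_list a \<and> upper_cut n a (v - 1) = 2*n - sum_list a"
    proof (intro conjI; rule cuts_unique[OF i s cutset_mirror[OF s]])
      show "q \<le> sum_list a \<or> 2*n - sum_list a \<le> q" if q: "q \<in> cutset n a" for q
      proof -
        obtain m where "q = psum a m \<or> q = 2*n - psum a m" using cut[OF q] by blast
        then show ?thesis using psum_le[of a m] by linarith
      qed
      then show "q \<le> sum_list a \<or> 2*n - sum_list a \<le> q" if q: "q \<in> cutset n a" for q using that by blast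
    qed (use True v' in linarith)+
    then have "(v - 1) + reflect n a (v - 1) + 1 = 2*n" using reflect_between(4)[OF i] psum_le_n[of "length a"]
      by (simp add: psum_length)
    then have r: "reflect n a (v - 1) = bar n (v - 1)" unfolding bar_def by linarith
    have "vtx n (v - 1) = v" using v' by (auto simp: vtx_def)
    then show ?thesis using r vtx_bar[OF i] mate_outside[of v a] True by simp
  next
    case False
    then obtain k where k: "k < length a" "psum a k < v" "v \<le> psum a (Suc k)" using v' by (auto intro: block_exists[of v a])
    have "q \<le> psum a k \<or> psum a (Suc k) \<le> q" if q: "q \<in> cutset n a" for q
    proof -
      obtain m where "q = psum a m \<or> q = 2*n - psum a m" using cut[OF q] by blast
      moreover have "psum a m \<le> psum a k \<or> psum a (Suc k) \<le> psum a m"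
        using psum_mono[of m k a] psum_mono[of "Suc k" m a] by (cases "m \<le> k") auto
      ultimately show ?thesis using psum_le_n[of m] psum_le_n[of "Suc k"] by linarith
    qed
    note cu = cuts_unique[OF i mem mem _ _ this]
    have "lower_cut n a (v - 1) = psum a k" "upper_cut n a (v - 1) = psum a (Suc k)"
      by (rule cu; use k v' in linarith)+
    then have e: "(v - 1) + reflect n a (v - 1) + 1 = psum a k + psum a (Suc k)" and lt: "reflect n a (v - 1) < psum a (Suc k)"
      using reflect_between(2,4)[OF i] by simp_all
    have rn: "reflect n a (v - 1) < n" using lt psum_le_n[of "Suc k"] by linarith
    have "mate a v + v = psum a k + psum a (Suc k) + 1" by (rule mate_block[OF k])
    then have "vtx n (reflect n a (v - 1)) = mate a v" using rn e v' by (simp add: vtx_def)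
    moreover have "reflect n a (v - 1) \<noteq> bar n (v - 1)" using rn v' unfolding bar_def by linarith
    ultimately show ?thesis using False by simp
  qed
  then show "vtx n (reflect n a (v - 1)) = mate a v" "reflect n a (v - 1) = bar n (v - 1) \<longleftrightarrow> sum_list a < v" by blast+
qed

lemma vtx_reflect: assumes i: "i < 2*n" shows "vtx n (reflect n a i) = mate a (vtx n i)"
proof (cases "i < n")
  case True
  then have "Suc i \<in> {1..n}" "vtx n i = Suc i" by (auto simp: vtx_def)
  then show ?thesis using reflect_mate(1)[of "Suc i"] by simp
next
  case False
  interpret block_reflection n "same_block n a" "reflect n a" by (rule block_reflection_reflect)
  have "vtx n i \<in> {1..n}" "vtx n i - 1 = bar n i" using i False by (auto simp: vtx_def bar_def)
  then have "vtx n (reflect n a (bar n i)) = mate a (vtx n i)" using reflect_mate(1)[of "vtx n i"] by simp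
  then show ?thesis unfolding r_bar[OF i] vtx_bar[OF r_less[OF i]] .
qed

text \<open>The indices m - 1 and m are separated exactly when m is a boundary. Among 1, ..., n the
  boundaries are the nonempty partial sums, since a mirrored boundary there can only be n itself,
  which is then also a partial sum.\<close>

lemma phi_C_cuts: "phi_C n a = simple_root n ` {m \<in> {1..n}. \<not> same_block n a m (m - 1)}"
proof -
  have pos: "0 < psum a i" if "1 \<le> i" "i \<le> length a" for i
  proof -
    have l: "0 < length a" using that by linarith
    have "a ! 0 \<in> set a" by (rule nth_mem[OF l])
    then have "0 < a ! 0" using a unfolding strings_le_def by blast
    moreover have "psum a (Suc 0) = a ! 0" using psum_Suc[OF l] by simp
    ultimately show ?thesis using psum_mono[of "Suc 0" i a] that by simp
  qed
  have same: "\<not> same_block n a m (m - 1) \<longleftrightarrow> m \<in> cutset n a" if "1 \<le> m" for m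
  proof
    assume "\<not> same_block n a m (m - 1)"
    then obtain q where q: "q \<in> cutset n a" "\<not> (q \<le> m \<longleftrightarrow> q \<le> m - 1)" unfolding same_block_def by blast
    then have "q = m" by linarith
    then show "m \<in> cutset n a" using q(1) by simp
  next
    assume "m \<in> cutset n a"
    moreover have "\<not> (m \<le> m \<longleftrightarrow> m \<le> m - 1)" using that by linarith
    ultimately show "\<not> same_block n a m (m - 1)" unfolding same_block_def by blast
  qed
  have "{m \<in> {1..n}. \<not> same_block n a m (m - 1)} = psum a ` {1..length a}"
  proof (rule equalityI; rule subsetI)
    fix m assume m: "m \<in> {m \<in> {1..n}. \<not> same_block n a m (m - 1)}"
    then have m1: "1 \<le> m" "m \<le> n" by auto
    then have "m \<in> cutset n a" using m same by blast
    then obtain k where k: "k \<le> length a" "m = psum a k \<or> m = 2*n - psum a k" unfolding cutset_def by blast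
    then have e: "m = psum a k" using psum_le_n[of k] m1 by linarith
    then have "k \<noteq> 0" using m1 by (cases k) auto
    then have "k \<in> {1..length a}" using k(1) by simp
    then show "m \<in> psum a ` {1..length a}" unfolding e by (rule imageI)
  next
    fix m assume "m \<in> psum a ` {1..length a}"
    then obtain k where k: "m = psum a k" "1 \<le> k" "k \<le> length a" by auto
    have "1 \<le> m" using pos[OF k(2,3)] k(1) by simp
    moreover have "m \<le> n" unfolding k(1) by (rule psum_le_n)
    moreover have "m \<in> cutset n a" using k(1,3) unfolding cutset_def by blast
    ultimately show "m \<in> {m \<in> {1..n}. \<not> same_block n a m (m - 1)}" using same by simp
  qed
  then show ?thesis unfolding phi_C_def psum_def[symmetric] by auto
qed

end

section \<open>From the meander to the two index formulas\<close>

lemma block_edges_mate: "block_edges a = {{v, mate a v} | v. mate a v \<noteq> v}"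
proof (rule equalityI; rule subsetI)
  fix e assume e: "e \<in> block_edges a"
  then obtain j k where jk: "e = {j, k}" unfolding block_edges_def by blast
  then have "k = mate a j \<and> k \<noteq> j" using e unfolding jk block_edge_mate by blast
  then show "e \<in> {{v, mate a v} | v. mate a v \<noteq> v}" using jk by blast
next
  fix e assume "e \<in> {{v, mate a v} | v. mate a v \<noteq> v}"
  then obtain v where "e = {v, mate a v}" "mate a v \<noteq> v" by blast
  then show "e \<in> block_edges a" unfolding block_edge_mate[of v "mate a v" a, symmetric] using block_edge_mate[of v "mate a v" a] by simp
qed

text \<open>A vertex in both tails counts twice in the sum of the two cardinalities and not at all
  in the symmetric difference. As that sum is at most 2, being 0 or 2 means the same for both
  counts. Cyclic components belong to both families and provide the extra summand.\<close>

lemma (in meander_components) card_loop_free_closed_up: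
  "card loop_free + card closed_up = card {K \<in> \<K>. cyclic K} + card {K \<in> \<K>. card (K \<inter> sym_diff Ta Tb) \<in> {0, 2}}"
proof -
  let ?C = "{K \<in> \<K>. cyclic K}"
  have mem: "card (K \<inter> sym_diff Ta Tb) \<in> {0, 2} \<longleftrightarrow> K \<in> loop_free \<or> K \<in> closed_up - ?C" if K: "K \<in> \<K>" for K
  proof -
    have fK: "finite K" by (rule K_finite[OF K])
    let ?s = "card (K \<inter> sym_diff Ta Tb)" and ?c = "card (K \<inter> Ta \<inter> Tb)"
    have 1: "card (K \<inter> Ta) = ?c + card (K \<inter> Ta - Tb)" by (rule card_Int_Diff) (use fK in simp)
    have 2: "card (K \<inter> Tb) = card (K \<inter> Tb \<inter> Ta) + card (K \<inter> Tb - Ta)" by (rule card_Int_Diff) (use fK in simp)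
    have 3: "K \<inter> Tb \<inter> Ta = K \<inter> Ta \<inter> Tb" by blast
    have 4: "K \<inter> sym_diff Ta Tb = (K \<inter> Ta - Tb) \<union> (K \<inter> Tb - Ta)" by blast
    have 5: "?s = card (K \<inter> Ta - Tb) + card (K \<inter> Tb - Ta)" unfolding 4 by (rule card_Un_disjoint) (use fK in auto)
    have tau: "card (K \<inter> Ta) + card (K \<inter> Tb) = ?s + 2 * ?c" using 1 2 5 unfolding 3 by linarith
    have "card (K \<inter> Ta) \<le> card {v \<in> K. t v = v}" by (rule card_mono) (use fK Ta_fixed in auto)
    moreover have "card (K \<inter> Tb) \<le> card {v \<in> K. b v = v}" by (rule card_mono) (use fK Tb_fixed in auto)
    moreover have "x \<le> 2" if "x \<in> {0, 2}" for x :: nat using that by auto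
    from this[OF K_fixed[OF K]] have "card {v \<in> K. t v = v} + card {v \<in> K. b v = v} \<le> 2" .
    ultimately have le: "card (K \<inter> Ta) + card (K \<inter> Tb) \<le> 2" by linarith
    have lf: "K \<in> loop_free \<longleftrightarrow> card (K \<inter> Ta) + card (K \<inter> Tb) = 0"
      using fK K by (auto simp: loop_free_def)
    have cu: "K \<in> closed_up - ?C \<longleftrightarrow> card (K \<inter> Ta) + card (K \<inter> Tb) = 2"
    proof
      assume "card (K \<inter> Ta) + card (K \<inter> Tb) = 2"
      moreover from this have "\<not> cyclic K" using cyclic_loop_free[OF K] lf by auto
      ultimately show "K \<in> closed_up - ?C" using K by (simp add: closed_up_def)
    qed (auto simp: closed_up_def)
    have "s = 0 \<or> s = 2 \<longleftrightarrow> x = 0 \<or> x = 2" if "x = s + 2 * c" "x \<le> 2" for x s c :: nat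
      using that by presburger
    from this[OF tau le] show ?thesis unfolding lf cu by (simp only: insert_iff empty_iff simp_thms)
  qed
  have fin: "finite loop_free" "finite closed_up" "finite ?C" using finite_\<K> by (auto simp: loop_free_def closed_up_def)
  have sub: "loop_free \<subseteq> \<K>" "closed_up \<subseteq> \<K>" "?C \<subseteq> closed_up" by (auto simp: loop_free_def closed_up_def)
  have "{K \<in> \<K>. card (K \<inter> sym_diff Ta Tb) \<in> {0, 2}} = loop_free \<union> (closed_up - ?C)"
  proof (rule equalityI; rule subsetI)
    fix K assume "K \<in> {K \<in> \<K>. card (K \<inter> sym_diff Ta Tb) \<in> {0, 2}}"
    then have "K \<in> \<K>" "card (K \<inter> sym_diff Ta Tb) \<in> {0, 2}" by blast+
    then show "K \<in> loop_free \<union> (closed_up - ?C)" using mem by blast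
  next
    fix K assume k: "K \<in> loop_free \<union> (closed_up - ?C)"
    then have K: "K \<in> \<K>" using sub by blast
    then show "K \<in> {K \<in> \<K>. card (K \<inter> sym_diff Ta Tb) \<in> {0, 2}}" using mem[OF K] k by blast
  qed
  moreover have "loop_free \<inter> (closed_up - ?C) = {}" using loop_free_closed_up sub by blast
  then have "card (loop_free \<union> (closed_up - ?C)) = card loop_free + card (closed_up - ?C)"
    using card_Un_disjoint[OF fin(1) finite_Diff[OF fin(2)]] by blast
  moreover have "card closed_up = card ?C + card (closed_up - ?C)"
    using card_Diff_subset[OF fin(3) sub(3)] card_mono[OF fin(2) sub(3)] by linarith
  ultimately show ?thesis by simp
qed

theorem theorem4p5:
  fixes n :: nat and a b :: "nat list"
  assumes "n > 0" and "a \<in> strings_le n" and "b \<in> strings_le n"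
  shows "index_in_sp n (seaweed_C n a b :: 'k::{alg_closed_field, field_char_0} mat set) =
           card (graph_cycles (meander_C n a b)) +
           card {K \<in> components (meander_C n a b). card (K \<inter> tail n a b) \<in> {0, 2}}
       \<and> index_in_sp n (seaweed_C n a b :: 'k mat set) =
           card {Z \<in> perm_cycles (sigma n a b) {1..n}. card (Z \<inter> tail n a b) \<in> {0, 2}}"
proof -
  note a = assms(2) and b = assms(3)
  have out: "mate x v = v" if "v \<notin> {1..n}" "x \<in> strings_le n" for x v
    by (rule mate_outside) (use that in \<open>auto simp: strings_le_def\<close>)
  interpret ip: involution_pair "{1..n}" "mate a" "mate b"
    by (rule involution_pair.intro[OF finite_atLeastAtMost mate_mate mate_mate out[OF _ a] out[OF _ b]])
  let ?M = "meander_C n a b"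
  have M: "?M = ip.pair_graph"
    unfolding meander_C_def ip.pair_graph_def block_edges_mate by auto
  have op: "opposite ?M Top = mate a" "opposite ?M Bottom = mate b"
    by (rule ext, simp add: opposite_def mate_def meander_C_def)+
  have \<sigma>: "sigma n a b = ip.\<sigma>" by (rule ext) (simp add: sigma_def ip.\<sigma>_def op)
  note comps = ip.components_pair_graph[folded M]
  have tl: "tail1 n x = {v \<in> {1..n}. reflect n x (v - 1) = bar n (v - 1)}" if x: "x \<in> strings_le n" for x
    using reflect_mate(2)[OF x] by (auto simp: tail1_def)
  interpret mc: meander_components n "same_block n a" "reflect n a" "same_block n b" "reflect n b"
    "mate a" "mate b" "tail1 n a" "tail1 n b" "components ?M"
  proof (intro meander_components.intro seaweed_blocks.intro meander_components_axioms.intro)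
    show "block_reflection n (same_block n a) (reflect n a)" by (rule block_reflection_reflect[OF a])
    show "block_reflection n (same_block n b) (reflect n b)" by (rule block_reflection_reflect[OF b])
    show "vtx n (reflect n a i) = mate a (vtx n i)" if "i < 2*n" for i by (rule vtx_reflect[OF a that])
    show "vtx n (reflect n b i) = mate b (vtx n i)" if "i < 2*n" for i by (rule vtx_reflect[OF b that])
    show "tail1 n a = {v \<in> {1..n}. reflect n a (v - 1) = bar n (v - 1)}" by (rule tl[OF a])
    show "tail1 n b = {v \<in> {1..n}. reflect n b (v - 1) = bar n (v - 1)}" by (rule tl[OF b])
    show "\<Union>(components ?M) = {1..n}" by (rule comps(1))
    show "K = L" if "K \<in> components ?M" "L \<in> components ?M" "K \<inter> L \<noteq> {}" for K L by (rule comps(2)[OF that])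
    show "K \<noteq> {}" if "K \<in> components ?M" for K by (rule ip.componentD(2)[OF comps(3)[OF that]])
    show "mate a v \<in> K" if "K \<in> components ?M" "v \<in> K" for K v by (rule ip.componentD(3)[OF comps(3)[OF that(1)] that(2)])
    show "mate b v \<in> K" if "K \<in> components ?M" "v \<in> K" for K v by (rule ip.componentD(4)[OF comps(3)[OF that(1)] that(2)])
    show "Z = K" if "K \<in> components ?M" "Z \<subseteq> K" "Z \<noteq> {}" "\<And>v. v \<in> Z \<Longrightarrow> mate a v \<in> Z \<and> mate b v \<in> Z" for K Z
      by (rule ip.componentD(6)[OF comps(3)[OF that(1)] that(2,3)]) (rule that(4))
    show "card {v \<in> K. mate a v = v} + card {v \<in> K. mate b v = v} \<in> {0, 2}" if "K \<in> components ?M" for K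
      by (rule ip.card_fixed[OF comps(3)[OF that]])
  qed
  have cyc: "mc.cyclic K = ip.fixpoint_free K" for K by (simp only: mc.cyclic_def ip.fixpoint_free_def)
  have "(seaweed_C n a b :: 'k mat set) = mc.S"
    unfolding seaweed_C_def phi_C_cuts[OF a] phi_C_cuts[OF b] by (rule mc.seaweed_cuts)
  then have ix: "index_in_sp n (seaweed_C n a b :: 'k mat set) =
      card {K \<in> components ?M. ip.fixpoint_free K} + card {K \<in> components ?M. card (K \<inter> tail n a b) \<in> {0, 2}}"
    using mc.index_S[where 'k = 'k] mc.card_loop_free_closed_up by (simp only: cyc tail_def)
  \<comment> \<open>A tail vertex lies beyond the sum of one of the compositions and is fixed by the
    corresponding \<open>mate\<close>; this keeps tails out of fixpoint-free components in the orbit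
    count.\<close>
  have T: "mate a v = v \<or> mate b v = v" if "v \<in> tail n a b" for v
    using that mc.Ta_fixed mc.Tb_fixed unfolding tail_def by blast
  have 1: "card (graph_cycles ?M) = card {K \<in> components ?M. ip.fixpoint_free K}"
    unfolding M by (rule ip.card_graph_cycles)
  have 2: "card {Z \<in> perm_cycles (sigma n a b) {1..n}. card (Z \<inter> tail n a b) \<in> {0, 2}} =
      card {K \<in> components ?M. ip.fixpoint_free K} + card {K \<in> components ?M. card (K \<inter> tail n a b) \<in> {0, 2}}"
    unfolding perm_cycles_def \<sigma> by (rule ip.card_orbits[OF comps T])
  show ?thesis unfolding ix 1 2 by (intro conjI refl)
qed

end
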